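(* Assume (A1)--(A4) and that $\mathbf F(u,v)=\mathbf F(u)$, i.e. $\mathbf F$ does not depend on $v$. Let $v_l:=\inf\{v_0\}$ and $v_r:=\sup\{v_0\}$ (essential infimum and supremum over $\Omega$), and suppose there exists a pair $\{u_l,u_r\}$ with $u_l<u_r$ such that $u_0(\mathbf x)\in[u_l,u_r]$ for almost all $\mathbf x\in\Omega$ and $$\Psi_1(u_r,v_l)\le0\le\Psi_2(u_r,v_l),\qquad \Psi_2(u_l,v_r)\le0\le\Psi_1(u_l,v_r).$$ Then the weak solution $(u,v)$ (as defined in the context) satisfies $v_l\le v\le v_r$ and $u_l\le u\le u_r$ a.e.
   Context: $\Omega\subset\mathbb R^d$ is a bounded open domain with $\partial\Omega\in C^1$; $T>0$; $Q:=\Omega\times(0,T]$; $(\cdot,\cdot)$ is the $L^2(\Omega)$ inner product; $\langle\cdot,\cdot\rangle$ is the $H^{-1}(\Omega)$--$H^1_0(\Omega)$ duality pairing; $\mathcal W:=\{u\in L^2(0,T;H^1_0(\Omega)):\partial_t u\in L^2(0,T;H^{-1}(\Omega))\}$ (continuously embedded in $C([0,T];L^2(\Omega))$). Assumptions on the data: (A1) $\mathcal D\in C^1(\mathbb R^2)$ with $0<\mathcal D_m\le \mathcal D(u,v)\le \mathcal D_M<\infty$ for all $u,v\in\mathbb R$. (A2) $\mathbf F:\mathbb R^2\to\mathbb R^d$ has components $F_j\in C^1(\mathbb R^2)$ and $|\mathbf F|\le F_M$ for some $F_M>0$. (A3) For $j\in\{1,2\}$, $|\Psi_j(u_1,v_1)-\Psi_j(u_2,v_2)|\le\Psi_u|u_1-u_2|+\Psi_v|v_1-v_2|$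 with constants $\Psi_u,\Psi_v>0$; moreover $\frac{\Psi_j(u,v)-\Psi_j(u,v_1)}{v-v_1}\le 0$ and $\frac{\Psi_j(u,v)-\Psi_j(u_1,v)}{u-u_1}\le0$ for all $u\ne u_1$, $v\neq v_1$ in $\mathbb R$. (A4) $u_0\in L^\infty(\Omega)$ and $v_0\in H^1(\Omega)\cap L^\infty(\Omega)$, with $\Psi_2(0,v_0)=0$ on $\partial\Omega$. Weak solution: a pair $(u,v)$ with $u\in\mathcal W$, $v\in H^1(0,T;L^2(\Omega))\cap L^2(0,T;H^1(\Omega))$, $u(0)=u_0$, $v(0)=v_0$, such that for all $\phi\in L^2(0,T;H^1_0(\Omega))$ and $\xi\in L^2(Q)$, $$\int_0^T\langle\partial_t u,\phi\rangle\,dt+\int_0^T(\mathcal D(u,v)\nabla u,\nabla\phi)\,dt=\int_0^T(\mathbf F(u,v),\nabla\phi)\,dt+\int_0^T(\Psi_1(u,v),\phi)\,dt,$$ $$\int_0^T(\partial_t v,\xi)\,dt=\int_0^T(\Psi_2(u,v),\xi)\,dt.$$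
   Formalization: The formal theorem adds the hypothesis u_l ≤ 0 ≤ u_r (the zero Dirichlet boundary value lies in [u_l,u_r]); without it the claim fails, e.g. for the heat equation with u_0=3/2, u_l=1, u_r=2. *)

theory Defs
  imports "HOL-Analysis.Analysis" "HOL-Probability.Essential_Supremum"
begin

section \<open>Classical smoothness and domains\<close>

definition partial_deriv :: "'a::euclidean_space \<Rightarrow> ('a \<Rightarrow> real) \<Rightarrow> 'a \<Rightarrow> real" where
  "partial_deriv i f x = frechet_derivative f (at x) i"

primrec Ck :: "nat \<Rightarrow> ('a::euclidean_space \<Rightarrow> real) \<Rightarrow> bool" where
  "Ck 0 f \<longleftrightarrow> continuous_on UNIV f"
| "Ck (Suc k) f \<longleftrightarrow> (\<forall>x. f differentiable (at x)) \<and> (\<forall>i\<in>Basis. Ck k (partial_deriv i f))"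

definition test_functions :: "'a::euclidean_space set \<Rightarrow> ('a \<Rightarrow> real) set" where
  "test_functions \<Omega> = {\<phi>. (\<forall>k. Ck k \<phi>) \<and> (\<exists>K. compact K \<and> K \<subseteq> \<Omega> \<and> (\<forall>x. x \<notin> K \<longrightarrow> \<phi> x = 0))}"

text \<open>Near every boundary point, and after a rotation taking the last coordinate axis to
  the unit vector \<open>e\<close>, the set lies strictly above the graph of a \<open>C\<^sup>1\<close> function \<open>\<gamma>\<close> of the
  coordinates orthogonal to \<open>e\<close>.\<close>

definition C1_boundary :: "'a::euclidean_space set \<Rightarrow> bool" where
  "C1_boundary \<Omega> \<longleftrightarrow>
     (\<forall>p\<in>frontier \<Omega>. \<exists>r>0. \<exists>e \<gamma>. norm e = 1 \<and> Ck 1 \<gamma> \<and>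
        \<Omega> \<inter> ball p r = {x \<in> ball p r. x \<bullet> e > \<gamma> (x - (x \<bullet> e) *\<^sub>R e)})"

definition C1_domain :: "'a::euclidean_space set \<Rightarrow> bool" where
  "C1_domain \<Omega> \<longleftrightarrow> open \<Omega> \<and> connected \<Omega> \<and> \<Omega> \<noteq> {} \<and> bounded \<Omega> \<and> C1_boundary \<Omega>"


section \<open>Lebesgue spaces\<close>

text \<open>Elements of function spaces are represented by functions rather than by classes of
  functions modulo null sets; no notion below distinguishes functions that agree almost
  everywhere.\<close>

definition L2 :: "'a::euclidean_space set \<Rightarrow> ('a \<Rightarrow> 'b::euclidean_space) set" where
  "L2 \<Omega> = {f \<in> borel_measurable (lebesgue_on \<Omega>). integrable (lebesgue_on \<Omega>) (\<lambda>x. (norm (f x))\<^sup>2)}"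

definition L2_norm :: "'a::euclidean_space set \<Rightarrow> ('a \<Rightarrow> 'b::euclidean_space) \<Rightarrow> real" where
  "L2_norm \<Omega> f = sqrt (LINT x|lebesgue_on \<Omega>. (norm (f x))\<^sup>2)"

definition L2_inner :: "'a::euclidean_space set \<Rightarrow> ('a \<Rightarrow> 'b::euclidean_space) \<Rightarrow> ('a \<Rightarrow> 'b) \<Rightarrow> real" where
  "L2_inner \<Omega> f g = (LINT x|lebesgue_on \<Omega>. f x \<bullet> g x)"

definition Linf :: "'a::euclidean_space set \<Rightarrow> ('a \<Rightarrow> real) set" where
  "Linf \<Omega> = {f \<in> borel_measurable (lebesgue_on \<Omega>). \<exists>C. AE x in lebesgue_on \<Omega>. \<bar>f x\<bar> \<le> C}"

text \<open>The library's \<^const>\<open>esssup\<close> takes values in a complete order, hence the detour through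
  \<^typ>\<open>ereal\<close>; both values are finite for functions in \<open>Linf \<Omega>\<close> when \<open>\<Omega>\<close> is open and nonempty.\<close>

definition ess_sup_on :: "'a::euclidean_space set \<Rightarrow> ('a \<Rightarrow> real) \<Rightarrow> real" where
  "ess_sup_on \<Omega> f = real_of_ereal (esssup (lebesgue_on \<Omega>) (\<lambda>x. ereal (f x)))"

definition ess_inf_on :: "'a::euclidean_space set \<Rightarrow> ('a \<Rightarrow> real) \<Rightarrow> real" where
  "ess_inf_on \<Omega> f = - ess_sup_on \<Omega> (\<lambda>x. - f x)"


section \<open>Sobolev spaces\<close>

definition is_weak_gradient :: "'a::euclidean_space set \<Rightarrow> ('a \<Rightarrow> real) \<Rightarrow> ('a \<Rightarrow> 'a) \<Rightarrow> bool" where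
  "is_weak_gradient \<Omega> f g \<longleftrightarrow> (\<forall>\<phi>\<in>test_functions \<Omega>. \<forall>i\<in>Basis.
     (LINT x|lebesgue_on \<Omega>. f x * partial_deriv i \<phi> x) = - (LINT x|lebesgue_on \<Omega>. (g x \<bullet> i) * \<phi> x))"

definition H1 :: "'a::euclidean_space set \<Rightarrow> ('a \<Rightarrow> real) set" where
  "H1 \<Omega> = {f \<in> L2 \<Omega>. \<exists>g\<in>L2 \<Omega>. is_weak_gradient \<Omega> f g}"

text \<open>For \<open>f \<in> H1 \<Omega>\<close> the choice is unique up to null sets.\<close>

definition weak_gradient :: "'a::euclidean_space set \<Rightarrow> ('a \<Rightarrow> real) \<Rightarrow> 'a \<Rightarrow> 'a" where
  "weak_gradient \<Omega> f = (SOME g. g \<in> L2 \<Omega> \<and> is_weak_gradient \<Omega> f g)"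

definition H1_norm :: "'a::euclidean_space set \<Rightarrow> ('a \<Rightarrow> real) \<Rightarrow> real" where
  "H1_norm \<Omega> f = sqrt ((L2_norm \<Omega> f)\<^sup>2 + (L2_norm \<Omega> (weak_gradient \<Omega> f))\<^sup>2)"

definition H10 :: "'a::euclidean_space set \<Rightarrow> ('a \<Rightarrow> real) set" where
  "H10 \<Omega> = {f \<in> H1 \<Omega>. \<exists>\<phi>. (\<forall>n::nat. \<phi> n \<in> test_functions \<Omega>) \<and> (\<lambda>n. H1_norm \<Omega> (f - \<phi> n)) \<longlonglongrightarrow> 0}"

text \<open>The dual of \<open>H10 \<Omega>\<close>. Its elements are functionals on all functions, but only their
  restriction to \<open>H10 \<Omega>\<close> is relevant. Boundedness makes a functional respect equality
  almost everywhere. The duality pairing is application.\<close>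

definition Hm1 :: "'a::euclidean_space set \<Rightarrow> (('a \<Rightarrow> real) \<Rightarrow> real) set" where
  "Hm1 \<Omega> = {l. (\<forall>f\<in>H10 \<Omega>. \<forall>g\<in>H10 \<Omega>. l (\<lambda>x. f x + g x) = l f + l g) \<and>
               (\<forall>f\<in>H10 \<Omega>. \<forall>c. l (\<lambda>x. c * f x) = c * l f) \<and>
               (\<exists>C. \<forall>f\<in>H10 \<Omega>. \<bar>l f\<bar> \<le> C * H1_norm \<Omega> f)}"

definition Hm1_norm :: "'a::euclidean_space set \<Rightarrow> (('a \<Rightarrow> real) \<Rightarrow> real) \<Rightarrow> real" where
  "Hm1_norm \<Omega> l = (SUP f\<in>{f \<in> H10 \<Omega>. H1_norm \<Omega> f \<le> 1}. \<bar>l f\<bar>)"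


section \<open>Bochner spaces\<close>

text \<open>The space \<open>L\<^sup>2(0,T;X)\<close>, where \<open>X\<close> is given by its carrier and its (semi)norm \<open>N\<close>:
  almost everywhere defined \<open>X\<close>-valued functions that are strongly measurable (almost
  everywhere limits of simple functions) and have a square integrable norm.\<close>

definition simple_map :: "real \<Rightarrow> 'b set \<Rightarrow> (real \<Rightarrow> 'b) \<Rightarrow> bool" where
  "simple_map T X s \<longleftrightarrow> s ` {0<..<T} \<subseteq> X \<and> finite (s ` {0<..<T}) \<and>
     (\<forall>y. {t \<in> {0<..<T}. s t = y} \<in> sets lebesgue)"

definition L2_Bochner :: "real \<Rightarrow> 'b::minus set \<Rightarrow> ('b \<Rightarrow> real) \<Rightarrow> (real \<Rightarrow> 'b) set" where
  "L2_Bochner T X N = {w.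
     (AE t in lebesgue_on {0<..<T}. w t \<in> X) \<and>
     (\<exists>s. (\<forall>n::nat. simple_map T X (s n)) \<and>
          (AE t in lebesgue_on {0<..<T}. (\<lambda>n. N (w t - s n t)) \<longlonglongrightarrow> 0)) \<and>
     integrable (lebesgue_on {0<..<T}) (\<lambda>t. (N (w t))\<^sup>2)}"

abbreviation L2_L2 :: "real \<Rightarrow> 'a::euclidean_space set \<Rightarrow> (real \<Rightarrow> 'a \<Rightarrow> real) set" where
  "L2_L2 T \<Omega> \<equiv> L2_Bochner T (L2 \<Omega>) (L2_norm \<Omega>)"

abbreviation L2_H1 :: "real \<Rightarrow> 'a::euclidean_space set \<Rightarrow> (real \<Rightarrow> 'a \<Rightarrow> real) set" where
  "L2_H1 T \<Omega> \<equiv> L2_Bochner T (H1 \<Omega>) (H1_norm \<Omega>)"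

abbreviation L2_H10 :: "real \<Rightarrow> 'a::euclidean_space set \<Rightarrow> (real \<Rightarrow> 'a \<Rightarrow> real) set" where
  "L2_H10 T \<Omega> \<equiv> L2_Bochner T (H10 \<Omega>) (H1_norm \<Omega>)"

abbreviation L2_Hm1 :: "real \<Rightarrow> 'a::euclidean_space set \<Rightarrow> (real \<Rightarrow> ('a \<Rightarrow> real) \<Rightarrow> real) set" where
  "L2_Hm1 T \<Omega> \<equiv> L2_Bochner T (Hm1 \<Omega>) (Hm1_norm \<Omega>)"

text \<open>Weak derivatives in time: \<open>\<integral>\<eta>' u dt = - \<integral>\<eta> w dt\<close> for all test functions \<open>\<eta>\<close> on \<open>(0,T)\<close>.
  The Bochner integrals are elements of \<open>Hm1 \<Omega>\<close> and \<open>L2 \<Omega>\<close>, respectively, so their equality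
  is expressed by pairing with all \<open>\<psi>\<close> in \<open>H10 \<Omega>\<close> and in \<open>L2 \<Omega>\<close>. In the first case \<open>u t\<close>
  acts on \<open>H10 \<Omega>\<close> through the \<open>L\<^sup>2\<close> inner product.\<close>

definition time_deriv_Hm1 ::
    "real \<Rightarrow> 'a::euclidean_space set \<Rightarrow> (real \<Rightarrow> 'a \<Rightarrow> real) \<Rightarrow> (real \<Rightarrow> ('a \<Rightarrow> real) \<Rightarrow> real) \<Rightarrow> bool" where
  "time_deriv_Hm1 T \<Omega> u w \<longleftrightarrow> w \<in> L2_Hm1 T \<Omega> \<and>
     (\<forall>\<psi>\<in>H10 \<Omega>. \<forall>\<eta>\<in>test_functions {0<..<T}.
        (LINT t|lebesgue_on {0<..<T}. deriv \<eta> t * L2_inner \<Omega> (u t) \<psi>)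
          = - (LINT t|lebesgue_on {0<..<T}. \<eta> t * w t \<psi>))"

definition time_deriv_L2 ::
    "real \<Rightarrow> 'a::euclidean_space set \<Rightarrow> (real \<Rightarrow> 'a \<Rightarrow> real) \<Rightarrow> (real \<Rightarrow> 'a \<Rightarrow> real) \<Rightarrow> bool" where
  "time_deriv_L2 T \<Omega> v w \<longleftrightarrow> w \<in> L2_L2 T \<Omega> \<and>
     (\<forall>\<psi>\<in>L2 \<Omega>. \<forall>\<eta>\<in>test_functions {0<..<T}.
        (LINT t|lebesgue_on {0<..<T}. deriv \<eta> t * L2_inner \<Omega> (v t) \<psi>)
          = - (LINT t|lebesgue_on {0<..<T}. \<eta> t * L2_inner \<Omega> (w t) \<psi>))"

definition W_space :: "real \<Rightarrow> 'a::euclidean_space set \<Rightarrow> (real \<Rightarrow> 'a \<Rightarrow> real) set" where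
  "W_space T \<Omega> = {u \<in> L2_H10 T \<Omega>. \<exists>w. time_deriv_Hm1 T \<Omega> u w}"

definition H1_L2 :: "real \<Rightarrow> 'a::euclidean_space set \<Rightarrow> (real \<Rightarrow> 'a \<Rightarrow> real) set" where
  "H1_L2 T \<Omega> = {v \<in> L2_L2 T \<Omega>. \<exists>w. time_deriv_L2 T \<Omega> v w}"

text \<open>Elements of \<open>W_space\<close> and \<open>H1_L2\<close> have a unique representative that is continuous from
  \<open>[0,T]\<close> into \<open>L\<^sup>2(\<Omega>)\<close>; the initial value is the value of that representative at \<open>0\<close>.\<close>

definition has_initial_value ::
    "real \<Rightarrow> 'a::euclidean_space set \<Rightarrow> (real \<Rightarrow> 'a \<Rightarrow> real) \<Rightarrow> ('a \<Rightarrow> real) \<Rightarrow> bool" where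
  "has_initial_value T \<Omega> u u0 \<longleftrightarrow> (\<exists>U.
     (\<forall>t\<in>{0..T}. U t \<in> L2 \<Omega>) \<and>
     (\<forall>t\<in>{0..T}. ((\<lambda>s. L2_norm \<Omega> (U s - U t)) \<longlongrightarrow> 0) (at t within {0..T})) \<and>
     (AE t in lebesgue_on {0<..<T}. AE x in lebesgue_on \<Omega>. U t x = u t x) \<and>
     (AE x in lebesgue_on \<Omega>. U 0 x = u0 x))"


section \<open>Weak solutions\<close>

definition space_time :: "real \<Rightarrow> 'a::euclidean_space set \<Rightarrow> ('a \<times> real) set" where
  "space_time T \<Omega> = \<Omega> \<times> {0<..T}"

text \<open>The first two conditions only select representatives that are jointly measurable
  (\<open>L\<^sup>2(0,T;L\<^sup>2(\<Omega>)) = L\<^sup>2(Q)\<close>), so that statements almost everywhere in \<open>Q\<close> make sense.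
  The time derivatives \<open>ut\<close> and \<open>vt\<close> are determined by \<open>u\<close> and \<open>v\<close> almost everywhere.\<close>

definition weak_solution ::
    "real \<Rightarrow> 'a::euclidean_space set \<Rightarrow> (real \<Rightarrow> real \<Rightarrow> real) \<Rightarrow> (real \<Rightarrow> real \<Rightarrow> 'a) \<Rightarrow>
     (real \<Rightarrow> real \<Rightarrow> real) \<Rightarrow> (real \<Rightarrow> real \<Rightarrow> real) \<Rightarrow> ('a \<Rightarrow> real) \<Rightarrow> ('a \<Rightarrow> real) \<Rightarrow>
     (real \<Rightarrow> 'a \<Rightarrow> real) \<Rightarrow> (real \<Rightarrow> 'a \<Rightarrow> real) \<Rightarrow> bool" where
  "weak_solution T \<Omega> D F \<Psi>1 \<Psi>2 u0 v0 u v \<longleftrightarrow>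
     (\<lambda>(x, t). u t x) \<in> L2 (space_time T \<Omega>) \<and>
     (\<lambda>(x, t). v t x) \<in> L2 (space_time T \<Omega>) \<and>
     u \<in> W_space T \<Omega> \<and>
     v \<in> H1_L2 T \<Omega> \<inter> L2_H1 T \<Omega> \<and>
     has_initial_value T \<Omega> u u0 \<and>
     has_initial_value T \<Omega> v v0 \<and>
     (\<exists>ut vt. time_deriv_Hm1 T \<Omega> u ut \<and> time_deriv_L2 T \<Omega> v vt \<and>
        (\<forall>\<phi>\<in>L2_H10 T \<Omega>.
           (LINT t|lebesgue_on {0<..<T}. ut t (\<phi> t))
           + (LINT t|lebesgue_on {0<..<T}.
                L2_inner \<Omega> (\<lambda>x. D (u t x) (v t x) *\<^sub>R weak_gradient \<Omega> (u t) x) (weak_gradient \<Omega> (\<phi> t)))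
           = (LINT t|lebesgue_on {0<..<T}.
                L2_inner \<Omega> (\<lambda>x. F (u t x) (v t x)) (weak_gradient \<Omega> (\<phi> t)))
           + (LINT t|lebesgue_on {0<..<T}. L2_inner \<Omega> (\<lambda>x. \<Psi>1 (u t x) (v t x)) (\<phi> t))) \<and>
        (\<forall>\<xi>. (\<lambda>(x, t). \<xi> t x) \<in> L2 (space_time T \<Omega>) \<longrightarrow>
           (LINT t|lebesgue_on {0<..<T}. L2_inner \<Omega> (vt t) (\<xi> t))
           = (LINT t|lebesgue_on {0<..<T}. L2_inner \<Omega> (\<lambda>x. \<Psi>2 (u t x) (v t x)) (\<xi> t))))"


section \<open>Assumptions on the data\<close>

definition diffusion_admissible :: "(real \<Rightarrow> real \<Rightarrow> real) \<Rightarrow> bool" where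
  "diffusion_admissible D \<longleftrightarrow> Ck 1 (\<lambda>(a, b). D a b) \<and>
     (\<exists>Dm DM. 0 < Dm \<and> (\<forall>a b. Dm \<le> D a b \<and> D a b \<le> DM))"

definition flux_admissible :: "(real \<Rightarrow> real \<Rightarrow> 'a::euclidean_space) \<Rightarrow> bool" where
  "flux_admissible F \<longleftrightarrow> (\<forall>i\<in>Basis. Ck 1 (\<lambda>(a, b). F a b \<bullet> i)) \<and>
     (\<exists>FM>0. \<forall>a b. norm (F a b) \<le> FM)"

definition reaction_admissible :: "real \<Rightarrow> real \<Rightarrow> (real \<Rightarrow> real \<Rightarrow> real) \<Rightarrow> bool" where
  "reaction_admissible Lu Lv \<Psi> \<longleftrightarrow>
     (\<forall>a1 b1 a2 b2. \<bar>\<Psi> a1 b1 - \<Psi> a2 b2\<bar> \<le> Lu * \<bar>a1 - a2\<bar> + Lv * \<bar>b1 - b2\<bar>) \<and>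
     (\<forall>a b b1. b \<noteq> b1 \<longrightarrow> (\<Psi> a b - \<Psi> a b1) / (b - b1) \<le> 0) \<and>
     (\<forall>a a1 b. a \<noteq> a1 \<longrightarrow> (\<Psi> a b - \<Psi> a1 b) / (a - a1) \<le> 0)"

text \<open>The condition \<open>\<Psi>2 0 v0 = 0\<close> on the boundary is meant in the sense of traces of
  functions in \<open>H1 \<Omega>\<close>, that is, as membership in \<open>H10 \<Omega>\<close>.\<close>

definition initial_admissible ::
    "'a::euclidean_space set \<Rightarrow> (real \<Rightarrow> real \<Rightarrow> real) \<Rightarrow> ('a \<Rightarrow> real) \<Rightarrow> ('a \<Rightarrow> real) \<Rightarrow> bool" where
  "initial_admissible \<Omega> \<Psi>2 u0 v0 \<longleftrightarrow>
     u0 \<in> Linf \<Omega> \<and> v0 \<in> H1 \<Omega> \<inter> Linf \<Omega> \<and> (\<lambda>x. \<Psi>2 0 (v0 x)) \<in> H10 \<Omega>"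

end

theory Submission
  imports Defs
begin

text \<open>The upper bound for \<open>u\<close> is proved together with the lower bound for \<open>v\<close>, and the other two
  bounds likewise with all signs reversed; a sign \<open>\<sigma>\<close> covers both cases, with levels \<open>k\<close> for \<open>u\<close>
  and \<open>m\<close> for \<open>v\<close>. Let \<open>P\<close> and \<open>Q\<close> be the positive parts of \<open>\<sigma> (u - k)\<close> and \<open>\<sigma> (m - v)\<close>. Testing the two
  equations with \<open>\<sigma> P\<close> and \<open>- \<sigma> Q\<close>, the sign conditions at the corner \<open>(k, m)\<close> and the monotonicity of the
  reactions leave at most \<open>L (P\<^sup>2 + Q\<^sup>2)\<close> of the reaction terms. As \<open>F\<close> is bounded and differentiable
  at \<open>k\<close>, it satisfies \<open>\<bar>F(u) - F(k)\<bar> \<le> C \<bar>u - k\<bar>\<close>, so the convective term is absorbed into the diffusive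
  one. Gronwall's inequality for \<open>\<integral> P\<^sup>2 + Q\<^sup>2\<close> then gives \<open>P = Q = 0\<close>.

  To make the test functions admissible, the positive part is replaced by smooth approximations \<open>\<beta>\<close>. For a
  primitive \<open>G\<close> of \<open>\<beta>\<close> only the inequality \<open>\<integral> G(u(b)) - \<integral> G(u(0)) \<le> \<integral> \<langle>\<partial>\<^sub>t u, \<beta>(u)\<rangle> dt\<close> is needed. It follows
  by averaging the convexity inequality \<open>G(u(t)) - G(u(t - h)) \<le> \<beta>(u(t)) (u(t) - u(t - h))\<close> over \<open>t\<close>
  and letting \<open>h\<close> tend to 0.\<close>

section \<open>Smooth functions\<close>

text \<open>Since both reactions decrease in both arguments, an excess of \<open>u\<close> over
  \<open>k\<close> is fed only by a deficit of \<open>v\<close> below \<open>m\<close> (for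
  \<open>\<sigma> = 1\<close>), and conversely. Neither bound closes alone, and this pairs them.

  Smoothness of \<beta> also serves the time variable. A test function must be strongly measurable
  with values in \<open>H10\<close>; this follows from continuity of
  \<open>f \<mapsto> \<beta> (f)\<close> on \<open>H10\<close>, which is elementary when the
  derivative of \<beta> is continuous and bounded. Moreover \<beta> has to vanish at 0 to preserve
  zero boundary values, hence the levels must enclose 0.

  In the averaged convexity inequality the obstacle is that \<open>\<beta> (u t)\<close> moves with
  \<open>t\<close>, while the time derivative is integrated over \<open>(t - h, t)\<close>.
  Approximating \<open>\<beta> (u t)\<close> by a map with finitely many values in time freezes it
  on measurable sets, so that scalar Lebesgue differentiation is enough to pass to the limit; the
  error is controlled by the dual norm of the derivative. Backward differences have the right sign
  for an inequality, and an inequality is all that Gronwall's argument consumes.\<close>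

abbreviation smooth :: "('a::euclidean_space \<Rightarrow> real) \<Rightarrow> bool" where
  "smooth f \<equiv> \<forall>k. Ck k f"

text \<open>\<open>Ck (Suc k)\<close> does not contain \<open>Ck k\<close> by definition; the
  inclusion rests on the bottom case, where differentiability yields continuity.\<close>

lemma Ck_SucD: "Ck (Suc k) f \<Longrightarrow> Ck k f"
proof (induction k arbitrary: f)
  case 0
  then show ?case
    by (auto intro!: continuous_at_imp_continuous_on differentiable_imp_continuous_within)
next
  case (Suc k)
  then show ?case by (metis Ck.simps(2))
qed

lemma smoothD:
  assumes "smooth f"
  shows "f differentiable (at x)" "i \<in> Basis \<Longrightarrow> smooth (partial_deriv i f)" "continuous_on UNIV f"
  using assms Ck.simps by metis+

lemma smoothI:
  assumes "\<And>x. f differentiable (at x)" and "\<And>i. i \<in> Basis \<Longrightarrow> smooth (partial_deriv i f)"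
  shows "smooth f"
proof
  fix k show "Ck k f"
  proof (cases k)
    case 0
    have "Ck 0 (partial_deriv i f)" if "i \<in> Basis" for i using assms(2)[OF that] by blast
    then have "Ck (Suc 0) f" using assms(1) by simp
    then show ?thesis using 0 Ck_SucD by blast
  qed (use assms in simp)
qed

section \<open>Differentiation rules for the classes \<open>Ck\<close>\<close>

lemma partial_deriv_eq:
  "(f has_derivative f') (at x) \<Longrightarrow> partial_deriv i f x = f' i"
  unfolding partial_deriv_def using frechet_derivative_at by fastforce

lemma has_derivative_frechet:
  "f differentiable (at x) \<Longrightarrow> (f has_derivative frechet_derivative f (at x)) (at x)"
  using frechet_derivative_works by blast

lemma partial_deriv_real:
  fixes f :: "real \<Rightarrow> real"
  assumes "(f has_real_derivative d) (at x)"
  shows "partial_deriv 1 f x = d"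
  using partial_deriv_eq[OF assms[unfolded has_field_derivative_def], of 1] by simp

lemma Ck_const: "Ck k (\<lambda>x::'a::euclidean_space. c)"
proof (induction k arbitrary: c)
  case (Suc k)
  have "partial_deriv i (\<lambda>x::'a. c) = (\<lambda>x. 0)" for i
    by (rule ext, rule partial_deriv_eq) (auto intro!: derivative_eq_intros)
  then show ?case using Suc by simp
qed auto

lemma Ck_add: "Ck k f \<Longrightarrow> Ck k g \<Longrightarrow> Ck k (\<lambda>x. f x + g x)"
proof (induction k arbitrary: f g)
  case (Suc k)
  then have d: "\<And>x. f differentiable (at x)" "\<And>x. g differentiable (at x)" by auto
  have "partial_deriv i (\<lambda>x. f x + g x) = (\<lambda>x. partial_deriv i f x + partial_deriv i g x)" for i
    unfolding partial_deriv_def[of _ f] partial_deriv_def[of _ g]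
    by (rule ext, rule partial_deriv_eq, intro has_derivative_add has_derivative_frechet d)
  then show ?case using Suc by simp
qed (auto intro!: continuous_intros)

lemma Ck_mult: "Ck k f \<Longrightarrow> Ck k g \<Longrightarrow> Ck k (\<lambda>x. f x * g x)"
proof (induction k arbitrary: f g)
  case (Suc k)
  then have d: "\<And>x. f differentiable (at x)" "\<And>x. g differentiable (at x)" by auto
  have "partial_deriv i (\<lambda>x. f x * g x) = (\<lambda>x. f x * partial_deriv i g x + partial_deriv i f x * g x)" for i
    unfolding partial_deriv_def[of _ f] partial_deriv_def[of _ g]
    by (rule ext, rule partial_deriv_eq, intro has_derivative_mult has_derivative_frechet d)
  moreover have "Ck k f" "Ck k g" using Suc.prems Ck_SucD by blast+
  ultimately show ?case using Suc by (auto intro!: Ck_add)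
qed (auto intro!: continuous_intros)

lemma Ck_prod:
  "finite I \<Longrightarrow> (\<And>i. i \<in> I \<Longrightarrow> Ck k (f i)) \<Longrightarrow> Ck k (\<lambda>x. \<Prod>i\<in>I. f i x)"
  by (induction I rule: finite_induct) (auto intro!: Ck_const Ck_mult)

lemma partial_deriv_compose:
  fixes \<beta> :: "real \<Rightarrow> real"
  assumes "f differentiable (at x)" "\<beta> differentiable (at (f x))"
  shows "partial_deriv i (\<lambda>x. \<beta> (f x)) x = partial_deriv 1 \<beta> (f x) * partial_deriv i f x"
proof -
  let ?f' = "frechet_derivative f (at x)" and ?b' = "frechet_derivative \<beta> (at (f x))"
  have "((\<lambda>x. \<beta> (f x)) has_derivative (\<lambda>h. ?b' (?f' h))) (at x)"
    using has_derivative_compose[OF has_derivative_frechet[OF assms(1)] has_derivative_frechet[OF assms(2)]] .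
  then have "partial_deriv i (\<lambda>x. \<beta> (f x)) x = ?b' (?f' i *\<^sub>R 1)"
    by (simp add: partial_deriv_eq)
  also have "\<dots> = ?f' i * ?b' 1"
    using has_derivative_linear[OF has_derivative_frechet[OF assms(2)]]
    by (subst linear_scale) simp_all
  finally show ?thesis by (simp add: partial_deriv_def)
qed

text \<open>The chain rule produces a product whose first factor is again a composition, with the
  derivative as outer function. The induction therefore varies \<open>\<beta>\<close> as well as
  \<open>f\<close>.\<close>

lemma Ck_compose:
  fixes \<beta> :: "real \<Rightarrow> real"
  shows "Ck k \<beta> \<Longrightarrow> Ck k f \<Longrightarrow> Ck k (\<lambda>x. \<beta> (f x))"
proof (induction k arbitrary: f \<beta>)
  case 0
  then show ?case using continuous_on_compose2[of UNIV \<beta> UNIV f] by auto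
next
  case (Suc k)
  then have d: "\<And>x. f differentiable (at x)" "\<And>x. \<beta> differentiable (at x)" by auto
  have "(\<lambda>x. \<beta> (f x)) differentiable (at x)" for x
    using differentiable_chain_at[OF d(1) d(2)] by (simp add: o_def)
  moreover have "partial_deriv i (\<lambda>x. \<beta> (f x)) = (\<lambda>x. partial_deriv 1 \<beta> (f x) * partial_deriv i f x)" for i
    by (rule ext) (rule partial_deriv_compose[OF d])
  moreover have "Ck k f" using Suc.prems Ck_SucD by blast
  ultimately show ?case using Suc by (auto intro!: Ck_mult)
qed

lemma Ck_inner: "Ck k (\<lambda>x. x \<bullet> e)"
proof (cases k)
  case (Suc k)
  have "partial_deriv i (\<lambda>x. x \<bullet> e) = (\<lambda>x. i \<bullet> e)" for i
    by (rule ext, rule partial_deriv_eq) (auto intro!: derivative_eq_intros)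
  then show ?thesis using Suc by (auto intro!: Ck_const derivative_intros)
qed (auto intro!: continuous_intros)

lemma Ck_affine_real: "Ck k (\<lambda>x::real. a * x + b)"
  using Ck_add[OF Ck_mult[OF Ck_const[of k a] Ck_inner[of k "1::real"]] Ck_const[of k b]] by simp

text \<open>The classical flat function \<open>exp (- 1 / x)\<close> times a power of
  \<open>1 / x\<close>. The index makes the linear span of the family closed under differentiation,
  so that smoothness needs no bookkeeping of polynomials in \<open>1 / x\<close>.\<close>

definition flat_exp :: "nat \<Rightarrow> real \<Rightarrow> real" where
  "flat_exp n x = (if x > 0 then inverse x ^ n * exp (- inverse x) else 0)"

lemma flat_exp_nonneg: "0 \<le> flat_exp n x" and flat_exp_pos_iff: "0 < flat_exp n x \<longleftrightarrow> 0 < x"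
  by (auto simp: flat_exp_def)

text \<open>On the right of 0 the substitution \<open>y = 1 / x\<close> leaves
  \<open>y ^ n / exp y\<close> at infinity; on the left the function is 0.\<close>

lemma flat_exp_tendsto_0: "(flat_exp n \<longlongrightarrow> 0) (at 0)"
proof -
  have "((\<lambda>y. y ^ n / exp y) \<longlongrightarrow> (0::real)) at_top" by (rule tendsto_power_div_exp_0)
  then have "((\<lambda>x. inverse x ^ n / exp (inverse x)) \<longlongrightarrow> (0::real)) (at_right 0)"
    using filterlim_compose[OF _ filterlim_inverse_at_top_right] by blast
  then have "(flat_exp n \<longlongrightarrow> 0) (at_right 0)"
    by (rule tendsto_cong[THEN iffD1, rotated])
      (auto simp: eventually_at_filter flat_exp_def exp_minus divide_inverse)
  moreover have "(flat_exp n \<longlongrightarrow> 0) (at_left 0)"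
    by (rule tendsto_eventually) (auto simp: eventually_at_filter flat_exp_def)
  ultimately show ?thesis
    using filterlim_split_at by blast
qed

lemma flat_exp_deriv:
  "(flat_exp n has_real_derivative (flat_exp (n + 2) x - real n * flat_exp (n + 1) x)) (at x)"
proof -
  consider "x > 0" | "x < 0" | "x = 0" by linarith
  then show ?thesis
  proof cases
    case 1
    have "((\<lambda>x. inverse x ^ n * exp (- inverse x)) has_real_derivative
        (flat_exp (n + 2) x - real n * flat_exp (n + 1) x)) (at x)"
    proof -
      have "((\<lambda>x. inverse x) has_real_derivative - (inverse x * inverse x)) (at x)"
        using 1 DERIV_inverse[of x] by (simp add: power2_eq_square)
      from DERIV_mult[OF DERIV_power[OF this, of n] DERIV_fun_exp[OF DERIV_minus[OF this]]]
      show ?thesis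
        by (rule DERIV_cong) (use 1 in \<open>cases n; simp add: flat_exp_def algebra_simps\<close>)
    qed
    then show ?thesis
      by (rule has_field_derivative_transform_within_open[where S = "{0<..}"]) (use 1 in \<open>auto simp: flat_exp_def\<close>)
  next
    case 2
    have "((\<lambda>x. 0) has_real_derivative 0) (at x)" by simp
    then have "(flat_exp n has_real_derivative 0) (at x)"
      by (rule has_field_derivative_transform_within_open[where S = "{..<0}"]) (use 2 in \<open>auto simp: flat_exp_def\<close>)
    then show ?thesis using 2 by (simp add: flat_exp_def)
  next
    case 3
    \<comment> \<open>Dividing by \<open>y\<close> only raises the power of \<open>1 / y\<close>, so
      the difference quotient at 0 is \<open>flat_exp (n + 1)\<close>, whose limit is known.\<close>
    have "((\<lambda>y. (flat_exp n y - flat_exp n 0) / (y - 0)) \<longlongrightarrow> 0) (at 0)"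
      by (rule tendsto_cong[THEN iffD1, OF _ flat_exp_tendsto_0[of "n + 1"]])
        (auto simp: eventually_at_filter flat_exp_def divide_inverse)
    then show ?thesis using 3 by (simp add: has_field_derivative_iff flat_exp_def)
  qed
qed

lemma smooth_flat_exp: "smooth (flat_exp n)"
proof -
  have "Ck k (flat_exp n)" for k
  proof (induction k arbitrary: n)
    case 0
    have "isCont (flat_exp n) x" for x using DERIV_isCont[OF flat_exp_deriv] .
    then show ?case by (simp add: continuous_at_imp_continuous_on)
  next
    case (Suc k)
    have eq: "partial_deriv 1 (flat_exp n) = (\<lambda>x. flat_exp (n + 2) x + (- real n) * flat_exp (n + 1) x)"
      by (rule ext, rule partial_deriv_real) (use flat_exp_deriv in simp)
    have "flat_exp n differentiable (at x)" for x
      using flat_exp_deriv by (meson has_field_derivative_imp_has_derivative differentiable_def)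
    moreover have "Ck k (partial_deriv 1 (flat_exp n))"
      unfolding eq by (intro Ck_add Ck_mult Ck_const Suc)
    ultimately show ?case by simp
  qed
  then show ?thesis by blast
qed

text \<open>Antiderivatives of \<open>\<rho> x = flat_exp 0 x * flat_exp 0 (1 - x)\<close> are smooth transitions from 0 to 1.\<close>

lemma smooth_step:
  "\<exists>\<rho> R :: real \<Rightarrow> real. smooth R \<and> (\<forall>x. (R has_real_derivative \<rho> x) (at x)) \<and>
    (\<forall>x. \<rho> x \<ge> 0) \<and> (\<forall>x\<le>0. \<rho> x = 0) \<and> (\<forall>x\<ge>1. \<rho> x = 0) \<and> continuous_on UNIV \<rho> \<and>
    (\<forall>x\<le>0. R x = 0) \<and> (\<forall>x\<ge>1. R x = 1) \<and> (\<forall>x. 0 \<le> R x) \<and> (\<forall>x. R x \<le> 1)"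
proof -
  define \<rho>0 where "\<rho>0 x = flat_exp 0 x * flat_exp 0 (1 - x)" for x
  have sm0: "smooth \<rho>0"
  proof
    fix k
    have "Ck k (\<lambda>x::real. flat_exp 0 ((-1) * x + 1))"
      by (rule Ck_compose[OF _ Ck_affine_real]) (use smooth_flat_exp in blast)
    then show "Ck k \<rho>0" unfolding \<rho>0_def using smooth_flat_exp by (intro Ck_mult) auto
  qed
  have cont0: "continuous_on S \<rho>0" for S
    using smoothD(3)[OF sm0] continuous_on_subset by blast
  have pos0: "\<rho>0 x \<ge> 0" for x by (simp add: \<rho>0_def flat_exp_nonneg)
  define c where "c = integral {0..1} \<rho>0"
  have "c \<noteq> 0"
  proof
    assume "c = 0"
    then have "\<rho>0 (1/2) = 0"
      using integral_eq_0_iff[of 0 1 \<rho>0] pos0 cont0 by (auto simp: c_def)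
    then show False by (auto simp: \<rho>0_def flat_exp_def)
  qed
  then have c: "c > 0" using integral_nonneg[of \<rho>0 "{0..1}"] pos0 cont0
    by (auto simp: c_def integrable_continuous_real less_le)
  define \<rho> where "\<rho> x = \<rho>0 x / c" for x
  have sm: "smooth \<rho>"
  proof
    fix k show "Ck k \<rho>" unfolding \<rho>_def divide_inverse
      by (rule Ck_mult[OF _ Ck_const]) (use sm0 in blast)
  qed
  have cont: "continuous_on S \<rho>" for S
    using smoothD(3)[OF sm] continuous_on_subset by blast
  have z: "\<rho> x = 0" if "x \<le> 0 \<or> x \<ge> 1" for x
    using that by (auto simp: \<rho>_def \<rho>0_def flat_exp_def)
  have pos: "\<rho> x \<ge> 0" for x using pos0 c by (simp add: \<rho>_def)
  obtain Q where Q: "\<And>x. (Q has_real_derivative \<rho> x) (at x)"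
  proof -
    show ?thesis
    proof (rule that[of "\<lambda>x. integral {0..x} \<rho>"])
      fix x :: real
      show "((\<lambda>x. integral {0..x} \<rho>) has_real_derivative \<rho> x) (at x)"
      proof (cases "x \<le> 0")
        case True
        \<comment> \<open>For \<open>y < 0\<close> the interval \<open>{0..y}\<close> is empty, so
          the fundamental theorem does not apply directly at \<open>x \<le> 0\<close>. As
          \<open>\<rho>\<close> vanishes there, the base point may be moved to
          \<open>- \<bar>x\<bar> - 1\<close>, which lies to the left of \<open>x\<close>.\<close>
        have e: "integral {0..y} \<rho> = integral {-\<bar>x\<bar>-1..y} \<rho>" if "y \<in> {-\<bar>x\<bar>-1<..<1}" for y
        proof (cases "y \<ge> 0")
          case True
          have "integral {-\<bar>x\<bar>-1..0} \<rho> + integral {0..y} \<rho> = integral {-\<bar>x\<bar>-1..y} \<rho>"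
            by (rule Henstock_Kurzweil_Integration.integral_combine)
              (use True in \<open>auto intro!: integrable_continuous_real cont\<close>)
          moreover have "integral {-\<bar>x\<bar>-1..0} \<rho> = integral {-\<bar>x\<bar>-1..0} (\<lambda>x. 0)"
            by (rule integral_cong) (use z in auto)
          ultimately show ?thesis by simp
        next
          case False
          have "integral {-\<bar>x\<bar>-1..y} \<rho> = integral {-\<bar>x\<bar>-1..y} (\<lambda>x. 0)"
            by (rule integral_cong) (use z False in auto)
          then show ?thesis using False by simp
        qed
        have "((\<lambda>y. integral {-\<bar>x\<bar>-1..y} \<rho>) has_real_derivative \<rho> x) (at x within {-\<bar>x\<bar>-1..1})"
          by (rule integral_has_real_derivative) (use True cont in auto)
        then have "((\<lambda>y. integral {-\<bar>x\<bar>-1..y} \<rho>) has_real_derivative \<rho> x) (at x)"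
          using True by (simp add: at_within_Icc_at)
        then show ?thesis
          by (rule has_field_derivative_transform_within_open[where S = "{-\<bar>x\<bar>-1<..<1}"])
            (use True e in auto)
      next
        case False
        have "((\<lambda>y. integral {0..y} \<rho>) has_real_derivative \<rho> x) (at x within {0..x+1})"
          by (rule integral_has_real_derivative) (use False cont in auto)
        then show ?thesis
          using False by (simp add: at_within_Icc_at)
      qed
    qed
  qed
  define R where "R x = Q x - Q 0" for x
  have R: "(R has_real_derivative \<rho> x) (at x)" for x
    unfolding R_def using Q by (auto intro!: derivative_eq_intros)
  have mono: "R x \<le> R y" if "x \<le> y" for x y
    using DERIV_nonneg_imp_nondecreasing[OF that, of R] R pos by blast
  have R0: "R x = 0" if "x \<le> 0" for x
  proof (cases "x = 0")
    case False
    have "R 0 = R x"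
    proof (rule DERIV_isconst_end[of x 0 R])
      show "x < 0" using that False by simp
      show "continuous_on {x..0} R"
        by (rule DERIV_continuous_on[OF has_field_derivative_at_within[OF R]])
      show "(R has_real_derivative 0) (at y)" if "x < y" "y < 0" for y
        using R[of y] z[of y] that by simp
    qed
    then show ?thesis by (simp add: R_def)
  qed (simp add: R_def)
  have "(\<rho> has_integral R 1 - R 0) {0..1}"
    by (rule fundamental_theorem_of_calculus)
      (auto simp: has_real_derivative_iff_has_vector_derivative[symmetric] intro!: has_field_derivative_at_within[OF R])
  moreover have "(\<rho> has_integral 1) {0..1}"
  proof -
    have "(\<rho>0 has_integral c) {0..1}" unfolding c_def
      by (simp add: cont0 integrable_continuous_real integrable_integral)
    then have "(\<rho> has_integral c / c) {0..1}" unfolding \<rho>_def by (rule has_integral_divide)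
    then show ?thesis using c by simp
  qed
  ultimately have "R 1 - R 0 = 1" by (rule has_integral_unique)
  then have R1': "R 1 = 1" by (simp add: R_def)
  have R1: "R x = 1" if "x \<ge> 1" for x
  proof (cases "x = 1")
    case False
    have "R x = R 1"
    proof (rule DERIV_isconst_end[of 1 x R])
      show "1 < x" using that False by simp
      show "continuous_on {1..x} R"
        by (rule DERIV_continuous_on[OF has_field_derivative_at_within[OF R]])
      show "(R has_real_derivative 0) (at y)" if "1 < y" "y < x" for y
        using R[of y] z[of y] that by simp
    qed
    then show ?thesis using R1' by simp
  qed (use R1' in simp)
  have "smooth R"
  proof (rule smoothI)
    show "R differentiable at x" for x
      using R by (meson has_field_derivative_imp_has_derivative differentiable_def)
    have "partial_deriv 1 R = \<rho>" by (rule ext, rule partial_deriv_real[OF R])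
    then show "smooth (partial_deriv i R)" if "i \<in> Basis" for i using that sm by simp
  qed
  moreover have "0 \<le> R x" for x using mono[of 0 x] R0 by (cases "x \<le> 0") auto
  moreover have "R x \<le> 1" for x using mono[of x 1] R1 by (cases "x \<le> 1") auto
  ultimately show ?thesis
    by (intro exI[of _ \<rho>] exI[of _ R] conjI allI impI) (simp_all add: R pos z cont R0 R1)
qed

section \<open>Test functions\<close>

lemma test_functionsD: "\<phi> \<in> test_functions \<Omega> \<Longrightarrow> smooth \<phi>"
  by (simp add: test_functions_def)

lemma test_functionsE:
  assumes "\<phi> \<in> test_functions \<Omega>"
  obtains K where "compact K" "K \<subseteq> \<Omega>" "\<forall>x. x \<notin> K \<longrightarrow> \<phi> x = 0"
  using assms unfolding test_functions_def by (elim CollectE conjE exE) simp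

lemma test_functionsI:
  "smooth \<phi> \<Longrightarrow> compact K \<Longrightarrow> K \<subseteq> \<Omega> \<Longrightarrow> (\<And>x. x \<notin> K \<Longrightarrow> \<phi> x = 0) \<Longrightarrow> \<phi> \<in> test_functions \<Omega>"
  unfolding test_functions_def by (intro CollectI conjI exI[of _ K]) simp_all

lemma test_functions_mult_smooth:
  assumes "\<phi> \<in> test_functions \<Omega>" "smooth \<psi>"
  shows "(\<lambda>x. \<phi> x * \<psi> x) \<in> test_functions \<Omega>"
proof -
  obtain K where K: "compact K" "K \<subseteq> \<Omega>" "\<forall>x. x \<notin> K \<longrightarrow> \<phi> x = 0"
    by (rule test_functionsE[OF assms(1)])
  have "smooth (\<lambda>x. \<phi> x * \<psi> x)" using test_functionsD[OF assms(1)] assms(2) by (simp add: Ck_mult)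
  then show ?thesis by (rule test_functionsI[OF _ K(1,2)]) (simp add: K(3))
qed

lemma test_functions_compose:
  assumes "\<phi> \<in> test_functions \<Omega>" "smooth \<beta>" "\<beta> 0 = 0"
  shows "(\<lambda>x. \<beta> (\<phi> x)) \<in> test_functions \<Omega>"
proof -
  obtain K where K: "compact K" "K \<subseteq> \<Omega>" "\<forall>x. x \<notin> K \<longrightarrow> \<phi> x = 0"
    by (rule test_functionsE[OF assms(1)])
  have "smooth (\<lambda>x. \<beta> (\<phi> x))" using test_functionsD[OF assms(1)] assms(2) by (simp add: Ck_compose)
  then show ?thesis by (rule test_functionsI[OF _ K(1,2)]) (simp add: K(3) assms(3))
qed

lemma test_functions_add:
  assumes "\<phi> \<in> test_functions \<Omega>" "\<psi> \<in> test_functions \<Omega>"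
  shows "(\<lambda>x. \<phi> x + \<psi> x) \<in> test_functions \<Omega>"
proof -
  obtain K where K: "compact K" "K \<subseteq> \<Omega>" "\<forall>x. x \<notin> K \<longrightarrow> \<phi> x = 0"
    by (rule test_functionsE[OF assms(1)])
  obtain L where L: "compact L" "L \<subseteq> \<Omega>" "\<forall>x. x \<notin> L \<longrightarrow> \<psi> x = 0"
    by (rule test_functionsE[OF assms(2)])
  have "smooth (\<lambda>x. \<phi> x + \<psi> x)" using assms[THEN test_functionsD] by (simp add: Ck_add)
  then show ?thesis
    by (rule test_functionsI[of _ "K \<union> L"]) (use K L in \<open>auto intro: compact_Un\<close>)
qed

lemma partial_deriv_outside:
  assumes "open U" "x \<in> U" "\<And>y. y \<in> U \<Longrightarrow> \<phi> y = 0"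
  shows "partial_deriv i \<phi> x = 0"
proof -
  have "(\<phi> has_derivative (\<lambda>h. 0)) (at x)"
    by (rule has_derivative_transform_within_open[OF has_derivative_const[of 0]]) (use assms in auto)
  then show ?thesis by (rule partial_deriv_eq)
qed

lemma test_functions_partial_deriv:
  assumes "\<phi> \<in> test_functions \<Omega>" "i \<in> Basis"
  shows "partial_deriv i \<phi> \<in> test_functions \<Omega>"
proof -
  obtain K where K: "compact K" "K \<subseteq> \<Omega>" "\<forall>x. x \<notin> K \<longrightarrow> \<phi> x = 0"
    by (rule test_functionsE[OF assms(1)])
  have "partial_deriv i \<phi> x = 0" if "x \<notin> K" for x
    by (rule partial_deriv_outside[of "- K"]) (use K that compact_imp_closed in auto)
  then show ?thesis
    by (intro test_functionsI[of _ K] smoothD(2)[OF test_functionsD[OF assms(1)] assms(2)] K)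
qed

lemma test_functions_bounded:
  assumes "\<phi> \<in> test_functions \<Omega>"
  obtains B where "B > 0" "\<And>x. \<bar>\<phi> x\<bar> \<le> B"
proof -
  obtain K where K: "compact K" "K \<subseteq> \<Omega>" "\<forall>x. x \<notin> K \<longrightarrow> \<phi> x = 0"
    by (rule test_functionsE[OF assms])
  have "compact (\<phi> ` K)"
    using K(1) smoothD(3)[OF test_functionsD[OF assms]]
    by (meson compact_continuous_image continuous_on_subset top_greatest)
  then obtain B where "B > 0" "\<forall>x\<in>K. \<bar>\<phi> x\<bar> \<le> B"
    by (metis bounded_pos compact_imp_bounded imageI real_norm_def)
  then show ?thesis using that[of B] K by (metis abs_zero less_eq_real_def)
qed

section \<open>Integrals of test functions and of their derivatives\<close>

lemma test_functions_integrable: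
  fixes \<phi> :: "'a::euclidean_space \<Rightarrow> real"
  assumes "\<phi> \<in> test_functions \<Omega>"
  shows "integrable lborel \<phi>"
proof -
  obtain K where K: "compact K" "K \<subseteq> \<Omega>" "\<forall>x. x \<notin> K \<longrightarrow> \<phi> x = 0"
    by (rule test_functionsE[OF assms])
  have "integrable lborel (\<lambda>x. indicator K x *\<^sub>R \<phi> x)"
    using K(1) smoothD(3)[OF test_functionsD[OF assms]]
    by (intro borel_integrable_compact) (auto intro: continuous_on_subset)
  moreover have "(\<lambda>x. indicator K x *\<^sub>R \<phi> x) = \<phi>"
    using K(3) by (intro ext) (simp add: indicator_def, metis)
  ultimately show ?thesis by simp
qed

text \<open>Partial derivatives are again test functions, hence bounded; the sum of their bounds
  controls the operator norm of the derivative, and the mean value inequality applies on the whole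
  space. The summand 1 in \<open>B\<close> makes the constant positive.\<close>

lemma test_functions_lipschitz:
  fixes \<phi> :: "'a::euclidean_space \<Rightarrow> real"
  assumes "\<phi> \<in> test_functions \<Omega>"
  obtains B where "B > 0" "\<forall>x y. \<bar>\<phi> x - \<phi> y\<bar> \<le> B * norm (x - y)"
proof -
  have d: "\<phi> differentiable at x" for x
    using smoothD(1)[OF test_functionsD[OF assms]] .
  have "\<forall>i\<in>Basis. \<exists>B>0. \<forall>x. \<bar>partial_deriv i \<phi> x\<bar> \<le> B"
    using test_functions_bounded[OF test_functions_partial_deriv[OF assms]] by metis
  then obtain b where b: "\<And>i x. i \<in> Basis \<Longrightarrow> \<bar>partial_deriv i \<phi> x\<bar> \<le> b i"
    by metis
  define B where "B = 1 + (\<Sum>i\<in>Basis. \<bar>b i\<bar>)"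
  have "onorm (frechet_derivative \<phi> (at x)) \<le> B" for x
  proof (rule onorm_le)
    fix h
    let ?D = "frechet_derivative \<phi> (at x)"
    have lin: "linear ?D" using has_derivative_linear[OF has_derivative_frechet[OF d]] .
    have "?D h = ?D (\<Sum>i\<in>Basis. (h \<bullet> i) *\<^sub>R i)" by (simp add: euclidean_representation)
    also have "\<dots> = (\<Sum>i\<in>Basis. (h \<bullet> i) * partial_deriv i \<phi> x)"
      using lin by (simp add: linear_sum linear_scale partial_deriv_def)
    also have "norm \<dots> \<le> (\<Sum>i\<in>Basis. norm h * \<bar>b i\<bar>)"
    proof (rule sum_norm_le)
      fix i :: 'a assume "i \<in> Basis"
      then show "norm ((h \<bullet> i) * partial_deriv i \<phi> x) \<le> norm h * \<bar>b i\<bar>"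
        unfolding real_norm_def abs_mult using b[of i x] Basis_le_norm[of i h]
        by (intro mult_mono) auto
    qed
    also have "\<dots> \<le> B * norm h"
      by (simp add: B_def sum_distrib_left[symmetric] algebra_simps)
    finally show "norm (?D h) \<le> B * norm h" .
  qed
  then have "norm (\<phi> x - \<phi> y) \<le> B * norm (x - y)" for x y
    by (intro differentiable_bound[of UNIV \<phi> "\<lambda>x. frechet_derivative \<phi> (at x)"])
      (use has_derivative_frechet[OF d] in auto)
  moreover have "B > 0" unfolding B_def by (smt (verit) sum_nonneg)
  ultimately show ?thesis using that by auto
qed

lemma integral_lborel_shift:
  fixes f :: "'a::euclidean_space \<Rightarrow> real"
  assumes "f \<in> borel_measurable borel"
  shows "(\<integral>x. f (c + x) \<partial>lborel) = (\<integral>x. f x \<partial>lborel)"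
    and "integrable lborel f \<Longrightarrow> integrable lborel (\<lambda>x. f (c + x))"
proof -
  have m: "(+) c \<in> measurable lborel borel" by simp
  show "(\<integral>x. f (c + x) \<partial>lborel) = (\<integral>x. f x \<partial>lborel)"
    using integral_distr[OF m, of f] assms by (simp add: lborel_distr_plus)
  show "integrable lborel (\<lambda>x. f (c + x))" if "integrable lborel f"
    using integrable_distr[OF m, of f] that by (simp add: lborel_distr_plus)
qed

text \<open>Translation invariance makes the integrals of all difference quotients vanish.\<close>

lemma integral_partial_deriv:
  fixes \<phi> :: "'a::euclidean_space \<Rightarrow> real"
  assumes \<phi>: "\<phi> \<in> test_functions \<Omega>" and i: "i \<in> Basis"
  shows "(\<integral>x. partial_deriv i \<phi> x \<partial>lborel) = 0"
proof -
  obtain K where K: "compact K" "K \<subseteq> \<Omega>" "\<forall>x. x \<notin> K \<longrightarrow> \<phi> x = 0"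
    by (rule test_functionsE[OF \<phi>])
  obtain r where r: "\<And>x. x \<in> K \<Longrightarrow> norm x \<le> r"
    using K(1) by (meson bounded_iff compact_imp_bounded)
  obtain B where B: "B > 0" "\<forall>x y. \<bar>\<phi> x - \<phi> y\<bar> \<le> B * norm (x - y)"
    by (rule test_functions_lipschitz[OF \<phi>])
  have [measurable]: "\<phi> \<in> borel_measurable borel"
    using smoothD(3)[OF test_functionsD[OF \<phi>]] borel_measurable_continuous_onI by blast
  have [measurable]: "partial_deriv i \<phi> \<in> borel_measurable borel"
    using smoothD(3)[OF test_functionsD[OF test_functions_partial_deriv[OF \<phi> i]]] borel_measurable_continuous_onI by blast
  \<comment> \<open>Difference quotients with step \<open>1 / (n + 1)\<close>. The step never
    exceeds 1, so all of them are supported in the ball of radius \<open>r + 1\<close>, where the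
    Lipschitz constant \<open>B\<close> bounds them; this is the integrable majorant below.\<close>
  define q where "q n x = (\<phi> (inverse (real (Suc n)) *\<^sub>R i + x) - \<phi> x) * real (Suc n)" for n x
  have q0: "(\<integral>x. q n x \<partial>lborel) = 0" for n
    unfolding q_def using integral_lborel_shift[of \<phi> "inverse (real (Suc n)) *\<^sub>R i"] test_functions_integrable[OF \<phi>]
    by simp
  have "(\<lambda>n. \<integral>x. q n x \<partial>lborel) \<longlonglongrightarrow> (\<integral>x. partial_deriv i \<phi> x \<partial>lborel)"
  proof (rule integral_dominated_convergence[where w = "\<lambda>x. indicator (cball 0 (r + 1)) x * B"])
    show "integrable lborel (\<lambda>x::'a. indicator (cball 0 (r + 1)) x * B)"
      using borel_integrable_compact[of "cball (0::'a) (r+1)" "\<lambda>_. B"] by simp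
    show "AE x in lborel. norm (q n x) \<le> indicator (cball 0 (r + 1)) x * B" for n
    proof (rule AE_I2)
      fix x :: 'a
      let ?h = "inverse (real (Suc n))"
      have h: "norm (?h *\<^sub>R i) = ?h" "?h \<le> 1" using i by (auto simp: divide_simps)
      show "norm (q n x) \<le> indicator (cball 0 (r + 1)) x * B"
      proof (cases "x \<in> cball 0 (r + 1)")
        case True
        have "\<bar>\<phi> (?h *\<^sub>R i + x) - \<phi> x\<bar> \<le> B * ?h" using B(2)[rule_format, of "?h *\<^sub>R i + x" x] h by simp
        then have "\<bar>q n x\<bar> \<le> B * ?h * real (Suc n)"
          unfolding q_def abs_mult by (intro mult_mono) auto
        also have "\<dots> = B" by (simp add: field_simps)
        finally show ?thesis using True by simp
      next
        case False
        then have "norm x > r + 1" by simp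
        moreover have "norm x \<le> norm (?h *\<^sub>R i + x) + norm (?h *\<^sub>R i)"
          by (metis add.commute add_diff_cancel_left' norm_triangle_ineq4)
        ultimately have "norm (?h *\<^sub>R i + x) > r" "norm x > r" using h by linarith+
        then have "x \<notin> K" "?h *\<^sub>R i + x \<notin> K" using r by (meson not_le)+
        then show ?thesis using K B by (simp add: q_def)
      qed
    qed
    show "AE x in lborel. (\<lambda>n. q n x) \<longlonglongrightarrow> partial_deriv i \<phi> x"
    proof (rule AE_I2)
      fix x :: 'a
      let ?D = "frechet_derivative \<phi> (at x)"
      have D: "(\<phi> has_derivative ?D) (at x)"
        using smoothD(1)[OF test_functionsD[OF \<phi>]] by (rule has_derivative_frechet)
      moreover have "((\<lambda>h. h *\<^sub>R i + x) has_derivative (\<lambda>h. h *\<^sub>R i)) (at 0)"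
        by (auto intro!: derivative_eq_intros)
      ultimately have "((\<lambda>h. \<phi> (h *\<^sub>R i + x)) has_derivative (\<lambda>h. ?D (h *\<^sub>R i))) (at 0)"
        using has_derivative_compose[of "\<lambda>h. h *\<^sub>R i + x" "\<lambda>h. h *\<^sub>R i" 0 UNIV \<phi> ?D] by simp
      moreover have "?D (h *\<^sub>R i) = partial_deriv i \<phi> x * h" for h
        using has_derivative_linear[OF D]
        by (simp add: linear_scale partial_deriv_def)
      ultimately have "((\<lambda>h. \<phi> (h *\<^sub>R i + x)) has_real_derivative partial_deriv i \<phi> x) (at 0)"
        by (simp add: has_field_derivative_def)
      then have "((\<lambda>h. (\<phi> (h *\<^sub>R i + x) - \<phi> x) / h) \<longlongrightarrow> partial_deriv i \<phi> x) (at 0)"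
        by (simp add: has_field_derivative_iff)
      moreover have "filterlim (\<lambda>n. inverse (real (Suc n))) (at 0) sequentially"
        using LIMSEQ_inverse_real_of_nat by (auto simp: filterlim_at)
      ultimately have "(\<lambda>n. (\<phi> (inverse (real (Suc n)) *\<^sub>R i + x) - \<phi> x) / inverse (real (Suc n))) \<longlonglongrightarrow> partial_deriv i \<phi> x"
        by (rule filterlim_compose)
      then show "(\<lambda>n. q n x) \<longlonglongrightarrow> partial_deriv i \<phi> x"
        unfolding q_def by (simp add: field_simps)
    qed
  qed (simp_all add: q_def)
  then show ?thesis using q0 by (simp add: LIMSEQ_const_iff)
qed

section \<open>Square integrable functions\<close>

lemma L2_measurable: "f \<in> L2 \<Omega> \<Longrightarrow> f \<in> borel_measurable (lebesgue_on \<Omega>)"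
  and L2_integrable_sq: "f \<in> L2 \<Omega> \<Longrightarrow> integrable (lebesgue_on \<Omega>) (\<lambda>x. (norm (f x))\<^sup>2)"
  by (auto simp: L2_def)

lemma L2I_bound:
  fixes f :: "'a::euclidean_space \<Rightarrow> 'b::euclidean_space" and g :: "'a \<Rightarrow> 'c::euclidean_space"
  assumes "g \<in> L2 \<Omega>" "f \<in> borel_measurable (lebesgue_on \<Omega>)"
    and "AE x in lebesgue_on \<Omega>. norm (f x) \<le> norm (g x)"
  shows "f \<in> L2 \<Omega>"
proof -
  have "integrable (lebesgue_on \<Omega>) (\<lambda>x. (norm (f x))\<^sup>2)"
  proof (rule Bochner_Integration.integrable_bound[OF L2_integrable_sq[OF assms(1)]])
    show "AE x in lebesgue_on \<Omega>. norm ((norm (f x))\<^sup>2) \<le> norm ((norm (g x))\<^sup>2)"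
      using assms(3) by eventually_elim (simp add: power_mono)
  qed (use assms(2) in measurable)
  then show ?thesis using assms(2) by (simp add: L2_def)
qed

lemma L2_norm_nonneg [simp]: "0 \<le> L2_norm \<Omega> f"
  by (simp add: L2_norm_def)

lemma L2_norm_sq: "(L2_norm \<Omega> f)\<^sup>2 = (LINT x|lebesgue_on \<Omega>. (norm (f x))\<^sup>2)"
  by (simp add: L2_norm_def)

lemma L2_norm_cong_AE:
  assumes "f \<in> borel_measurable (lebesgue_on \<Omega>)" "g \<in> borel_measurable (lebesgue_on \<Omega>)"
    "AE x in lebesgue_on \<Omega>. f x = g x"
  shows "L2_norm \<Omega> f = L2_norm \<Omega> g"
proof -
  have "(LINT x|lebesgue_on \<Omega>. (norm (f x))\<^sup>2) = (LINT x|lebesgue_on \<Omega>. (norm (g x))\<^sup>2)"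
    by (rule integral_cong_AE) (use assms in auto)
  then show ?thesis by (simp add: L2_norm_def)
qed

lemma L2_norm_mono:
  fixes f :: "'a::euclidean_space \<Rightarrow> 'b::euclidean_space" and g :: "'a \<Rightarrow> 'c::euclidean_space"
  assumes "f \<in> L2 \<Omega>" "g \<in> L2 \<Omega>" "AE x in lebesgue_on \<Omega>. norm (f x) \<le> norm (g x)"
  shows "L2_norm \<Omega> f \<le> L2_norm \<Omega> g"
  unfolding L2_norm_def real_sqrt_le_iff
  by (rule integral_mono_AE[OF L2_integrable_sq[OF assms(1)] L2_integrable_sq[OF assms(2)]])
    (use assms(3) in eventually_elim, simp add: power_mono)

lemma L2_scaleR:
  fixes f :: "'a::euclidean_space \<Rightarrow> 'b::euclidean_space"
  assumes "f \<in> L2 \<Omega>" shows "(\<lambda>x. c *\<^sub>R f x) \<in> L2 \<Omega>"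
  using assms unfolding L2_def by (auto simp: power_mult_distrib intro!: borel_measurable_scaleR)

lemma L2_norm_scaleR: "L2_norm \<Omega> (\<lambda>x. c *\<^sub>R f x) = \<bar>c\<bar> * L2_norm \<Omega> f"
  by (simp add: L2_norm_def power_mult_distrib real_sqrt_mult)

lemma L2_cmult: "f \<in> L2 \<Omega> \<Longrightarrow> (\<lambda>x. c * f x) \<in> L2 \<Omega>" for f :: "'a::euclidean_space \<Rightarrow> real"
  using L2_scaleR[of f \<Omega> c] by simp

lemma L2_add:
  fixes f g :: "'a::euclidean_space \<Rightarrow> 'b::euclidean_space"
  assumes "f \<in> L2 \<Omega>" "g \<in> L2 \<Omega>" shows "(\<lambda>x. f x + g x) \<in> L2 \<Omega>"
proof -
  have "integrable (lebesgue_on \<Omega>) (\<lambda>x. (norm (f x + g x))\<^sup>2)"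
  proof (rule Bochner_Integration.integrable_bound)
    show "integrable (lebesgue_on \<Omega>) (\<lambda>x. 2 * (norm (f x))\<^sup>2 + 2 * (norm (g x))\<^sup>2)"
      by (intro Bochner_Integration.integrable_add integrable_mult_right L2_integrable_sq assms)
    have "(norm (a + b))\<^sup>2 \<le> 2 * (norm a)\<^sup>2 + 2 * (norm b)\<^sup>2" for a b :: 'b
    proof -
      have "(norm (a + b))\<^sup>2 \<le> (norm a + norm b)\<^sup>2" by (simp add: norm_triangle_ineq power_mono)
      also have "\<dots> \<le> 2 * (norm a)\<^sup>2 + 2 * (norm b)\<^sup>2"
        using zero_le_power2[of "norm a - norm b"] by (simp add: power2_eq_square algebra_simps)
      finally show ?thesis .
    qed
    then show "AE x in lebesgue_on \<Omega>. norm ((norm (f x + g x))\<^sup>2) \<le> norm (2 * (norm (f x))\<^sup>2 + 2 * (norm (g x))\<^sup>2)"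
      by simp
  qed (use assms[THEN L2_measurable] in measurable)
  moreover have "(\<lambda>x. f x + g x) \<in> borel_measurable (lebesgue_on \<Omega>)"
    using assms[THEN L2_measurable] by (rule borel_measurable_add)
  ultimately show ?thesis by (simp add: L2_def)
qed

lemma L2_diff:
  fixes f g :: "'a::euclidean_space \<Rightarrow> 'b::euclidean_space"
  assumes "f \<in> L2 \<Omega>" "g \<in> L2 \<Omega>" shows "(\<lambda>x. f x - g x) \<in> L2 \<Omega>"
  using L2_add[OF assms(1) L2_scaleR[OF assms(2), of "-1"]] by simp

lemma L2_zero: "(\<lambda>x. 0) \<in> L2 \<Omega>"
  by (simp add: L2_def)

lemma L2_bounded_scaleR:
  fixes f :: "'a::euclidean_space \<Rightarrow> 'b::euclidean_space"
  assumes "f \<in> L2 \<Omega>" "\<kappa> \<in> borel_measurable (lebesgue_on \<Omega>)" "\<And>x. \<bar>\<kappa> x\<bar> \<le> C"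
  shows "(\<lambda>x. \<kappa> x *\<^sub>R f x) \<in> L2 \<Omega>" "L2_norm \<Omega> (\<lambda>x. \<kappa> x *\<^sub>R f x) \<le> C * L2_norm \<Omega> f"
proof -
  have C: "C \<ge> 0" using assms(3)[of undefined] by linarith
  have le: "AE x in lebesgue_on \<Omega>. norm (\<kappa> x *\<^sub>R f x) \<le> norm (C *\<^sub>R f x)"
    using C assms(3) by (auto intro!: mult_right_mono)
  show *: "(\<lambda>x. \<kappa> x *\<^sub>R f x) \<in> L2 \<Omega>"
    by (rule L2I_bound[OF L2_scaleR[OF assms(1), of C] _ le])
      (use assms L2_measurable in measurable)
  show "L2_norm \<Omega> (\<lambda>x. \<kappa> x *\<^sub>R f x) \<le> C * L2_norm \<Omega> f"
    using L2_norm_mono[OF * L2_scaleR[OF assms(1), of C] le] C by (simp add: L2_norm_scaleR)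
qed

lemma L2_inner_integrable:
  assumes "f \<in> L2 \<Omega>" "g \<in> L2 \<Omega>"
  shows "integrable (lebesgue_on \<Omega>) (\<lambda>x. f x \<bullet> g x)"
proof (rule Bochner_Integration.integrable_bound)
  show "integrable (lebesgue_on \<Omega>) (\<lambda>x. (norm (f x))\<^sup>2 + (norm (g x))\<^sup>2)"
    by (intro Bochner_Integration.integrable_add L2_integrable_sq assms)
  have "\<bar>a \<bullet> b\<bar> \<le> (norm a)\<^sup>2 + (norm b)\<^sup>2" for a b :: 'b
  proof -
    have "\<bar>a \<bullet> b\<bar> \<le> norm a * norm b" by (rule Cauchy_Schwarz_ineq2)
    also have "\<dots> \<le> (norm a)\<^sup>2 + (norm b)\<^sup>2"
      using zero_le_power2[of "norm a - norm b"] mult_nonneg_nonneg[OF norm_ge_zero[of a] norm_ge_zero[of b]]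
      unfolding power2_diff by linarith
    finally show ?thesis .
  qed
  then show "AE x in lebesgue_on \<Omega>. norm (f x \<bullet> g x) \<le> norm ((norm (f x))\<^sup>2 + (norm (g x))\<^sup>2)"
    by simp
qed (rule borel_measurable_inner[OF assms[THEN L2_measurable]])

lemma L2_norm_eq_0:
  assumes "f \<in> L2 \<Omega>"
  shows "L2_norm \<Omega> f = 0 \<longleftrightarrow> (AE x in lebesgue_on \<Omega>. f x = 0)"
  using integral_nonneg_eq_0_iff_AE[OF L2_integrable_sq[OF assms]] by (simp add: L2_norm_def)

section \<open>Inner product and triangle inequality in \<open>L2\<close>\<close>

lemma L2_inner_add_left:
  assumes "f \<in> L2 \<Omega>" "g \<in> L2 \<Omega>" "h \<in> L2 \<Omega>"
  shows "L2_inner \<Omega> (\<lambda>x. f x + g x) h = L2_inner \<Omega> f h + L2_inner \<Omega> g h"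
  using L2_inner_integrable[OF assms(1,3)] L2_inner_integrable[OF assms(2,3)]
  by (simp add: L2_inner_def inner_add_left)

lemma L2_inner_diff_left:
  assumes "f \<in> L2 \<Omega>" "g \<in> L2 \<Omega>" "h \<in> L2 \<Omega>"
  shows "L2_inner \<Omega> (\<lambda>x. f x - g x) h = L2_inner \<Omega> f h - L2_inner \<Omega> g h"
  using L2_inner_integrable[OF assms(1,3)] L2_inner_integrable[OF assms(2,3)]
  by (simp add: L2_inner_def inner_diff_left)

lemma L2_inner_commute: "L2_inner \<Omega> f g = L2_inner \<Omega> g f"
  by (simp add: L2_inner_def inner_commute)

lemma L2_inner_scaleR_left: "L2_inner \<Omega> (\<lambda>x. c *\<^sub>R f x) g = c * L2_inner \<Omega> f g"
  by (simp add: L2_inner_def)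

lemma L2_norm_add_sq:
  assumes "f \<in> L2 \<Omega>" "g \<in> L2 \<Omega>"
  shows "(L2_norm \<Omega> (\<lambda>x. f x + g x))\<^sup>2 = (L2_norm \<Omega> f)\<^sup>2 + 2 * L2_inner \<Omega> f g + (L2_norm \<Omega> g)\<^sup>2"
proof -
  have "(norm (f x + g x))\<^sup>2 = (norm (f x))\<^sup>2 + 2 * (f x \<bullet> g x) + (norm (g x))\<^sup>2" for x
    by (simp add: power2_norm_eq_inner inner_add_left inner_add_right inner_commute)
  then show ?thesis
    using L2_inner_integrable[OF assms] L2_integrable_sq[OF assms(1)] L2_integrable_sq[OF assms(2)]
    by (simp add: L2_norm_sq L2_inner_def)
qed

text \<open>With \<open>a\<close>, \<open>b\<close> the two norms and \<open>I\<close> the inner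
  product, expanding the squared norms of \<open>b f + a g\<close> and \<open>b f - a g\<close>
  gives \<open>a b (a b + I) \<ge> 0\<close> and \<open>a b (a b - I) \<ge> 0\<close>. Dividing by
  \<open>a b\<close> fails only if a norm is 0, and then that function vanishes almost
  everywhere.\<close>

lemma L2_Cauchy_Schwarz:
  assumes "f \<in> L2 \<Omega>" "g \<in> L2 \<Omega>"
  shows "\<bar>L2_inner \<Omega> f g\<bar> \<le> L2_norm \<Omega> f * L2_norm \<Omega> g"
proof -
  let ?a = "L2_norm \<Omega> f" and ?b = "L2_norm \<Omega> g" and ?I = "L2_inner \<Omega> f g"
  have z: "L2_inner \<Omega> f g = 0" if "L2_norm \<Omega> f = 0" "f \<in> L2 \<Omega>" for f g :: "'a \<Rightarrow> 'b"
  proof -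
    have "AE x in lebesgue_on \<Omega>. f x \<bullet> g x = 0"
      using that(1) unfolding L2_norm_eq_0[OF that(2)] by auto
    then show ?thesis by (simp add: L2_inner_def integral_eq_zero_AE)
  qed
  have ex: "(L2_norm \<Omega> (\<lambda>x. c *\<^sub>R f x + d *\<^sub>R g x))\<^sup>2 = c\<^sup>2 * ?a\<^sup>2 + 2 * (c * d * ?I) + d\<^sup>2 * ?b\<^sup>2" for c d
  proof -
    have "L2_inner \<Omega> (\<lambda>x. c *\<^sub>R f x) (\<lambda>x. d *\<^sub>R g x) = c * d * ?I"
      by (simp add: L2_inner_def mult.assoc)
    then show ?thesis
      unfolding L2_norm_add_sq[OF L2_scaleR[OF assms(1)] L2_scaleR[OF assms(2)]] L2_norm_scaleR
      by (simp add: power_mult_distrib)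
  qed
  have "0 \<le> ?b\<^sup>2 * ?a\<^sup>2 + 2 * (?b * ?a * ?I) + ?a\<^sup>2 * ?b\<^sup>2"
    using zero_le_power2[of "L2_norm \<Omega> (\<lambda>x. ?b *\<^sub>R f x + ?a *\<^sub>R g x)"] unfolding ex .
  then have p: "0 \<le> (?a * ?b) * (?a * ?b + ?I)" by (simp add: power2_eq_square algebra_simps)
  have "0 \<le> ?b\<^sup>2 * ?a\<^sup>2 + 2 * (?b * (- ?a) * ?I) + (- ?a)\<^sup>2 * ?b\<^sup>2"
    using zero_le_power2[of "L2_norm \<Omega> (\<lambda>x. ?b *\<^sub>R f x + (- ?a) *\<^sub>R g x)"] unfolding ex .
  then have m: "0 \<le> (?a * ?b) * (?a * ?b - ?I)" by (simp add: power2_eq_square algebra_simps)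
  show ?thesis
  proof (cases "?a = 0 \<or> ?b = 0")
    case True
    then have "?I = 0"
      using z[OF _ assms(1), of g] z[OF _ assms(2), of f] L2_inner_commute[of \<Omega> f g] by argo
    then show ?thesis by simp
  next
    case False
    then have "?a * ?b > 0"
      using L2_norm_nonneg[of \<Omega> f] L2_norm_nonneg[of \<Omega> g] by (simp add: less_le)
    then have "?a * ?b + ?I \<ge> 0" "?a * ?b - ?I \<ge> 0" using p m zero_le_mult_iff[of "?a * ?b"] by auto
    then show ?thesis by (simp add: abs_le_iff)
  qed
qed

lemma L2_norm_triangle:
  assumes "f \<in> L2 \<Omega>" "g \<in> L2 \<Omega>"
  shows "L2_norm \<Omega> (\<lambda>x. f x + g x) \<le> L2_norm \<Omega> f + L2_norm \<Omega> g"
proof (rule power2_le_imp_le)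
  show "(L2_norm \<Omega> (\<lambda>x. f x + g x))\<^sup>2 \<le> (L2_norm \<Omega> f + L2_norm \<Omega> g)\<^sup>2"
    unfolding L2_norm_add_sq[OF assms] using L2_Cauchy_Schwarz[OF assms]
    by (simp add: power2_eq_square algebra_simps abs_le_iff)
qed simp

lemma L2_norm_minus_commute: "L2_norm \<Omega> (\<lambda>x. f x - g x) = L2_norm \<Omega> (\<lambda>x. g x - f x)"
  by (simp add: L2_norm_def norm_minus_commute)

lemma L2_norm_triangle_diff:
  assumes "f \<in> L2 \<Omega>" "g \<in> L2 \<Omega>"
  shows "\<bar>L2_norm \<Omega> f - L2_norm \<Omega> g\<bar> \<le> L2_norm \<Omega> (\<lambda>x. f x - g x)"
  using L2_norm_triangle[OF L2_diff[OF assms] assms(2)] L2_norm_triangle[OF L2_diff[OF assms(2,1)] assms(1)]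
    L2_norm_minus_commute[of \<Omega> f g] by simp

text \<open>A sequence that does not converge to \<open>L\<close> keeps a fixed distance from
  \<open>L\<close> along some subsequence, and no further subsequence of that one can converge to
  \<open>L\<close>. The principle is needed because \<open>L2\<close> convergence gives convergence
  almost everywhere only along subsequences.\<close>

lemma tendsto_subseqI:
  fixes X :: "nat \<Rightarrow> real"
  assumes "\<And>r :: nat \<Rightarrow> nat. strict_mono r \<Longrightarrow> \<exists>s. strict_mono s \<and> (\<lambda>n. X (r (s n))) \<longlonglongrightarrow> L"
  shows "X \<longlonglongrightarrow> L"
proof (rule ccontr)
  assume "\<not> X \<longlonglongrightarrow> L"
  then obtain e where e: "e > 0" "\<not> (\<forall>\<^sub>F n in sequentially. dist (X n) L < e)"
    unfolding tendsto_iff by blast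
  then have "infinite {n. \<not> dist (X n) L < e}"
    by (simp add: frequently_cofinite cofinite_eq_sequentially not_eventually flip: frequently_cofinite)
  then obtain r :: "nat \<Rightarrow> nat" where r: "strict_mono r" "\<And>n. r n \<in> {n. \<not> dist (X n) L < e}"
    using infinite_enumerate by blast
  obtain s where s: "(\<lambda>n. X (r (s n))) \<longlonglongrightarrow> L" using assms r(1) by blast
  have "\<forall>\<^sub>F n in sequentially. dist (X (r (s n))) L < e" using tendstoD[OF s e(1)] .
  then show False using r(2) by (auto simp: eventually_sequentially)
qed

text \<open>The squared distance tends to 0 in \<open>L1\<close>, where the extraction of a
  subsequence converging almost everywhere is known.\<close>

lemma L2_AE_subseq:
  fixes f :: "'a::euclidean_space \<Rightarrow> 'b::euclidean_space"
  assumes "\<And>n. fn n \<in> L2 \<Omega>" "f \<in> L2 \<Omega>" "(\<lambda>n. L2_norm \<Omega> (\<lambda>x. fn n x - f x)) \<longlonglongrightarrow> 0"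
  obtains r :: "nat \<Rightarrow> nat" where "strict_mono r" "AE x in lebesgue_on \<Omega>. (\<lambda>n. fn (r n) x) \<longlonglongrightarrow> f x"
proof -
  have "\<exists>r::nat\<Rightarrow>nat. strict_mono r \<and> (AE x in lebesgue_on \<Omega>. (\<lambda>n. (norm (fn (r n) x - f x))\<^sup>2) \<longlonglongrightarrow> 0)"
  proof (rule tendsto_L1_AE_subseq)
    show "integrable (lebesgue_on \<Omega>) (\<lambda>x. (norm (fn n x - f x))\<^sup>2)" for n
      using L2_integrable_sq[OF L2_diff[OF assms(1,2)]] .
    have "(\<lambda>n. (L2_norm \<Omega> (\<lambda>x. fn n x - f x))\<^sup>2) \<longlonglongrightarrow> 0\<^sup>2" using assms(3) by (intro tendsto_power)
    then show "(\<lambda>n. LINT x|lebesgue_on \<Omega>. norm ((norm (fn n x - f x))\<^sup>2)) \<longlonglongrightarrow> 0"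
      by (simp add: L2_norm_sq)
  qed
  then obtain r :: "nat \<Rightarrow> nat" where r: "strict_mono r" "AE x in lebesgue_on \<Omega>. (\<lambda>n. (norm (fn (r n) x - f x))\<^sup>2) \<longlonglongrightarrow> 0"
    by blast
  have "AE x in lebesgue_on \<Omega>. (\<lambda>n. fn (r n) x) \<longlonglongrightarrow> f x"
    using r(2)
  proof eventually_elim
    case (elim x)
    then have "(\<lambda>n. sqrt ((norm (fn (r n) x - f x))\<^sup>2)) \<longlonglongrightarrow> sqrt 0" by (rule tendsto_real_sqrt)
    then have "(\<lambda>n. norm (fn (r n) x - f x)) \<longlonglongrightarrow> 0" by simp
    then show ?case using Lim_null tendsto_norm_zero_iff by blast
  qed
  with r(1) show ?thesis using that by blast
qed

lemma L2_dominated_convergence: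
  fixes hn :: "nat \<Rightarrow> 'a::euclidean_space \<Rightarrow> 'b::euclidean_space" and w :: "'a \<Rightarrow> real"
  assumes w: "w \<in> L2 \<Omega>" and hn: "\<And>n. hn n \<in> borel_measurable (lebesgue_on \<Omega>)"
    and b: "\<And>n. AE x in lebesgue_on \<Omega>. norm (hn n x) \<le> w x"
    and c: "AE x in lebesgue_on \<Omega>. (\<lambda>n. hn n x) \<longlonglongrightarrow> 0"
  shows "(\<lambda>n. L2_norm \<Omega> (hn n)) \<longlonglongrightarrow> 0"
proof -
  have "(\<lambda>n. LINT x|lebesgue_on \<Omega>. (norm (hn n x))\<^sup>2) \<longlonglongrightarrow> (LINT x|lebesgue_on \<Omega>. 0)"
  proof (rule integral_dominated_convergence)
    show "integrable (lebesgue_on \<Omega>) (\<lambda>x. (norm (w x))\<^sup>2)" by (rule L2_integrable_sq[OF w])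
    show "AE x in lebesgue_on \<Omega>. (\<lambda>n. (norm (hn n x))\<^sup>2) \<longlonglongrightarrow> 0"
      using c by eventually_elim (auto intro!: tendsto_eq_intros)
    show "AE x in lebesgue_on \<Omega>. norm ((norm (hn n x))\<^sup>2) \<le> (norm (w x))\<^sup>2" for n
      using b[of n] by eventually_elim (auto intro!: power_mono)
  qed (use hn in auto)
  then have "(\<lambda>n. sqrt (LINT x|lebesgue_on \<Omega>. (norm (hn n x))\<^sup>2)) \<longlonglongrightarrow> sqrt 0"
    by (intro tendsto_real_sqrt) simp
  then show ?thesis by (simp add: L2_norm_def)
qed

text \<open>Continuity of superposition operators. Along a further subsequence both arguments
  converge almost everywhere, and the majorant \<open>w\<close>, independent of the arguments,
  allows dominated convergence; the subsequence principle does the rest. The last argument of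
  \<open>h\<close> leaves room for a fixed factor depending on the point.\<close>

lemma L2_compose_tendsto:
  fixes f g :: "'a::euclidean_space \<Rightarrow> real" and h :: "real \<Rightarrow> real \<Rightarrow> 'a \<Rightarrow> 'b::euclidean_space"
  assumes fn: "\<And>n. fn n \<in> L2 \<Omega>" "f \<in> L2 \<Omega>" "(\<lambda>n. L2_norm \<Omega> (\<lambda>x. fn n x - f x)) \<longlonglongrightarrow> 0"
    and gn: "\<And>n. gn n \<in> L2 \<Omega>" "g \<in> L2 \<Omega>" "(\<lambda>n. L2_norm \<Omega> (\<lambda>x. gn n x - g x)) \<longlonglongrightarrow> 0"
    and cont: "\<And>x. continuous_on UNIV (\<lambda>p. h (fst p) (snd p) x)"
    and meas: "\<And>f g. f \<in> L2 \<Omega> \<Longrightarrow> g \<in> L2 \<Omega> \<Longrightarrow> (\<lambda>x. h (f x) (g x) x) \<in> borel_measurable (lebesgue_on \<Omega>)"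
    and w: "w \<in> L2 \<Omega>" "\<And>a b x. norm (h a b x) \<le> w x"
  shows "(\<lambda>n. L2_norm \<Omega> (\<lambda>x. h (fn n x) (gn n x) x - h (f x) (g x) x)) \<longlonglongrightarrow> 0"
proof (rule tendsto_subseqI)
  fix r :: "nat \<Rightarrow> nat" assume r: "strict_mono r"
  have "(\<lambda>n. L2_norm \<Omega> (\<lambda>x. fn (r n) x - f x)) \<longlonglongrightarrow> 0"
    using LIMSEQ_subseq_LIMSEQ[OF fn(3) r] by (simp add: o_def)
  then obtain s :: "nat \<Rightarrow> nat" where s: "strict_mono s" "AE x in lebesgue_on \<Omega>. (\<lambda>n. fn (r (s n)) x) \<longlonglongrightarrow> f x"
    using L2_AE_subseq[of "\<lambda>n. fn (r n)" \<Omega> f] fn by blast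
  have "(\<lambda>n. L2_norm \<Omega> (\<lambda>x. gn (r (s n)) x - g x)) \<longlonglongrightarrow> 0"
    using LIMSEQ_subseq_LIMSEQ[OF gn(3) strict_mono_o[OF r s(1)]] by (simp add: o_def)
  then obtain q :: "nat \<Rightarrow> nat" where q: "strict_mono q" "AE x in lebesgue_on \<Omega>. (\<lambda>n. gn (r (s (q n))) x) \<longlonglongrightarrow> g x"
    using L2_AE_subseq[of "\<lambda>n. gn (r (s n))" \<Omega> g] gn by blast
  have "(\<lambda>n. L2_norm \<Omega> (\<lambda>x. h (fn (r (s (q n))) x) (gn (r (s (q n))) x) x - h (f x) (g x) x)) \<longlonglongrightarrow> 0"
  proof (rule L2_dominated_convergence[OF L2_cmult[OF w(1), of 2]])
    show "AE x in lebesgue_on \<Omega>. norm (h (fn (r (s (q n))) x) (gn (r (s (q n))) x) x - h (f x) (g x) x) \<le> 2 * w x" for n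
    proof (rule AE_I2)
      fix x
      show "norm (h (fn (r (s (q n))) x) (gn (r (s (q n))) x) x - h (f x) (g x) x) \<le> 2 * w x"
        using norm_triangle_ineq4[of "h (fn (r (s (q n))) x) (gn (r (s (q n))) x) x" "h (f x) (g x) x"]
          w(2)[of "fn (r (s (q n))) x" "gn (r (s (q n))) x" x] w(2)[of "f x" "g x" x] by linarith
    qed
    show "AE x in lebesgue_on \<Omega>. (\<lambda>n. h (fn (r (s (q n))) x) (gn (r (s (q n))) x) x - h (f x) (g x) x) \<longlonglongrightarrow> 0"
      using s(2) q(2)
    proof eventually_elim
      case (elim x)
      have "(\<lambda>n. (fn (r (s (q n))) x, gn (r (s (q n))) x)) \<longlonglongrightarrow> (f x, g x)"
        using LIMSEQ_subseq_LIMSEQ[OF elim(1) q(1)] elim(2) by (intro tendsto_Pair) (auto simp: o_def)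
      from continuous_on_tendsto_compose[OF cont[of x] this]
      show ?case by (simp add: Lim_null[symmetric] LIM_zero_iff)
    qed
  qed (use meas fn gn in \<open>auto intro!: borel_measurable_diff\<close>)
  then show "\<exists>s. strict_mono s \<and> (\<lambda>n. L2_norm \<Omega> (\<lambda>x. h (fn (r (s n)) x) (gn (r (s n)) x) x - h (f x) (g x) x)) \<longlonglongrightarrow> 0"
    using strict_mono_o[OF s(1) q(1)] by (intro exI[of _ "s \<circ> q"]) (auto simp: o_def)
qed

lemma L2_inner_tendsto:
  assumes "\<And>n. fn n \<in> L2 \<Omega>" "f \<in> L2 \<Omega>" "(\<lambda>n. L2_norm \<Omega> (\<lambda>x. fn n x - f x)) \<longlonglongrightarrow> 0"
    and "\<And>n. gn n \<in> L2 \<Omega>" "g \<in> L2 \<Omega>" "(\<lambda>n. L2_norm \<Omega> (\<lambda>x. gn n x - g x)) \<longlonglongrightarrow> 0"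
  shows "(\<lambda>n. L2_inner \<Omega> (fn n) (gn n)) \<longlonglongrightarrow> L2_inner \<Omega> f g"
proof -
  let ?a = "\<lambda>n. L2_norm \<Omega> (\<lambda>x. fn n x - f x)" and ?b = "\<lambda>n. L2_norm \<Omega> (\<lambda>x. gn n x - g x)"
  have "\<bar>L2_inner \<Omega> (fn n) (gn n) - L2_inner \<Omega> f g\<bar> \<le> ?a n * (L2_norm \<Omega> g + ?b n) + L2_norm \<Omega> f * ?b n" for n
  proof -
    have "L2_inner \<Omega> (fn n) (gn n) - L2_inner \<Omega> f g
        = L2_inner \<Omega> (\<lambda>x. fn n x - f x) (gn n) + L2_inner \<Omega> (\<lambda>x. gn n x - g x) f"
      using assms by (simp add: L2_inner_diff_left) (simp add: L2_inner_commute)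
    moreover have "\<bar>L2_inner \<Omega> (\<lambda>x. fn n x - f x) (gn n)\<bar> \<le> ?a n * L2_norm \<Omega> (gn n)"
      using assms by (intro L2_Cauchy_Schwarz L2_diff)
    moreover have "?a n * L2_norm \<Omega> (gn n) \<le> ?a n * (L2_norm \<Omega> g + ?b n)"
      using L2_norm_triangle_diff[OF assms(4)[of n] assms(5)] by (intro mult_left_mono) auto
    moreover have "\<bar>L2_inner \<Omega> (\<lambda>x. gn n x - g x) f\<bar> \<le> ?b n * L2_norm \<Omega> f"
      using assms by (intro L2_Cauchy_Schwarz L2_diff)
    ultimately show ?thesis by (simp add: mult.commute[of "L2_norm \<Omega> f"])
  qed
  then have bd: "\<forall>n. norm (L2_inner \<Omega> (fn n) (gn n) - L2_inner \<Omega> f g) \<le> ?a n * (L2_norm \<Omega> g + ?b n) + L2_norm \<Omega> f * ?b n"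
    unfolding real_norm_def by (rule allI)
  have "(\<lambda>n. ?a n * (L2_norm \<Omega> g + ?b n) + L2_norm \<Omega> f * ?b n) \<longlonglongrightarrow> 0 * (L2_norm \<Omega> g + 0) + L2_norm \<Omega> f * 0"
    by (intro tendsto_intros assms(3,6))
  then have "(\<lambda>n. ?a n * (L2_norm \<Omega> g + ?b n) + L2_norm \<Omega> f * ?b n) \<longlonglongrightarrow> 0"
    by simp
  from Lim_null_comparison[OF always_eventually[OF bd] this]
  have "(\<lambda>n. L2_inner \<Omega> (fn n) (gn n) - L2_inner \<Omega> f g) \<longlonglongrightarrow> 0" .
  then show ?thesis by (simp add: LIM_zero_iff)
qed

lemma finite_measure_lebesgue_on: "\<Omega> \<in> lmeasurable \<Longrightarrow> finite_measure (lebesgue_on \<Omega>)"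
  by (rule finite_measureI) (auto simp: emeasure_restrict_space space_restrict_space fmeasurable_def
      dest: fmeasurableD2)

lemma L2_const:
  assumes "\<Omega> \<in> lmeasurable" shows "(\<lambda>x. c) \<in> L2 \<Omega>"
  using finite_measure.integrable_const[OF finite_measure_lebesgue_on[OF assms]] by (simp add: L2_def)

lemma L2_integrable:
  assumes "\<Omega> \<in> lmeasurable" "f \<in> L2 \<Omega>"
  shows "integrable (lebesgue_on \<Omega>) f"
proof (rule Bochner_Integration.integrable_bound)
  show "integrable (lebesgue_on \<Omega>) (\<lambda>x. 1 + (norm (f x))\<^sup>2)"
    by (intro Bochner_Integration.integrable_add L2_integrable_sq assms(2)
        finite_measure.integrable_const[OF finite_measure_lebesgue_on[OF assms(1)]])
  have "norm a \<le> 1 + (norm a)\<^sup>2" for a :: 'b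
    using zero_le_power2[of "norm a - 1"] norm_ge_zero[of a] unfolding power2_diff by (simp, linarith)
  then show "AE x in lebesgue_on \<Omega>. norm (f x) \<le> norm (1 + (norm (f x))\<^sup>2)" by simp
qed (rule L2_measurable[OF assms(2)])

section \<open>Sobolev functions on a bounded open set\<close>

locale bounded_open =
  fixes \<Omega> :: "'a::euclidean_space set"
  assumes open_\<Omega>: "open \<Omega>" and bounded_\<Omega>: "bounded \<Omega>"
begin

lemma lmeasurable_\<Omega>: "\<Omega> \<in> lmeasurable"
  using bounded_\<Omega> open_\<Omega> by (rule lmeasurable_open)

lemma sets_\<Omega>: "\<Omega> \<in> sets lebesgue"
  using lmeasurable_\<Omega> by (rule fmeasurableD)

lemma continuous_measurable: "continuous_on UNIV f \<Longrightarrow> f \<in> borel_measurable (lebesgue_on \<Omega>)"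
  using continuous_imp_measurable_on_sets_lebesgue[OF _ sets_\<Omega>] continuous_on_subset by blast

lemma bounded_L2:
  assumes "f \<in> borel_measurable (lebesgue_on \<Omega>)" "\<And>x. norm (f x) \<le> C"
  shows "f \<in> L2 \<Omega>"
  by (rule L2I_bound[OF L2_const[OF lmeasurable_\<Omega>, of C]])
    (use assms in \<open>auto intro: order_trans[OF _ abs_ge_self]\<close>)

lemma test_L2:
  assumes "\<phi> \<in> test_functions \<Omega>" shows "\<phi> \<in> L2 \<Omega>"
proof -
  obtain B where "B > 0" "\<And>x. \<bar>\<phi> x\<bar> \<le> B" using test_functions_bounded[OF assms] by blast
  then show ?thesis
    using continuous_measurable[OF smoothD(3)[OF test_functionsD[OF assms]]] by (intro bounded_L2) auto
qed

section \<open>The fundamental lemma of the calculus of variations\<close>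

lemma integral_test:
  assumes "\<phi> \<in> test_functions \<Omega>"
  shows "(LINT x|lebesgue_on \<Omega>. \<phi> x) = (\<integral>x. \<phi> x \<partial>lborel)"
proof -
  obtain K where K: "compact K" "K \<subseteq> \<Omega>" "\<forall>x. x \<notin> K \<longrightarrow> \<phi> x = 0"
    by (rule test_functionsE[OF assms])
  have "(LINT x|lebesgue_on \<Omega>. \<phi> x) = (LINT x|lebesgue. indicat_real \<Omega> x *\<^sub>R \<phi> x)"
    using sets_\<Omega> by (subst integral_restrict_space) auto
  also have "(\<lambda>x. indicat_real \<Omega> x *\<^sub>R \<phi> x) = \<phi>"
  proof
    fix x show "indicat_real \<Omega> x *\<^sub>R \<phi> x = \<phi> x"
      using K(2,3) by (cases "x \<in> \<Omega>") auto
  qed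
  also have "(LINT x|lebesgue. \<phi> x) = (\<integral>x. \<phi> x \<partial>lborel)"
    using borel_measurable_continuous_onI[OF smoothD(3)[OF test_functionsD[OF assms]]]
    by (intro integral_completion) simp
  finally show ?thesis .
qed

text \<open>The smooth function \<open>B\<close> is positive exactly on the open box, so the test
  functions \<open>R (n B)\<close> are 0 off the box and equal 1 at a point of the box as soon as
  \<open>n B \<ge> 1\<close> there. They converge boundedly to the indicator, and orthogonality
  passes to the limit.\<close>

lemma integral_cbox_eq_0:
  assumes f: "integrable (lebesgue_on \<Omega>) f"
    and ortho: "\<And>\<phi>. \<phi> \<in> test_functions \<Omega> \<Longrightarrow> (LINT x|lebesgue_on \<Omega>. f x * \<phi> x) = 0"
    and ab: "cbox a b \<subseteq> \<Omega>"
  shows "(LINT x|lebesgue_on \<Omega>. f x * indicat_real (box a b) x) = 0"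
proof -
  obtain \<rho> R :: "real \<Rightarrow> real" where R: "smooth R" "\<And>x. x \<le> 0 \<Longrightarrow> R x = 0" "\<And>x. x \<ge> 1 \<Longrightarrow> R x = 1"
    "\<And>x. 0 \<le> R x" "\<And>x. R x \<le> 1"
    using smooth_step by metis
  define B where "B x = (\<Prod>i\<in>Basis. flat_exp 0 (x \<bullet> i - a \<bullet> i) * flat_exp 0 (b \<bullet> i - x \<bullet> i))" for x :: 'a
  have smB: "smooth B"
  proof
    fix k
    have "Ck k (\<lambda>x::'a. flat_exp 0 (x \<bullet> i - a \<bullet> i) * flat_exp 0 (b \<bullet> i - x \<bullet> i))" for i
    proof (rule Ck_mult)
      have "Ck k (\<lambda>x::'a. flat_exp 0 (1 * (x \<bullet> i) + (- (a \<bullet> i))))"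
        by (rule Ck_compose[of k "flat_exp 0"])
          (intro smooth_flat_exp[rule_format] Ck_add Ck_mult Ck_const Ck_inner)+
      then show "Ck k (\<lambda>x::'a. flat_exp 0 (x \<bullet> i - a \<bullet> i))" by simp
      have "Ck k (\<lambda>x::'a. flat_exp 0 (b \<bullet> i + (- 1) * (x \<bullet> i)))"
        by (rule Ck_compose[of k "flat_exp 0"])
          (intro smooth_flat_exp[rule_format] Ck_add Ck_mult Ck_const Ck_inner)+
      then show "Ck k (\<lambda>x::'a. flat_exp 0 (b \<bullet> i - x \<bullet> i))" by simp
    qed
    then show "Ck k B" unfolding B_def by (intro Ck_prod) auto
  qed
  have Bpos: "B x > 0" if "x \<in> box a b" for x
    using that unfolding B_def by (intro prod_pos) (auto simp: mem_box flat_exp_pos_iff)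
  have B0: "B x = 0" if "x \<notin> box a b" for x
  proof -
    obtain i where "i \<in> Basis" "x \<bullet> i \<le> a \<bullet> i \<or> b \<bullet> i \<le> x \<bullet> i"
      using \<open>x \<notin> box a b\<close> unfolding mem_box by (meson not_le)
    then show ?thesis unfolding B_def by (intro prod_zero) (auto simp: flat_exp_def intro!: bexI[of _ i])
  qed
  define \<phi> where "\<phi> n x = R (real n * B x)" for n x
  have \<phi>: "\<phi> n \<in> test_functions \<Omega>" for n
  proof (rule test_functionsI[of _ "cbox a b"])
    show "smooth (\<phi> n)"
    proof
      fix k show "Ck k (\<phi> n)" unfolding \<phi>_def
        by (rule Ck_compose[of k R]) (use R(1) smB in \<open>auto intro!: Ck_mult Ck_const\<close>)
    qed
    show "\<phi> n x = 0" if "x \<notin> cbox a b" for x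
    proof -
      have "x \<notin> box a b" using that box_subset_cbox[of a b] by blast
      then show ?thesis using B0[of x] R(2)[of 0] by (simp add: \<phi>_def)
    qed
  qed (use ab in auto)
  have "(\<lambda>n. LINT x|lebesgue_on \<Omega>. f x * \<phi> n x) \<longlonglongrightarrow> (LINT x|lebesgue_on \<Omega>. f x * indicat_real (box a b) x)"
  proof (rule integral_dominated_convergence[where w = "\<lambda>x. norm (f x)"])
    show "AE x in lebesgue_on \<Omega>. (\<lambda>n. f x * \<phi> n x) \<longlonglongrightarrow> f x * indicat_real (box a b) x"
    proof (rule AE_I2, rule tendsto_mult_left)
      fix x
      show "(\<lambda>n. \<phi> n x) \<longlonglongrightarrow> indicat_real (box a b) x"
      proof (cases "x \<in> box a b")
        case True
        obtain N where N: "inverse (B x) < real N" using reals_Archimedean2 by blast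
        have "\<phi> n x = 1" if "n \<ge> N" for n
        proof -
          have "inverse (B x) \<le> real n" using N that by linarith
          then have "1 \<le> real n * B x" using Bpos[OF True] by (simp add: field_simps)
          then show ?thesis by (simp add: \<phi>_def R(3))
        qed
        then show ?thesis using True
          by (intro tendsto_eventually) (auto simp: eventually_sequentially)
      next
        case False
        then show ?thesis by (simp add: \<phi>_def B0 R(2))
      qed
    qed
    show "AE x in lebesgue_on \<Omega>. norm (f x * \<phi> n x) \<le> norm (f x)" for n
    proof (rule AE_I2)
      fix x
      have "\<bar>f x\<bar> * \<bar>\<phi> n x\<bar> \<le> \<bar>f x\<bar> * 1"
        using R(4,5)[of "real n * B x"] unfolding \<phi>_def by (intro mult_left_mono) auto
      then show "norm (f x * \<phi> n x) \<le> norm (f x)" by (simp add: abs_mult)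
    qed
    show "(\<lambda>x. f x * \<phi> n x) \<in> borel_measurable (lebesgue_on \<Omega>)" for n
      using borel_measurable_integrable[OF f] L2_measurable[OF test_L2[OF \<phi>]] by (rule borel_measurable_times)
    have "indicat_real (box a b) \<in> borel_measurable (lebesgue_on \<Omega>)"
      by (intro measurable_restrict_space1 borel_measurable_indicator) auto
    then show "(\<lambda>x. f x * indicat_real (box a b) x) \<in> borel_measurable (lebesgue_on \<Omega>)"
      by (rule borel_measurable_times[OF borel_measurable_integrable[OF f]])
  qed (use f in auto)
  then show ?thesis using ortho[OF \<phi>] by (simp add: LIMSEQ_const_iff)
qed

text \<open>Lebesgue differentiation: at almost every point \<open>f\<close> is the limit of its
  means over shrinking cubes with a corner at the point, and these means are 0 once the cubes lie in
  \<open>\<Omega>\<close>. Extension by 0 makes \<open>f\<close> available on all cubes.\<close>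

theorem fundamental_lemma:
  assumes f: "integrable (lebesgue_on \<Omega>) f"
    and ortho: "\<And>\<phi>. \<phi> \<in> test_functions \<Omega> \<Longrightarrow> (LINT x|lebesgue_on \<Omega>. f x * \<phi> x) = 0"
  shows "AE x in lebesgue_on \<Omega>. f x = 0"
proof -
  define f0 where "f0 x = (if x \<in> \<Omega> then f x else 0)" for x
  have f0: "integrable lebesgue f0"
    using Lebesgue_Measure.integrable_restrict_UNIV[OF sets_\<Omega>, of f] f unfolding f0_def[abs_def] by simp
  have f0S: "integrable (lebesgue_on S) f0" if "S \<in> sets lebesgue" for S
  proof -
    have "integrable lebesgue (\<lambda>x. indicator S x *\<^sub>R f0 x)"
      using that f0 by (rule integrable_mult_indicator)
    then show ?thesis using that by (subst integrable_restrict_space) auto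
  qed
  have "f0 integrable_on cbox a b" for a b
    using f0S[of "cbox a b"] by (intro integrable_on_lebesgue_on) auto
  then obtain N where N: "negligible N" and lim: "\<And>x e. \<lbrakk>x \<notin> N; 0 < e\<rbrakk> \<Longrightarrow>
      \<exists>d>0. \<forall>h. 0 < h \<and> h < d \<longrightarrow> norm (integral (cbox x (x + h *\<^sub>R One)) f0 /\<^sub>R h ^ DIM('a) - f0 x) < e"
    using integrable_ccontinuous_explicit by blast
  have z: "integral (cbox a b) f0 = 0" if ab: "cbox a b \<subseteq> \<Omega>" for a b
  proof -
    have "integral (cbox a b) f0 = integral (box a b) f0" by (simp add: integral_open_interval)
    also have "\<dots> = integral\<^sup>L (lebesgue_on (box a b)) f0"
      by (rule lebesgue_integral_eq_integral[symmetric]) (auto intro: f0S)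
    also have "\<dots> = (LINT x|lebesgue. indicat_real (box a b) x *\<^sub>R f0 x)"
      by (subst integral_restrict_space) auto
    also have "\<dots> = (LINT x|lebesgue. indicat_real \<Omega> x *\<^sub>R (f x * indicat_real (box a b) x))"
      by (rule Bochner_Integration.integral_cong) (auto simp: f0_def indicator_def)
    also have "\<dots> = (LINT x|lebesgue_on \<Omega>. f x * indicat_real (box a b) x)"
      using sets_\<Omega> by (subst integral_restrict_space) auto
    also have "\<dots> = 0" by (rule integral_cbox_eq_0[OF f ortho ab])
    finally show ?thesis .
  qed
  have "f x = 0" if x: "x \<in> \<Omega>" "x \<notin> N" for x
  proof (rule ccontr)
    assume "f x \<noteq> 0"
    then obtain d where d: "d > 0"
      "\<forall>h. 0 < h \<and> h < d \<longrightarrow> norm (integral (cbox x (x + h *\<^sub>R One)) f0 /\<^sub>R h ^ DIM('a) - f0 x) < \<bar>f x\<bar>"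
      using lim[OF x(2), of "\<bar>f x\<bar>"] by auto
    obtain r where r: "r > 0" "ball x r \<subseteq> \<Omega>" using open_\<Omega> x(1) open_contains_ball by blast
    \<comment> \<open>Below \<open>d\<close> for the differentiation theorem. A vector in a cube of
      side \<open>h\<close> has norm at most \<open>h * DIM('a)\<close>, by comparison with the l1
      norm; the second bound keeps this below \<open>r\<close>, hence the cube inside the
      ball.\<close>
    define h where "h = min (d / 2) (r / (2 * real DIM('a)))"
    have h: "0 < h" "h < d" "h * real DIM('a) < r"
    proof -
      show "0 < h" "h < d" using d(1) r(1) by (auto simp: h_def)
      have "h * real DIM('a) \<le> r / (2 * real DIM('a)) * real DIM('a)"
        by (intro mult_right_mono) (auto simp: h_def)
      also have "\<dots> = r / 2" by simp
      finally show "h * real DIM('a) < r" using r(1) by linarith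
    qed
    have "cbox x (x + h *\<^sub>R One) \<subseteq> \<Omega>"
    proof
      fix y assume y: "y \<in> cbox x (x + h *\<^sub>R One)"
      have "norm (y - x) \<le> (\<Sum>i\<in>Basis. \<bar>(y - x) \<bullet> i\<bar>)" by (rule norm_le_l1)
      also have "\<dots> \<le> (\<Sum>i\<in>(Basis::'a set). h)"
        by (rule sum_mono) (use y in \<open>auto simp: mem_box inner_simps\<close>)
      also have "\<dots> < r" using h(3) by (simp add: mult.commute)
      finally show "y \<in> \<Omega>" using r(2) by (auto simp: dist_norm norm_minus_commute)
    qed
    from z[OF this] d(2)[rule_format, of h] h x(1) show False by (simp add: f0_def)
  qed
  moreover have "AE x in lebesgue. x \<notin> N"
    using N by (intro AE_not_in) (simp add: negligible_iff_null_sets)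
  ultimately have "AE x in lebesgue. x \<in> \<Omega> \<longrightarrow> f x = 0"
    by (auto elim: eventually_mono)
  then show ?thesis using sets_\<Omega> by (subst AE_restrict_space_iff) auto
qed

section \<open>Weak gradients and the space \<open>H1\<close>\<close>

definition grad :: "('a \<Rightarrow> real) \<Rightarrow> 'a \<Rightarrow> 'a" where
  "grad \<phi> x = (\<Sum>i\<in>Basis. partial_deriv i \<phi> x *\<^sub>R i)"

lemma grad_inner: "i \<in> Basis \<Longrightarrow> grad \<phi> x \<bullet> i = partial_deriv i \<phi> x"
  by (simp add: grad_def inner_sum_left_Basis)

lemma grad_L2:
  assumes "\<phi> \<in> test_functions \<Omega>" shows "grad \<phi> \<in> L2 \<Omega>"
proof -
  have *: "(\<lambda>x. partial_deriv i \<phi> x *\<^sub>R i) \<in> L2 \<Omega>" if "i \<in> Basis" for i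
  proof (rule L2I_bound[OF test_L2[OF test_functions_partial_deriv[OF assms that]]])
    show "(\<lambda>x. partial_deriv i \<phi> x *\<^sub>R i) \<in> borel_measurable (lebesgue_on \<Omega>)"
      using L2_measurable[OF test_L2[OF test_functions_partial_deriv[OF assms that]]] by measurable
  qed (use that in auto)
  have "(\<lambda>x. \<Sum>i\<in>I. partial_deriv i \<phi> x *\<^sub>R i) \<in> L2 \<Omega>" if "I \<subseteq> Basis" for I
    using finite_subset[OF that finite_Basis] that
  proof (induction I rule: finite_induct)
    case (insert i I)
    then show ?case using * by (simp add: L2_add)
  qed (simp add: L2_zero)
  then show ?thesis unfolding grad_def by blast
qed

lemma weak_gradient_iff_inner:
  "is_weak_gradient \<Omega> f g \<longleftrightarrow> (\<forall>\<phi>\<in>test_functions \<Omega>. \<forall>i\<in>Basis.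
     L2_inner \<Omega> f (partial_deriv i \<phi>) = - L2_inner \<Omega> g (\<lambda>x. \<phi> x *\<^sub>R i))"
  unfolding is_weak_gradient_def L2_inner_def by (simp add: mult.commute)

lemma test_scaleR_L2:
  assumes "\<phi> \<in> test_functions \<Omega>" shows "(\<lambda>x. \<phi> x *\<^sub>R i) \<in> L2 \<Omega>"
proof (rule L2I_bound[OF L2_cmult[OF test_L2[OF assms], of "norm i"]])
  show "(\<lambda>x. \<phi> x *\<^sub>R i) \<in> borel_measurable (lebesgue_on \<Omega>)"
    using L2_measurable[OF test_L2[OF assms]] by measurable
qed (simp add: abs_mult)

text \<open>The product of two test functions is a test function, so its partial derivatives have
  integral 0; the product rule turns this into integration by parts.\<close>

lemma weak_gradient_test:
  assumes "\<phi> \<in> test_functions \<Omega>" shows "is_weak_gradient \<Omega> \<phi> (grad \<phi>)"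
  unfolding is_weak_gradient_def
proof (intro ballI)
  fix \<psi> and i :: 'a assume \<psi>: "\<psi> \<in> test_functions \<Omega>" and i: "i \<in> Basis"
  have d: "\<phi> differentiable (at x)" "\<psi> differentiable (at x)" for x
    using smoothD(1)[OF test_functionsD[OF assms]] smoothD(1)[OF test_functionsD[OF \<psi>]] by auto
  have "partial_deriv i (\<lambda>x. \<phi> x * \<psi> x) x = \<phi> x * partial_deriv i \<psi> x + partial_deriv i \<phi> x * \<psi> x" for x
    unfolding partial_deriv_def[of _ \<phi>] partial_deriv_def[of _ \<psi>]
    by (rule partial_deriv_eq, intro has_derivative_mult has_derivative_frechet d)
  moreover have t: "(\<lambda>x. \<phi> x * \<psi> x) \<in> test_functions \<Omega>"
    using test_functions_mult_smooth[OF assms test_functionsD[OF \<psi>]] .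
  have "(LINT x|lebesgue_on \<Omega>. partial_deriv i (\<lambda>x. \<phi> x * \<psi> x) x) = 0"
    unfolding integral_test[OF test_functions_partial_deriv[OF t i]] using t i by (rule integral_partial_deriv)
  ultimately have "(LINT x|lebesgue_on \<Omega>. \<phi> x * partial_deriv i \<psi> x + partial_deriv i \<phi> x * \<psi> x) = 0"
    by simp
  moreover have "integrable (lebesgue_on \<Omega>) (\<lambda>x. \<phi> x * partial_deriv i \<psi> x)"
    "integrable (lebesgue_on \<Omega>) (\<lambda>x. partial_deriv i \<phi> x * \<psi> x)"
    using L2_inner_integrable[OF test_L2[OF assms] test_L2[OF test_functions_partial_deriv[OF \<psi> i]]]
      L2_inner_integrable[OF test_L2[OF test_functions_partial_deriv[OF assms i]] test_L2[OF \<psi>]] by auto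
  ultimately show "(LINT x|lebesgue_on \<Omega>. \<phi> x * partial_deriv i \<psi> x) = - (LINT x|lebesgue_on \<Omega>. grad \<phi> x \<bullet> i * \<psi> x)"
    by (simp add: grad_inner[OF i])
qed

lemma weak_gradient_unique_AE:
  assumes "is_weak_gradient \<Omega> f g" "is_weak_gradient \<Omega> f g'" "g \<in> L2 \<Omega>" "g' \<in> L2 \<Omega>"
  shows "AE x in lebesgue_on \<Omega>. g x = g' x"
proof -
  have d: "(\<lambda>x. g x - g' x) \<in> L2 \<Omega>" using assms by (intro L2_diff)
  have "AE x in lebesgue_on \<Omega>. (g x - g' x) \<bullet> i = 0" if i: "i \<in> Basis" for i
  proof (rule fundamental_lemma)
    show "integrable (lebesgue_on \<Omega>) (\<lambda>x. (g x - g' x) \<bullet> i)"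
      by (rule L2_inner_integrable[OF d L2_const[OF lmeasurable_\<Omega>]])
    fix \<phi> assume \<phi>: "\<phi> \<in> test_functions \<Omega>"
    have "L2_inner \<Omega> (\<lambda>x. g x - g' x) (\<lambda>x. \<phi> x *\<^sub>R i) = 0"
      using assms(1,2) \<phi> i unfolding weak_gradient_iff_inner
      by (simp add: L2_inner_diff_left[OF assms(3,4) test_scaleR_L2[OF \<phi>]])
    then show "(LINT x|lebesgue_on \<Omega>. (g x - g' x) \<bullet> i * \<phi> x) = 0"
      by (simp add: L2_inner_def mult.commute)
  qed
  then have "AE x in lebesgue_on \<Omega>. \<forall>i\<in>Basis. (g x - g' x) \<bullet> i = 0"
    by (intro AE_finite_allI) auto
  then show ?thesis
    by eventually_elim (metis (no_types, lifting) euclidean_eq_iff eq_iff_diff_eq_0 inner_diff_left)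
qed

lemma weak_gradientD:
  assumes "f \<in> H1 \<Omega>"
  shows "f \<in> L2 \<Omega>" "weak_gradient \<Omega> f \<in> L2 \<Omega>" "is_weak_gradient \<Omega> f (weak_gradient \<Omega> f)"
proof -
  from assms obtain g where "g \<in> L2 \<Omega> \<and> is_weak_gradient \<Omega> f g" unfolding H1_def by blast
  then have "weak_gradient \<Omega> f \<in> L2 \<Omega> \<and> is_weak_gradient \<Omega> f (weak_gradient \<Omega> f)"
    unfolding weak_gradient_def by (rule someI[where P = "\<lambda>g. g \<in> L2 \<Omega> \<and> is_weak_gradient \<Omega> f g"])
  then show "weak_gradient \<Omega> f \<in> L2 \<Omega>" "is_weak_gradient \<Omega> f (weak_gradient \<Omega> f)" by auto
  show "f \<in> L2 \<Omega>" using assms unfolding H1_def by blast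
qed

text \<open>\<open>weak_gradient\<close> is an arbitrary choice, so explicit formulas for it hold
  only almost everywhere. They are obtained by exhibiting a candidate and comparing it with the
  choice by uniqueness.\<close>

lemma H1I:
  assumes "f \<in> L2 \<Omega>" "g \<in> L2 \<Omega>" "is_weak_gradient \<Omega> f g"
  shows "f \<in> H1 \<Omega>" "AE x in lebesgue_on \<Omega>. weak_gradient \<Omega> f x = g x"
proof -
  show "f \<in> H1 \<Omega>" using assms unfolding H1_def by blast
  from weak_gradient_unique_AE[OF weak_gradientD(3)[OF this] assms(3) weak_gradientD(2)[OF this] assms(2)]
  show "AE x in lebesgue_on \<Omega>. weak_gradient \<Omega> f x = g x" .
qed

lemma H1_add:
  assumes "f \<in> H1 \<Omega>" "g \<in> H1 \<Omega>"
  shows "(\<lambda>x. f x + g x) \<in> H1 \<Omega>"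
    "AE x in lebesgue_on \<Omega>. weak_gradient \<Omega> (\<lambda>x. f x + g x) x = weak_gradient \<Omega> f x + weak_gradient \<Omega> g x"
proof -
  note D = weak_gradientD[OF assms(1)] weak_gradientD[OF assms(2)]
  have w: "is_weak_gradient \<Omega> (\<lambda>x. f x + g x) (\<lambda>x. weak_gradient \<Omega> f x + weak_gradient \<Omega> g x)"
    unfolding weak_gradient_iff_inner
  proof (intro ballI)
    fix \<phi> and i :: 'a assume "\<phi> \<in> test_functions \<Omega>" "i \<in> Basis"
    then show "L2_inner \<Omega> (\<lambda>x. f x + g x) (partial_deriv i \<phi>)
      = - L2_inner \<Omega> (\<lambda>x. weak_gradient \<Omega> f x + weak_gradient \<Omega> g x) (\<lambda>x. \<phi> x *\<^sub>R i)"
      using D(3,6) L2_inner_add_left[OF D(1,4) test_L2[OF test_functions_partial_deriv]]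
        L2_inner_add_left[OF D(2,5) test_scaleR_L2]
      unfolding weak_gradient_iff_inner by simp
  qed
  show "(\<lambda>x. f x + g x) \<in> H1 \<Omega>"
    "AE x in lebesgue_on \<Omega>. weak_gradient \<Omega> (\<lambda>x. f x + g x) x = weak_gradient \<Omega> f x + weak_gradient \<Omega> g x"
    by (rule H1I[OF L2_add[OF D(1,4)] L2_add[OF D(2,5)] w])+
qed

lemma H1_cmult:
  assumes "f \<in> H1 \<Omega>"
  shows "(\<lambda>x. c * f x) \<in> H1 \<Omega>"
    "AE x in lebesgue_on \<Omega>. weak_gradient \<Omega> (\<lambda>x. c * f x) x = c *\<^sub>R weak_gradient \<Omega> f x"
proof -
  note D = weak_gradientD[OF assms]
  have w: "is_weak_gradient \<Omega> (\<lambda>x. c * f x) (\<lambda>x. c *\<^sub>R weak_gradient \<Omega> f x)"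
    unfolding weak_gradient_iff_inner
  proof (intro ballI)
    fix \<phi> and i :: 'a assume "\<phi> \<in> test_functions \<Omega>" "i \<in> Basis"
    then show "L2_inner \<Omega> (\<lambda>x. c * f x) (partial_deriv i \<phi>)
      = - L2_inner \<Omega> (\<lambda>x. c *\<^sub>R weak_gradient \<Omega> f x) (\<lambda>x. \<phi> x *\<^sub>R i)"
      using D(3) L2_inner_scaleR_left[of \<Omega> c f] unfolding weak_gradient_iff_inner
      by (simp add: L2_inner_scaleR_left)
  qed
  show "(\<lambda>x. c * f x) \<in> H1 \<Omega>"
    "AE x in lebesgue_on \<Omega>. weak_gradient \<Omega> (\<lambda>x. c * f x) x = c *\<^sub>R weak_gradient \<Omega> f x"
    by (rule H1I[OF L2_cmult[OF D(1)] L2_scaleR[OF D(2)] w])+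
qed

lemma H1_diff:
  assumes "f \<in> H1 \<Omega>" "g \<in> H1 \<Omega>"
  shows "(\<lambda>x. f x - g x) \<in> H1 \<Omega>"
    "AE x in lebesgue_on \<Omega>. weak_gradient \<Omega> (\<lambda>x. f x - g x) x = weak_gradient \<Omega> f x - weak_gradient \<Omega> g x"
proof -
  note A = H1_add[OF assms(1) H1_cmult(1)[OF assms(2), of "-1"]]
  show "(\<lambda>x. f x - g x) \<in> H1 \<Omega>" using A(1) by simp
  show "AE x in lebesgue_on \<Omega>. weak_gradient \<Omega> (\<lambda>x. f x - g x) x = weak_gradient \<Omega> f x - weak_gradient \<Omega> g x"
    using A(2) H1_cmult(2)[OF assms(2), of "-1"] by eventually_elim simp
qed

text \<open>The weak gradient is a closed operator: both sides of the defining identity are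
  \<open>L2\<close> inner products with fixed functions, and these pass to the limit.\<close>

lemma weak_gradient_limit:
  assumes "\<And>n. fn n \<in> L2 \<Omega>" "f \<in> L2 \<Omega>" "(\<lambda>n. L2_norm \<Omega> (\<lambda>x. fn n x - f x)) \<longlonglongrightarrow> 0"
    and "\<And>n. gn n \<in> L2 \<Omega>" "g \<in> L2 \<Omega>" "(\<lambda>n. L2_norm \<Omega> (\<lambda>x. gn n x - g x)) \<longlonglongrightarrow> 0"
    and w: "\<And>n. is_weak_gradient \<Omega> (fn n) (gn n)"
  shows "is_weak_gradient \<Omega> f g"
  unfolding weak_gradient_iff_inner
proof (intro ballI)
  fix \<phi> and i :: 'a assume \<phi>: "\<phi> \<in> test_functions \<Omega>" and i: "i \<in> Basis"
  have c: "(\<lambda>n. L2_norm \<Omega> (\<lambda>x. h x - h x)) \<longlonglongrightarrow> 0" for h :: "'a \<Rightarrow> 'c::euclidean_space"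
    by (simp add: L2_norm_def)
  have "(\<lambda>n. L2_inner \<Omega> (fn n) (partial_deriv i \<phi>)) \<longlonglongrightarrow> L2_inner \<Omega> f (partial_deriv i \<phi>)"
    using test_L2[OF test_functions_partial_deriv[OF \<phi> i]]
    by (intro L2_inner_tendsto[OF assms(1-3) _ _ c]) auto
  moreover have "(\<lambda>n. - L2_inner \<Omega> (gn n) (\<lambda>x. \<phi> x *\<^sub>R i)) \<longlonglongrightarrow> - L2_inner \<Omega> g (\<lambda>x. \<phi> x *\<^sub>R i)"
    using test_scaleR_L2[OF \<phi>] by (intro tendsto_minus L2_inner_tendsto[OF assms(4-6) _ _ c]) auto
  ultimately show "L2_inner \<Omega> f (partial_deriv i \<phi>) = - L2_inner \<Omega> g (\<lambda>x. \<phi> x *\<^sub>R i)"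
    using w \<phi> i LIMSEQ_unique unfolding weak_gradient_iff_inner by auto
qed

text \<open>A function together with its weak gradient, as one map into a product space. Its
  \<open>L2\<close> norm is the \<open>H1\<close> norm, so the triangle inequality, scaling and
  monotonicity of the latter are inherited from \<open>L2\<close>.\<close>

definition jet :: "('a \<Rightarrow> real) \<Rightarrow> 'a \<Rightarrow> real \<times> 'a" where
  "jet f x = (f x, weak_gradient \<Omega> f x)"

lemma jet_L2: "f \<in> H1 \<Omega> \<Longrightarrow> jet f \<in> L2 \<Omega>"
proof -
  assume f: "f \<in> H1 \<Omega>"
  note D = weak_gradientD[OF f]
  have "jet f \<in> borel_measurable (lebesgue_on \<Omega>)"
    using D(1,2)[THEN L2_measurable] unfolding jet_def by (rule borel_measurable_Pair)
  moreover have "(norm (jet f x))\<^sup>2 = (norm (f x))\<^sup>2 + (norm (weak_gradient \<Omega> f x))\<^sup>2" for x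
    by (simp add: jet_def norm_Pair)
  ultimately show ?thesis
    using D(1,2)[THEN L2_integrable_sq] unfolding L2_def by simp
qed

lemma H1_norm_jet: "f \<in> H1 \<Omega> \<Longrightarrow> H1_norm \<Omega> f = L2_norm \<Omega> (jet f)"
proof -
  assume f: "f \<in> H1 \<Omega>"
  note D = weak_gradientD[OF f]
  have "(norm (jet f x))\<^sup>2 = (norm (f x))\<^sup>2 + (norm (weak_gradient \<Omega> f x))\<^sup>2" for x
    by (simp add: jet_def norm_Pair)
  then have "(L2_norm \<Omega> (jet f))\<^sup>2 = (L2_norm \<Omega> f)\<^sup>2 + (L2_norm \<Omega> (weak_gradient \<Omega> f))\<^sup>2"
    using D(1,2)[THEN L2_integrable_sq] unfolding L2_norm_sq by simp
  then show ?thesis by (metis H1_norm_def L2_norm_nonneg real_sqrt_unique)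
qed

lemma H1_norm_diff:
  assumes "f \<in> H1 \<Omega>" "g \<in> H1 \<Omega>"
  shows "H1_norm \<Omega> (\<lambda>x. f x - g x) = L2_norm \<Omega> (\<lambda>x. jet f x - jet g x)"
  unfolding H1_norm_jet[OF H1_diff(1)[OF assms]]
proof (rule L2_norm_cong_AE)
  show "AE x in lebesgue_on \<Omega>. jet (\<lambda>x. f x - g x) x = jet f x - jet g x"
    using H1_diff(2)[OF assms] by eventually_elim (simp add: jet_def)
qed (use assms jet_L2 H1_diff(1) L2_measurable L2_diff in blast)+

lemma H1_norm_add:
  assumes "f \<in> H1 \<Omega>" "g \<in> H1 \<Omega>"
  shows "H1_norm \<Omega> (\<lambda>x. f x + g x) = L2_norm \<Omega> (\<lambda>x. jet f x + jet g x)"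
  unfolding H1_norm_jet[OF H1_add(1)[OF assms]]
proof (rule L2_norm_cong_AE)
  show "AE x in lebesgue_on \<Omega>. jet (\<lambda>x. f x + g x) x = jet f x + jet g x"
    using H1_add(2)[OF assms] by eventually_elim (simp add: jet_def)
qed (use assms jet_L2 H1_add(1) L2_measurable L2_add in blast)+

lemma H1_norm_cmult:
  assumes "f \<in> H1 \<Omega>"
  shows "H1_norm \<Omega> (\<lambda>x. c * f x) = \<bar>c\<bar> * H1_norm \<Omega> f"
  unfolding H1_norm_jet[OF H1_cmult(1)[OF assms]] H1_norm_jet[OF assms] L2_norm_scaleR[symmetric]
proof (rule L2_norm_cong_AE)
  show "AE x in lebesgue_on \<Omega>. jet (\<lambda>x. c * f x) x = c *\<^sub>R jet f x"
    using H1_cmult(2)[OF assms] by eventually_elim (simp add: jet_def)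
qed (use assms jet_L2 H1_cmult(1) L2_measurable L2_scaleR in blast)+

lemma H1_norm_nonneg [simp]: "0 \<le> H1_norm \<Omega> f"
  by (simp add: H1_norm_def)

lemma H1_norm_triangle:
  assumes "f \<in> H1 \<Omega>" "g \<in> H1 \<Omega>"
  shows "H1_norm \<Omega> (\<lambda>x. f x + g x) \<le> H1_norm \<Omega> f + H1_norm \<Omega> g"
  using L2_norm_triangle[OF assms[THEN jet_L2]] by (simp add: H1_norm_add H1_norm_jet assms)

lemma L2_norm_le_H1_norm: "L2_norm \<Omega> f \<le> H1_norm \<Omega> f" "L2_norm \<Omega> (weak_gradient \<Omega> f) \<le> H1_norm \<Omega> f"
  by (auto simp: H1_norm_def intro!: real_le_rsqrt)

lemma H1_norm_le: "H1_norm \<Omega> f \<le> L2_norm \<Omega> f + L2_norm \<Omega> (weak_gradient \<Omega> f)"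
  by (simp add: H1_norm_def sqrt_add_le_add_sqrt[THEN order_trans])

lemma H1_tendsto_iff:
  assumes "\<And>n. fn n \<in> H1 \<Omega>" "f \<in> H1 \<Omega>"
  shows "(\<lambda>n. H1_norm \<Omega> (\<lambda>x. fn n x - f x)) \<longlonglongrightarrow> 0 \<longleftrightarrow>
    (\<lambda>n. L2_norm \<Omega> (\<lambda>x. fn n x - f x)) \<longlonglongrightarrow> 0 \<and>
    (\<lambda>n. L2_norm \<Omega> (\<lambda>x. weak_gradient \<Omega> (fn n) x - weak_gradient \<Omega> f x)) \<longlonglongrightarrow> 0"
    (is "?N \<longlonglongrightarrow> 0 \<longleftrightarrow> ?a \<longlonglongrightarrow> 0 \<and> ?b \<longlonglongrightarrow> 0")
proof -
  have eq: "L2_norm \<Omega> (weak_gradient \<Omega> (\<lambda>x. fn n x - f x)) = ?b n" for n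
  proof (rule L2_norm_cong_AE[OF _ _ H1_diff(2)[OF assms(1,2)]])
    show "weak_gradient \<Omega> (\<lambda>x. fn n x - f x) \<in> borel_measurable (lebesgue_on \<Omega>)"
      by (rule L2_measurable[OF weak_gradientD(2)[OF H1_diff(1)[OF assms(1,2)]]])
    show "(\<lambda>x. weak_gradient \<Omega> (fn n) x - weak_gradient \<Omega> f x) \<in> borel_measurable (lebesgue_on \<Omega>)"
      by (rule L2_measurable[OF L2_diff[OF weak_gradientD(2)[OF assms(1)] weak_gradientD(2)[OF assms(2)]]])
  qed
  have le: "?a n \<le> ?N n" "?b n \<le> ?N n" "?N n \<le> ?a n + ?b n" for n
    using L2_norm_le_H1_norm[of "\<lambda>x. fn n x - f x"] H1_norm_le[of "\<lambda>x. fn n x - f x"] eq by auto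
  show ?thesis
  proof
    assume N: "?N \<longlonglongrightarrow> 0"
    have "?a \<longlonglongrightarrow> 0" "?b \<longlonglongrightarrow> 0"
      by (rule tendsto_sandwich[OF _ _ tendsto_const[of 0] N]; simp add: le)+
    then show "?a \<longlonglongrightarrow> 0 \<and> ?b \<longlonglongrightarrow> 0" by blast
  next
    assume "?a \<longlonglongrightarrow> 0 \<and> ?b \<longlonglongrightarrow> 0"
    then have ab: "(\<lambda>n. ?a n + ?b n) \<longlonglongrightarrow> 0" using tendsto_add_zero by blast
    show "?N \<longlonglongrightarrow> 0"
      by (rule tendsto_sandwich[OF _ _ tendsto_const[of 0] ab]; simp add: le)
  qed
qed

lemma H1_norm_minus_commute:
  "f \<in> H1 \<Omega> \<Longrightarrow> g \<in> H1 \<Omega> \<Longrightarrow> H1_norm \<Omega> (\<lambda>x. f x - g x) = H1_norm \<Omega> (\<lambda>x. g x - f x)"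
  by (simp only: H1_norm_diff, rule L2_norm_minus_commute)

lemma test_H1:
  assumes "\<phi> \<in> test_functions \<Omega>"
  shows "\<phi> \<in> H1 \<Omega>" "AE x in lebesgue_on \<Omega>. weak_gradient \<Omega> \<phi> x = grad \<phi> x"
  by (rule H1I[OF test_L2[OF assms] grad_L2[OF assms] weak_gradient_test[OF assms]])+

section \<open>The closure of the test functions in \<open>H1\<close>\<close>

lemma H10_H1: "f \<in> H10 \<Omega> \<Longrightarrow> f \<in> H1 \<Omega>"
  by (simp add: H10_def)

lemma H10_iff: "f \<in> H10 \<Omega> \<longleftrightarrow> f \<in> H1 \<Omega> \<and>
    (\<exists>\<phi>. (\<forall>n. \<phi> n \<in> test_functions \<Omega>) \<and> (\<lambda>n. H1_norm \<Omega> (\<lambda>x. \<phi> n x - f x)) \<longlonglongrightarrow> 0)"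
proof -
  have "H1_norm \<Omega> (f - \<phi>) = H1_norm \<Omega> (\<lambda>x. \<phi> x - f x)" if "f \<in> H1 \<Omega>" "\<phi> \<in> test_functions \<Omega>" for \<phi>
    using H1_norm_minus_commute[OF that(1) test_H1(1)[OF that(2)]] by (simp add: fun_diff_def)
  then show ?thesis unfolding H10_def by (simp cong: conj_cong)
qed

lemma test_H10:
  assumes "\<phi> \<in> test_functions \<Omega>" shows "\<phi> \<in> H10 \<Omega>"
  unfolding H10_iff
proof (intro conjI test_H1(1)[OF assms] exI[of _ "\<lambda>n. \<phi>"] allI assms)
  have "H1_norm \<Omega> (\<lambda>x. \<phi> x - \<phi> x) = 0"
    using H1_norm_diff[OF test_H1(1)[OF assms] test_H1(1)[OF assms]] by (simp add: L2_norm_def)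
  then show "(\<lambda>n. H1_norm \<Omega> (\<lambda>x. \<phi> x - \<phi> x)) \<longlonglongrightarrow> 0" by simp
qed

lemma test_zero: "(\<lambda>x. 0) \<in> test_functions \<Omega>"
  by (rule test_functionsI[of _ "{}"]) (auto intro: Ck_const)

lemma H10_zero: "(\<lambda>x. 0) \<in> H10 \<Omega>"
  by (rule test_H10[OF test_zero])

lemma H10_add:
  assumes "f \<in> H10 \<Omega>" "g \<in> H10 \<Omega>" shows "(\<lambda>x. f x + g x) \<in> H10 \<Omega>"
proof -
  obtain \<phi> \<psi> where \<phi>: "\<forall>n. \<phi> n \<in> test_functions \<Omega>" "(\<lambda>n. H1_norm \<Omega> (\<lambda>x. \<phi> n x - f x)) \<longlonglongrightarrow> 0"
    and \<psi>: "\<forall>n. \<psi> n \<in> test_functions \<Omega>" "(\<lambda>n. H1_norm \<Omega> (\<lambda>x. \<psi> n x - g x)) \<longlonglongrightarrow> 0"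
    using assms unfolding H10_iff by blast
  note H = assms[THEN H10_H1]
  have le: "H1_norm \<Omega> (\<lambda>x. (\<phi> n x + \<psi> n x) - (f x + g x))
      \<le> H1_norm \<Omega> (\<lambda>x. \<phi> n x - f x) + H1_norm \<Omega> (\<lambda>x. \<psi> n x - g x)" for n
    using H1_norm_triangle[OF H1_diff(1)[OF test_H1(1) H(1)] H1_diff(1)[OF test_H1(1) H(2)], of "\<phi> n" "\<psi> n"] \<phi>(1) \<psi>(1)
    by (simp add: algebra_simps)
  have "(\<lambda>n. H1_norm \<Omega> (\<lambda>x. (\<phi> n x + \<psi> n x) - (f x + g x))) \<longlonglongrightarrow> 0"
    by (rule tendsto_sandwich[OF _ _ tendsto_const[of 0] tendsto_add_zero[OF \<phi>(2) \<psi>(2)]]) (simp_all add: le)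
  then show ?thesis
    unfolding H10_iff
    by (intro conjI exI[of _ "\<lambda>n x. \<phi> n x + \<psi> n x"] allI H1_add(1)[OF H] test_functions_add
        \<phi>(1)[rule_format] \<psi>(1)[rule_format])
qed

lemma H10_cmult:
  assumes "f \<in> H10 \<Omega>" shows "(\<lambda>x. c * f x) \<in> H10 \<Omega>"
proof -
  obtain \<phi> where \<phi>: "\<forall>n. \<phi> n \<in> test_functions \<Omega>" "(\<lambda>n. H1_norm \<Omega> (\<lambda>x. \<phi> n x - f x)) \<longlonglongrightarrow> 0"
    using assms unfolding H10_iff by blast
  note H = assms[THEN H10_H1]
  have eq: "H1_norm \<Omega> (\<lambda>x. \<phi> n x * c - c * f x) = \<bar>c\<bar> * H1_norm \<Omega> (\<lambda>x. \<phi> n x - f x)" for n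
    using H1_norm_cmult[OF H1_diff(1)[OF test_H1(1) H], of "\<phi> n" c] \<phi>(1)
    by (simp add: algebra_simps)
  have "(\<lambda>n. H1_norm \<Omega> (\<lambda>x. \<phi> n x * c - c * f x)) \<longlonglongrightarrow> 0"
    unfolding eq by (rule tendsto_mult_right_zero[OF \<phi>(2)])
  then show ?thesis
    unfolding H10_iff
    by (intro conjI exI[of _ "\<lambda>n x. \<phi> n x * c"] allI H1_cmult(1)[OF H] test_functions_mult_smooth
        \<phi>(1)[rule_format] Ck_const)
qed

lemma H10_diff:
  assumes "f \<in> H10 \<Omega>" "g \<in> H10 \<Omega>" shows "(\<lambda>x. f x - g x) \<in> H10 \<Omega>"
  using H10_add[OF assms(1) H10_cmult[OF assms(2), of "-1"]] by simp

text \<open>For test functions each partial derivative has integral 0; the limit is legitimate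
  because constants belong to \<open>L2\<close> of a bounded set. Later this allows subtracting a
  constant vector from the flux.\<close>

lemma H10_integral_gradient:
  assumes "f \<in> H10 \<Omega>"
  shows "L2_inner \<Omega> (\<lambda>x. c) (weak_gradient \<Omega> f) = 0"
proof -
  obtain \<phi> where \<phi>: "\<And>n. \<phi> n \<in> test_functions \<Omega>" "(\<lambda>n. H1_norm \<Omega> (\<lambda>x. \<phi> n x - f x)) \<longlonglongrightarrow> 0"
    using assms unfolding H10_iff by blast
  note H = assms[THEN H10_H1]
  have conv: "(\<lambda>n. L2_norm \<Omega> (\<lambda>x. weak_gradient \<Omega> (\<phi> n) x - weak_gradient \<Omega> f x)) \<longlonglongrightarrow> 0"
    using \<phi>(2) H1_tendsto_iff[of \<phi> f, OF test_H1(1)[OF \<phi>(1)] H] by blast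
  have C: "(\<lambda>x::'a. c) \<in> L2 \<Omega>" by (rule L2_const[OF lmeasurable_\<Omega>])
  have "(\<lambda>n. L2_inner \<Omega> (\<lambda>x. c) (weak_gradient \<Omega> (\<phi> n))) \<longlonglongrightarrow> L2_inner \<Omega> (\<lambda>x. c) (weak_gradient \<Omega> f)"
    by (rule L2_inner_tendsto[OF C C _ weak_gradientD(2)[OF test_H1(1)[OF \<phi>(1)]] weak_gradientD(2)[OF H] conv])
      (simp add: L2_norm_def)
  moreover have "L2_inner \<Omega> (\<lambda>x. c) (weak_gradient \<Omega> (\<phi> n)) = 0" for n
  proof -
    have "L2_inner \<Omega> (\<lambda>x. c) (weak_gradient \<Omega> (\<phi> n)) = (LINT x|lebesgue_on \<Omega>. c \<bullet> grad (\<phi> n) x)"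
      unfolding L2_inner_def
    proof (rule integral_cong_AE)
      show "AE x in lebesgue_on \<Omega>. c \<bullet> weak_gradient \<Omega> (\<phi> n) x = c \<bullet> grad (\<phi> n) x"
        using test_H1(2)[OF \<phi>(1)[of n]] by eventually_elim simp
      show "(\<lambda>x. c \<bullet> weak_gradient \<Omega> (\<phi> n) x) \<in> borel_measurable (lebesgue_on \<Omega>)"
        "(\<lambda>x. c \<bullet> grad (\<phi> n) x) \<in> borel_measurable (lebesgue_on \<Omega>)"
        using L2_measurable[OF weak_gradientD(2)[OF test_H1(1)[OF \<phi>(1)[of n]]]] L2_measurable[OF grad_L2[OF \<phi>(1)[of n]]]
        by measurable
    qed
    also have "\<dots> = (LINT x|lebesgue_on \<Omega>. (\<Sum>i\<in>Basis. (c \<bullet> i) * partial_deriv i (\<phi> n) x))"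
      by (simp add: grad_def inner_sum_right mult.commute)
    also have "\<dots> = (\<Sum>i\<in>Basis. (c \<bullet> i) * (LINT x|lebesgue_on \<Omega>. partial_deriv i (\<phi> n) x))"
      using L2_integrable[OF lmeasurable_\<Omega> test_L2[OF test_functions_partial_deriv[OF \<phi>(1)]]]
      by (subst Bochner_Integration.integral_sum) auto
    also have "\<dots> = 0"
      by (intro sum.neutral ballI)
        (simp add: integral_test[OF test_functions_partial_deriv[OF \<phi>(1)]] integral_partial_deriv[OF \<phi>(1)])
    finally show ?thesis .
  qed
  ultimately show ?thesis by (simp add: LIMSEQ_const_iff)
qed



section \<open>Multiplication by bounded coefficients\<close>

lemma L2_scaleR_compose:
  fixes \<kappa> :: "real \<Rightarrow> real \<Rightarrow> real" and z :: "'a \<Rightarrow> 'b::euclidean_space"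
  assumes cont: "continuous_on UNIV (\<lambda>p. \<kappa> (fst p) (snd p))" and bound: "\<And>a b. \<bar>\<kappa> a b\<bar> \<le> C"
    and "f \<in> L2 \<Omega>" "g \<in> L2 \<Omega>" "z \<in> L2 \<Omega>"
  shows "(\<lambda>x. \<kappa> (f x) (g x) *\<^sub>R z x) \<in> L2 \<Omega>"
    "L2_norm \<Omega> (\<lambda>x. \<kappa> (f x) (g x) *\<^sub>R z x) \<le> C * L2_norm \<Omega> z"
proof -
  have "(\<lambda>x. \<kappa> (f x) (g x)) \<in> borel_measurable (lebesgue_on \<Omega>)"
    using assms(3,4)[THEN L2_measurable] cont by (rule borel_measurable_continuous_Pair)
  from L2_bounded_scaleR[OF assms(5) this bound]
  show "(\<lambda>x. \<kappa> (f x) (g x) *\<^sub>R z x) \<in> L2 \<Omega>"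
    "L2_norm \<Omega> (\<lambda>x. \<kappa> (f x) (g x) *\<^sub>R z x) \<le> C * L2_norm \<Omega> z" .
qed

text \<open>The difference splits into the new coefficient times \<open>zn n - z\<close>, controlled
  by \<open>C\<close>, and the change of the coefficient times \<open>z\<close>. The second part
  needs dominated convergence with majorant \<open>C * norm (z x)\<close>, since \<open>z\<close> is
  unbounded and the coefficients need not converge uniformly.\<close>

lemma L2_scaleR_compose_tendsto:
  fixes \<kappa> :: "real \<Rightarrow> real \<Rightarrow> real" and zn :: "nat \<Rightarrow> 'a \<Rightarrow> 'b::euclidean_space"
  assumes cont: "continuous_on UNIV (\<lambda>p. \<kappa> (fst p) (snd p))" and bound: "\<And>a b. \<bar>\<kappa> a b\<bar> \<le> C"
    and fn: "\<And>n. fn n \<in> L2 \<Omega>" "f \<in> L2 \<Omega>" "(\<lambda>n. L2_norm \<Omega> (\<lambda>x. fn n x - f x)) \<longlonglongrightarrow> 0"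
    and gn: "\<And>n. gn n \<in> L2 \<Omega>" "g \<in> L2 \<Omega>" "(\<lambda>n. L2_norm \<Omega> (\<lambda>x. gn n x - g x)) \<longlonglongrightarrow> 0"
    and zn: "\<And>n. zn n \<in> L2 \<Omega>" "z \<in> L2 \<Omega>" "(\<lambda>n. L2_norm \<Omega> (\<lambda>x. zn n x - z x)) \<longlonglongrightarrow> 0"
  shows "(\<lambda>n. L2_norm \<Omega> (\<lambda>x. \<kappa> (fn n x) (gn n x) *\<^sub>R zn n x - \<kappa> (f x) (g x) *\<^sub>R z x)) \<longlonglongrightarrow> 0"
proof -
  note sc = L2_scaleR_compose[OF cont bound]
  define A where "A n = L2_norm \<Omega> (\<lambda>x. \<kappa> (fn n x) (gn n x) *\<^sub>R z x - \<kappa> (f x) (g x) *\<^sub>R z x)" for n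
  have A: "A \<longlonglongrightarrow> 0"
    unfolding A_def
  proof (rule L2_compose_tendsto[OF fn gn, where h = "\<lambda>a b x. \<kappa> a b *\<^sub>R z x" and w = "\<lambda>x. C * norm (z x)"])
    show "continuous_on UNIV (\<lambda>p. \<kappa> (fst p) (snd p) *\<^sub>R z x)" for x
      by (intro continuous_on_scaleR cont continuous_on_const)
    show "(\<lambda>x. \<kappa> (f x) (g x) *\<^sub>R z x) \<in> borel_measurable (lebesgue_on \<Omega>)" if "f \<in> L2 \<Omega>" "g \<in> L2 \<Omega>" for f g
      by (rule L2_measurable[OF sc(1)[OF that zn(2)]])
    have "(\<lambda>x. norm (z x)) \<in> L2 \<Omega>"
      by (rule L2I_bound[OF zn(2)]) (use L2_measurable[OF zn(2)] in auto)
    then show "(\<lambda>x. C * norm (z x)) \<in> L2 \<Omega>" by (rule L2_cmult)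
    show "norm (\<kappa> a b *\<^sub>R z x) \<le> C * norm (z x)" for a b x
      using bound[of a b] by (simp add: mult_right_mono)
  qed
  have le: "L2_norm \<Omega> (\<lambda>x. \<kappa> (fn n x) (gn n x) *\<^sub>R zn n x - \<kappa> (f x) (g x) *\<^sub>R z x)
      \<le> C * L2_norm \<Omega> (\<lambda>x. zn n x - z x) + A n" for n
  proof -
    have "(\<lambda>x. \<kappa> (fn n x) (gn n x) *\<^sub>R zn n x - \<kappa> (f x) (g x) *\<^sub>R z x)
      = (\<lambda>x. \<kappa> (fn n x) (gn n x) *\<^sub>R (zn n x - z x) + (\<kappa> (fn n x) (gn n x) *\<^sub>R z x - \<kappa> (f x) (g x) *\<^sub>R z x))"
      by (simp add: algebra_simps)
    then have "L2_norm \<Omega> (\<lambda>x. \<kappa> (fn n x) (gn n x) *\<^sub>R zn n x - \<kappa> (f x) (g x) *\<^sub>R z x)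
      \<le> L2_norm \<Omega> (\<lambda>x. \<kappa> (fn n x) (gn n x) *\<^sub>R (zn n x - z x)) + A n"
      using L2_norm_triangle[OF sc(1)[OF fn(1)[of n] gn(1)[of n] L2_diff[OF zn(1)[of n] zn(2)]]
          L2_diff[OF sc(1)[OF fn(1)[of n] gn(1)[of n] zn(2)] sc(1)[OF fn(2) gn(2) zn(2)]]]
      by (simp add: A_def)
    then show ?thesis
      using sc(2)[OF fn(1)[of n] gn(1)[of n] L2_diff[OF zn(1)[of n] zn(2)]] by linarith
  qed
  have "(\<lambda>n. C * L2_norm \<Omega> (\<lambda>x. zn n x - z x) + A n) \<longlonglongrightarrow> C * 0 + 0"
    by (intro tendsto_intros zn(3) A)
  then have "(\<lambda>n. C * L2_norm \<Omega> (\<lambda>x. zn n x - z x) + A n) \<longlonglongrightarrow> 0" by simp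
  from tendsto_sandwich[OF _ _ tendsto_const[of 0] this] le show ?thesis by simp
qed

end

section \<open>Composition with smooth truncations\<close>

text \<open>\<open>\<beta> 0 = 0\<close> keeps supports compact, so composition maps test functions
  to test functions. The bounds on \<open>\<beta>'\<close> make \<open>\<beta>\<close> monotone and
  1-Lipschitz, and they keep composition from increasing the \<open>H1\<close> norm.\<close>

locale truncation =
  fixes \<beta> \<beta>' :: "real \<Rightarrow> real"
  assumes smooth_\<beta>: "smooth \<beta>" and \<beta>_0: "\<beta> 0 = 0"
    and deriv_\<beta>: "\<And>s. (\<beta> has_real_derivative \<beta>' s) (at s)" and \<beta>'_bounds: "\<And>s. 0 \<le> \<beta>' s" "\<And>s. \<beta>' s \<le> 1"
begin

lemma \<beta>_mono: "a \<le> b \<Longrightarrow> \<beta> a \<le> \<beta> b"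
  using DERIV_nonneg_imp_nondecreasing[of a b \<beta>] deriv_\<beta> \<beta>'_bounds(1) by blast

lemma \<beta>_lipschitz: "\<bar>\<beta> a - \<beta> b\<bar> \<le> \<bar>a - b\<bar>"
proof -
  have "norm (\<beta> a - \<beta> b) \<le> 1 * norm (a - b)"
    by (rule field_differentiable_bound[of UNIV \<beta> \<beta>'])
      (use deriv_\<beta> \<beta>'_bounds in \<open>auto simp: abs_le_iff intro: order_trans[of _ 0]\<close>)
  then show ?thesis by simp
qed

lemma \<beta>_abs_le: "\<bar>\<beta> a\<bar> \<le> \<bar>a\<bar>"
  using \<beta>_lipschitz[of a 0] \<beta>_0 by simp

lemma \<beta>'_abs_le: "\<bar>\<beta>' a\<bar> \<le> 1"
  using \<beta>'_bounds[of a] by simp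

lemma \<beta>'_eq: "partial_deriv 1 \<beta> = \<beta>'"
  by (rule ext) (rule partial_deriv_real[OF deriv_\<beta>])

lemma continuous_\<beta>: "continuous_on S \<beta>"
  using smoothD(3)[OF smooth_\<beta>] continuous_on_subset by blast

lemma continuous_\<beta>': "continuous_on S \<beta>'"
  using smoothD(3)[OF smoothD(2)[OF smooth_\<beta>, of 1]] continuous_on_subset by (auto simp: \<beta>'_eq)

end

locale truncation_on = bounded_open + truncation
begin

lemma \<beta>_L2:
  assumes "f \<in> L2 \<Omega>" shows "(\<lambda>x. \<beta> (f x)) \<in> L2 \<Omega>"
  by (rule L2I_bound[OF assms])
    (use borel_measurable_continuous_on[OF continuous_\<beta> L2_measurable[OF assms]] \<beta>_abs_le in auto)

lemma \<beta>_L2_norm_le: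
  assumes "f \<in> L2 \<Omega>" "g \<in> L2 \<Omega>"
  shows "L2_norm \<Omega> (\<lambda>x. \<beta> (f x) - \<beta> (g x)) \<le> L2_norm \<Omega> (\<lambda>x. f x - g x)"
  by (rule L2_norm_mono[OF L2_diff[OF \<beta>_L2[OF assms(1)] \<beta>_L2[OF assms(2)]] L2_diff[OF assms]])
    (simp add: \<beta>_lipschitz)

lemma \<beta>'_scaleR_tendsto:
  assumes fn: "\<And>n. fn n \<in> L2 \<Omega>" "f \<in> L2 \<Omega>" "(\<lambda>n. L2_norm \<Omega> (\<lambda>x. fn n x - f x)) \<longlonglongrightarrow> 0"
    and zn: "\<And>n. zn n \<in> L2 \<Omega>" "z \<in> L2 \<Omega>" "(\<lambda>n. L2_norm \<Omega> (\<lambda>x. zn n x - z x)) \<longlonglongrightarrow> 0"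
  shows "(\<lambda>n. L2_norm \<Omega> (\<lambda>x. \<beta>' (fn n x) *\<^sub>R zn n x - \<beta>' (f x) *\<^sub>R z x)) \<longlonglongrightarrow> 0"
  by (rule L2_scaleR_compose_tendsto[of "\<lambda>a b. \<beta>' a", OF _ \<beta>'_abs_le fn fn zn])
    (intro continuous_on_compose2[OF continuous_\<beta>'[of UNIV]] continuous_intros subset_UNIV)

lemma \<beta>'_L2:
  assumes "f \<in> L2 \<Omega>" "z \<in> L2 \<Omega>" shows "(\<lambda>x. \<beta>' (f x) *\<^sub>R z x) \<in> L2 \<Omega>"
  by (rule L2_scaleR_compose(1)[of "\<lambda>a b. \<beta>' a", OF _ \<beta>'_abs_le assms(1,1,2)])
    (intro continuous_on_compose2[OF continuous_\<beta>'[of UNIV]] continuous_intros subset_UNIV)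

lemma test_\<beta>:
  assumes \<phi>: "\<phi> \<in> test_functions \<Omega>"
  shows "(\<lambda>x. \<beta> (\<phi> x)) \<in> test_functions \<Omega>"
    "AE x in lebesgue_on \<Omega>. weak_gradient \<Omega> (\<lambda>x. \<beta> (\<phi> x)) x = \<beta>' (\<phi> x) *\<^sub>R weak_gradient \<Omega> \<phi> x"
proof -
  show t: "(\<lambda>x. \<beta> (\<phi> x)) \<in> test_functions \<Omega>"
    by (rule test_functions_compose[OF \<phi> smooth_\<beta> \<beta>_0])
  have "partial_deriv i (\<lambda>x. \<beta> (\<phi> x)) x = \<beta>' (\<phi> x) * partial_deriv i \<phi> x" for i x
    using partial_deriv_compose[OF smoothD(1)[OF test_functionsD[OF \<phi>]] smoothD(1)[OF smooth_\<beta>]]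
    by (simp add: \<beta>'_eq)
  then have "grad (\<lambda>x. \<beta> (\<phi> x)) x = \<beta>' (\<phi> x) *\<^sub>R grad \<phi> x" for x
    by (simp add: grad_def scaleR_sum_right)
  then show "AE x in lebesgue_on \<Omega>. weak_gradient \<Omega> (\<lambda>x. \<beta> (\<phi> x)) x = \<beta>' (\<phi> x) *\<^sub>R weak_gradient \<Omega> \<phi> x"
    using test_H1(2)[OF \<phi>] test_H1(2)[OF t] by (auto elim: eventually_elim2)
qed

text \<open>Chain rule by density. For test functions converging to \<open>f\<close> the
  compositions are test functions, and they converge in \<open>L2\<close> together with the
  gradients given by the classical chain rule. Closedness of the weak gradient identifies the limit;
  the same convergences, read in \<open>H1\<close>, then place it in the closure.\<close>

lemma H10_\<beta>:
  assumes f: "f \<in> H10 \<Omega>"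
  shows "(\<lambda>x. \<beta> (f x)) \<in> H10 \<Omega>"
    "AE x in lebesgue_on \<Omega>. weak_gradient \<Omega> (\<lambda>x. \<beta> (f x)) x = \<beta>' (f x) *\<^sub>R weak_gradient \<Omega> f x"
proof -
  obtain \<phi> where \<phi>: "\<And>n. \<phi> n \<in> test_functions \<Omega>" "(\<lambda>n. H1_norm \<Omega> (\<lambda>x. \<phi> n x - f x)) \<longlonglongrightarrow> 0"
    using f unfolding H10_iff by blast
  note D = weak_gradientD[OF H10_H1[OF f]] and T = test_\<beta>[OF \<phi>(1)]
  note Dn = weak_gradientD[OF test_H1(1)[OF \<phi>(1)]]
  have conv: "(\<lambda>n. L2_norm \<Omega> (\<lambda>x. \<phi> n x - f x)) \<longlonglongrightarrow> 0"
    "(\<lambda>n. L2_norm \<Omega> (\<lambda>x. weak_gradient \<Omega> (\<phi> n) x - weak_gradient \<Omega> f x)) \<longlonglongrightarrow> 0"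
    using \<phi>(2) H1_tendsto_iff[of \<phi> f, OF test_H1(1)[OF \<phi>(1)] H10_H1[OF f]] by blast+
  have c0: "(\<lambda>n. L2_norm \<Omega> (\<lambda>x. \<beta> (\<phi> n x) - \<beta> (f x))) \<longlonglongrightarrow> 0"
    by (rule tendsto_sandwich[OF _ _ tendsto_const[of 0] conv(1)]) (simp_all add: \<beta>_L2_norm_le Dn(1) D(1))
  let ?g = "\<lambda>x. \<beta>' (f x) *\<^sub>R weak_gradient \<Omega> f x"
  have c1': "(\<lambda>n. L2_norm \<Omega> (\<lambda>x. \<beta>' (\<phi> n x) *\<^sub>R weak_gradient \<Omega> (\<phi> n) x - ?g x)) \<longlonglongrightarrow> 0"
    by (rule \<beta>'_scaleR_tendsto[OF Dn(1) D(1) conv(1) Dn(2) D(2) conv(2)])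
  have g: "?g \<in> L2 \<Omega>" by (rule \<beta>'_L2[OF D(1,2)])
  have Tg: "weak_gradient \<Omega> (\<lambda>x. \<beta> (\<phi> n x)) \<in> L2 \<Omega>" for n
    by (rule weak_gradientD(2)[OF test_H1(1)[OF T(1)]])
  have eq: "L2_norm \<Omega> (\<lambda>x. weak_gradient \<Omega> (\<lambda>x. \<beta> (\<phi> n x)) x - ?g x)
      = L2_norm \<Omega> (\<lambda>x. \<beta>' (\<phi> n x) *\<^sub>R weak_gradient \<Omega> (\<phi> n) x - ?g x)" for n
  proof (rule L2_norm_cong_AE)
    show "AE x in lebesgue_on \<Omega>. weak_gradient \<Omega> (\<lambda>x. \<beta> (\<phi> n x)) x - ?g x = \<beta>' (\<phi> n x) *\<^sub>R weak_gradient \<Omega> (\<phi> n) x - ?g x"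
      using T(2)[of n] by eventually_elim simp
    show "(\<lambda>x. weak_gradient \<Omega> (\<lambda>x. \<beta> (\<phi> n x)) x - ?g x) \<in> borel_measurable (lebesgue_on \<Omega>)"
      by (rule L2_measurable[OF L2_diff[OF Tg g]])
    show "(\<lambda>x. \<beta>' (\<phi> n x) *\<^sub>R weak_gradient \<Omega> (\<phi> n) x - ?g x) \<in> borel_measurable (lebesgue_on \<Omega>)"
      by (rule L2_measurable[OF L2_diff[OF \<beta>'_L2[OF Dn(1,2)] g]])
  qed
  have c1: "(\<lambda>n. L2_norm \<Omega> (\<lambda>x. weak_gradient \<Omega> (\<lambda>x. \<beta> (\<phi> n x)) x - ?g x)) \<longlonglongrightarrow> 0"
    using c1' unfolding eq .
  have w: "is_weak_gradient \<Omega> (\<lambda>x. \<beta> (f x)) ?g"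
    by (rule weak_gradient_limit[OF \<beta>_L2[OF Dn(1)] \<beta>_L2[OF D(1)] c0 Tg g c1 weak_gradientD(3)[OF test_H1(1)[OF T(1)]]])
  note B = H1I[OF \<beta>_L2[OF D(1)] g w]
  show "AE x in lebesgue_on \<Omega>. weak_gradient \<Omega> (\<lambda>x. \<beta> (f x)) x = ?g x" by (rule B(2))
  have "L2_norm \<Omega> (\<lambda>x. weak_gradient \<Omega> (\<lambda>x. \<beta> (\<phi> n x)) x - weak_gradient \<Omega> (\<lambda>x. \<beta> (f x)) x)
      = L2_norm \<Omega> (\<lambda>x. weak_gradient \<Omega> (\<lambda>x. \<beta> (\<phi> n x)) x - ?g x)" for n
  proof (rule L2_norm_cong_AE)
    show "AE x in lebesgue_on \<Omega>. weak_gradient \<Omega> (\<lambda>x. \<beta> (\<phi> n x)) x - weak_gradient \<Omega> (\<lambda>x. \<beta> (f x)) x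
        = weak_gradient \<Omega> (\<lambda>x. \<beta> (\<phi> n x)) x - ?g x"
      using B(2) by eventually_elim simp
  qed (intro L2_measurable[OF L2_diff] Tg g weak_gradientD(2)[OF B(1)])+
  then have "(\<lambda>n. H1_norm \<Omega> (\<lambda>x. \<beta> (\<phi> n x) - \<beta> (f x))) \<longlonglongrightarrow> 0"
    using c0 c1 H1_tendsto_iff[of "\<lambda>n x. \<beta> (\<phi> n x)" "\<lambda>x. \<beta> (f x)", OF test_H1(1)[OF T(1)] B(1)] by simp
  then show "(\<lambda>x. \<beta> (f x)) \<in> H10 \<Omega>"
    unfolding H10_iff by (intro conjI B(1) exI[of _ "\<lambda>n x. \<beta> (\<phi> n x)"] allI T(1))
qed

text \<open>Continuity of the composition, rather than mere boundedness, makes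
  \<open>\<beta> (u t)\<close> strongly measurable in time: simple approximations of
  \<open>u\<close> are sent to simple approximations of the composition. It relies on the continuity
  of \<open>\<beta>'\<close>.\<close>

lemma H10_\<beta>_tendsto:
  assumes fn: "\<And>n. fn n \<in> H10 \<Omega>" and f: "f \<in> H10 \<Omega>"
    and lim: "(\<lambda>n. H1_norm \<Omega> (\<lambda>x. fn n x - f x)) \<longlonglongrightarrow> 0"
  shows "(\<lambda>n. H1_norm \<Omega> (\<lambda>x. \<beta> (fn n x) - \<beta> (f x))) \<longlonglongrightarrow> 0"
proof -
  note D = weak_gradientD[OF H10_H1[OF f]] and Dn = weak_gradientD[OF H10_H1[OF fn]]
  note B = H10_\<beta>[OF f] and Bn = H10_\<beta>[OF fn]
  have conv: "(\<lambda>n. L2_norm \<Omega> (\<lambda>x. fn n x - f x)) \<longlonglongrightarrow> 0"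
    "(\<lambda>n. L2_norm \<Omega> (\<lambda>x. weak_gradient \<Omega> (fn n) x - weak_gradient \<Omega> f x)) \<longlonglongrightarrow> 0"
    using lim H1_tendsto_iff[of fn f, OF H10_H1[OF fn] H10_H1[OF f]] by blast+
  have c0: "(\<lambda>n. L2_norm \<Omega> (\<lambda>x. \<beta> (fn n x) - \<beta> (f x))) \<longlonglongrightarrow> 0"
    by (rule tendsto_sandwich[OF _ _ tendsto_const[of 0] conv(1)]) (simp_all add: \<beta>_L2_norm_le Dn(1) D(1))
  have c1: "(\<lambda>n. L2_norm \<Omega> (\<lambda>x. \<beta>' (fn n x) *\<^sub>R weak_gradient \<Omega> (fn n) x - \<beta>' (f x) *\<^sub>R weak_gradient \<Omega> f x)) \<longlonglongrightarrow> 0"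
    by (rule \<beta>'_scaleR_tendsto[OF Dn(1) D(1) conv(1) Dn(2) D(2) conv(2)])
  have "L2_norm \<Omega> (\<lambda>x. weak_gradient \<Omega> (\<lambda>x. \<beta> (fn n x)) x - weak_gradient \<Omega> (\<lambda>x. \<beta> (f x)) x)
      = L2_norm \<Omega> (\<lambda>x. \<beta>' (fn n x) *\<^sub>R weak_gradient \<Omega> (fn n) x - \<beta>' (f x) *\<^sub>R weak_gradient \<Omega> f x)" for n
  proof (rule L2_norm_cong_AE)
    show "AE x in lebesgue_on \<Omega>. weak_gradient \<Omega> (\<lambda>x. \<beta> (fn n x)) x - weak_gradient \<Omega> (\<lambda>x. \<beta> (f x)) x
        = \<beta>' (fn n x) *\<^sub>R weak_gradient \<Omega> (fn n) x - \<beta>' (f x) *\<^sub>R weak_gradient \<Omega> f x"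
      using B(2) Bn(2)[of n] by eventually_elim simp
  qed (intro L2_measurable[OF L2_diff] \<beta>'_L2 D Dn weak_gradientD(2)[OF H10_H1] B(1) Bn(1))+
  then show ?thesis
    using c0 c1 H1_tendsto_iff[of "\<lambda>n x. \<beta> (fn n x)" "\<lambda>x. \<beta> (f x)", OF H10_H1[OF Bn(1)] H10_H1[OF B(1)]] by simp
qed

text \<open>Both components of the jet shrink pointwise, the first by
  \<open>\<bar>\<beta> a\<bar> \<le> \<bar>a\<bar>\<close>, the second by
  \<open>\<bar>\<beta>' a\<bar> \<le> 1\<close>.\<close>

lemma H1_norm_\<beta>_le:
  assumes f: "f \<in> H10 \<Omega>"
  shows "H1_norm \<Omega> (\<lambda>x. \<beta> (f x)) \<le> H1_norm \<Omega> f"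
  unfolding H1_norm_jet[OF H10_H1[OF f]] H1_norm_jet[OF H10_H1[OF H10_\<beta>(1)[OF f]]]
proof (rule L2_norm_mono)
  show "AE x in lebesgue_on \<Omega>. norm (jet (\<lambda>x. \<beta> (f x)) x) \<le> norm (jet f x)"
    using H10_\<beta>(2)[OF f]
  proof eventually_elim
    case (elim x)
    have "\<bar>\<beta>' (f x)\<bar> * norm (weak_gradient \<Omega> f x) \<le> norm (weak_gradient \<Omega> f x)"
      using mult_right_mono[OF \<beta>'_abs_le] by fastforce
    then show ?case
      unfolding jet_def norm_Pair elim
      by (intro real_sqrt_le_mono add_mono power_mono norm_ge_zero) (simp_all add: \<beta>_abs_le)
  qed
qed (intro jet_L2 H10_H1 H10_\<beta>(1) f)+

end

section \<open>Strongly measurable functions of time\<close>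

text \<open>Lebesgue measure is complete: the null set where convergence fails is cut out by an
  indicator, and restoring \<open>f\<close> on it does not affect measurability. With a constant
  sequence this also transfers measurability between functions that agree almost everywhere.\<close>

lemma borel_measurable_lebesgue_on_AE_limit:
  fixes f :: "'a::euclidean_space \<Rightarrow> real"
  assumes S: "S \<in> sets lebesgue" and s: "\<And>n. s n \<in> borel_measurable (lebesgue_on S)"
    and lim: "AE t in lebesgue_on S. (\<lambda>n. s n t) \<longlonglongrightarrow> f t"
  shows "f \<in> borel_measurable (lebesgue_on S)"
proof -
  have "AE t in lebesgue. t \<in> S \<longrightarrow> (\<lambda>n. s n t) \<longlonglongrightarrow> f t"
    using lim S by (subst (asm) AE_restrict_space_iff) auto
  then obtain N where N: "N \<in> null_sets lebesgue"
      "{t \<in> space lebesgue. \<not> (t \<in> S \<longrightarrow> (\<lambda>n. s n t) \<longlonglongrightarrow> f t)} \<subseteq> N"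
    unfolding eventually_ae_filter by blast
  have "(\<lambda>t. if t \<in> S then s n t else 0) \<in> borel_measurable lebesgue" for n
    using borel_measurable_if[OF S, of "s n"] s by simp
  then have m: "(\<lambda>t. indicat_real (- N) t * (if t \<in> S then s n t else 0)) \<in> borel_measurable lebesgue" for n
    using null_setsD2[OF N(1)]
    by (intro borel_measurable_times borel_measurable_indicator) (simp_all add: Compl_eq_Diff_UNIV sets.Diff)
  have "(\<lambda>t. indicat_real (- N) t * (if t \<in> S then f t else 0)) \<in> borel_measurable lebesgue"
  proof (rule borel_measurable_LIMSEQ_real[OF _ m])
    fix t :: 'a
    show "(\<lambda>n. indicat_real (- N) t * (if t \<in> S then s n t else 0)) \<longlonglongrightarrow> indicat_real (- N) t * (if t \<in> S then f t else 0)"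
      using N(2) by (cases "t \<in> N"; cases "t \<in> S") auto
  qed
  moreover have "AE t in lebesgue. indicat_real (- N) t * (if t \<in> S then f t else 0) = (if t \<in> S then f t else 0)"
    using AE_not_in[OF N(1)] by eventually_elim simp
  ultimately have "(\<lambda>t. if t \<in> S then f t else 0) \<in> borel_measurable lebesgue"
    by (rule borel_measurable_AE)
  then show ?thesis using borel_measurable_if[OF S] by blast
qed

section \<open>Maps of time with finitely many values\<close>

lemma simple_mapD:
  assumes "simple_map T X s"
  shows "t \<in> {0<..<T} \<Longrightarrow> s t \<in> X" "finite (s ` {0<..<T})" "{t \<in> {0<..<T}. s t = y} \<in> sets lebesgue"
  using assms unfolding simple_map_def by auto

lemma simple_map_Pair:
  assumes s: "simple_map T X s" and r: "simple_map T Y r"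
  shows "simple_map T (X \<times> Y) (\<lambda>t. (s t, r t))"
  unfolding simple_map_def
proof (intro conjI allI)
  show "(\<lambda>t. (s t, r t)) ` {0<..<T} \<subseteq> X \<times> Y"
    using simple_mapD(1)[OF s] simple_mapD(1)[OF r] by auto
  show "finite ((\<lambda>t. (s t, r t)) ` {0<..<T})"
    by (rule finite_subset[OF _ finite_cartesian_product[OF simple_mapD(2)[OF s] simple_mapD(2)[OF r]]]) auto
  fix y
  have "{t \<in> {0<..<T}. (s t, r t) = y} = {t \<in> {0<..<T}. s t = fst y} \<inter> {t \<in> {0<..<T}. r t = snd y}"
    by auto
  then show "{t \<in> {0<..<T}. (s t, r t) = y} \<in> sets lebesgue"
    using sets.Int[OF simple_mapD(3)[OF s] simple_mapD(3)[OF r]] by simp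
qed

lemma simple_map_compose:
  assumes s: "simple_map T X s" and f: "\<And>x. x \<in> X \<Longrightarrow> f x \<in> Y"
  shows "simple_map T Y (\<lambda>t. f (s t))"
  unfolding simple_map_def
proof (intro conjI allI)
  show "(\<lambda>t. f (s t)) ` {0<..<T} \<subseteq> Y" using simple_mapD(1)[OF s] f by auto
  show "finite ((\<lambda>t. f (s t)) ` {0<..<T})"
    using finite_imageI[OF simple_mapD(2)[OF s], of f] by (simp add: image_image)
  fix y
  have "{t \<in> {0<..<T}. f (s t) = y} = (\<Union>z\<in>{z \<in> s ` {0<..<T}. f z = y}. {t \<in> {0<..<T}. s t = z})"
    by auto
  also have "\<dots> \<in> sets lebesgue"
    using simple_mapD(2,3)[OF s] by (intro sets.finite_UN) auto
  finally show "{t \<in> {0<..<T}. f (s t) = y} \<in> sets lebesgue" .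
qed

lemma simple_map_if:
  assumes s: "simple_map T X s" and r: "simple_map T X r" and A: "A \<in> sets lebesgue"
  shows "simple_map T X (\<lambda>t. if t \<in> A then s t else r t)"
  unfolding simple_map_def
proof (intro conjI allI)
  show "(\<lambda>t. if t \<in> A then s t else r t) ` {0<..<T} \<subseteq> X"
    using simple_mapD(1)[OF s] simple_mapD(1)[OF r] by auto
  show "finite ((\<lambda>t. if t \<in> A then s t else r t) ` {0<..<T})"
    by (rule finite_subset[OF _ finite_UnI[OF simple_mapD(2)[OF s] simple_mapD(2)[OF r]]]) auto
  fix y
  have "{t \<in> {0<..<T}. (if t \<in> A then s t else r t) = y}
      = ({t \<in> {0<..<T}. s t = y} \<inter> A) \<union> ({t \<in> {0<..<T}. r t = y} - A)"
    by auto
  then show "{t \<in> {0<..<T}. (if t \<in> A then s t else r t) = y} \<in> sets lebesgue"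
    using sets.Un[OF sets.Int[OF simple_mapD(3)[OF s, of y] A] sets.Diff[OF simple_mapD(3)[OF r, of y] A]] by simp
qed

lemma simple_map_const: "x \<in> X \<Longrightarrow> simple_map T X (\<lambda>t. x)"
  unfolding simple_map_def
  by (intro conjI allI finite_subset[of "(\<lambda>t. x) ` {0<..<T}" "{x}"]) (auto intro: sets.sets_Collect_conj)

text \<open>The identity is pointwise and \<open>\<Phi>\<close> is arbitrary, so
  \<open>\<Phi>\<close> may change with \<open>t\<close>. This turns a pairing
  \<open>w t (s t)\<close> into a finite sum of indicators times the scalar functions
  \<open>w t y\<close>.\<close>

lemma simple_map_sum:
  assumes "simple_map T X s" "t \<in> {0<..<T}"
  shows "\<Phi> (s t) = (\<Sum>y\<in>s ` {0<..<T}. \<Phi> y * indicat_real {t \<in> {0<..<T}. s t = y} t)"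
proof -
  have "(\<Sum>y\<in>s ` {0<..<T}. \<Phi> y * indicat_real {t \<in> {0<..<T}. s t = y} t) = (\<Sum>y\<in>{s t}. \<Phi> y)"
    using simple_mapD(2)[OF assms(1)] assms(2) by (intro sum.mono_neutral_cong_right) (auto simp: indicator_def)
  then show ?thesis by simp
qed

lemma simple_map_measurable:
  fixes \<Phi> :: "'b \<Rightarrow> real"
  assumes s: "simple_map T X s"
  shows "(\<lambda>t. \<Phi> (s t)) \<in> borel_measurable (lebesgue_on {0<..<T})"
proof -
  have "indicat_real {t \<in> {0<..<T}. s t = y} \<in> borel_measurable (lebesgue_on {0<..<T})" for y
    by (intro measurable_restrict_space1 borel_measurable_indicator simple_mapD(3)[OF s])
  then have "(\<lambda>t. \<Sum>y\<in>s ` {0<..<T}. \<Phi> y * indicat_real {t \<in> {0<..<T}. s t = y} t) \<in> borel_measurable (lebesgue_on {0<..<T})"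
    by (intro borel_measurable_sum borel_measurable_times borel_measurable_const)
  moreover have "(\<Sum>y\<in>s ` {0<..<T}. \<Phi> y * indicat_real {t \<in> {0<..<T}. s t = y} t) = \<Phi> (s t)"
    if "t \<in> space (lebesgue_on {0<..<T})" for t
    using simple_map_sum[OF s, of t \<Phi>] that by (simp add: space_restrict_space)
  ultimately show ?thesis by (rule measurable_cong[THEN iffD1, rotated])
qed

lemma L2_BochnerD:
  assumes "w \<in> L2_Bochner T X N"
  shows "AE t in lebesgue_on {0<..<T}. w t \<in> X"
    "\<exists>s. (\<forall>n::nat. simple_map T X (s n)) \<and> (AE t in lebesgue_on {0<..<T}. (\<lambda>n. N (w t - s n t)) \<longlonglongrightarrow> 0)"
    "integrable (lebesgue_on {0<..<T}) (\<lambda>t. (N (w t))\<^sup>2)"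
  using assms unfolding L2_Bochner_def by blast+

text \<open>Measurability reduces to sequential continuity of \<open>\<Phi>\<close>: along simple
  approximations the composition has finitely many values on measurable sets, and it converges
  almost everywhere. No sigma-algebra on the function spaces is involved.\<close>

lemma L2_Bochner_measurable2:
  fixes \<Phi> :: "'b::minus \<Rightarrow> 'c::minus \<Rightarrow> real"
  assumes w: "w \<in> L2_Bochner T X N" and z: "z \<in> L2_Bochner T Y M"
    and cont: "\<And>fn f gn g. \<lbrakk>\<forall>n::nat. fn n \<in> X; f \<in> X; (\<lambda>n. N (f - fn n)) \<longlonglongrightarrow> 0;
        \<forall>n. gn n \<in> Y; g \<in> Y; (\<lambda>n. M (g - gn n)) \<longlonglongrightarrow> 0\<rbrakk> \<Longrightarrow> (\<lambda>n. \<Phi> (fn n) (gn n)) \<longlonglongrightarrow> \<Phi> f g"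
  shows "(\<lambda>t. \<Phi> (w t) (z t)) \<in> borel_measurable (lebesgue_on {0<..<T})"
proof -
  obtain s where s: "\<And>n::nat. simple_map T X (s n)" "AE t in lebesgue_on {0<..<T}. (\<lambda>n. N (w t - s n t)) \<longlonglongrightarrow> 0"
    using L2_BochnerD(2)[OF w] by blast
  obtain r where r: "\<And>n::nat. simple_map T Y (r n)" "AE t in lebesgue_on {0<..<T}. (\<lambda>n. M (z t - r n t)) \<longlonglongrightarrow> 0"
    using L2_BochnerD(2)[OF z] by blast
  show ?thesis
  proof (rule borel_measurable_lebesgue_on_AE_limit)
    show "(\<lambda>t. \<Phi> (s n t) (r n t)) \<in> borel_measurable (lebesgue_on {0<..<T})" for n
      using simple_map_measurable[OF simple_map_Pair[OF s(1)[of n] r(1)[of n]], of "\<lambda>p. \<Phi> (fst p) (snd p)"] by simp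
    have "AE t in lebesgue_on {0<..<T}. t \<in> {0<..<T}"
      by (rule AE_I2) (simp add: space_restrict_space)
    then show "AE t in lebesgue_on {0<..<T}. (\<lambda>n. \<Phi> (s n t) (r n t)) \<longlonglongrightarrow> \<Phi> (w t) (z t)"
      using s(2) r(2) L2_BochnerD(1)[OF w] L2_BochnerD(1)[OF z]
    proof eventually_elim
      case (elim t)
      show ?case
        by (rule cont[OF _ elim(4) elim(2) _ elim(5) elim(3)])
          (use simple_mapD(1)[OF s(1)] simple_mapD(1)[OF r(1)] elim(1) in auto)
    qed
  qed simp
qed

lemma L2_Bochner_measurable:
  fixes \<Phi> :: "'b::minus \<Rightarrow> real"
  assumes w: "w \<in> L2_Bochner T X N"
    and cont: "\<And>fn f. \<lbrakk>\<forall>n::nat. fn n \<in> X; f \<in> X; (\<lambda>n. N (f - fn n)) \<longlonglongrightarrow> 0\<rbrakk> \<Longrightarrow> (\<lambda>n. \<Phi> (fn n)) \<longlonglongrightarrow> \<Phi> f"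
  shows "(\<lambda>t. \<Phi> (w t)) \<in> borel_measurable (lebesgue_on {0<..<T})"
  by (rule L2_Bochner_measurable2[OF w w, where \<Phi> = "\<lambda>f g. \<Phi> f"]) (rule cont)

text \<open>Elements are functions rather than classes, so \<open>N\<close> may vanish on nonzero
  functions. Subtraction suffices as vector operation because distances in \<open>L2_Bochner\<close>
  are written with it; the usual triangle inequality is derived from \<open>N_diff\<close>.\<close>

locale seminormed =
  fixes X :: "('c \<Rightarrow> real) set" and N :: "('c \<Rightarrow> real) \<Rightarrow> real"
  assumes X_zero: "(\<lambda>x. 0) \<in> X" and X_diff: "\<And>f g. f \<in> X \<Longrightarrow> g \<in> X \<Longrightarrow> f - g \<in> X"
    and N_nonneg: "\<And>f. 0 \<le> N f" and N_zero: "N (\<lambda>x. 0) = 0"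
    and N_diff: "\<And>f g. f \<in> X \<Longrightarrow> g \<in> X \<Longrightarrow> N (f - g) \<le> N f + N g"
begin

lemma N_minus_commute:
  assumes "f \<in> X" "g \<in> X" shows "N (f - g) = N (g - f)"
proof -
  have le: "N (f - g) \<le> N (g - f)" if "f \<in> X" "g \<in> X" for f g
  proof -
    have "f - g = (\<lambda>x. 0) - (g - f)" by (simp add: fun_diff_def)
    then show ?thesis using N_diff[OF X_zero X_diff[OF that(2,1)]] N_zero by simp
  qed
  show ?thesis using le[OF assms] le[OF assms(2,1)] by simp
qed

lemma N_triangle:
  assumes "f \<in> X" "g \<in> X" "h \<in> X" shows "N (f - h) \<le> N (f - g) + N (g - h)"
proof -
  have "f - h = (f - g) - (h - g)" by (simp add: fun_diff_def)
  then show ?thesis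
    using N_diff[OF X_diff[OF assms(1,2)] X_diff[OF assms(3,2)]] N_minus_commute[OF assms(2,3)] by simp
qed

lemma N_diff_abs:
  assumes "f \<in> X" "g \<in> X" shows "\<bar>N f - N g\<bar> \<le> N (f - g)"
proof -
  have z: "f - (\<lambda>x. 0) = f" for f :: "'c \<Rightarrow> real" by (simp add: fun_diff_def)
  show ?thesis
    using N_triangle[OF assms X_zero] N_triangle[OF assms(2,1) X_zero] N_minus_commute[OF assms] by (simp add: z)
qed

lemma N_tendsto:
  assumes "\<forall>n::nat. fn n \<in> X" "f \<in> X" "(\<lambda>n. N (f - fn n)) \<longlonglongrightarrow> 0"
  shows "(\<lambda>n. N (fn n)) \<longlonglongrightarrow> N f"
proof -
  have b: "\<forall>n. norm (N f - N (fn n)) \<le> N (f - fn n)"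
    using N_diff_abs[OF assms(2)] assms(1) by simp
  have "(\<lambda>n. N f - N (fn n)) \<longlonglongrightarrow> 0"
    by (rule Lim_null_comparison[OF always_eventually[OF b] assms(3)])
  from tendsto_diff[OF tendsto_const[of "N f"] this] show ?thesis by simp
qed

lemma Bochner_norm_measurable:
  assumes "w \<in> L2_Bochner T X N"
  shows "(\<lambda>t. N (w t)) \<in> borel_measurable (lebesgue_on {0<..<T})"
  by (rule L2_Bochner_measurable[OF assms]) (rule N_tendsto)

text \<open>Truncating at twice the norm of the limit makes the pointwise simple approximations dominated.\<close>

lemma Bochner_simple_approx:
  assumes w: "w \<in> L2_Bochner T X N"
  obtains s where "\<And>n::nat. simple_map T X (s n)"
    "\<And>n. (\<lambda>t. N (w t - s n t)) \<in> L2 {0<..<T}"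
    "(\<lambda>n. L2_norm {0<..<T} (\<lambda>t. N (w t - s n t))) \<longlonglongrightarrow> 0"
proof -
  let ?M = "lebesgue_on {0<..<T}"
  obtain r where r: "\<And>n::nat. simple_map T X (r n)" "AE t in ?M. (\<lambda>n. N (w t - r n t)) \<longlonglongrightarrow> 0"
    using L2_BochnerD(2)[OF w] by blast
  note Nm = Bochner_norm_measurable[OF w]
  define A where "A n = {t \<in> space ?M. N (r n t) \<le> 2 * N (w t)}" for n
  have "A n \<in> sets ?M" for n
    unfolding A_def using Nm simple_map_measurable[OF r(1)[of n], of N]
    by (intro borel_measurable_le borel_measurable_times borel_measurable_const)
  then have A: "A n \<in> sets lebesgue" for n
    by (simp add: sets_restrict_space_iff)
  define s where "s n t = (if t \<in> A n then r n t else (\<lambda>x. 0))" for n t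
  have s: "simple_map T X (s n)" for n
    unfolding s_def[abs_def] by (rule simple_map_if[OF r(1) simple_map_const[OF X_zero] A])
  \<comment> \<open>Each \<open>s n\<close> is itself in the Bochner space, approximated by the
    constant sequence \<open>s n\<close>; the distance is then a jointly continuous function of two
    Bochner elements.\<close>
  have m: "(\<lambda>t. N (w t - s n t)) \<in> borel_measurable ?M" for n
  proof (rule L2_Bochner_measurable2[OF w, of "s n" X N "\<lambda>f g. N (f - g)"])
    show "s n \<in> L2_Bochner T X N"
    proof -
      have "AE t in ?M. t \<in> {0<..<T}" by (rule AE_I2) (simp add: space_restrict_space)
      then have "AE t in ?M. s n t \<in> X" by eventually_elim (rule simple_mapD(1)[OF s])
      moreover have "integrable ?M (\<lambda>t. (N (s n t))\<^sup>2)"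
      proof -
        have nm: "(\<lambda>t. N (s n t)) \<in> borel_measurable ?M" by (rule simple_map_measurable[OF s])
        have "finite ((\<lambda>t. N (s n t)) ` {0<..<T})"
          using finite_imageI[OF simple_mapD(2)[OF s[of n]], of N] by (simp add: image_image)
        then obtain B where B: "\<forall>x\<in>(\<lambda>t. N (s n t)) ` {0<..<T}. norm x \<le> B"
          using finite_imp_bounded[of "(\<lambda>t. N (s n t)) ` {0<..<T}"] unfolding bounded_iff by blast
        have bd: "norm ((N (s n t))\<^sup>2) \<le> B\<^sup>2" if "t \<in> space ?M" for t
        proof -
          have "\<bar>N (s n t)\<bar> \<le> B" using B that by (simp add: space_restrict_space)
          then have "\<bar>N (s n t)\<bar>\<^sup>2 \<le> B\<^sup>2" by (rule power_mono) simp
          then show ?thesis by simp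
        qed
        show ?thesis
          by (rule finite_measure.integrable_const_bound[OF finite_measure_lebesgue_on AE_I2[OF bd]])
            (use nm in auto)
      qed
      moreover have "N (s n t - s n t) = 0" for t
        using N_zero by (simp add: fun_diff_def)
      ultimately show ?thesis
        unfolding L2_Bochner_def using s by (intro CollectI conjI exI[of _ "\<lambda>k. s n"]) auto
    qed
    fix fn f gn g assume *: "\<forall>n. fn n \<in> X" "f \<in> X" "(\<lambda>n. N (f - fn n)) \<longlonglongrightarrow> 0"
        "\<forall>n. gn n \<in> X" "g \<in> X" "(\<lambda>n. N (g - gn n)) \<longlonglongrightarrow> 0"
    show "(\<lambda>n. N (fn n - gn n)) \<longlonglongrightarrow> N (f - g)"
    proof (rule N_tendsto)
      show "(\<lambda>n. N (f - g - (fn n - gn n))) \<longlonglongrightarrow> 0"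
      proof (rule tendsto_sandwich[OF _ _ tendsto_const[of 0] tendsto_add_zero[OF *(3,6)]])
        have "f - g - (fn n - gn n) = (f - fn n) - (g - gn n)" for n by (simp add: fun_eq_iff)
        then show "\<forall>\<^sub>F n in sequentially. N (f - g - (fn n - gn n)) \<le> N (f - fn n) + N (g - gn n)"
          using N_diff[OF X_diff X_diff] * by (intro always_eventually) simp
      qed (simp add: N_nonneg)
    qed (use * X_diff in auto)
  qed
  \<comment> \<open>The factor 3 is 1 for \<open>w t\<close> plus 2 for the truncated
    approximation.\<close>
  have D: "AE t in ?M. norm (N (w t - s n t)) \<le> 3 * N (w t)" for n
  proof -
    have "AE t in ?M. t \<in> {0<..<T}" by (rule AE_I2) (simp add: space_restrict_space)
    with L2_BochnerD(1)[OF w] show ?thesis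
    proof eventually_elim
      case (elim t)
      have "N (s n t) \<le> 2 * N (w t)"
        using elim(2) N_nonneg[of "w t"] N_zero by (auto simp: s_def A_def)
      then show ?case using N_diff[OF elim(1) simple_mapD(1)[OF s elim(2)], of n] N_nonneg[of "w t - s n t"] by simp
    qed
  qed
  have L: "AE t in ?M. (\<lambda>n. N (w t - s n t)) \<longlonglongrightarrow> 0"
  proof -
    have "AE t in ?M. t \<in> {0<..<T}" by (rule AE_I2) (simp add: space_restrict_space)
    with L2_BochnerD(1)[OF w] r(2) show ?thesis
    proof eventually_elim
      case (elim t)
      have rX: "\<forall>n. r n t \<in> X" using simple_mapD(1)[OF r(1) elim(3)] by blast
      show ?case
      proof (cases "N (w t) = 0")
        case True
        \<comment> \<open>Where \<open>N (w t) = 0\<close> the truncation may discard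
          \<open>r n t\<close> for every \<open>n\<close>, but the replacement 0 then has distance 0
          from \<open>w t\<close>.\<close>
        have "N (w t - s n t) \<le> N (w t - r n t)" for n
          using True N_nonneg[of "w t - r n t"] by (auto simp: s_def fun_diff_def)
        then show ?thesis
          using N_nonneg by (intro tendsto_sandwich[OF _ _ tendsto_const[of 0] elim(2)] always_eventually) auto
      next
        case False
        then have "N (w t) < 2 * N (w t)" using N_nonneg[of "w t"] by simp
        with order_tendstoD(2)[OF N_tendsto[OF rX elim(1,2)]]
        have "\<forall>\<^sub>F n in sequentially. N (r n t) < 2 * N (w t)" by blast
        then have "\<forall>\<^sub>F n in sequentially. N (w t - r n t) = N (w t - s n t)"
          by eventually_elim (use elim(3) in \<open>simp add: s_def A_def space_restrict_space\<close>)
        from tendsto_cong[OF this] elim(2) show ?thesis by blast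
      qed
    qed
  qed
  have W: "(\<lambda>t. 3 * N (w t)) \<in> L2 {0<..<T}"
    by (rule L2_cmult) (use Nm L2_BochnerD(3)[OF w] in \<open>simp add: L2_def\<close>)
  show ?thesis
  proof (rule that[OF s])
    show "(\<lambda>t. N (w t - s n t)) \<in> L2 {0<..<T}" for n
    proof (rule L2I_bound[OF W m])
      show "AE t in ?M. norm (N (w t - s n t)) \<le> norm (3 * N (w t))"
        using D[of n] by eventually_elim simp
    qed
    show "(\<lambda>n. L2_norm {0<..<T} (\<lambda>t. N (w t - s n t))) \<longlonglongrightarrow> 0"
      by (rule L2_dominated_convergence[OF W m D L])
  qed
qed

end

section \<open>Backward averages\<close>

lemma integrable_lebesgue_on_subset:
  fixes f :: "'a::euclidean_space \<Rightarrow> 'b::euclidean_space"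
  assumes "integrable (lebesgue_on S) f" "A \<subseteq> S" "A \<in> sets lebesgue" "S \<in> sets lebesgue"
  shows "integrable (lebesgue_on A) f"
  using set_integrable_subset[of lebesgue S f A] assms by (simp add: set_integrable_eq)

lemma integrable_lebesgue_on:
  fixes f :: "'a::euclidean_space \<Rightarrow> 'b::euclidean_space"
  assumes "integrable lebesgue f" "A \<in> sets lebesgue"
  shows "integrable (lebesgue_on A) f"
  using integrable_mult_indicator[OF assms(2,1)] assms(2) by (subst integrable_restrict_space) auto

lemma continuous_integrable_Ioo:
  fixes f :: "real \<Rightarrow> real"
  assumes "continuous_on UNIV f"
  shows "integrable (lebesgue_on {a<..<b}) f"
proof (rule integrable_lebesgue_on_subset[of "{a..b}"])
  show "integrable (lebesgue_on {a..b}) f"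
    using assms by (intro continuous_imp_integrable_real) (auto intro: continuous_on_subset)
qed auto

lemma LINT_Ioo:
  fixes f :: "real \<Rightarrow> real"
  assumes "integrable (lebesgue_on {a<..<b}) f"
  shows "(LINT t|lebesgue_on {a<..<b}. f t) = integral {a..b} f"
  using lebesgue_integral_eq_integral[OF assms] by (simp add: integral_open_interval_real)

lemma integrable_on_Icc:
  fixes f :: "real \<Rightarrow> real"
  assumes "integrable lebesgue f" shows "f integrable_on {a..b}"
  by (rule integrable_on_lebesgue_on[OF integrable_lebesgue_on[OF assms]]) auto

lemma continuous_integrable_Icc:
  fixes p :: "real \<Rightarrow> real"
  assumes "continuous_on UNIV p" shows "p integrable_on {a..b}"
  using assms by (intro integrable_continuous_real) (auto intro: continuous_on_subset)

text \<open>Everything cancels after the shift except two intervals of length \<open>h\<close> at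
  the ends. Divided by \<open>h\<close>, the remainders are the backward averages of
  \<open>p\<close> at \<open>b\<close> and at 0.\<close>

lemma integral_shift_difference:
  fixes p :: "real \<Rightarrow> real"
  assumes p: "continuous_on UNIV p" and h: "0 < h" "0 < b"
  shows "integral {0..b} (\<lambda>t. p t - p (t - h)) = integral {b-h..b} p - integral {-h..0} p"
proof -
  note i = continuous_integrable_Icc[OF p]
  have "((p \<circ> (+) (- h)) has_integral integral {-h..b-h} p) {0..b}"
    using has_integral_shift_Icc_real[of p "-h" "integral {-h..b-h} p" 0 b] integrable_integral[OF i, of "-h" "b-h"]
    by simp
  then have sh: "((\<lambda>t. p (t - h)) has_integral integral {-h..b-h} p) {0..b}"
    by (simp add: o_def)
  have "integral {0..b} (\<lambda>t. p t - p (t - h)) = integral {0..b} p - integral {-h..b-h} p"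
    by (rule integral_unique[OF has_integral_diff[OF integrable_integral[OF i] sh]])
  also have "\<dots> = integral {b-h..b} p - integral {-h..0} p"
    using Henstock_Kurzweil_Integration.integral_combine[of "-h" 0 b p]
      Henstock_Kurzweil_Integration.integral_combine[of "-h" "b-h" b p] h i by simp
  finally show ?thesis .
qed

lemma integral_Icc_between:
  fixes p :: "real \<Rightarrow> real"
  assumes "p integrable_on {a..b}" "a \<le> b" "\<And>s. s \<in> {a..b} \<Longrightarrow> l \<le> p s" "\<And>s. s \<in> {a..b} \<Longrightarrow> p s \<le> u"
  shows "l * (b - a) \<le> integral {a..b} p" "integral {a..b} p \<le> u * (b - a)"
  using integral_le[OF integrable_const_ivl assms(1), of l] integral_le[OF assms(1) integrable_const_ivl, of u] assms
  by (auto simp: mult.commute)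

lemma backward_average_continuous:
  fixes p :: "real \<Rightarrow> real"
  assumes p: "continuous_on UNIV p" and h: "\<And>n::nat. 0 < h n" "h \<longlonglongrightarrow> 0"
  shows "(\<lambda>n. integral {b - h n..b} p / h n) \<longlonglongrightarrow> p b"
proof (rule LIMSEQ_I)
  fix e :: real assume e: "e > 0"
  have "isCont p b" using p by (simp add: continuous_on_eq_continuous_at)
  then obtain d where d: "d > 0" "\<forall>s. dist s b < d \<longrightarrow> dist (p s) (p b) < e / 2"
    using e unfolding continuous_at_eps_delta by (meson half_gt_zero)
  obtain n0 where n0: "\<forall>n\<ge>n0. norm (h n - 0) < d"
    using LIMSEQ_D[OF h(2) d(1)] by blast
  have "norm (integral {b - h n..b} p / h n - p b) < e" if "n \<ge> n0" for n
  proof -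
    have hd: "0 < h n" "h n < d" using n0 \<open>n \<ge> n0\<close> h(1)[of n] by auto
    have close: "\<bar>p s - p b\<bar> < e / 2" if "s \<in> {b - h n..b}" for s
      using d(2)[rule_format, of s] hd that by (auto simp: dist_real_def)
    have b: "p b - e / 2 \<le> p s" "p s \<le> p b + e / 2" if "s \<in> {b - h n..b}" for s
      using close[OF that] by linarith+
    have "(p b - e / 2) * h n \<le> integral {b - h n..b} p" "integral {b - h n..b} p \<le> (p b + e / 2) * h n"
      using integral_Icc_between[OF continuous_integrable_Icc[OF p], of "b - h n" b "p b - e / 2" "p b + e / 2"] b hd
      by auto
    then have "p b - e / 2 \<le> integral {b - h n..b} p / h n" "integral {b - h n..b} p / h n \<le> p b + e / 2"
      using hd by (auto simp: field_simps)
    then have "\<bar>integral {b - h n..b} p / h n - p b\<bar> \<le> e / 2" by linarith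
    then show ?thesis using e unfolding real_norm_def by linarith
  qed
  then show "\<exists>no. \<forall>n\<ge>no. norm (integral {b - h n..b} p / h n - p b) < e" by blast
qed

lemma primitive_continuous:
  fixes g :: "real \<Rightarrow> real"
  assumes g: "integrable lebesgue g"
  shows "continuous_on UNIV (\<lambda>t. integral {0..t} g)"
proof -
  have c: "continuous_on {0..R} (\<lambda>t. integral {0..t} g)" for R
    by (rule indefinite_integral_continuous_1[OF integrable_on_Icc[OF g]])
  \<comment> \<open>For negative \<open>t\<close> the interval \<open>{0..t}\<close> is empty and
    the integral 0, so \<open>t\<close> may be replaced by \<open>max t 0\<close>. This transports
    continuity from \<open>{0..R}\<close> to the whole line, including the point 0.\<close>
  have "isCont (\<lambda>t. integral {0..max t 0} g) t" for t
  proof -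
    have "continuous_on {..<\<bar>t\<bar> + 1} (\<lambda>t. integral {0..max t 0} g)"
      by (rule continuous_on_compose2[OF c[of "\<bar>t\<bar> + 1"]]) (auto intro!: continuous_intros)
    then show ?thesis by (simp add: continuous_on_eq_continuous_at)
  qed
  moreover have "integral {0..max t 0} g = integral {0..t} g" for t
    by (cases "t < 0") (auto simp: max_def)
  ultimately show ?thesis by (simp add: continuous_at_imp_continuous_on)
qed

text \<open>As \<open>g\<close> vanishes on negative times, the convention that the integral over an
  empty interval is 0 agrees with the true primitive, so \<open>s\<close> may be negative.\<close>

lemma primitive_diff:
  fixes g :: "real \<Rightarrow> real"
  assumes g: "integrable lebesgue g" and z: "\<And>t. t \<le> 0 \<Longrightarrow> g t = 0" and st: "s \<le> t"
  shows "integral {s..t} g = integral {0..t} g - integral {0..s} g"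
proof -
  have neg: "integral {a..b} g = 0" if "b \<le> 0" for a b
  proof -
    have "integral {a..b} g = integral {a..b} (\<lambda>_. 0)"
      by (rule Henstock_Kurzweil_Integration.integral_cong) (use z that in auto)
    then show ?thesis by simp
  qed
  consider "0 \<le> s" | "s < 0" "0 \<le> t" | "t < 0" by linarith
  then show ?thesis
  proof cases
    case 1
    then show ?thesis
      using Henstock_Kurzweil_Integration.integral_combine[OF _ st integrable_on_Icc[OF g], of 0] by simp
  next
    case 2
    then show ?thesis
      using Henstock_Kurzweil_Integration.integral_combine[OF _ _ integrable_on_Icc[OF g], of s 0 t] neg[of 0 s] by simp
  next
    case 3
    then show ?thesis using neg[of t s] st by simp
  qed
qed

text \<open>The differentiation theorem concerns cubes with their lower corner at the point, that is
  forward averages. Applied to the reflected function it gives backward averages, and reflection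
  preserves null sets.\<close>

lemma backward_average_AE:
  fixes g :: "real \<Rightarrow> real"
  assumes g: "integrable lebesgue g" and h: "\<And>n::nat. 0 < h n" "h \<longlonglongrightarrow> 0"
  shows "AE t in lebesgue. (\<lambda>n. integral {t - h n..t} g / h n) \<longlonglongrightarrow> g t"
proof -
  have r: "(\<lambda>x. g (- x)) integrable_on {a..b}" for a b
    using integrable_on_Icc[OF g, of "-b" "-a"] Henstock_Kurzweil_Integration.integrable_reflect_real[of g "-a" "-b"] by simp
  obtain N where N: "negligible N" and lim: "\<And>x e. \<lbrakk>x \<notin> N; 0 < e\<rbrakk> \<Longrightarrow>
      \<exists>d>0. \<forall>h. 0 < h \<and> h < d \<longrightarrow> norm (integral (cbox x (x + h *\<^sub>R One)) (\<lambda>x. g (- x)) /\<^sub>R h ^ DIM(real) - g (- x)) < e"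
    using integrable_ccontinuous_explicit[of "\<lambda>x. g (- x)"] r by (metis box_real(2))
  have "negligible (uminus ` N)"
    by (rule negligible_differentiable_image_negligible[OF _ N]) (auto intro!: derivative_intros simp: differentiable_on_def)
  then have "AE t in lebesgue. t \<notin> uminus ` N"
    by (intro AE_not_in) (simp add: negligible_iff_null_sets)
  then show ?thesis
  proof eventually_elim
    case (elim t)
    then have t: "- t \<notin> N" by (metis image_eqI minus_minus)
    show ?case
    proof (rule LIMSEQ_I)
      fix e :: real assume "e > 0"
      then obtain d where d: "d > 0" "\<forall>h. 0 < h \<and> h < d \<longrightarrow>
          norm (integral (cbox (- t) (- t + h *\<^sub>R One)) (\<lambda>x. g (- x)) /\<^sub>R h ^ DIM(real) - g (- (- t))) < e"
        using lim[OF t] by blast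
      obtain n0 where n0: "\<forall>n\<ge>n0. norm (h n - 0) < d"
        using LIMSEQ_D[OF h(2) d(1)] by blast
      have "norm (integral {t - h n..t} g / h n - g t) < e" if "n \<ge> n0" for n
      proof -
        have "h n < d" using n0 that h(1)[of n] by auto
        with d(2)[rule_format, of "h n"] h(1)[of n]
        have "norm (integral {- t..- t + h n} (\<lambda>x. g (- x)) / h n - g t) < e"
          by (simp add: divide_inverse mult.commute)
        moreover have "integral {- t..- t + h n} (\<lambda>x. g (- x)) = integral {t - h n..t} g"
          using Henstock_Kurzweil_Integration.integral_reflect_real[where a = "t - h n" and b = t and f = g] by simp
        ultimately show ?thesis by simp
      qed
      then show "\<exists>no. \<forall>n\<ge>no. norm (integral {t - h n..t} g / h n - g t) < e" by blast
    qed
  qed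
qed

lemma backward_average_continuous_on:
  fixes g :: "real \<Rightarrow> real"
  assumes g: "integrable lebesgue g" and z: "\<And>t. t \<le> 0 \<Longrightarrow> g t = 0" and h: "h > 0"
  shows "continuous_on UNIV (\<lambda>t. integral {t - h..t} g / h)"
proof -
  have eq: "(\<lambda>t. integral {t - h..t} g / h) = (\<lambda>t. (integral {0..t} g - integral {0..t - h} g) / h)"
    using primitive_diff[OF g z, of "_ - h"] h by (intro ext) simp
  have "continuous_on UNIV (\<lambda>t. integral {0..t - h} g)"
    by (rule continuous_on_compose2[OF primitive_continuous[OF g]]) (auto intro!: continuous_intros)
  with primitive_continuous[OF g] show ?thesis
    unfolding eq using h by (intro continuous_on_divide continuous_on_diff continuous_on_const) auto
qed

text \<open>The average is a difference quotient of the primitive, so its integral telescopes to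
  means of the primitive over two end intervals. The mean next to 0 vanishes; since the primitive is
  nondecreasing, the mean next to \<open>b\<close> is at most its value at \<open>b\<close>.\<close>

lemma backward_average_integral_le:
  fixes g :: "real \<Rightarrow> real"
  assumes g: "integrable lebesgue g" and z: "\<And>t. t \<le> 0 \<Longrightarrow> g t = 0" and h: "h > 0" and b: "b > 0"
    and pos: "\<And>t. g t \<ge> 0"
  shows "(LINT t|lebesgue_on {0<..<b}. integral {t - h..t} g / h) \<le> (LINT t|lebesgue_on {0<..<b}. g t)"
proof -
  let ?q = "\<lambda>t. integral {0..t} g"
  note qc = primitive_continuous[OF g]
  have "(LINT t|lebesgue_on {0<..<b}. integral {t - h..t} g / h) = integral {0..b} (\<lambda>t. integral {t - h..t} g / h)"
    by (rule LINT_Ioo[OF continuous_integrable_Ioo[OF backward_average_continuous_on[OF g z h]]])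
  also have "\<dots> = integral {0..b} (\<lambda>t. ?q t - ?q (t - h)) / h"
    using primitive_diff[OF g z, of "_ - h"] h by simp
  also have "\<dots> = (integral {b - h..b} ?q - integral {- h..0} ?q) / h"
    by (simp add: integral_shift_difference[OF qc h b])
  also have "integral {- h..0} ?q = 0"
  proof -
    have "integral {- h..0} ?q = integral {- h..0} (\<lambda>_. 0)"
    proof (rule Henstock_Kurzweil_Integration.integral_cong)
      show "?q t = 0" if "t \<in> {- h..0}" for t using that by (cases "t = 0") auto
    qed
    then show ?thesis by simp
  qed
  also have "(integral {b - h..b} ?q - 0) / h \<le> ?q b"
  proof -
    have "?q t \<le> ?q b" if "t \<in> {b - h..b}" for t
      by (rule integral_subset_le[OF _ integrable_on_Icc[OF g] integrable_on_Icc[OF g]]) (use that pos in auto)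
    then have "integral {b - h..b} ?q \<le> integral {b - h..b} (\<lambda>_. ?q b)"
      by (intro integral_le[OF continuous_integrable_Icc[OF qc] integrable_const_ivl]) auto
    then show ?thesis using h by (simp add: field_simps)
  qed
  also have "?q b = (LINT t|lebesgue_on {0<..<b}. g t)"
    by (rule LINT_Ioo[OF integrable_lebesgue_on[OF g], symmetric]) simp
  finally show ?thesis .
qed

lemma backward_average_nonneg:
  fixes g :: "real \<Rightarrow> real"
  assumes "integrable lebesgue g" "\<And>t. g t \<ge> 0" "h > 0"
  shows "0 \<le> integral {t - h..t} g / h"
  using Henstock_Kurzweil_Integration.integral_nonneg[OF integrable_on_Icc[OF assms(1)]] assms(2,3) by simp

text \<open>Scheffe's lemma: the averages converge almost everywhere and their integrals do not
  exceed that of \<open>g\<close>, which for nonnegative functions forces convergence in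
  \<open>L1\<close>.\<close>

lemma backward_average_L1_nonneg:
  fixes g :: "real \<Rightarrow> real"
  assumes g: "integrable lebesgue g" and z: "\<And>t. t \<le> 0 \<Longrightarrow> g t = 0" and h: "\<And>n::nat. 0 < h n" "h \<longlonglongrightarrow> 0"
    and b: "b > 0" and pos: "\<And>t. g t \<ge> 0"
  shows "(\<lambda>n. LINT t|lebesgue_on {0<..<b}. \<bar>integral {t - h n..t} g / h n - g t\<bar>) \<longlonglongrightarrow> 0"
proof -
  let ?M = "lebesgue_on {0<..<b}" and ?F = "\<lambda>n t. integral {t - h n..t} g / h n"
  have Fi: "integrable ?M (?F n)" for n
    by (rule continuous_integrable_Ioo[OF backward_average_continuous_on[OF g z h(1)]])
  have gi: "integrable ?M g" by (rule integrable_lebesgue_on[OF g]) simp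
  have ae: "AE t in ?M. (\<lambda>n. ?F n t) \<longlonglongrightarrow> g t"
  proof -
    have "AE t in lebesgue. t \<in> {0<..<b} \<longrightarrow> (\<lambda>n. ?F n t) \<longlonglongrightarrow> g t"
      using backward_average_AE[OF g h] by eventually_elim simp
    then show ?thesis by (subst AE_restrict_space_iff) auto
  qed
  have le: "(\<integral>\<^sup>+ t. norm (?F n t) \<partial>?M) \<le> (\<integral>\<^sup>+ t. norm (g t) \<partial>?M)" for n
  proof -
    have "(\<integral>\<^sup>+ t. norm (?F n t) \<partial>?M) = ennreal (LINT t|?M. ?F n t)"
      unfolding real_norm_def abs_of_nonneg[OF backward_average_nonneg[OF g pos h(1)]]
      by (rule nn_integral_eq_integral[OF Fi]) (simp only: backward_average_nonneg[OF g pos h(1)], simp)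
    also have "\<dots> \<le> ennreal (LINT t|?M. g t)"
      by (rule ennreal_leI[OF backward_average_integral_le[OF g z h(1) b pos]])
    also have "\<dots> = (\<integral>\<^sup>+ t. norm (g t) \<partial>?M)"
      using nn_integral_eq_integral[OF gi] pos by simp
    finally show ?thesis .
  qed
  have "(\<lambda>n. \<integral>\<^sup>+ t. norm (?F n t - g t) \<partial>?M) \<longlonglongrightarrow> 0"
    by (rule Scheffe_lemma2[OF borel_measurable_integrable[OF Fi] gi ae le])
  moreover have "(\<integral>\<^sup>+ t. norm (?F n t - g t) \<partial>?M) = ennreal (LINT t|?M. norm (?F n t - g t))" for n
    by (rule nn_integral_eq_integral) (use Fi gi in auto)
  ultimately have "(\<lambda>n. ennreal (LINT t|?M. norm (?F n t - g t))) \<longlonglongrightarrow> ennreal 0" by simp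
  then show ?thesis by (subst (asm) tendsto_ennreal_iff) auto
qed

text \<open>\<open>A\<close> will be a level set of a simple test function, on which that test
  function does not depend on time. The sign of \<open>g\<close> being arbitrary, the
  \<open>L1\<close> convergence is applied to its positive and negative parts.\<close>

lemma backward_average_indicator:
  fixes g :: "real \<Rightarrow> real"
  assumes g: "integrable lebesgue g" and z: "\<And>t. t \<le> 0 \<Longrightarrow> g t = 0" and h: "\<And>n::nat. 0 < h n" "h \<longlonglongrightarrow> 0"
    and b: "b > 0" and A: "A \<in> sets lebesgue"
  shows "(\<lambda>n. LINT t|lebesgue_on {0<..<b}. indicat_real A t * (integral {t - h n..t} g / h n))
    \<longlonglongrightarrow> (LINT t|lebesgue_on {0<..<b}. indicat_real A t * g t)"
    and "integrable (lebesgue_on {0<..<b}) (\<lambda>t. indicat_real A t * (integral {t - h n..t} g / h n))"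
    and "integrable (lebesgue_on {0<..<b}) (\<lambda>t. indicat_real A t * g t)"
proof -
  let ?M = "lebesgue_on {0<..<b}" and ?F = "\<lambda>g n t. integral {t - h n..t} g / h n"
  have ind: "indicat_real A \<in> borel_measurable ?M"
    using A by (intro measurable_restrict_space1 borel_measurable_indicator)
  have Ai: "integrable ?M (\<lambda>t. indicat_real A t * f t)" if "integrable ?M f" for f :: "real \<Rightarrow> real"
    by (rule Bochner_Integration.integrable_bound[OF that borel_measurable_times[OF ind borel_measurable_integrable[OF that]]])
      (auto simp: indicator_def)
  have Fi: "integrable ?M (?F g n)" if "integrable lebesgue g" "\<And>t. t \<le> 0 \<Longrightarrow> g t = 0" for g n
    by (rule continuous_integrable_Ioo[OF backward_average_continuous_on[OF that h(1)]])
  have gi: "integrable ?M g" if "integrable lebesgue g" for g :: "real \<Rightarrow> real"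
    by (rule integrable_lebesgue_on[OF that]) simp
  show "integrable ?M (\<lambda>t. indicat_real A t * ?F g n t)" for n by (rule Ai[OF Fi[OF g z]])
  show "integrable ?M (\<lambda>t. indicat_real A t * g t)" by (rule Ai[OF gi[OF g]])
  have pos: "(\<lambda>n. LINT t|?M. indicat_real A t * ?F g n t) \<longlonglongrightarrow> (LINT t|?M. indicat_real A t * g t)"
    if g: "integrable lebesgue g" and z: "\<And>t. t \<le> 0 \<Longrightarrow> g t = 0" and p: "\<And>t. g t \<ge> 0" for g
  proof -
    have "\<forall>n. norm ((LINT t|?M. indicat_real A t * ?F g n t) - (LINT t|?M. indicat_real A t * g t))
        \<le> (LINT t|?M. \<bar>?F g n t - g t\<bar>)"
    proof
      fix n
      have "(LINT t|?M. indicat_real A t * ?F g n t) - (LINT t|?M. indicat_real A t * g t)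
          = (LINT t|?M. indicat_real A t * ?F g n t - indicat_real A t * g t)"
        by (rule Bochner_Integration.integral_diff[symmetric, OF Ai[OF Fi[OF g z]] Ai[OF gi[OF g]]])
      also have "norm \<dots> \<le> (LINT t|?M. \<bar>?F g n t - g t\<bar>)"
      proof (rule order_trans[OF Bochner_Integration.integral_norm_bound integral_mono])
        show "integrable ?M (\<lambda>t. norm (indicat_real A t * ?F g n t - indicat_real A t * g t))"
          by (rule integrable_norm[OF Bochner_Integration.integrable_diff[OF Ai[OF Fi[OF g z]] Ai[OF gi[OF g]]]])
        show "integrable ?M (\<lambda>t. \<bar>?F g n t - g t\<bar>)"
          by (rule integrable_abs[OF Bochner_Integration.integrable_diff[OF Fi[OF g z] gi[OF g]]])
      qed (auto simp: indicator_def)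
      finally show "norm ((LINT t|?M. indicat_real A t * ?F g n t) - (LINT t|?M. indicat_real A t * g t))
        \<le> (LINT t|?M. \<bar>?F g n t - g t\<bar>)" .
    qed
    from Lim_null_comparison[OF always_eventually[OF this] backward_average_L1_nonneg[OF g z h b p]]
    show ?thesis by (simp add: LIM_zero_iff)
  qed
  define gp where "gp t = max (g t) 0" for t
  define gm where "gm t = max (- g t) 0" for t
  have gp: "integrable lebesgue gp" "\<And>t. t \<le> 0 \<Longrightarrow> gp t = 0" "\<And>t. gp t \<ge> 0"
    unfolding gp_def[abs_def] using g z by (auto intro!: integrable_max)
  have gm: "integrable lebesgue gm" "\<And>t. t \<le> 0 \<Longrightarrow> gm t = 0" "\<And>t. gm t \<ge> 0"
    unfolding gm_def[abs_def] using g z by (auto intro!: integrable_max)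
  have eq: "g t = gp t - gm t" for t by (simp add: gp_def gm_def max_def)
  have Feq: "?F g n t = ?F gp n t - ?F gm n t" for n t
  proof -
    have "integral {t - h n..t} g = integral {t - h n..t} (\<lambda>t. gp t - gm t)" by (simp only: eq[symmetric])
    also have "\<dots> = integral {t - h n..t} gp - integral {t - h n..t} gm"
      by (rule Henstock_Kurzweil_Integration.integral_diff[OF integrable_on_Icc[OF gp(1)] integrable_on_Icc[OF gm(1)]])
    finally show ?thesis by (simp add: diff_divide_distrib)
  qed
  have "(LINT t|?M. indicat_real A t * ?F g n t)
      = (LINT t|?M. indicat_real A t * ?F gp n t) - (LINT t|?M. indicat_real A t * ?F gm n t)" for n
    unfolding Feq right_diff_distrib
    by (rule Bochner_Integration.integral_diff[OF Ai[OF Fi[OF gp(1,2)]] Ai[OF Fi[OF gm(1,2)]]])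
  moreover have "(LINT t|?M. indicat_real A t * g t)
      = (LINT t|?M. indicat_real A t * gp t) - (LINT t|?M. indicat_real A t * gm t)"
    unfolding eq right_diff_distrib
    by (rule Bochner_Integration.integral_diff[OF Ai[OF gi[OF gp(1)]] Ai[OF gi[OF gm(1)]]])
  ultimately show "(\<lambda>n. LINT t|?M. indicat_real A t * ?F g n t) \<longlonglongrightarrow> (LINT t|?M. indicat_real A t * g t)"
    using tendsto_diff[OF pos[OF gp] pos[OF gm]] by simp
qed

text \<open>By Cauchy-Schwarz on \<open>{t - h..t}\<close> the square of an average is at most the
  average of the square, and averaging a nonnegative function does not increase its integral over
  time.\<close>

lemma backward_average_L2:
  fixes W :: "real \<Rightarrow> real"
  assumes W: "integrable lebesgue W" "integrable lebesgue (\<lambda>t. (W t)\<^sup>2)" and z: "\<And>t. t \<le> 0 \<Longrightarrow> W t = 0"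
    and h: "h > 0" and b: "b > 0"
  shows "(\<lambda>t. integral {t - h..t} W / h) \<in> L2 {0<..<b}"
    "L2_norm {0<..<b} (\<lambda>t. integral {t - h..t} W / h) \<le> L2_norm {0<..<b} W"
proof -
  let ?M = "lebesgue_on {0<..<b}" and ?F = "\<lambda>t. integral {t - h..t} W / h"
  let ?G = "\<lambda>t. integral {t - h..t} (\<lambda>t. (W t)\<^sup>2) / h"
  have z2: "(W t)\<^sup>2 = 0" if "t \<le> 0" for t using z[OF that] by simp
  have sq: "(?F t)\<^sup>2 \<le> ?G t" for t
  proof -
    let ?S = "{t - h..t}"
    have m: "W \<in> L2 ?S"
      using integrable_lebesgue_on[OF W(1), of ?S] integrable_lebesgue_on[OF W(2), of ?S]
      by (simp add: L2_def borel_measurable_integrable)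
    have one: "(\<lambda>_. 1) \<in> L2 ?S" by (rule L2_const) simp
    have i1: "L2_inner ?S W (\<lambda>_. 1) = integral ?S W"
      using lebesgue_integral_eq_integral[OF integrable_lebesgue_on[OF W(1), of ?S]] by (simp add: L2_inner_def)
    have i2: "(L2_norm ?S W)\<^sup>2 = integral ?S (\<lambda>t. (W t)\<^sup>2)"
      using lebesgue_integral_eq_integral[OF integrable_lebesgue_on[OF W(2), of ?S]] by (simp add: L2_norm_sq)
    have i3: "(L2_norm ?S (\<lambda>_. 1::real))\<^sup>2 = h"
      unfolding L2_norm_sq norm_one one_power2
      by (subst lebesgue_integral_eq_integral[OF L2_integrable[OF _ one]]) (use h in auto)
    have "\<bar>integral ?S W\<bar>\<^sup>2 \<le> (L2_norm ?S W * L2_norm ?S (\<lambda>_. 1::real))\<^sup>2"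
      using L2_Cauchy_Schwarz[OF m one] unfolding i1 by (intro power_mono) auto
    then have "(integral ?S W)\<^sup>2 \<le> integral ?S (\<lambda>t. (W t)\<^sup>2) * h"
      unfolding power_mult_distrib i2 i3 by simp
    then show ?thesis using h by (simp add: power_divide power2_eq_square field_simps)
  qed
  note Fc = backward_average_continuous_on[OF W(1) z h]
  have F2: "integrable ?M (\<lambda>t. (?F t)\<^sup>2)"
    by (rule continuous_integrable_Ioo) (intro continuous_intros Fc)
  then show "?F \<in> L2 {0<..<b}"
    using borel_measurable_integrable[OF continuous_integrable_Ioo[OF Fc]] by (simp add: L2_def)
  have "(LINT t|?M. (?F t)\<^sup>2) \<le> (LINT t|?M. ?G t)"
    by (rule integral_mono[OF F2 continuous_integrable_Ioo[OF backward_average_continuous_on[OF W(2) z2 h]] sq])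
  also have "\<dots> \<le> (LINT t|?M. (W t)\<^sup>2)"
    by (rule backward_average_integral_le[OF W(2) z2 h b]) simp_all
  finally show "L2_norm {0<..<b} ?F \<le> L2_norm {0<..<b} W"
    unfolding L2_norm_def real_sqrt_le_iff real_norm_def power2_abs .
qed

section \<open>Energy inequality\<close>

lemma L2_subset:
  fixes f :: "'a::euclidean_space \<Rightarrow> 'b::euclidean_space"
  assumes "f \<in> L2 S" "A \<subseteq> S" "A \<in> sets lebesgue" "S \<in> sets lebesgue"
  shows "f \<in> L2 A" "L2_norm A f \<le> L2_norm S f"
proof -
  have "f \<in> borel_measurable (lebesgue_on A)"
    using measurable_restrict_mono[OF L2_measurable[OF assms(1)] assms(2)] .
  then show "f \<in> L2 A"
    using integrable_lebesgue_on_subset[OF L2_integrable_sq[OF assms(1)] assms(2-4)] by (simp add: L2_def)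
  have "(LINT x|lebesgue_on A. (norm (f x))\<^sup>2) \<le> (LINT x|lebesgue_on S. (norm (f x))\<^sup>2)"
    by (rule integral_mono_lebesgue_on_AE[OF L2_integrable_sq[OF assms(1)] _ _ assms(2-4)]) auto
  then show "L2_norm A f \<le> L2_norm S f" by (simp add: L2_norm_def)
qed

text \<open>The kernel is one-sided, supported in \<open>{a..a + h n}\<close>. Its primitive is a
  rescaled \<open>R\<close>, so its mass in \<open>{0..T}\<close> is exactly 1 once
  \<open>h n < T - a\<close>, and on its support \<open>p\<close> is close to
  \<open>p a\<close>.\<close>

lemma mollifier_tendsto:
  fixes p \<rho> R :: "real \<Rightarrow> real"
  assumes p: "continuous_on UNIV p" and a: "0 < a" "a < T"
    and R: "\<And>x. (R has_real_derivative \<rho> x) (at x)" "\<And>x. x \<le> 0 \<Longrightarrow> R x = 0" "\<And>x. x \<ge> 1 \<Longrightarrow> R x = 1"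
    and \<rho>: "\<And>x. \<rho> x \<ge> 0" "\<And>x. x \<le> 0 \<Longrightarrow> \<rho> x = 0" "\<And>x. x \<ge> 1 \<Longrightarrow> \<rho> x = 0" "continuous_on UNIV \<rho>"
    and h: "\<And>n::nat. 0 < h n" "h \<longlonglongrightarrow> 0"
  shows "(\<lambda>n. LINT t|lebesgue_on {0<..<T}. \<rho> ((t - a) / h n) / h n * p t) \<longlonglongrightarrow> p a"
proof (rule LIMSEQ_I)
  fix e :: real assume e: "e > 0"
  have "isCont p a" using p by (simp add: continuous_on_eq_continuous_at)
  then obtain d where d: "d > 0" "\<forall>s. dist s a < d \<longrightarrow> dist (p s) (p a) < e / 2"
    using e unfolding continuous_at_eps_delta by (meson half_gt_zero)
  have "min d (T - a) > 0" using d(1) a by simp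
  then obtain n0 where n0: "\<forall>n\<ge>n0. norm (h n - 0) < min d (T - a)"
    using LIMSEQ_D[OF h(2)] by blast
  have "norm ((LINT t|lebesgue_on {0<..<T}. \<rho> ((t - a) / h n) / h n * p t) - p a) < e" if "n \<ge> n0" for n
  proof -
    have hn: "0 < h n" "h n < d" "h n < T - a" using n0 \<open>n \<ge> n0\<close> h(1)[of n] by auto
    let ?r = "\<lambda>t. \<rho> ((t - a) / h n) / h n"
    have rc: "continuous_on UNIV ?r"
      using hn by (intro continuous_on_divide continuous_on_const continuous_on_compose2[OF \<rho>(4)])
        (auto intro!: continuous_intros)
    have "((\<lambda>t. R ((t - a) / h n)) has_real_derivative ?r t) (at t within {0..T})" for t
    proof -
      have "((\<lambda>t. (t - a) / h n) has_real_derivative 1 / h n) (at t)"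
        using hn by (auto intro!: derivative_eq_intros)
      from DERIV_chain2[OF R(1) this] show ?thesis by (simp add: has_field_derivative_at_within)
    qed
    then have "(?r has_integral R ((T - a) / h n) - R ((0 - a) / h n)) {0..T}"
      using a by (intro fundamental_theorem_of_calculus)
        (simp_all add: has_real_derivative_iff_has_vector_derivative[symmetric])
    moreover have "R ((T - a) / h n) = 1" "R ((0 - a) / h n) = 0"
      using hn a by (auto intro!: R simp: field_simps)
    ultimately have r1: "(?r has_integral 1) {0..T}" by simp
    have "(LINT t|lebesgue_on {0<..<T}. ?r t * p t) = integral {0..T} (\<lambda>t. ?r t * p t)"
      by (intro LINT_Ioo continuous_integrable_Ioo continuous_on_mult rc p)
    also have "\<dots> - p a = integral {0..T} (\<lambda>t. ?r t * (p t - p a))"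
    proof -
      have "((\<lambda>t. ?r t * p t - ?r t * p a) has_integral (integral {0..T} (\<lambda>t. ?r t * p t) - 1 * p a)) {0..T}"
        by (intro has_integral_diff has_integral_mult_left r1 integrable_integral continuous_integrable_Icc
            continuous_on_mult rc p)
      then show ?thesis by (simp add: right_diff_distrib integral_unique)
    qed
    also have "norm \<dots> \<le> integral {0..T} (\<lambda>t. ?r t * (e / 2))"
    proof (rule integral_norm_bound_integral)
      show "(\<lambda>t. ?r t * (p t - p a)) integrable_on {0..T}" "(\<lambda>t. ?r t * (e / 2)) integrable_on {0..T}"
        by (intro continuous_integrable_Icc continuous_on_mult continuous_on_diff continuous_on_const rc p)+
      fix t assume "t \<in> {0..T}"
      show "norm (?r t * (p t - p a)) \<le> ?r t * (e / 2)"
      proof (cases "0 < (t - a) / h n \<and> (t - a) / h n < 1")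
        case True
        then have "dist t a < d" using hn by (auto simp: dist_real_def field_simps zero_less_divide_iff)
        then have "\<bar>p t - p a\<bar> \<le> e / 2" using d(2) by (auto simp: dist_real_def intro: less_imp_le)
        moreover have "?r t \<ge> 0" using \<rho>(1) hn by simp
        ultimately show ?thesis unfolding real_norm_def abs_mult by (intro mult_mono) auto
      next
        case False
        then have "\<rho> ((t - a) / h n) = 0" using \<rho>(2,3) by (meson not_le)
        then show ?thesis by simp
      qed
    qed
    also have "\<dots> = 1 * (e / 2)" by (rule integral_unique[OF has_integral_mult_left[OF r1]])
    finally show ?thesis using e by simp
  qed
  then show "\<exists>no. \<forall>n\<ge>no. norm ((LINT t|lebesgue_on {0<..<T}. \<rho> ((t - a) / h n) / h n * p t) - p a) < e"
    by blast
qed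

text \<open>\<open>U\<close> is the continuous representative of \<open>u\<close>, and \<open>w\<close> its time derivative with values in the dual of
  the space \<open>X\<close>, with dual norm at most \<open>W\<close>. Below, \<open>X\<close> is \<open>H10 \<Omega>\<close> or \<open>L2 \<Omega>\<close>.\<close>

locale evolution = bounded_open \<Omega> + seminormed X N
  for \<Omega> :: "'a::euclidean_space set" and X :: "('a \<Rightarrow> real) set" and N :: "('a \<Rightarrow> real) \<Rightarrow> real" +
  fixes T :: real and u U :: "real \<Rightarrow> 'a \<Rightarrow> real" and w :: "real \<Rightarrow> ('a \<Rightarrow> real) \<Rightarrow> real" and W :: "real \<Rightarrow> real"
  assumes T: "T > 0" and X_L2: "X \<subseteq> L2 \<Omega>"
    and W_L2: "W \<in> L2 {0<..<T}"
    and w_meas: "\<And>\<psi>. \<psi> \<in> X \<Longrightarrow> (\<lambda>t. w t \<psi>) \<in> borel_measurable (lebesgue_on {0<..<T})"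
    and w_bound: "AE t in lebesgue_on {0<..<T}. \<forall>\<psi>\<in>X. \<bar>w t \<psi>\<bar> \<le> W t * N \<psi>"
    and w_diff: "AE t in lebesgue_on {0<..<T}. \<forall>f\<in>X. \<forall>g\<in>X. w t (f - g) = w t f - w t g"
    and weak: "\<And>\<psi> \<eta>. \<psi> \<in> X \<Longrightarrow> \<eta> \<in> test_functions {0<..<T} \<Longrightarrow>
      (LINT t|lebesgue_on {0<..<T}. deriv \<eta> t * L2_inner \<Omega> (u t) \<psi>) = - (LINT t|lebesgue_on {0<..<T}. \<eta> t * w t \<psi>)"
    and u_L2: "AE t in lebesgue_on {0<..<T}. u t \<in> L2 \<Omega>"
    and U_L2: "\<And>t. t \<in> {0..T} \<Longrightarrow> U t \<in> L2 \<Omega>"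
    and U_cont: "\<And>t. t \<in> {0..T} \<Longrightarrow> ((\<lambda>s. L2_norm \<Omega> (U s - U t)) \<longlongrightarrow> 0) (at t within {0..T})"
    and U_eq: "AE t in lebesgue_on {0<..<T}. AE x in lebesgue_on \<Omega>. U t x = u t x"
begin

abbreviation M where "M \<equiv> lebesgue_on {0<..<T}"

lemma AE_M: "AE t in M. t \<in> {0<..<T}"
  by (rule AE_I2) (simp add: space_restrict_space)

lemma lmeas_T: "{0<..<T} \<in> lmeasurable" by simp

text \<open>Extension by 0 outside the time interval gives averages over \<open>{t - h..t}\<close> a
  meaning for \<open>t < h\<close> as well, and matches the vanishing condition under which
  primitives are handled.\<close>

definition w0 where "w0 \<psi> t = (if t \<in> {0<..<T} then w t \<psi> else 0)"

definition W0 where "W0 t = (if t \<in> {0<..<T} then W t else 0)"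

lemma w_integrable: "\<psi> \<in> X \<Longrightarrow> integrable M (\<lambda>t. w t \<psi>)"
proof (rule Bochner_Integration.integrable_bound[OF _ w_meas])
  assume \<psi>: "\<psi> \<in> X"
  show "integrable M (\<lambda>t. W t * N \<psi>)"
    by (intro integrable_mult_left L2_integrable[OF lmeas_T W_L2])
  show "AE t in M. norm (w t \<psi>) \<le> norm (W t * N \<psi>)"
    using w_bound
  proof eventually_elim
    case (elim t)
    then have "\<bar>w t \<psi>\<bar> \<le> W t * N \<psi>" using \<psi> by blast
    then show ?case by simp
  qed
qed

lemma w0_integrable: "\<psi> \<in> X \<Longrightarrow> integrable lebesgue (w0 \<psi>)"
  unfolding w0_def[abs_def]
  using Lebesgue_Measure.integrable_restrict_UNIV[of "{0<..<T}" "\<lambda>t. w t \<psi>"] w_integrable by simp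

lemma w0_zero: "t \<le> 0 \<Longrightarrow> w0 \<psi> t = 0"
  by (simp add: w0_def)

lemma W0_integrable: "integrable lebesgue W0" "integrable lebesgue (\<lambda>t. (W0 t)\<^sup>2)"
proof -
  show "integrable lebesgue W0"
    unfolding W0_def[abs_def]
    using Lebesgue_Measure.integrable_restrict_UNIV[of "{0<..<T}" W] L2_integrable[OF lmeas_T W_L2] by simp
  have "(\<lambda>t. (W0 t)\<^sup>2) = (\<lambda>t. if t \<in> {0<..<T} then (W t)\<^sup>2 else 0)"
    by (auto simp: W0_def)
  then show "integrable lebesgue (\<lambda>t. (W0 t)\<^sup>2)"
    using Lebesgue_Measure.integrable_restrict_UNIV[of "{0<..<T}" "\<lambda>t. (W t)\<^sup>2"] L2_integrable_sq[OF W_L2] by simp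
qed

lemma W0_zero: "t \<le> 0 \<Longrightarrow> W0 t = 0"
  by (simp add: W0_def)

text \<open>The exceptional times are the same for all \<open>f\<close> and \<open>g\<close>. The
  uniformity matters because the lemma is later applied with \<open>f\<close> equal to
  \<open>\<beta> (u t)\<close> while the integration runs over other times.\<close>

lemma w0_AE:
  "AE t in lebesgue. \<forall>f\<in>X. \<forall>g\<in>X. w0 f t \<le> w0 g t + N (f - g) * W0 t"
proof -
  have "AE t in M. \<forall>f\<in>X. \<forall>g\<in>X. w0 f t \<le> w0 g t + N (f - g) * W0 t"
    using w_bound w_diff AE_M
  proof eventually_elim
    case (elim t)
    show ?case
    proof (intro ballI)
      fix f g assume fg: "f \<in> X" "g \<in> X"
      have "w t f - w t g \<le> W t * N (f - g)"
        using elim(1,2) fg X_diff[OF fg] by (metis abs_le_D1)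
      then show "w0 f t \<le> w0 g t + N (f - g) * W0 t" using elim(3) by (simp add: w0_def W0_def mult.commute)
    qed
  qed
  then have "AE t in lebesgue. t \<in> {0<..<T} \<longrightarrow> (\<forall>f\<in>X. \<forall>g\<in>X. w0 f t \<le> w0 g t + N (f - g) * W0 t)"
    by (subst (asm) AE_restrict_space_iff) auto
  then show ?thesis by eventually_elim (auto simp: w0_def W0_def)
qed

section \<open>Integrated form of the time derivative\<close>

lemma U_diff_L2: "s \<in> {0..T} \<Longrightarrow> t \<in> {0..T} \<Longrightarrow> U s - U t \<in> L2 \<Omega>"
  using L2_diff[OF U_L2 U_L2] by (simp add: fun_diff_def)

lemma pairing_continuous:
  assumes "\<psi> \<in> L2 \<Omega>" shows "continuous_on {0..T} (\<lambda>t. L2_inner \<Omega> (U t) \<psi>)"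
  unfolding continuous_on_def
proof (intro ballI)
  fix t assume t: "t \<in> {0..T}"
  have "((\<lambda>s. L2_inner \<Omega> (U s) \<psi> - L2_inner \<Omega> (U t) \<psi>) \<longlongrightarrow> 0) (at t within {0..T})"
  proof (rule Lim_null_comparison)
    show "((\<lambda>s. L2_norm \<Omega> (U s - U t) * L2_norm \<Omega> \<psi>) \<longlongrightarrow> 0) (at t within {0..T})"
      using U_cont[OF t] by (rule tendsto_mult_left_zero)
    show "\<forall>\<^sub>F s in at t within {0..T}. norm (L2_inner \<Omega> (U s) \<psi> - L2_inner \<Omega> (U t) \<psi>) \<le> L2_norm \<Omega> (U s - U t) * L2_norm \<Omega> \<psi>"
      unfolding eventually_at_filter
    proof (rule always_eventually, intro allI impI)
      fix s assume s: "s \<in> {0..T}"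
      show "norm (L2_inner \<Omega> (U s) \<psi> - L2_inner \<Omega> (U t) \<psi>) \<le> L2_norm \<Omega> (U s - U t) * L2_norm \<Omega> \<psi>"
        using L2_Cauchy_Schwarz[OF U_diff_L2[OF s t] assms] L2_inner_diff_left[OF U_L2[OF s] U_L2[OF t] assms]
        by (simp add: fun_diff_def)
    qed
  qed
  then show "((\<lambda>s. L2_inner \<Omega> (U s) \<psi>) \<longlongrightarrow> L2_inner \<Omega> (U t) \<psi>) (at t within {0..T})"
    by (simp add: LIM_zero_iff)
qed

lemma weak_U:
  assumes \<psi>: "\<psi> \<in> X" and \<eta>: "\<eta> \<in> test_functions {0<..<T}"
  shows "(LINT t|M. deriv \<eta> t * L2_inner \<Omega> (U t) \<psi>) = - (LINT t|M. \<eta> t * w t \<psi>)"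
proof -
  have \<psi>2: "\<psi> \<in> L2 \<Omega>" using \<psi> X_L2 by blast
  have eq: "AE t in M. L2_inner \<Omega> (U t) \<psi> = L2_inner \<Omega> (u t) \<psi>"
    using U_eq u_L2 AE_M
  proof eventually_elim
    case (elim t)
    show ?case unfolding L2_inner_def
    proof (rule integral_cong_AE)
      show "AE x in lebesgue_on \<Omega>. U t x \<bullet> \<psi> x = u t x \<bullet> \<psi> x"
        using elim(1) by eventually_elim simp
    qed (use elim in \<open>intro borel_measurable_inner L2_measurable U_L2 \<psi>2; simp\<close>)+
  qed
  have mU: "(\<lambda>t. L2_inner \<Omega> (U t) \<psi>) \<in> borel_measurable M"
    by (rule continuous_imp_measurable_on_sets_lebesgue[OF continuous_on_subset[OF pairing_continuous[OF \<psi>2]]]) auto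
  \<comment> \<open>The locale assumes no measurability of \<open>u\<close> in time; it comes from
    the continuous pairing with \<open>U\<close> by completeness.\<close>
  have mu: "(\<lambda>t. L2_inner \<Omega> (u t) \<psi>) \<in> borel_measurable M"
    by (rule borel_measurable_lebesgue_on_AE_limit[where s = "\<lambda>n t. L2_inner \<Omega> (U t) \<psi>", OF _ mU])
      (use eq in \<open>simp, eventually_elim, simp\<close>)
  have "deriv \<eta> = partial_deriv 1 \<eta>"
  proof
    fix t
    have "\<eta> differentiable (at t)" using smoothD(1)[OF test_functionsD[OF \<eta>]] .
    then have "(\<eta> has_real_derivative deriv \<eta> t) (at t)"
      by (metis DERIV_imp_deriv real_differentiable_def)
    then show "deriv \<eta> t = partial_deriv 1 \<eta> t" by (simp add: partial_deriv_real)
  qed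
  then have md: "deriv \<eta> \<in> borel_measurable M"
    using smoothD(3)[OF smoothD(2)[OF test_functionsD[OF \<eta>], of 1]]
    by (intro continuous_imp_measurable_on_sets_lebesgue) (auto intro: continuous_on_subset)
  have "(LINT t|M. deriv \<eta> t * L2_inner \<Omega> (U t) \<psi>) = (LINT t|M. deriv \<eta> t * L2_inner \<Omega> (u t) \<psi>)"
  proof (rule integral_cong_AE)
    show "AE t in M. deriv \<eta> t * L2_inner \<Omega> (U t) \<psi> = deriv \<eta> t * L2_inner \<Omega> (u t) \<psi>"
      using eq by eventually_elim simp
  qed (intro borel_measurable_times md mU mu)+
  then show ?thesis using weak[OF \<psi> \<eta>] by simp
qed

text \<open>The test functions in time approximate the indicator of \<open>{s<..t}\<close>; their
  derivatives concentrate at \<open>s\<close> and, with the opposite sign, at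
  \<open>t\<close>.\<close>

lemma pairing_increment_interior:
  assumes \<psi>: "\<psi> \<in> X" and st: "0 < s" "s < t" "t < T"
  shows "L2_inner \<Omega> (U t) \<psi> - L2_inner \<Omega> (U s) \<psi> = integral {s..t} (w0 \<psi>)"
proof -
  have \<psi>2: "\<psi> \<in> L2 \<Omega>" using \<psi> X_L2 by blast
  \<comment> \<open>Clamping the time argument extends the pairing continuously to the whole line,
    as the mollification requires.\<close>
  define p where "p \<tau> = L2_inner \<Omega> (U (max 0 (min T \<tau>))) \<psi>" for \<tau>
  have p: "continuous_on UNIV p"
    unfolding p_def using T
    by (intro continuous_on_compose2[OF pairing_continuous[OF \<psi>2]]) (auto intro!: continuous_intros)
  have p_eq: "p \<tau> = L2_inner \<Omega> (U \<tau>) \<psi>" if "\<tau> \<in> {0..T}" for \<tau>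
    using that by (simp add: p_def)
  obtain \<rho> R :: "real \<Rightarrow> real" where S: "smooth R" "\<forall>x. (R has_real_derivative \<rho> x) (at x)"
    "\<forall>x. \<rho> x \<ge> 0" "\<forall>x\<le>0. \<rho> x = 0" "\<forall>x\<ge>1. \<rho> x = 0" "continuous_on UNIV \<rho>"
    "\<forall>x\<le>0. R x = 0" "\<forall>x\<ge>1. R x = 1" "\<forall>x. 0 \<le> R x" "\<forall>x. R x \<le> 1"
    using smooth_step by blast
  note R = S[rule_format]
  \<comment> \<open>With \<open>n + 2\<close> in the denominator already \<open>h 0\<close> is half
    of \<open>T - t\<close>. The second transition ends at \<open>t + h n\<close>, so the support is
    a compact part of the open interval for every \<open>n\<close>.\<close>
  define h where "h n = (T - t) / real (n + 2)" for n
  have h: "0 < h n" "h n < T - t" for n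
  proof -
    show "0 < h n" using st by (simp add: h_def)
    have "h n \<le> (T - t) / 2" unfolding h_def using st by (intro divide_left_mono) auto
    then show "h n < T - t" using st by simp
  qed
  have h0: "h \<longlonglongrightarrow> 0"
    unfolding h_def by (rule LIMSEQ_ignore_initial_segment[OF lim_const_over_n, of "T - t" 2])
  define \<eta> where "\<eta> n \<tau> = R ((\<tau> - s) / h n) - R ((\<tau> - t) / h n)" for n \<tau>
  have d: "((\<lambda>\<tau>. R ((\<tau> - a) / h n)) has_real_derivative \<rho> ((\<tau> - a) / h n) / h n) (at \<tau>)" for a n \<tau>
  proof -
    have "((\<lambda>\<tau>. (\<tau> - a) / h n) has_real_derivative 1 / h n) (at \<tau>)"
      using h(1)[of n] by (auto intro!: derivative_eq_intros)
    from DERIV_chain2[OF R(2) this] show ?thesis by simp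
  qed
  have deta: "deriv (\<eta> n) \<tau> = \<rho> ((\<tau> - s) / h n) / h n - \<rho> ((\<tau> - t) / h n) / h n" for n \<tau>
    unfolding \<eta>_def by (rule DERIV_imp_deriv[OF DERIV_diff[OF d d]])
  have \<eta>: "\<eta> n \<in> test_functions {0<..<T}" for n
  proof (rule test_functionsI[of _ "{s..t + h n}"])
    have sm: "Ck k (\<lambda>\<tau>. R ((\<tau> - a) / h n))" for k a
    proof -
      have "Ck k (\<lambda>\<tau>. R ((1 / h n) * \<tau> + (- a / h n)))"
        by (rule Ck_compose[OF _ Ck_affine_real]) (rule R(1))
      then show ?thesis by (simp add: diff_divide_distrib)
    qed
    show "smooth (\<eta> n)"
    proof
      fix k
      have "Ck k (\<lambda>\<tau>. R ((\<tau> - s) / h n) + (- 1) * R ((\<tau> - t) / h n))"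
        by (intro Ck_add Ck_mult Ck_const sm)
      then show "Ck k (\<eta> n)" unfolding \<eta>_def by simp
    qed
    show "{s..t + h n} \<subseteq> {0<..<T}" using st h[of n] by auto
    show "\<eta> n \<tau> = 0" if "\<tau> \<notin> {s..t + h n}" for \<tau>
    proof (cases "\<tau> < s")
      case True
      then have "(\<tau> - s) / h n \<le> 0" "(\<tau> - t) / h n \<le> 0"
        using h(1)[of n] st by (auto simp: divide_le_0_iff)
      then show ?thesis by (simp add: \<eta>_def R(7))
    next
      case False
      then have "(\<tau> - s) / h n \<ge> 1" "(\<tau> - t) / h n \<ge> 1"
        using that h(1)[of n] st by auto
      then show ?thesis by (simp add: \<eta>_def R(8))
    qed
  qed simp
  have lhs: "(\<lambda>n. LINT \<tau>|M. deriv (\<eta> n) \<tau> * L2_inner \<Omega> (U \<tau>) \<psi>) \<longlonglongrightarrow> p s - p t"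
  proof -
    have "(LINT \<tau>|M. deriv (\<eta> n) \<tau> * L2_inner \<Omega> (U \<tau>) \<psi>)
      = (LINT \<tau>|M. \<rho> ((\<tau> - s) / h n) / h n * p \<tau>) - (LINT \<tau>|M. \<rho> ((\<tau> - t) / h n) / h n * p \<tau>)" for n
    proof -
      have i: "integrable M (\<lambda>\<tau>. \<rho> ((\<tau> - a) / h n) / h n * p \<tau>)" for a
        using h(1)[of n] by (intro continuous_integrable_Ioo continuous_on_mult p continuous_on_divide
            continuous_on_const continuous_on_compose2[OF R(6)]) (auto intro!: continuous_intros)
      have "(LINT \<tau>|M. deriv (\<eta> n) \<tau> * L2_inner \<Omega> (U \<tau>) \<psi>)
        = (LINT \<tau>|M. \<rho> ((\<tau> - s) / h n) / h n * p \<tau> - \<rho> ((\<tau> - t) / h n) / h n * p \<tau>)"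
        by (rule Bochner_Integration.integral_cong)
          (auto simp: space_restrict_space deta p_eq left_diff_distrib)
      then show ?thesis using Bochner_Integration.integral_diff[OF i i] by simp
    qed
    moreover have "(\<lambda>n. (LINT \<tau>|M. \<rho> ((\<tau> - s) / h n) / h n * p \<tau>) - (LINT \<tau>|M. \<rho> ((\<tau> - t) / h n) / h n * p \<tau>)) \<longlonglongrightarrow> p s - p t"
      using st by (intro tendsto_diff mollifier_tendsto[OF p _ _ R(2,7,8,3-6) h(1) h0]) auto
    ultimately show ?thesis by simp
  qed
  have rhs: "(\<lambda>n. LINT \<tau>|M. \<eta> n \<tau> * w \<tau> \<psi>) \<longlonglongrightarrow> (LINT \<tau>|M. indicat_real {s<..t} \<tau> * w \<tau> \<psi>)"
  proof (rule integral_dominated_convergence[where w = "\<lambda>\<tau>. norm (w \<tau> \<psi>)"])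
    show "integrable M (\<lambda>\<tau>. norm (w \<tau> \<psi>))" by (rule integrable_norm[OF w_integrable[OF \<psi>]])
    have "indicat_real {s<..t} \<in> borel_measurable M"
      by (intro measurable_restrict_space1 borel_measurable_indicator) auto
    then show "(\<lambda>\<tau>. indicat_real {s<..t} \<tau> * w \<tau> \<psi>) \<in> borel_measurable M"
      using w_meas[OF \<psi>] by (rule borel_measurable_times)
    have "\<eta> n \<in> borel_measurable M" for n
      using smoothD(3)[OF test_functionsD[OF \<eta>]]
      by (intro continuous_imp_measurable_on_sets_lebesgue) (auto intro: continuous_on_subset)
    then show "(\<lambda>\<tau>. \<eta> n \<tau> * w \<tau> \<psi>) \<in> borel_measurable M" for n
      using w_meas[OF \<psi>] by (rule borel_measurable_times)
    show "AE \<tau> in M. norm (\<eta> n \<tau> * w \<tau> \<psi>) \<le> norm (w \<tau> \<psi>)" for n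
    proof (rule AE_I2)
      fix \<tau>
      have "\<bar>\<eta> n \<tau>\<bar> \<le> 1"
        using R(9,10)[of "(\<tau> - s) / h n"] R(9,10)[of "(\<tau> - t) / h n"] unfolding \<eta>_def by linarith
      then show "norm (\<eta> n \<tau> * w \<tau> \<psi>) \<le> norm (w \<tau> \<psi>)"
        by (simp add: abs_mult mult_left_le_one_le)
    qed
    have lim: "(\<lambda>n. R ((\<tau> - a) / h n)) \<longlonglongrightarrow> indicat_real {a<..} \<tau>" for a \<tau>
    proof (cases "a < \<tau>")
      case True
      then have "\<forall>\<^sub>F n in sequentially. h n < \<tau> - a" using order_tendstoD(2)[OF h0] by simp
      then have "\<forall>\<^sub>F n in sequentially. R ((\<tau> - a) / h n) = 1"
        by eventually_elim (use h(1) in \<open>auto intro!: R(8)\<close>)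
      then show ?thesis using True by (simp add: tendsto_eventually)
    next
      case False
      then have "R ((\<tau> - a) / h n) = 0" for n
        using h(1)[of n] by (intro R(7)) (simp add: divide_le_0_iff)
      then show ?thesis using False by simp
    qed
    have ind: "indicat_real {s<..} \<tau> - indicat_real {t<..} \<tau> = indicat_real {s<..t} \<tau>" for \<tau>
      using st by (auto simp: indicator_def)
    have "(\<lambda>n. \<eta> n \<tau>) \<longlonglongrightarrow> indicat_real {s<..t} \<tau>" for \<tau>
      using tendsto_diff[OF lim[of \<tau> s] lim[of \<tau> t]] unfolding \<eta>_def ind .
    then show "AE \<tau> in M. (\<lambda>n. \<eta> n \<tau> * w \<tau> \<psi>) \<longlonglongrightarrow> indicat_real {s<..t} \<tau> * w \<tau> \<psi>"
      by (intro AE_I2 tendsto_mult_right)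
  qed
  have "(LINT \<tau>|M. indicat_real {s<..t} \<tau> * w \<tau> \<psi>) = integral {s..t} (w0 \<psi>)"
  proof -
    have "(LINT \<tau>|M. indicat_real {s<..t} \<tau> * w \<tau> \<psi>)
        = (LINT \<tau>|lebesgue. indicat_real {0<..<T} \<tau> *\<^sub>R (indicat_real {s<..t} \<tau> * w \<tau> \<psi>))"
      by (rule integral_restrict_space) simp
    also have "\<dots> = (LINT \<tau>|lebesgue. indicat_real {s<..t} \<tau> *\<^sub>R w0 \<psi> \<tau>)"
      by (rule Bochner_Integration.integral_cong) (auto simp: w0_def indicator_def)
    also have "\<dots> = (LINT \<tau>|lebesgue_on {s<..t}. w0 \<psi> \<tau>)"
      by (rule integral_restrict_space[symmetric]) simp
    also have "\<dots> = integral {s<..t} (w0 \<psi>)"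
      by (rule lebesgue_integral_eq_integral[OF integrable_lebesgue_on[OF w0_integrable[OF \<psi>]]]) auto
    also have "\<dots> = integral {s..t} (w0 \<psi>)"
      by (rule integral_spike_set) (auto intro: negligible_subset[of "{s}"])
    finally show ?thesis .
  qed
  with LIMSEQ_unique[OF lhs] tendsto_minus[OF rhs] weak_U[OF \<psi> \<eta>] have "p s - p t = - integral {s..t} (w0 \<psi>)"
    by simp
  then show ?thesis using p_eq[of s] p_eq[of t] st by simp
qed

text \<open>By the interior identity, the pairing minus the primitive of \<open>w0 \<psi>\<close> is
  constant on the open interval. Both are continuous on the closed one, so the constant persists at
  the endpoints; the endpoint 0 brings in the initial value.\<close>

lemma pairing_increment:
  assumes \<psi>: "\<psi> \<in> X" and st: "0 \<le> s" "s \<le> t" "t \<le> T"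
  shows "L2_inner \<Omega> (U t) \<psi> - L2_inner \<Omega> (U s) \<psi> = integral {s..t} (w0 \<psi>)"
proof -
  have \<psi>2: "\<psi> \<in> L2 \<Omega>" using \<psi> X_L2 by blast
  note g = w0_integrable[OF \<psi>] w0_zero[of _ \<psi>]
  define k where "k \<tau> = L2_inner \<Omega> (U \<tau>) \<psi> - integral {0..\<tau>} (w0 \<psi>)" for \<tau>
  have kc: "continuous_on {0..T} k"
    unfolding k_def
    by (intro continuous_on_diff pairing_continuous[OF \<psi>2] continuous_on_subset[OF primitive_continuous[OF g(1)]]) simp
  have ki: "k \<tau> = k (T / 2)" if "\<tau> \<in> {0<..<T}" for \<tau>
  proof -
    have eq: "k a = k b" if "0 < a" "a < b" "b < T" for a b
      using pairing_increment_interior[OF \<psi> that] primitive_diff[OF g, of a b] that by (simp add: k_def)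
    consider "\<tau> < T / 2" | "\<tau> = T / 2" | "T / 2 < \<tau>" by linarith
    then show ?thesis
    proof cases
      case 1
      show ?thesis by (rule eq) (use 1 that T in auto)
    next
      case 3
      have "k (T / 2) = k \<tau>" by (rule eq) (use 3 that T in auto)
      then show ?thesis by simp
    next
      case 2
      then show ?thesis by (rule arg_cong)
    qed
  qed
  have cl: "closure {0<..<T} = {0..T}" using T by simp
  have kT: "k \<tau> = k (T / 2)" if "\<tau> \<in> {0..T}" for \<tau>
    by (rule continuous_constant_on_closure[of "{0<..<T}" k]) (unfold cl, fact kc, rule ki, assumption, fact that)
  have "s \<in> {0..T}" "t \<in> {0..T}" using st by auto
  then have "k s = k t" by (rule trans[OF kT kT[symmetric]])
  then show ?thesis using primitive_diff[OF g st(2)] by (simp add: k_def)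
qed

end

lemma integral_Icc_mono_AE:
  fixes f g :: "real \<Rightarrow> real"
  assumes "integrable lebesgue f" "integrable lebesgue g" "AE t in lebesgue. f t \<le> g t"
  shows "integral {a..b} f \<le> integral {a..b} g"
proof -
  have "AE t in lebesgue. t \<in> {a..b} \<longrightarrow> f t \<le> g t" using assms(3) by eventually_elim simp
  then have ae: "AE t in lebesgue_on {a..b}. f t \<le> g t"
    by (subst AE_restrict_space_iff) auto
  have "integral\<^sup>L (lebesgue_on {a..b}) f \<le> integral\<^sup>L (lebesgue_on {a..b}) g"
    by (rule integral_mono_AE[OF integrable_lebesgue_on[OF assms(1)] integrable_lebesgue_on[OF assms(2)] ae]) simp_all
  then show ?thesis
    using lebesgue_integral_eq_integral[OF integrable_lebesgue_on[OF assms(1), of "{a..b}"]]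
      lebesgue_integral_eq_integral[OF integrable_lebesgue_on[OF assms(2), of "{a..b}"]] by simp
qed

lemma AE_lebesgue_on_subset:
  assumes "AE x in lebesgue_on S. P x" "A \<subseteq> S" "A \<in> sets lebesgue" "S \<in> sets lebesgue"
  shows "AE x in lebesgue_on A. P x"
proof -
  have "AE x in lebesgue. x \<in> S \<longrightarrow> P x" using assms(1,4) by (subst (asm) AE_restrict_space_iff) auto
  then have "AE x in lebesgue. x \<in> A \<longrightarrow> P x" by eventually_elim (use assms(2) in blast)
  then show ?thesis using assms(3) by (subst AE_restrict_space_iff) auto
qed

text \<open>\<open>\<beta>\<close> is only asked to be a Lipschitz subgradient of \<open>G\<close>.
  This covers the smooth truncations used for \<open>u\<close> and also the positive part itself
  used for \<open>v\<close>.\<close>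

locale convex_energy = evolution +
  fixes G \<beta> :: "real \<Rightarrow> real"
  assumes G_cont: "continuous_on UNIV G"
    and convex: "\<And>s r. G s - G r \<le> \<beta> s * (s - r)"
    and lipschitz: "\<And>s r. \<bar>\<beta> s - \<beta> r\<bar> \<le> \<bar>s - r\<bar>"
    and \<phi>: "(\<lambda>t x. \<beta> (u t x)) \<in> L2_Bochner T X N"
begin

definition energy where "energy t = (LINT x|lebesgue_on \<Omega>. G (U t x))"

lemma \<beta>_cont: "continuous_on UNIV \<beta>"
  unfolding continuous_on_iff dist_real_def
proof (intro ballI allI impI)
  fix s e :: real assume "e > 0"
  then show "\<exists>d>0. \<forall>r\<in>UNIV. \<bar>r - s\<bar> < d \<longrightarrow> \<bar>\<beta> r - \<beta> s\<bar> < e"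
    using lipschitz le_less_trans by blast
qed

lemma \<beta>_comp_L2:
  assumes "f \<in> L2 \<Omega>" shows "(\<lambda>x. \<beta> (f x)) \<in> L2 \<Omega>"
proof (rule L2I_bound)
  show "(\<lambda>x. \<bar>\<beta> 0\<bar> + norm (f x)) \<in> L2 \<Omega>"
  proof (rule L2_add[OF L2_const[OF lmeasurable_\<Omega>]])
    show "(\<lambda>x. norm (f x)) \<in> L2 \<Omega>"
      by (rule L2I_bound[OF assms]) (use L2_measurable[OF assms] in auto)
  qed
  show "(\<lambda>x. \<beta> (f x)) \<in> borel_measurable (lebesgue_on \<Omega>)"
    by (rule borel_measurable_continuous_on[OF \<beta>_cont L2_measurable[OF assms]])
  show "AE x in lebesgue_on \<Omega>. norm (\<beta> (f x)) \<le> norm (\<bar>\<beta> 0\<bar> + norm (f x))"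
  proof (rule AE_I2)
    fix x show "norm (\<beta> (f x)) \<le> norm (\<bar>\<beta> 0\<bar> + norm (f x))"
      using lipschitz[of "f x" 0] by simp
  qed
qed

lemma G_integrable:
  assumes f: "f \<in> L2 \<Omega>" shows "integrable (lebesgue_on \<Omega>) (\<lambda>x. G (f x))"
proof (rule Bochner_Integration.integrable_bound)
  show "integrable (lebesgue_on \<Omega>) (\<lambda>x. \<bar>G 0\<bar> + \<bar>\<beta> 0 * f x\<bar> + \<bar>\<beta> (f x) * f x\<bar>)"
    using L2_inner_integrable[OF \<beta>_comp_L2[OF f] f, THEN integrable_abs]
    by (intro Bochner_Integration.integrable_add L2_integrable[OF lmeasurable_\<Omega> L2_const[OF lmeasurable_\<Omega>]]
        integrable_abs[OF L2_integrable[OF lmeasurable_\<Omega> L2_cmult[OF f]]]) simp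
  show "(\<lambda>x. G (f x)) \<in> borel_measurable (lebesgue_on \<Omega>)"
    by (rule borel_measurable_continuous_on[OF G_cont L2_measurable[OF f]])
  \<comment> \<open>The subgradient inequality based at \<open>s\<close> bounds \<open>G s\<close>
    from above, the one based at 0 bounds it from below.\<close>
  have "\<bar>G s\<bar> \<le> \<bar>G 0\<bar> + \<bar>\<beta> 0 * s\<bar> + \<bar>\<beta> s * s\<bar>" for s
    using convex[of s 0] convex[of 0 s] by simp
  then show "AE x in lebesgue_on \<Omega>. norm (G (f x)) \<le> norm (\<bar>G 0\<bar> + \<bar>\<beta> 0 * f x\<bar> + \<bar>\<beta> (f x) * f x\<bar>)"
    by simp
qed

lemma energy_increment_le:
  assumes s: "s \<in> {0..T}" and t: "t \<in> {0..T}"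
  shows "energy t - energy s \<le> L2_inner \<Omega> (\<lambda>x. U t x - U s x) (\<lambda>x. \<beta> (U t x))"
proof -
  have "energy t - energy s = (LINT x|lebesgue_on \<Omega>. G (U t x) - G (U s x))"
    unfolding energy_def by (rule Bochner_Integration.integral_diff[symmetric]) (intro G_integrable U_L2 s t)+
  also have "\<dots> \<le> (LINT x|lebesgue_on \<Omega>. (U t x - U s x) \<bullet> \<beta> (U t x))"
  proof (rule integral_mono)
    show "integrable (lebesgue_on \<Omega>) (\<lambda>x. G (U t x) - G (U s x))"
      by (intro Bochner_Integration.integrable_diff G_integrable U_L2 s t)
    show "integrable (lebesgue_on \<Omega>) (\<lambda>x. (U t x - U s x) \<bullet> \<beta> (U t x))"
      by (intro L2_inner_integrable L2_diff \<beta>_comp_L2 U_L2 s t)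
    show "G (U t x) - G (U s x) \<le> (U t x - U s x) \<bullet> \<beta> (U t x)" for x
      using convex[of "U t x" "U s x"] by (simp add: mult.commute)
  qed
  finally show ?thesis by (simp add: L2_inner_def)
qed

text \<open>Exchanging the two times in the increment inequality bounds the difference from both
  sides. The Lipschitz property of \<open>\<beta>\<close> keeps the norm of
  \<open>\<beta> (U s)\<close> bounded for \<open>s\<close> near \<open>t\<close>.\<close>

lemma energy_continuous: "continuous_on {0..T} energy"
  unfolding continuous_on_def
proof (intro ballI)
  fix t assume t: "t \<in> {0..T}"
  let ?d = "\<lambda>s. L2_norm \<Omega> (U s - U t)" and ?b = "L2_norm \<Omega> (\<lambda>x. \<beta> (U t x))"
  have "((\<lambda>s. energy s - energy t) \<longlongrightarrow> 0) (at t within {0..T})"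
  proof (rule Lim_null_comparison)
    have "((\<lambda>s. (?b + ?d s) * ?d s) \<longlongrightarrow> (?b + 0) * 0) (at t within {0..T})"
      by (intro tendsto_intros U_cont[OF t])
    then show "((\<lambda>s. (?b + ?d s) * ?d s) \<longlongrightarrow> 0) (at t within {0..T})" by simp
    show "\<forall>\<^sub>F s in at t within {0..T}. norm (energy s - energy t) \<le> (?b + ?d s) * ?d s"
      unfolding eventually_at_filter
    proof (rule always_eventually, intro allI impI)
      fix s assume s: "s \<in> {0..T}"
      have bL: "(\<lambda>x. \<beta> (U r x)) \<in> L2 \<Omega>" if "r \<in> {0..T}" for r by (intro \<beta>_comp_L2 U_L2 that)
      have eq: "(\<lambda>x. U s x - U t x) = U s - U t" "(\<lambda>x. U t x - U s x) = U t - U s"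
        by (simp_all add: fun_diff_def)
      have sym: "L2_norm \<Omega> (U t - U s) = ?d s"
        using L2_norm_minus_commute[of \<Omega> "U t" "U s"] by (simp add: fun_diff_def)
      have "L2_norm \<Omega> (\<lambda>x. \<beta> (U s x)) \<le> ?b + L2_norm \<Omega> (\<lambda>x. \<beta> (U s x) - \<beta> (U t x))"
        using L2_norm_triangle[OF bL[OF t] L2_diff[OF bL[OF s] bL[OF t]]] by simp
      also have "L2_norm \<Omega> (\<lambda>x. \<beta> (U s x) - \<beta> (U t x)) \<le> ?d s"
        by (rule L2_norm_mono[OF L2_diff[OF bL[OF s] bL[OF t]] U_diff_L2[OF s t]]) (simp add: lipschitz)
      finally have bs: "L2_norm \<Omega> (\<lambda>x. \<beta> (U s x)) \<le> ?b + ?d s" by simp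
      have "energy s - energy t \<le> ?d s * L2_norm \<Omega> (\<lambda>x. \<beta> (U s x))"
        using energy_increment_le[OF t s] L2_Cauchy_Schwarz[OF U_diff_L2[OF s t] bL[OF s]] unfolding eq by linarith
      also have "\<dots> \<le> ?d s * (?b + ?d s)" by (rule mult_left_mono[OF bs]) simp
      finally have 1: "energy s - energy t \<le> (?b + ?d s) * ?d s" by (simp add: mult.commute)
      have "energy t - energy s \<le> ?d s * ?b"
        using energy_increment_le[OF s t] L2_Cauchy_Schwarz[OF U_diff_L2[OF t s] bL[OF t]] unfolding eq sym by linarith
      also have "\<dots> \<le> ?d s * (?b + ?d s)" by (rule mult_left_mono) simp_all
      finally have 2: "energy t - energy s \<le> (?b + ?d s) * ?d s" by (simp add: mult.commute)
      show "norm (energy s - energy t) \<le> (?b + ?d s) * ?d s" using 1 2 by (simp add: abs_le_iff)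
    qed
  qed
  then show "(energy \<longlongrightarrow> energy t) (at t within {0..T})" by (simp add: LIM_zero_iff)
qed

text \<open>The test function is frozen at the later time \<open>t\<close>, while the functional is
  integrated over the earlier times. Only \<open>t\<close> is subject to an exceptional set. It is
  \<open>\<beta> (u t)\<close>, not \<open>\<beta> (U t)\<close>, that is known to lie in
  \<open>X\<close>.\<close>

lemma energy_increment_w0:
  "AE t in M. \<forall>s. 0 \<le> s \<longrightarrow> s \<le> t \<longrightarrow> energy t - energy s \<le> integral {s..t} (w0 (\<lambda>x. \<beta> (u t x)))"
  using U_eq u_L2 AE_M L2_BochnerD(1)[OF \<phi>]
proof eventually_elim
  case (elim t)
  show ?case
  proof (intro allI impI)
    fix s assume s: "0 \<le> s" "s \<le> t"
    have t: "t \<in> {0..T}" and s': "s \<in> {0..T}" using elim(3) s by auto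
    have bL: "(\<lambda>x. \<beta> (U t x)) \<in> L2 \<Omega>" "(\<lambda>x. \<beta> (u t x)) \<in> L2 \<Omega>"
      by (intro \<beta>_comp_L2 U_L2 t elim(2))+
    have dL: "(\<lambda>x. U t x - U s x) \<in> L2 \<Omega>" by (intro L2_diff U_L2 t s')
    have "energy t - energy s \<le> L2_inner \<Omega> (\<lambda>x. U t x - U s x) (\<lambda>x. \<beta> (U t x))"
      by (rule energy_increment_le[OF s' t])
    also have "\<dots> = L2_inner \<Omega> (\<lambda>x. U t x - U s x) (\<lambda>x. \<beta> (u t x))"
      unfolding L2_inner_def
    proof (rule integral_cong_AE)
      show "AE x in lebesgue_on \<Omega>. (U t x - U s x) \<bullet> \<beta> (U t x) = (U t x - U s x) \<bullet> \<beta> (u t x)"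
        using elim(1) by eventually_elim simp
    qed (intro borel_measurable_inner L2_measurable dL bL)+
    also have "\<dots> = L2_inner \<Omega> (U t) (\<lambda>x. \<beta> (u t x)) - L2_inner \<Omega> (U s) (\<lambda>x. \<beta> (u t x))"
      by (intro L2_inner_diff_left U_L2 t s' bL)
    also have "\<dots> = integral {s..t} (w0 (\<lambda>x. \<beta> (u t x)))"
      using elim(4) s t by (intro pairing_increment) auto
    finally show "energy t - energy s \<le> integral {s..t} (w0 (\<lambda>x. \<beta> (u t x)))" .
  qed
qed

section \<open>Pairings with strongly measurable test functions\<close>

lemma w_simple_measurable:
  assumes s: "simple_map T X s" shows "(\<lambda>t. w t (s t)) \<in> borel_measurable M"
proof -
  have "(\<lambda>t. \<Sum>y\<in>s ` {0<..<T}. indicat_real {t \<in> {0<..<T}. s t = y} t * w t y) \<in> borel_measurable M"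
  proof (intro borel_measurable_sum borel_measurable_times)
    fix y assume "y \<in> s ` {0<..<T}"
    then show "(\<lambda>t. w t y) \<in> borel_measurable M" using simple_mapD(1)[OF s] by (intro w_meas) auto
    show "indicat_real {t \<in> {0<..<T}. s t = y} \<in> borel_measurable M"
      by (intro measurable_restrict_space1 borel_measurable_indicator simple_mapD(3)[OF s])
  qed
  moreover have "(\<Sum>y\<in>s ` {0<..<T}. indicat_real {t \<in> {0<..<T}. s t = y} t * w t y) = w t (s t)"
    if "t \<in> space M" for t
    using simple_map_sum[OF s, of t "w t"] that by (simp add: space_restrict_space mult.commute)
  ultimately show ?thesis by (rule measurable_cong[THEN iffD1, rotated])
qed

lemma w_diff_bound:
  "AE t in M. \<forall>f\<in>X. \<forall>g\<in>X. \<bar>w t f - w t g\<bar> \<le> N (f - g) * W t"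
  using w_bound w_diff
proof eventually_elim
  case (elim t)
  show ?case
  proof (intro ballI)
    fix f g assume fg: "f \<in> X" "g \<in> X"
    then have "w t f - w t g = w t (f - g)" "\<bar>w t (f - g)\<bar> \<le> W t * N (f - g)"
      using elim X_diff[OF fg] by auto
    then show "\<bar>w t f - w t g\<bar> \<le> N (f - g) * W t" by (simp add: mult.commute)
  qed
qed

lemma w_Bochner_measurable:
  assumes z: "z \<in> L2_Bochner T X N" shows "(\<lambda>t. w t (z t)) \<in> borel_measurable M"
proof -
  obtain s where s: "\<And>n::nat. simple_map T X (s n)" "AE t in M. (\<lambda>n. N (z t - s n t)) \<longlonglongrightarrow> 0"
    using L2_BochnerD(2)[OF z] by blast
  show ?thesis
  proof (rule borel_measurable_lebesgue_on_AE_limit[OF _ w_simple_measurable[OF s(1)]])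
    show "AE t in M. (\<lambda>n. w t (s n t)) \<longlonglongrightarrow> w t (z t)"
      using w_diff_bound L2_BochnerD(1)[OF z] s(2) AE_M
    proof eventually_elim
      case (elim t)
      have "\<forall>n. norm (w t (z t) - w t (s n t)) \<le> N (z t - s n t) * W t"
        using elim(1,2) simple_mapD(1)[OF s(1) elim(4)] by simp
      from Lim_null_comparison[OF always_eventually[OF this] tendsto_mult_left_zero[OF elim(3)]]
      have "(\<lambda>n. w t (z t) - w t (s n t)) \<longlonglongrightarrow> 0" .
      from tendsto_diff[OF tendsto_const[of "w t (z t)"] this] show ?case by simp
    qed
  qed simp
qed

lemma Bochner_norm_mem_L2: "z \<in> L2_Bochner T X N \<Longrightarrow> (\<lambda>t. N (z t)) \<in> L2 {0<..<T}"
  using Bochner_norm_measurable[of z T] L2_BochnerD(3)[of z] by (simp add: L2_def)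

lemma w_Bochner_integrable:
  assumes z: "z \<in> L2_Bochner T X N" shows "integrable M (\<lambda>t. w t (z t))"
proof (rule Bochner_Integration.integrable_bound[OF L2_inner_integrable[OF W_L2 Bochner_norm_mem_L2[OF z]]
      w_Bochner_measurable[OF z]])
  show "AE t in M. norm (w t (z t)) \<le> norm (W t \<bullet> N (z t))"
    using w_bound L2_BochnerD(1)[OF z]
  proof eventually_elim
    case (elim t)
    then have "\<bar>w t (z t)\<bar> \<le> W t * N (z t)" by blast
    then show ?case by simp
  qed
qed

lemma energy_le_simple:
  assumes s: "simple_map T X s" and sL: "(\<lambda>t. N ((\<lambda>x. \<beta> (u t x)) - s t)) \<in> L2 {0<..<T}"
    and b: "0 < b" "b \<le> T"
  shows "energy b - energy 0 \<le> (LINT t|lebesgue_on {0<..<b}. w t (s t))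
    + L2_norm {0<..<T} (\<lambda>t. N ((\<lambda>x. \<beta> (u t x)) - s t)) * L2_norm {0<..<T} W"
proof -
  let ?Mb = "lebesgue_on {0<..<b}"
  let ?e = "\<lambda>t. N ((\<lambda>x. \<beta> (u t x)) - s t)"
  have sub: "{0<..<b} \<subseteq> {0<..<T}" using b by auto
  have so: "{0<..<b} \<in> sets lebesgue" "{0<..<T} \<in> sets lebesgue" by simp_all
  \<comment> \<open>Constant continuation beyond both ends: for \<open>t < h\<close> the earlier
    value is the initial energy, in agreement with \<open>w0\<close> being 0 at negative
    times.\<close>
  define E where "E t = energy (max 0 (min T t))" for t
  have E: "continuous_on UNIV E"
    unfolding E_def using T by (intro continuous_on_compose2[OF energy_continuous]) (auto intro!: continuous_intros)
  define h where "h n = inverse (real (Suc n))" for n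
  have h: "\<And>n. 0 < h n" "h \<longlonglongrightarrow> 0"
    unfolding h_def using LIMSEQ_inverse_real_of_nat by simp_all
  define Y where "Y = s ` {0<..<T}"
  define A where "A y = {t \<in> {0<..<T}. s t = y}" for y
  have Y: "finite Y" "Y \<subseteq> X" using simple_mapD(1,2)[OF s] by (auto simp: Y_def)
  have A: "A y \<in> sets lebesgue" for y unfolding A_def by (rule simple_mapD(3)[OF s])
  \<comment> \<open>The average acts on the time variable of \<open>g\<close> alone; in
    \<open>?avg n (w0 (s t)) t\<close> the argument \<open>s t\<close> stays fixed during the
    integration.\<close>
  let ?avg = "\<lambda>n g t. integral {t - h n..t} g / h n"
  have pt: "AE t in ?Mb. (E t - E (t - h n)) / h n \<le> (\<Sum>y\<in>Y. indicat_real (A y) t * ?avg n (w0 y) t) + ?e t * ?avg n W0 t" for n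
  proof -
    have "AE t in M. (E t - E (t - h n)) / h n \<le> (\<Sum>y\<in>Y. indicat_real (A y) t * ?avg n (w0 y) t) + ?e t * ?avg n W0 t"
      using energy_increment_w0 AE_M L2_BochnerD(1)[OF \<phi>]
    proof eventually_elim
      case (elim t)
      let ?f = "\<lambda>x. \<beta> (u t x)"
      have st: "s t \<in> X" by (rule simple_mapD(1)[OF s elim(2)])
      note f0 = w0_integrable[OF elim(3)] and s0 = w0_integrable[OF st]
      have "E t - E (t - h n) = energy t - energy (max 0 (t - h n))"
        using elim(2) h(1)[of n] by (simp add: E_def min_def max_def)
      also have "\<dots> \<le> integral {max 0 (t - h n)..t} (w0 ?f)"
        using elim(1,2) h(1)[of n] by (simp add: max_def)
      also have "\<dots> = integral {t - h n..t} (w0 ?f)"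
      proof (cases "t - h n \<ge> 0")
        case False
        then show ?thesis
          using primitive_diff[OF f0 w0_zero, of "t - h n" t] h(1)[of n] by simp
      qed simp
      also have "\<dots> \<le> integral {t - h n..t} (\<lambda>\<tau>. w0 (s t) \<tau> + ?e t * W0 \<tau>)"
      proof (rule integral_Icc_mono_AE[OF f0])
        show "integrable lebesgue (\<lambda>\<tau>. w0 (s t) \<tau> + ?e t * W0 \<tau>)"
          by (intro Bochner_Integration.integrable_add integrable_mult_right s0 W0_integrable(1))
        show "AE \<tau> in lebesgue. w0 ?f \<tau> \<le> w0 (s t) \<tau> + ?e t * W0 \<tau>"
          using w0_AE by eventually_elim (use elim(3) st in blast)
      qed
      also have "\<dots> = integral {t - h n..t} (w0 (s t)) + ?e t * integral {t - h n..t} W0"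
        using Henstock_Kurzweil_Integration.integral_add[OF integrable_on_Icc[OF s0]
            integrable_on_mult_right[OF integrable_on_Icc[OF W0_integrable(1)]]] by simp
      finally have "(E t - E (t - h n)) / h n \<le> (integral {t - h n..t} (w0 (s t)) + ?e t * integral {t - h n..t} W0) / h n"
        using h(1)[of n] by (intro divide_right_mono) auto
      also have "\<dots> = ?avg n (w0 (s t)) t + ?e t * ?avg n W0 t" by (simp add: add_divide_distrib)
      also have "?avg n (w0 (s t)) t = (\<Sum>y\<in>Y. indicat_real (A y) t * ?avg n (w0 y) t)"
        unfolding Y_def A_def using simple_map_sum[OF s elim(2), of "\<lambda>y. ?avg n (w0 y) t"]
        by (simp add: mult.commute)
      finally show ?case .
    qed
    then show ?thesis by (rule AE_lebesgue_on_subset[OF _ sub]) simp_all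
  qed
  note eb = L2_subset[OF sL sub so] and Wb = backward_average_L2[OF W0_integrable W0_zero h(1) b(1)]
  have W0b: "L2_norm {0<..<b} W0 \<le> L2_norm {0<..<T} W"
  proof -
    have "L2_norm {0<..<b} W0 = L2_norm {0<..<b} W"
      unfolding L2_norm_def
      by (rule arg_cong[where f = sqrt], rule Bochner_Integration.integral_cong)
        (use b in \<open>auto simp: space_restrict_space W0_def\<close>)
    then show ?thesis using L2_subset(2)[OF W_L2 sub so] by simp
  qed
  have int: "integral {0..b} (\<lambda>t. E t - E (t - h n)) / h n
      \<le> (\<Sum>y\<in>Y. LINT t|?Mb. indicat_real (A y) t * ?avg n (w0 y) t) + L2_norm {0<..<T} ?e * L2_norm {0<..<T} W" for n
  proof -
    have Ei: "integrable ?Mb (\<lambda>t. (E t - E (t - h n)) / h n)"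
      using h(1)[of n] by (intro continuous_integrable_Ioo continuous_on_divide continuous_on_diff E continuous_on_const
          continuous_on_compose2[OF E]) (auto intro!: continuous_intros)
    have ei: "integrable ?Mb (\<lambda>t. ?e t * ?avg n W0 t)"
      using L2_inner_integrable[OF eb(1) Wb(1)[of n]] by simp
    have yi: "integrable ?Mb (\<lambda>t. indicat_real (A y) t * ?avg n (w0 y) t)" if "y \<in> Y" for y
      using that Y(2) by (intro backward_average_indicator(2)[OF w0_integrable w0_zero h b(1) A]) auto
    have "integral {0..b} (\<lambda>t. E t - E (t - h n)) / h n = (LINT t|?Mb. (E t - E (t - h n)) / h n)"
      unfolding LINT_Ioo[OF Ei] by simp
    also have "\<dots> \<le> (LINT t|?Mb. (\<Sum>y\<in>Y. indicat_real (A y) t * ?avg n (w0 y) t) + ?e t * ?avg n W0 t)"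
      by (rule integral_mono_AE[OF Ei _ pt]) (intro Bochner_Integration.integrable_add Bochner_Integration.integrable_sum ei yi)
    also have "\<dots> = (LINT t|?Mb. (\<Sum>y\<in>Y. indicat_real (A y) t * ?avg n (w0 y) t)) + (LINT t|?Mb. ?e t * ?avg n W0 t)"
      by (rule Bochner_Integration.integral_add[OF Bochner_Integration.integrable_sum ei]) (rule yi)
    also have "(LINT t|?Mb. (\<Sum>y\<in>Y. indicat_real (A y) t * ?avg n (w0 y) t))
        = (\<Sum>y\<in>Y. LINT t|?Mb. indicat_real (A y) t * ?avg n (w0 y) t)"
      by (rule Bochner_Integration.integral_sum) (rule yi)
    also have "(LINT t|?Mb. ?e t * ?avg n W0 t) \<le> L2_norm {0<..<b} ?e * L2_norm {0<..<b} (?avg n W0)"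
      using order_trans[OF abs_ge_self L2_Cauchy_Schwarz[OF eb(1) Wb(1)[of n]]]
      unfolding L2_inner_def inner_real_def .
    also have "\<dots> \<le> L2_norm {0<..<T} ?e * L2_norm {0<..<T} W"
      using eb(2) Wb(2)[of n] W0b by (intro mult_mono) auto
    finally show ?thesis by simp
  qed
  have lim1: "(\<lambda>n. integral {0..b} (\<lambda>t. E t - E (t - h n)) / h n) \<longlonglongrightarrow> E b - E 0"
  proof -
    have "integral {0..b} (\<lambda>t. E t - E (t - h n)) / h n = integral {b - h n..b} E / h n - integral {0 - h n..0} E / h n" for n
      using integral_shift_difference[OF E h(1)[of n] b(1)] by (simp add: diff_divide_distrib)
    then show ?thesis
      using tendsto_diff[OF backward_average_continuous[OF E h, of b] backward_average_continuous[OF E h, of 0]] by simp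
  qed
  have lim2: "(\<lambda>n. (\<Sum>y\<in>Y. LINT t|?Mb. indicat_real (A y) t * ?avg n (w0 y) t) + L2_norm {0<..<T} ?e * L2_norm {0<..<T} W)
      \<longlonglongrightarrow> (\<Sum>y\<in>Y. LINT t|?Mb. indicat_real (A y) t * w0 y t) + L2_norm {0<..<T} ?e * L2_norm {0<..<T} W"
    using Y(2) by (intro tendsto_intros tendsto_sum backward_average_indicator(1)[OF w0_integrable w0_zero h b(1) A]) auto
  have "E b - E 0 \<le> (\<Sum>y\<in>Y. LINT t|?Mb. indicat_real (A y) t * w0 y t) + L2_norm {0<..<T} ?e * L2_norm {0<..<T} W"
    by (rule LIMSEQ_le[OF lim1 lim2]) (use int in blast)
  moreover have "(\<Sum>y\<in>Y. LINT t|?Mb. indicat_real (A y) t * w0 y t) = (LINT t|?Mb. w t (s t))"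
  proof -
    have yi: "integrable ?Mb (\<lambda>t. indicat_real (A y) t * w0 y t)" if "y \<in> Y" for y
      using that Y(2) by (intro backward_average_indicator(3)[OF w0_integrable w0_zero h b(1) A]) auto
    have "(\<Sum>y\<in>Y. LINT t|?Mb. indicat_real (A y) t * w0 y t) = (LINT t|?Mb. (\<Sum>y\<in>Y. indicat_real (A y) t * w0 y t))"
      by (rule Bochner_Integration.integral_sum[OF yi, symmetric])
    also have "\<dots> = (LINT t|?Mb. w t (s t))"
    proof (rule Bochner_Integration.integral_cong)
      fix t assume "t \<in> space ?Mb"
      then have t: "t \<in> {0<..<T}" using sub by (auto simp: space_restrict_space)
      then show "(\<Sum>y\<in>Y. indicat_real (A y) t * w0 y t) = w t (s t)"
        unfolding Y_def A_def using simple_map_sum[OF s t, of "\<lambda>y. w0 y t"] by (simp add: mult.commute w0_def)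
    qed simp
    finally show ?thesis .
  qed
  moreover have "E b = energy b" "E 0 = energy 0" using b T by (auto simp: E_def)
  ultimately show ?thesis by simp
qed

text \<open>Simple approximations in the Bochner norm remove the restriction to simple test
  functions, since the pairing is continuous with constant the \<open>L2\<close> norm of
  \<open>W\<close>.\<close>

lemma energy_inequality:
  assumes b: "0 < b" "b \<le> T"
  shows "energy b - energy 0 \<le> (LINT t|lebesgue_on {0<..<b}. w t (\<lambda>x. \<beta> (u t x)))"
proof -
  let ?Mb = "lebesgue_on {0<..<b}" and ?\<phi> = "\<lambda>t x. \<beta> (u t x)"
  have sub: "{0<..<b} \<subseteq> {0<..<T}" using b by auto
  have so: "{0<..<b} \<in> sets lebesgue" "{0<..<T} \<in> sets lebesgue" by simp_all
  obtain s where s: "\<And>n::nat. simple_map T X (s n)" "\<And>n. (\<lambda>t. N (?\<phi> t - s n t)) \<in> L2 {0<..<T}"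
    "(\<lambda>n. L2_norm {0<..<T} (\<lambda>t. N (?\<phi> t - s n t))) \<longlonglongrightarrow> 0"
  proof (rule Bochner_simple_approx[OF \<phi>])
    fix s :: "nat \<Rightarrow> real \<Rightarrow> 'a \<Rightarrow> real"
    assume "\<And>n. simple_map T X (s n)" "\<And>n. (\<lambda>t. N (?\<phi> t - s n t)) \<in> L2 {0<..<T}"
      "(\<lambda>n. L2_norm {0<..<T} (\<lambda>t. N (?\<phi> t - s n t))) \<longlonglongrightarrow> 0"
    then show thesis by (rule that)
  qed
  let ?\<delta> = "\<lambda>n. L2_norm {0<..<T} (\<lambda>t. N (?\<phi> t - s n t)) * L2_norm {0<..<T} W"
  note pi = integrable_lebesgue_on_subset[OF w_Bochner_integrable[OF \<phi>] sub so]
  \<comment> \<open>One \<open>?\<delta> n\<close> stems from the simple test function in the energy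
    estimate, the other from exchanging \<open>w t (s n t)\<close> for the pairing with the
    limit.\<close>
  have le: "energy b - energy 0 \<le> (LINT t|?Mb. w t (?\<phi> t)) + 2 * ?\<delta> n" for n
  proof -
    note eb = L2_subset[OF s(2)[of n] sub so] and Wb = L2_subset[OF W_L2 sub so]
    have ei: "integrable ?Mb (\<lambda>t. N (?\<phi> t - s n t) * W t)"
      using L2_inner_integrable[OF eb(1) Wb(1)] by simp
    have bound: "AE t in ?Mb. \<bar>w t (?\<phi> t) - w t (s n t)\<bar> \<le> N (?\<phi> t - s n t) * W t"
    proof -
      have "AE t in M. \<bar>w t (?\<phi> t) - w t (s n t)\<bar> \<le> N (?\<phi> t - s n t) * W t"
        using w_diff_bound AE_M L2_BochnerD(1)[OF \<phi>]
      proof eventually_elim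
        case (elim t)
        then show ?case using simple_mapD(1)[OF s(1) elim(2)] by blast
      qed
      then show ?thesis by (rule AE_lebesgue_on_subset[OF _ sub]) simp_all
    qed
    have m: "(\<lambda>t. w t (s n t)) \<in> borel_measurable ?Mb"
      by (rule measurable_restrict_mono[OF w_simple_measurable[OF s(1)] sub])
    have di: "integrable ?Mb (\<lambda>t. w t (?\<phi> t) - w t (s n t))"
    proof (rule Bochner_Integration.integrable_bound[OF ei])
      show "(\<lambda>t. w t (?\<phi> t) - w t (s n t)) \<in> borel_measurable ?Mb"
        by (intro borel_measurable_diff m borel_measurable_integrable pi)
      show "AE t in ?Mb. norm (w t (?\<phi> t) - w t (s n t)) \<le> norm (N (?\<phi> t - s n t) * W t)"
        using bound by eventually_elim simp
    qed
    have si: "integrable ?Mb (\<lambda>t. w t (s n t))"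
      using Bochner_Integration.integrable_diff[OF pi di] by simp
    have "(LINT t|?Mb. w t (s n t)) \<le> (LINT t|?Mb. w t (?\<phi> t) + N (?\<phi> t - s n t) * W t)"
    proof (rule integral_mono_AE[OF si])
      show "integrable ?Mb (\<lambda>t. w t (?\<phi> t) + N (?\<phi> t - s n t) * W t)"
        by (intro Bochner_Integration.integrable_add pi ei)
      show "AE t in ?Mb. w t (s n t) \<le> w t (?\<phi> t) + N (?\<phi> t - s n t) * W t"
        using bound by eventually_elim (simp add: abs_le_iff)
    qed
    also have "\<dots> = (LINT t|?Mb. w t (?\<phi> t)) + (LINT t|?Mb. N (?\<phi> t - s n t) * W t)"
      by (intro Bochner_Integration.integral_add pi ei)
    also have "(LINT t|?Mb. N (?\<phi> t - s n t) * W t) \<le> L2_norm {0<..<b} (\<lambda>t. N (?\<phi> t - s n t)) * L2_norm {0<..<b} W"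
      using L2_Cauchy_Schwarz[OF eb(1) Wb(1)] by (simp add: L2_inner_def abs_le_iff)
    also have "\<dots> \<le> ?\<delta> n" using eb(2) Wb(2) by (intro mult_mono) auto
    finally show ?thesis using energy_le_simple[OF s(1) s(2) b, of n] by linarith
  qed
  have "(\<lambda>n. (LINT t|?Mb. w t (?\<phi> t)) + 2 * ?\<delta> n) \<longlonglongrightarrow> (LINT t|?Mb. w t (?\<phi> t)) + 2 * (0 * L2_norm {0<..<T} W)"
    by (intro tendsto_intros s(3))
  then have "(\<lambda>n. (LINT t|?Mb. w t (?\<phi> t)) + 2 * ?\<delta> n) \<longlonglongrightarrow> (LINT t|?Mb. w t (?\<phi> t))" by simp
  from LIMSEQ_le_const[OF this] le show ?thesis by blast
qed

end

section \<open>Smooth approximations of the positive part\<close>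

text \<open>For \<open>s > 0\<close> this is
  \<open>(s + \<epsilon> / 2) * exp (- \<epsilon> / s)\<close>, the exact derivative of
  \<open>s\<^sup>2 / 2 * exp (- \<epsilon> / s)\<close>. Starting from the primitive keeps the
  energy in closed form; the flat factor makes the gluing with 0 at \<open>s = 0\<close>
  smooth.\<close>

definition soft_pos :: "real \<Rightarrow> real \<Rightarrow> real" where
  "soft_pos \<epsilon> s = (s + \<epsilon> / 2) * flat_exp 0 (s / \<epsilon>)"

definition soft_pos_deriv :: "real \<Rightarrow> real \<Rightarrow> real" where
  "soft_pos_deriv \<epsilon> s = flat_exp 0 (s / \<epsilon>) + flat_exp 1 (s / \<epsilon>) + flat_exp 2 (s / \<epsilon>) / 2"

definition soft_pos_primitive :: "real \<Rightarrow> real \<Rightarrow> real" where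
  "soft_pos_primitive \<epsilon> s = s\<^sup>2 / 2 * flat_exp 0 (s / \<epsilon>)"

lemma flat_exp_mult: "x * flat_exp (Suc n) x = flat_exp n x"
  by (simp add: flat_exp_def)

lemma flat_exp_0_scaled:
  assumes "\<epsilon> > 0"
  shows "((\<lambda>s. flat_exp 0 (s / \<epsilon>)) has_real_derivative flat_exp 2 (s / \<epsilon>) / \<epsilon>) (at s)"
proof -
  have "((\<lambda>s. s / \<epsilon>) has_real_derivative 1 / \<epsilon>) (at s)"
    using assms by (auto intro!: derivative_eq_intros)
  from DERIV_chain2[OF flat_exp_deriv[of 0] this] show ?thesis by (simp add: numeral_2_eq_2)
qed

lemma soft_pos_has_derivative:
  assumes "\<epsilon> > 0"
  shows "(soft_pos \<epsilon> has_real_derivative soft_pos_deriv \<epsilon> s) (at s)"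
proof -
  have "((\<lambda>s. s + \<epsilon> / 2) has_real_derivative 1) (at s)" by (auto intro!: derivative_eq_intros)
  from DERIV_mult[OF this flat_exp_0_scaled[OF assms]]
  have "(soft_pos \<epsilon> has_real_derivative 1 * flat_exp 0 (s / \<epsilon>) + flat_exp 2 (s / \<epsilon>) / \<epsilon> * (s + \<epsilon> / 2)) (at s)"
    unfolding soft_pos_def[abs_def] .
  moreover have "flat_exp 2 (s / \<epsilon>) / \<epsilon> * (s + \<epsilon> / 2) = flat_exp 1 (s / \<epsilon>) + flat_exp 2 (s / \<epsilon>) / 2"
  proof -
    have "flat_exp 2 (s / \<epsilon>) / \<epsilon> * (s + \<epsilon> / 2) = s / \<epsilon> * flat_exp (Suc 1) (s / \<epsilon>) + flat_exp 2 (s / \<epsilon>) / 2"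
      using assms by (simp add: field_simps numeral_2_eq_2)
    then show ?thesis unfolding flat_exp_mult .
  qed
  ultimately show ?thesis by (simp add: soft_pos_deriv_def add.assoc)
qed

lemma soft_pos_primitive_has_derivative:
  assumes "\<epsilon> > 0"
  shows "(soft_pos_primitive \<epsilon> has_real_derivative soft_pos \<epsilon> s) (at s)"
proof -
  have "((\<lambda>s. s\<^sup>2 / 2) has_real_derivative s) (at s)" by (auto intro!: derivative_eq_intros)
  from DERIV_mult[OF this flat_exp_0_scaled[OF assms]]
  have d: "(soft_pos_primitive \<epsilon> has_real_derivative s * flat_exp 0 (s / \<epsilon>) + flat_exp 2 (s / \<epsilon>) / \<epsilon> * (s\<^sup>2 / 2)) (at s)"
    unfolding soft_pos_primitive_def[abs_def] .
  have eq: "flat_exp 2 (s / \<epsilon>) / \<epsilon> * (s\<^sup>2 / 2) = \<epsilon> / 2 * flat_exp 0 (s / \<epsilon>)"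
  proof -
    have "flat_exp 2 (s / \<epsilon>) / \<epsilon> * (s\<^sup>2 / 2) = \<epsilon> / 2 * (s / \<epsilon> * (s / \<epsilon> * flat_exp (Suc (Suc 0)) (s / \<epsilon>)))"
      using assms by (simp add: field_simps numeral_2_eq_2 power2_eq_square)
    then show ?thesis unfolding flat_exp_mult .
  qed
  from d[unfolded eq] show ?thesis by (simp only: soft_pos_def distrib_right)
qed

text \<open>With \<open>y = \<epsilon> / s\<close> the derivative is
  \<open>(1 + y + y\<^sup>2 / 2) * exp (- y)\<close>; the bracket is the quadratic Taylor polynomial
  of \<open>exp y\<close> and lies below it for \<open>y \<ge> 0\<close>.\<close>

lemma soft_pos_deriv_bounds:
  assumes "\<epsilon> > 0"
  shows "0 \<le> soft_pos_deriv \<epsilon> s" "soft_pos_deriv \<epsilon> s \<le> 1" "s \<le> 0 \<Longrightarrow> soft_pos_deriv \<epsilon> s = 0"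
proof -
  show "0 \<le> soft_pos_deriv \<epsilon> s" by (simp add: soft_pos_deriv_def flat_exp_nonneg)
  show "soft_pos_deriv \<epsilon> s = 0" if "s \<le> 0"
    using that assms by (simp add: soft_pos_deriv_def flat_exp_def divide_le_0_iff not_less zero_less_divide_iff)
  show "soft_pos_deriv \<epsilon> s \<le> 1"
  proof (cases "s / \<epsilon> > 0")
    case True
    define y where "y = inverse (s / \<epsilon>)"
    have y: "y \<ge> 0" unfolding y_def using True by (simp only: inverse_nonnegative_iff_nonnegative less_imp_le)
    have "soft_pos_deriv \<epsilon> s = (1 + y + y\<^sup>2 / 2) * exp (- y)"
      using True by (simp add: soft_pos_deriv_def flat_exp_def y_def distrib_right power2_eq_square)
    also have "\<dots> \<le> exp y * exp (- y)"
      by (rule mult_right_mono[OF exp_lower_Taylor_quadratic[OF y]]) simp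
    also have "\<dots> = 1" by (simp add: exp_minus)
    finally show ?thesis .
  qed (simp add: soft_pos_deriv_def flat_exp_def)
qed

lemma soft_pos_zero: "\<epsilon> > 0 \<Longrightarrow> s \<le> 0 \<Longrightarrow> soft_pos \<epsilon> s = 0"
  by (simp add: soft_pos_def flat_exp_def divide_le_0_iff not_less zero_less_divide_iff)

lemma soft_pos_mono:
  assumes "\<epsilon> > 0" "a \<le> b" shows "soft_pos \<epsilon> a \<le> soft_pos \<epsilon> b"
  by (rule DERIV_nonneg_imp_nondecreasing[OF assms(2)])
    (use soft_pos_has_derivative[OF assms(1)] soft_pos_deriv_bounds(1)[OF assms(1)] in blast)

lemma soft_pos_bounds:
  assumes "\<epsilon> > 0" shows "0 \<le> soft_pos \<epsilon> s" "soft_pos \<epsilon> s \<le> max s 0"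
proof -
  show "0 \<le> soft_pos \<epsilon> s"
    using soft_pos_mono[OF assms, of 0 s] soft_pos_zero[OF assms, of 0] soft_pos_zero[OF assms, of s] by (cases "s \<ge> 0") auto
  have "norm (soft_pos \<epsilon> (max s 0) - soft_pos \<epsilon> 0) \<le> 1 * norm (max s 0 - 0)"
    by (rule field_differentiable_bound[of UNIV _ "soft_pos_deriv \<epsilon>"])
      (use soft_pos_has_derivative[OF assms] soft_pos_deriv_bounds(1,2)[OF assms] in \<open>auto intro: has_field_derivative_at_within\<close>)
  then show "soft_pos \<epsilon> s \<le> max s 0"
    using soft_pos_mono[OF assms, of s "max s 0"] soft_pos_zero[OF assms, of 0] by simp
qed

lemma smooth_soft_pos: "smooth (soft_pos \<epsilon>)"
proof
  fix k
  have "Ck k (\<lambda>s::real. flat_exp 0 ((1 / \<epsilon>) * s + 0))"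
    by (rule Ck_compose[OF _ Ck_affine_real]) (rule smooth_flat_exp[rule_format])
  moreover have "Ck k (\<lambda>s::real. 1 * s + \<epsilon> / 2)" by (rule Ck_affine_real)
  ultimately show "Ck k (soft_pos \<epsilon>)"
    unfolding soft_pos_def[abs_def] using Ck_mult by fastforce
qed

lemma soft_pos_primitive_bounds:
  "0 \<le> soft_pos_primitive \<epsilon> s" "\<epsilon> > 0 \<Longrightarrow> soft_pos_primitive \<epsilon> s \<le> (max s 0)\<^sup>2 / 2"
proof -
  show "0 \<le> soft_pos_primitive \<epsilon> s" by (simp add: soft_pos_primitive_def flat_exp_nonneg)
  assume e: "\<epsilon> > 0"
  show "soft_pos_primitive \<epsilon> s \<le> (max s 0)\<^sup>2 / 2"
  proof (cases "s > 0")
    case True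
    have "flat_exp 0 (s / \<epsilon>) \<le> 1" using True e by (simp add: flat_exp_def)
    then have "s\<^sup>2 / 2 * flat_exp 0 (s / \<epsilon>) \<le> s\<^sup>2 / 2 * 1" by (intro mult_left_mono) auto
    then show ?thesis using True by (simp add: soft_pos_primitive_def)
  next
    case False
    then have "\<not> s / \<epsilon> > 0" using e by (simp add: zero_less_divide_iff)
    then show ?thesis by (simp add: soft_pos_primitive_def flat_exp_def)
  qed
qed

lemma soft_pos_primitive_tendsto:
  assumes e: "\<And>n::nat. \<epsilon> n > 0" "\<epsilon> \<longlonglongrightarrow> 0"
  shows "(\<lambda>n. soft_pos_primitive (\<epsilon> n) s) \<longlonglongrightarrow> (max s 0)\<^sup>2 / 2"
proof (cases "s > 0")
  case True
  have "soft_pos_primitive (\<epsilon> n) s = s\<^sup>2 / 2 * exp (- (\<epsilon> n / s))" for n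
    using True e(1)[of n] by (simp add: soft_pos_primitive_def flat_exp_def)
  then have eq: "(\<lambda>n. soft_pos_primitive (\<epsilon> n) s) = (\<lambda>n. s\<^sup>2 / 2 * exp (- (\<epsilon> n / s)))" by blast
  have "(\<lambda>n. s\<^sup>2 / 2 * exp (- (\<epsilon> n / s))) \<longlonglongrightarrow> s\<^sup>2 / 2 * exp (- (0 / s))"
    using True by (intro tendsto_intros e(2)) auto
  then show ?thesis unfolding eq using True by simp
next
  case False
  then have "\<not> s / \<epsilon> n > 0" for n using e(1)[of n] by (simp add: zero_less_divide_iff)
  then show ?thesis using False by (simp add: soft_pos_primitive_def flat_exp_def max_def)
qed

lemma convex_of_mono_deriv:
  fixes G \<beta> :: "real \<Rightarrow> real"
  assumes d: "\<And>s. (G has_real_derivative \<beta> s) (at s)" and m: "\<And>a b. a \<le> b \<Longrightarrow> \<beta> a \<le> \<beta> b"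
  shows "G s - G r \<le> \<beta> s * (s - r)"
proof -
  consider "r < s" | "s < r" | "r = s" by linarith
  then show ?thesis
  proof cases
    case 1
    then obtain z where z: "r < z" "z < s" "G s - G r = (s - r) * \<beta> z" using MVT2[OF 1, of G \<beta>] d by blast
    then show ?thesis using mult_left_mono[OF m[of z s], of "s - r"] 1 by (simp add: mult.commute)
  next
    case 2
    then obtain z where z: "s < z" "z < r" "G r - G s = (r - s) * \<beta> z" using MVT2[OF 2, of G \<beta>] d by blast
    then show ?thesis using mult_left_mono[OF m[of s z], of "r - s"] 2 by (simp add: algebra_simps)
  qed simp
qed

text \<open>The sign \<open>\<sigma>\<close> selects between truncating above and below the level \<open>k\<close>.\<close>

lemma truncation_soft_pos:
  assumes e: "\<epsilon> > 0" and \<sigma>: "\<sigma> = 1 \<or> \<sigma> = - 1" and k: "\<sigma> * (0 - k) \<le> 0"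
  shows "truncation (\<lambda>s. \<sigma> * soft_pos \<epsilon> (\<sigma> * (s - k))) (\<lambda>s. soft_pos_deriv \<epsilon> (\<sigma> * (s - k)))"
proof
  show "\<sigma> * soft_pos \<epsilon> (\<sigma> * (0 - k)) = 0" by (simp only: soft_pos_zero[OF e k] mult_zero_right)
  show "0 \<le> soft_pos_deriv \<epsilon> (\<sigma> * (s - k))" "soft_pos_deriv \<epsilon> (\<sigma> * (s - k)) \<le> 1" for s
    using soft_pos_deriv_bounds[OF e] by auto
  show "((\<lambda>s. \<sigma> * soft_pos \<epsilon> (\<sigma> * (s - k))) has_real_derivative soft_pos_deriv \<epsilon> (\<sigma> * (s - k))) (at s)" for s
  proof -
    have "((\<lambda>s. \<sigma> * (s - k)) has_real_derivative \<sigma>) (at s)" by (auto intro!: derivative_eq_intros)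
    from DERIV_cmult[OF DERIV_chain2[OF soft_pos_has_derivative[OF e] this], of \<sigma>]
    show ?thesis using \<sigma> by (auto simp: mult.commute)
  qed
  show "smooth (\<lambda>s. \<sigma> * soft_pos \<epsilon> (\<sigma> * (s - k)))"
  proof
    fix j
    have "Ck j (\<lambda>s. soft_pos \<epsilon> (\<sigma> * s + (- \<sigma> * k)))"
      by (rule Ck_compose[OF _ Ck_affine_real]) (rule smooth_soft_pos[rule_format])
    then have "Ck j (\<lambda>s. soft_pos \<epsilon> (\<sigma> * (s - k)))" by (simp add: algebra_simps)
    then show "Ck j (\<lambda>s. \<sigma> * soft_pos \<epsilon> (\<sigma> * (s - k)))" by (intro Ck_mult Ck_const)
  qed
qed

section \<open>Bochner spaces of functions and functionals\<close>

context bounded_open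
begin

lemma seminormed_L2: "seminormed (L2 \<Omega> :: ('a \<Rightarrow> real) set) (L2_norm \<Omega>)"
proof
  show "(\<lambda>x. 0) \<in> L2 \<Omega>" by (rule L2_zero)
  show "f - g \<in> L2 \<Omega>" if "f \<in> L2 \<Omega>" "g \<in> L2 \<Omega>" for f g :: "'a \<Rightarrow> real"
    using L2_diff[OF that] by (simp add: fun_diff_def)
  show "L2_norm \<Omega> (f - g) \<le> L2_norm \<Omega> f + L2_norm \<Omega> g" if "f \<in> L2 \<Omega>" "g \<in> L2 \<Omega>" for f g :: "'a \<Rightarrow> real"
    using L2_norm_triangle[OF that(1) L2_scaleR[OF that(2), of "-1"]] L2_norm_scaleR[of \<Omega> "-1" g]
    by (simp add: fun_diff_def)
qed (simp_all add: L2_norm_def)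

lemma seminormed_H10: "seminormed (H10 \<Omega>) (H1_norm \<Omega>)"
proof
  show "(\<lambda>x. 0) \<in> H10 \<Omega>" by (rule H10_zero)
  show "f - g \<in> H10 \<Omega>" if "f \<in> H10 \<Omega>" "g \<in> H10 \<Omega>" for f g
    using H10_diff[OF that] by (simp add: fun_diff_def)
  show "H1_norm \<Omega> (\<lambda>x. 0) = 0"
    using H1_norm_cmult[OF H10_H1[OF H10_zero], of 0] by simp
  show "H1_norm \<Omega> (f - g) \<le> H1_norm \<Omega> f + H1_norm \<Omega> g" if "f \<in> H10 \<Omega>" "g \<in> H10 \<Omega>" for f g
    using H1_norm_triangle[OF H10_H1[OF that(1)] H10_H1[OF H10_cmult[OF that(2), of "-1"]]]
      H1_norm_cmult[OF H10_H1[OF that(2)], of "-1"] by (simp add: fun_diff_def)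
qed simp

text \<open>\<open>Hm1_norm\<close> is a supremum of reals and meaningful only after the set is
  bounded, which the constant in \<open>Hm1\<close> provides. An \<open>f\<close> of norm 0 cannot
  be normalised and is treated separately; it need not be the zero function.\<close>

lemma Hm1_bound:
  assumes l: "l \<in> Hm1 \<Omega>" and f: "f \<in> H10 \<Omega>"
  shows "\<bar>l f\<bar> \<le> Hm1_norm \<Omega> l * H1_norm \<Omega> f"
proof -
  obtain C where C: "\<forall>f\<in>H10 \<Omega>. \<bar>l f\<bar> \<le> C * H1_norm \<Omega> f" using l unfolding Hm1_def by blast
  have bdd: "bdd_above ((\<lambda>f. \<bar>l f\<bar>) ` {f \<in> H10 \<Omega>. H1_norm \<Omega> f \<le> 1})"
  proof (rule bdd_aboveI2)
    fix f assume f: "f \<in> {f \<in> H10 \<Omega>. H1_norm \<Omega> f \<le> 1}"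
    have "\<bar>l f\<bar> \<le> C * H1_norm \<Omega> f" using C f by blast
    also have "\<dots> \<le> \<bar>C\<bar> * H1_norm \<Omega> f" by (rule mult_right_mono) auto
    also have "\<dots> \<le> \<bar>C\<bar> * 1" by (rule mult_left_mono) (use f in auto)
    finally show "\<bar>l f\<bar> \<le> \<bar>C\<bar> * 1" .
  qed
  show ?thesis
  proof (cases "H1_norm \<Omega> f = 0")
    case True
    then have "l f = 0" using C f by fastforce
    then show ?thesis using True by simp
  next
    case False
    then have p: "H1_norm \<Omega> f > 0" using H1_norm_nonneg[of f] by linarith
    let ?c = "inverse (H1_norm \<Omega> f)"
    have "H1_norm \<Omega> (\<lambda>x. ?c * f x) = 1"
      using H1_norm_cmult[OF H10_H1[OF f], of ?c] p by simp
    then have "\<bar>l (\<lambda>x. ?c * f x)\<bar> \<le> Hm1_norm \<Omega> l"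
      unfolding Hm1_norm_def by (intro cSUP_upper[OF _ bdd]) (simp add: H10_cmult[OF f])
    moreover have "l (\<lambda>x. ?c * f x) = ?c * l f" using l f unfolding Hm1_def by blast
    ultimately have "?c * \<bar>l f\<bar> \<le> Hm1_norm \<Omega> l" using p by (simp add: abs_mult)
    then show ?thesis using p by (simp add: field_simps)
  qed
qed

lemma Hm1_D:
  assumes "l \<in> Hm1 \<Omega>"
  shows "f \<in> H10 \<Omega> \<Longrightarrow> g \<in> H10 \<Omega> \<Longrightarrow> l (\<lambda>x. f x + g x) = l f + l g"
    "f \<in> H10 \<Omega> \<Longrightarrow> l (\<lambda>x. c * f x) = c * l f"
  using assms unfolding Hm1_def by blast+


lemma Hm1_diff_arg:
  assumes l: "l \<in> Hm1 \<Omega>" and "f \<in> H10 \<Omega>" "g \<in> H10 \<Omega>"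
  shows "l (f - g) = l f - l g"
  using Hm1_D(1)[OF l assms(2) H10_cmult[OF assms(3), of "-1"]] Hm1_D(2)[OF l assms(3), of "-1"]
  by (simp add: fun_diff_def)

lemma Hm1_diff:
  assumes "l \<in> Hm1 \<Omega>" "m \<in> Hm1 \<Omega>" shows "l - m \<in> Hm1 \<Omega>"
proof -
  have "\<bar>(l - m) f\<bar> \<le> (Hm1_norm \<Omega> l + Hm1_norm \<Omega> m) * H1_norm \<Omega> f" if "f \<in> H10 \<Omega>" for f
    using Hm1_bound[OF assms(1) that] Hm1_bound[OF assms(2) that] by (simp add: distrib_right)
  then show ?thesis
    unfolding Hm1_def using Hm1_D[OF assms(1)] Hm1_D[OF assms(2)]
    by (intro CollectI conjI ballI allI exI[of _ "Hm1_norm \<Omega> l + Hm1_norm \<Omega> m"]) (simp_all add: right_diff_distrib)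
qed

end

text \<open>Nothing is assumed about the sign of \<open>N\<close>, and integrability gives
  measurability of its square only; the absolute value is recovered as a square root.\<close>

lemma Bochner_norm_L2:
  assumes "w \<in> L2_Bochner T X N"
  shows "(\<lambda>t. \<bar>N (w t)\<bar>) \<in> L2 {0<..<T}"
proof -
  have "(\<lambda>t. sqrt ((N (w t))\<^sup>2)) \<in> borel_measurable (lebesgue_on {0<..<T})"
    by (rule measurable_compose[OF borel_measurable_integrable[OF L2_BochnerD(3)[OF assms]] borel_measurable_sqrt])
  then show ?thesis using L2_BochnerD(3)[OF assms] by (simp add: L2_def)
qed

context seminormed
begin

text \<open>\<open>P\<close> sends the simple approximations to simple maps, and its continuity
  carries the convergence over. The constant \<open>c\<close> admits operators that do not fix 0; it
  is square integrable because the time interval is bounded.\<close>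

lemma Bochner_compose:
  assumes w: "w \<in> L2_Bochner T X N" and P: "\<And>f. f \<in> X \<Longrightarrow> P f \<in> X"
    and cont: "\<And>fn f. \<lbrakk>\<forall>n::nat. fn n \<in> X; f \<in> X; (\<lambda>n. N (f - fn n)) \<longlonglongrightarrow> 0\<rbrakk> \<Longrightarrow> (\<lambda>n. N (P f - P (fn n))) \<longlonglongrightarrow> 0"
    and bound: "\<And>f. f \<in> X \<Longrightarrow> N (P f) \<le> c + N f"
  shows "(\<lambda>t. P (w t)) \<in> L2_Bochner T X N"
proof -
  let ?M = "lebesgue_on {0<..<T}"
  obtain s where s: "\<And>n::nat. simple_map T X (s n)" "AE t in ?M. (\<lambda>n. N (w t - s n t)) \<longlonglongrightarrow> 0"
    using L2_BochnerD(2)[OF w] by blast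
  have I: "AE t in ?M. t \<in> {0<..<T}" by (rule AE_I2) (simp add: space_restrict_space)
  have 1: "AE t in ?M. P (w t) \<in> X" using L2_BochnerD(1)[OF w] by eventually_elim (rule P)
  have 2: "AE t in ?M. (\<lambda>n. N (P (w t) - P (s n t))) \<longlonglongrightarrow> 0"
    using L2_BochnerD(1)[OF w] s(2) I
  proof eventually_elim
    case (elim t)
    show ?case by (rule cont[OF _ elim(1,2)]) (use simple_mapD(1)[OF s(1) elim(3)] in blast)
  qed
  have m: "(\<lambda>t. N (P (w t))) \<in> borel_measurable ?M"
  proof (rule L2_Bochner_measurable[OF w])
    fix fn f assume *: "\<forall>n::nat. fn n \<in> X" "f \<in> X" "(\<lambda>n. N (f - fn n)) \<longlonglongrightarrow> 0"
    show "(\<lambda>n. N (P (fn n))) \<longlonglongrightarrow> N (P f)"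
      by (rule N_tendsto[OF _ P[OF *(2)] cont[OF *]]) (use *(1) P in blast)
  qed
  have 3: "integrable ?M (\<lambda>t. (N (P (w t)))\<^sup>2)"
  proof (rule Bochner_Integration.integrable_bound)
    show "integrable ?M (\<lambda>t. 2 * c\<^sup>2 + 2 * (N (w t))\<^sup>2)"
      by (intro Bochner_Integration.integrable_add integrable_mult_right L2_BochnerD(3)[OF w]
          finite_measure.integrable_const finite_measure_lebesgue_on) simp
    show "(\<lambda>t. (N (P (w t)))\<^sup>2) \<in> borel_measurable ?M" using m by measurable
    show "AE t in ?M. norm ((N (P (w t)))\<^sup>2) \<le> norm (2 * c\<^sup>2 + 2 * (N (w t))\<^sup>2)"
      using L2_BochnerD(1)[OF w]
    proof eventually_elim
      case (elim t)
      have "(N (P (w t)))\<^sup>2 \<le> (c + N (w t))\<^sup>2" by (rule power_mono[OF bound[OF elim] N_nonneg])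
      also have "\<dots> \<le> 2 * c\<^sup>2 + 2 * (N (w t))\<^sup>2"
        using zero_le_power2[of "c - N (w t)"] unfolding power2_diff power2_sum by linarith
      finally show ?case by simp
    qed
  qed
  show ?thesis
    unfolding L2_Bochner_def
    by (intro CollectI conjI exI[of _ "\<lambda>n t. P (s n t)"] allI 1 2 3 simple_map_compose[OF s(1)] P)
qed

text \<open>Test functions need no continuity in time, so they may be cut off at a time
  \<open>b\<close>. This localises an equation tested over \<open>{0<..<T}\<close> to
  \<open>{0<..<b}\<close>.\<close>

lemma Bochner_restrict:
  assumes w: "w \<in> L2_Bochner T X N" and A: "A \<in> sets lebesgue"
  shows "(\<lambda>t. if t \<in> A then w t else (\<lambda>x. 0)) \<in> L2_Bochner T X N"
proof -
  let ?M = "lebesgue_on {0<..<T}"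
  obtain s where s: "\<And>n::nat. simple_map T X (s n)" "AE t in ?M. (\<lambda>n. N (w t - s n t)) \<longlonglongrightarrow> 0"
    using L2_BochnerD(2)[OF w] by blast
  have z: "(\<lambda>x. 0) - (\<lambda>x. 0) = (\<lambda>x::'c. 0::real)" by (simp add: fun_diff_def)
  have 1: "AE t in ?M. (if t \<in> A then w t else (\<lambda>x. 0)) \<in> X"
    using L2_BochnerD(1)[OF w] by eventually_elim (simp add: X_zero)
  have 2: "AE t in ?M. (\<lambda>n. N ((if t \<in> A then w t else (\<lambda>x. 0)) - (if t \<in> A then s n t else (\<lambda>x. 0)))) \<longlonglongrightarrow> 0"
    using s(2) by eventually_elim (simp add: z N_zero)
  have ind: "indicat_real A \<in> borel_measurable ?M"
    by (intro measurable_restrict_space1 borel_measurable_indicator A)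
  have 3: "integrable ?M (\<lambda>t. (N (if t \<in> A then w t else (\<lambda>x. 0)))\<^sup>2)"
  proof -
    have "integrable ?M (\<lambda>t. indicat_real A t * (N (w t))\<^sup>2)"
      by (rule Bochner_Integration.integrable_bound[OF L2_BochnerD(3)[OF w]
            borel_measurable_times[OF ind borel_measurable_integrable[OF L2_BochnerD(3)[OF w]]]])
        (simp add: indicator_def)
    moreover have "indicat_real A t * (N (w t))\<^sup>2 = (N (if t \<in> A then w t else (\<lambda>x. 0)))\<^sup>2" for t
      by (simp add: N_zero)
    ultimately show ?thesis by simp
  qed
  show ?thesis
    unfolding L2_Bochner_def
    by (intro CollectI conjI exI[of _ "\<lambda>n t. if t \<in> A then s n t else (\<lambda>x. 0)"] allI 1 2 3
        simple_map_if s(1) simple_map_const X_zero A)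
qed

end

section \<open>Gronwall's inequality and essential bounds\<close>

text \<open>The primitive \<open>z\<close> of \<open>y\<close> satisfies \<open>z' \<le> C z\<close>
  and starts at 0, so \<open>exp (- C s) * z s\<close> is nonincreasing and
  \<open>z \<le> 0\<close>; the hypothesis then bounds \<open>y\<close> itself.\<close>

lemma Gronwall_zero:
  fixes y :: "real \<Rightarrow> real"
  assumes C: "C \<ge> 0" and y: "continuous_on {0..T} y"
    and le: "\<And>b. 0 < b \<Longrightarrow> b \<le> T \<Longrightarrow> y b \<le> C * integral {0..b} y" and t: "0 < t" "t \<le> T"
  shows "y t \<le> 0"
proof -
  define z where "z s = integral {0..s} y" for s
  define f where "f s = exp (- C * s) * z s" for s
  have zc: "continuous_on {0..T} z"
    unfolding z_def by (rule indefinite_integral_continuous_1[OF integrable_continuous_real[OF y]])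
  have fc: "continuous_on {0..t} f"
    unfolding f_def using t by (intro continuous_intros continuous_on_subset[OF zc]) auto
  have d: "\<exists>d. (f has_real_derivative d) (at s) \<and> d \<le> 0" if s: "0 < s" "s < t" for s
  proof -
    have "(z has_real_derivative y s) (at s within {0..T})"
      unfolding z_def by (rule integral_has_real_derivative[OF y]) (use s t in auto)
    then have zd: "(z has_real_derivative y s) (at s)"
      using s t by (simp add: at_within_Icc_at)
    have "((\<lambda>s. exp (- C * s)) has_real_derivative (exp (- C * s) * (- C))) (at s)"
      by (auto intro!: derivative_eq_intros)
    from DERIV_mult[OF this zd]
    have "(f has_real_derivative exp (- C * s) * (- C) * z s + y s * exp (- C * s)) (at s)"
      unfolding f_def[abs_def] .
    moreover have "exp (- C * s) * (- C) * z s + y s * exp (- C * s) = exp (- C * s) * (y s - C * z s)"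
      by (simp add: algebra_simps)
    moreover have "\<dots> \<le> 0"
      using le[of s] s t by (intro mult_nonneg_nonpos) (auto simp: z_def)
    ultimately show ?thesis by metis
  qed
  have "f t \<le> f 0"
    by (rule DERIV_nonpos_imp_decreasing_open[OF less_imp_le[OF t(1)] _ fc]) (use d in blast)
  then have "z t \<le> 0" by (simp add: f_def z_def mult_le_0_iff)
  then have "C * z t \<le> 0" using C by (simp add: mult_nonneg_nonpos)
  then show ?thesis using le[OF t] by (simp add: z_def)
qed

text \<open>Measurability of the exceptional set allows the use of Tonelli's theorem in the completion.\<close>

lemma AE_space_time:
  fixes \<Omega> :: "'a::euclidean_space set" and P :: "'a \<Rightarrow> real \<Rightarrow> bool"
  assumes \<Omega>: "\<Omega> \<in> sets lebesgue" and B: "{(x, t) \<in> space_time T \<Omega>. \<not> P x t} \<in> sets lebesgue"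
    and ae: "AE t in lebesgue_on {0<..<T}. AE x in lebesgue_on \<Omega>. P x t"
    and S: "space_time T \<Omega> \<in> sets lebesgue"
  shows "AE (x, t) in lebesgue_on (space_time T \<Omega>). P x t"
proof -
  define B where "B = {(x, t) \<in> space_time T \<Omega>. \<not> P x t}"
  \<comment> \<open>The exceptional set is a Borel set \<open>A\<close> up to a null set. Tonelli's
    theorem is applied to \<open>A\<close>, whose sections are null for almost every time.\<close>
  obtain A N N' where A: "B = A \<union> N" "N \<subseteq> N'" "N' \<in> null_sets lborel" "A \<in> sets lborel"
    using assms(2) unfolding B_def[symmetric] by (rule sets_completionE)
  have A': "A \<in> sets (lborel \<Otimes>\<^sub>M lborel)" unfolding lborel_prod by (rule A(4))
  have ae': "AE t in lborel. emeasure lborel ((\<lambda>x. (x, t)) -` A) = 0"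
  proof -
    have "AE t in lebesgue. t \<in> {0<..<T} \<longrightarrow> (AE x in lebesgue_on \<Omega>. P x t)"
      using ae by (subst (asm) AE_restrict_space_iff) auto
    \<comment> \<open>\<open>space_time\<close> contains the final time \<open>T\<close>, about
      which the hypothesis on \<open>{0<..<T}\<close> says nothing.\<close>
    moreover have "AE t in lebesgue. t \<noteq> T"
      by (rule AE_completion[OF AE_lborel_singleton])
    ultimately have "AE t in lebesgue. emeasure lborel ((\<lambda>x. (x, t)) -` A) = 0"
    proof eventually_elim
      case (elim t)
      have sub: "(\<lambda>x. (x, t)) -` A \<subseteq> {x \<in> \<Omega>. t \<in> {0<..T} \<and> \<not> P x t}"
        using A(1) by (auto simp: B_def space_time_def)
      show ?case
      proof (cases "t \<in> {0<..<T}")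
        case False
        then have "(\<lambda>x. (x, t)) -` A = {}" using sub elim(2) by force
        then show ?thesis by simp
      next
        case True
        have "AE x in lebesgue. x \<in> \<Omega> \<longrightarrow> P x t"
          using elim(1) True \<Omega> by (subst (asm) AE_restrict_space_iff) auto
        then have "AE x in lborel. x \<in> \<Omega> \<longrightarrow> P x t" by (simp add: AE_completion_iff)
        then have "AE x in lborel. x \<notin> (\<lambda>x. (x, t)) -` A" by eventually_elim (use sub in blast)
        moreover have "(\<lambda>x. (x, t)) -` A \<in> sets lborel"
          by (rule sets_Pair2[OF A']) 
        ultimately have "(\<lambda>x. (x, t)) -` A \<in> null_sets lborel" by (simp only: AE_iff_null_sets)
        then show ?thesis by (rule null_setsD1)
      qed
    qed
    then show ?thesis by (simp add: AE_completion_iff)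
  qed
  have "emeasure lborel A = emeasure (lborel \<Otimes>\<^sub>M lborel) A" by (simp add: lborel_prod)
  also have "\<dots> = (\<integral>\<^sup>+ t. emeasure lborel ((\<lambda>x. (x, t)) -` A) \<partial>lborel)"
    by (rule lborel_pair.emeasure_pair_measure_alt2[OF A'])
  also have "\<dots> = (\<integral>\<^sup>+ t. 0 \<partial>(lborel :: real measure))"
    by (rule nn_integral_cong_AE[OF ae'])
  finally have "A \<in> null_sets lborel" using A(4) by (simp add: null_sets_def)
  then have "A \<union> N' \<in> null_sets lborel" using A(3) by blast
  then have "AE p in lborel. p \<notin> A \<union> N'" by (rule AE_not_in)
  then have "AE p in lebesgue. p \<notin> A \<union> N'" by (rule AE_completion)
  then have "AE p in lebesgue. p \<in> space_time T \<Omega> \<longrightarrow> (case p of (x, t) \<Rightarrow> P x t)"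
  proof eventually_elim
    case (elim p)
    then have "p \<notin> B" using A(1,2) by blast
    then show ?case by (auto simp: B_def)
  qed
  then show ?thesis using S by (subst AE_restrict_space_iff) auto
qed

text \<open>\<open>real_of_ereal\<close> sends infinite values to 0, so finiteness has to be shown.
  A value below \<open>- C\<close> would contradict \<open>\<bar>f x\<bar> \<le> C\<close> almost
  everywhere, unless \<open>\<Omega>\<close> were null, which an open nonempty set is not.\<close>

lemma ess_sup_on_AE:
  assumes \<Omega>: "open \<Omega>" "\<Omega> \<noteq> {}" and f: "f \<in> Linf \<Omega>"
  shows "AE x in lebesgue_on \<Omega>. f x \<le> ess_sup_on \<Omega> f"
proof -
  let ?M = "lebesgue_on \<Omega>" and ?s = "esssup (lebesgue_on \<Omega>) (\<lambda>x. ereal (f x))"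
  obtain C where C: "AE x in ?M. \<bar>f x\<bar> \<le> C" and m: "f \<in> borel_measurable ?M"
    using f unfolding Linf_def by blast
  have le: "AE x in ?M. ereal (f x) \<le> ?s" by (rule esssup_AE)
  have "?s \<le> ereal C"
  proof (rule esssup_I)
    show "AE x in ?M. ereal (f x) \<le> ereal C" using C by eventually_elim simp
  qed (use m in simp)
  moreover have "ereal (- C) \<le> ?s"
  proof (rule ccontr)
    assume n: "\<not> ereal (- C) \<le> ?s"
    have "AE x in ?M. False"
      using le C
    proof (rule eventually_elim2)
      fix x assume x: "ereal (f x) \<le> ?s" "\<bar>f x\<bar> \<le> C"
      then have "ereal (- C) \<le> ereal (f x)" by simp
      then show False using x(1) n order_trans by blast
    qed
    then have "emeasure ?M (space ?M) = 0"
      using AE_iff_measurable[of "space ?M" ?M "\<lambda>_. False"] by simp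
    moreover have "emeasure ?M (space ?M) = emeasure lebesgue \<Omega>"
      using \<Omega>(1) by (simp add: space_restrict_space emeasure_restrict_space)
    ultimately have "negligible \<Omega>" using \<Omega>(1) by (simp add: negligible_iff_null_sets null_sets_def)
    then show False using open_not_negligible[OF \<Omega>] by blast
  qed
  ultimately obtain r where r: "?s = ereal r" by (cases ?s) auto
  show ?thesis using le unfolding ess_sup_on_def r by simp
qed

lemma ess_inf_on_AE:
  assumes \<Omega>: "open \<Omega>" "\<Omega> \<noteq> {}" and f: "f \<in> Linf \<Omega>"
  shows "AE x in lebesgue_on \<Omega>. ess_inf_on \<Omega> f \<le> f x"
proof -
  have "(\<lambda>x. - f x) \<in> Linf \<Omega>" using f unfolding Linf_def by auto
  from ess_sup_on_AE[OF \<Omega> this] show ?thesis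
    unfolding ess_inf_on_def by eventually_elim simp
qed

section \<open>One-sided comparison\<close>

text \<open>Used for test functions cut off at time \<open>b\<close>: each term of the tested
  equation becomes an integral over \<open>{0<..<b}\<close>. Measurability of \<open>f\<close> is
  deduced from the agreement with \<open>g\<close> rather than assumed.\<close>

lemma LINT_restrict_AE:
  fixes f g :: "real \<Rightarrow> real"
  assumes g: "g \<in> borel_measurable (lebesgue_on {0<..<T})"
    and ae: "AE t in lebesgue_on {0<..<T}. f t = (if t \<in> {0<..<b} then g t else 0)" and b: "b \<le> T"
  shows "(LINT t|lebesgue_on {0<..<T}. f t) = (LINT t|lebesgue_on {0<..<b}. g t)"
proof -
  let ?M = "lebesgue_on {0<..<T}"
  have "indicat_real {0<..<b} \<in> borel_measurable ?M"
    by (intro measurable_restrict_space1 borel_measurable_indicator) simp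
  then have "(\<lambda>t. indicat_real {0<..<b} t * g t) \<in> borel_measurable ?M"
    using g by (rule borel_measurable_times)
  moreover have "(\<lambda>t. indicat_real {0<..<b} t * g t) = (\<lambda>t. if t \<in> {0<..<b} then g t else 0)"
    by (auto simp: indicator_def)
  ultimately have m: "(\<lambda>t. if t \<in> {0<..<b} then g t else 0) \<in> borel_measurable ?M" by simp
  have "f \<in> borel_measurable ?M"
    by (rule borel_measurable_lebesgue_on_AE_limit[OF _ m])
      (use ae in \<open>simp, eventually_elim, simp\<close>)
  then have "(LINT t|?M. f t) = (LINT t|?M. (if t \<in> {0<..<b} then g t else 0))"
    by (rule integral_cong_AE[OF _ m ae])
  also have "\<dots> = (LINT t|lebesgue_on {0<..<b}. g t)"
    using b by (intro Lebesgue_Measure.integral_restrict) auto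
  finally show ?thesis .
qed

context bounded_open
begin

lemma lipschitz_compose_L2:
  fixes \<rho> :: "real \<Rightarrow> real"
  assumes lip: "\<And>a b. \<bar>\<rho> a - \<rho> b\<bar> \<le> \<bar>a - b\<bar>" and f: "f \<in> L2 \<Omega>"
  shows "(\<lambda>x. \<rho> (f x)) \<in> L2 \<Omega>" "L2_norm \<Omega> (\<lambda>x. \<rho> (f x)) \<le> L2_norm \<Omega> (\<lambda>x. \<bar>\<rho> 0\<bar>) + L2_norm \<Omega> f"
    "g \<in> L2 \<Omega> \<Longrightarrow> L2_norm \<Omega> (\<lambda>x. \<rho> (f x) - \<rho> (g x)) \<le> L2_norm \<Omega> (\<lambda>x. f x - g x)"
proof -
  have cont: "continuous_on UNIV \<rho>"
    unfolding continuous_on_iff dist_real_def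
  proof (intro ballI allI impI)
    fix s e :: real assume "e > 0"
    then show "\<exists>d>0. \<forall>r\<in>UNIV. \<bar>r - s\<bar> < d \<longrightarrow> \<bar>\<rho> r - \<rho> s\<bar> < e" using lip le_less_trans by blast
  qed
  have nf: "(\<lambda>x. norm (f x)) \<in> L2 \<Omega>" by (rule L2I_bound[OF f]) (use L2_measurable[OF f] in auto)
  have c: "(\<lambda>x. \<bar>\<rho> 0\<bar>) \<in> L2 \<Omega>" by (rule L2_const[OF lmeasurable_\<Omega>])
  have le: "AE x in lebesgue_on \<Omega>. norm (\<rho> (f x)) \<le> norm (\<bar>\<rho> 0\<bar> + norm (f x))"
  proof (rule AE_I2)
    fix x show "norm (\<rho> (f x)) \<le> norm (\<bar>\<rho> 0\<bar> + norm (f x))" using lip[of "f x" 0] by simp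
  qed
  have comp: "(\<lambda>x. \<rho> (f x)) \<in> L2 \<Omega>" if f: "f \<in> L2 \<Omega>" for f
  proof -
    have nf: "(\<lambda>x. norm (f x)) \<in> L2 \<Omega>" by (rule L2I_bound[OF f]) (use L2_measurable[OF f] in auto)
    show ?thesis
    proof (rule L2I_bound[OF L2_add[OF c nf] borel_measurable_continuous_on[OF cont L2_measurable[OF f]] AE_I2])
      fix x show "norm (\<rho> (f x)) \<le> norm (\<bar>\<rho> 0\<bar> + norm (f x))" using lip[of "f x" 0] by simp
    qed
  qed
  show 1: "(\<lambda>x. \<rho> (f x)) \<in> L2 \<Omega>" by (rule comp[OF f])
  have "L2_norm \<Omega> (\<lambda>x. norm (f x)) = L2_norm \<Omega> f" by (simp add: L2_norm_def)
  then show "L2_norm \<Omega> (\<lambda>x. \<rho> (f x)) \<le> L2_norm \<Omega> (\<lambda>x. \<bar>\<rho> 0\<bar>) + L2_norm \<Omega> f"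
    using L2_norm_mono[OF 1 L2_add[OF c nf] le] L2_norm_triangle[OF c nf] by linarith
  show "L2_norm \<Omega> (\<lambda>x. \<rho> (f x) - \<rho> (g x)) \<le> L2_norm \<Omega> (\<lambda>x. f x - g x)" if g: "g \<in> L2 \<Omega>"
    by (rule L2_norm_mono[OF L2_diff[OF 1 comp[OF g]] L2_diff[OF f g]]) (simp add: lip)
qed

text \<open>Bochner distances are written as \<open>f - fn n\<close>, the convergence lemmas for
  \<open>H1\<close> with the opposite sign. Since \<open>weak_gradient\<close> is a choice,
  exchanging the two uses membership in \<open>H1\<close>.\<close>

lemma H10_conv:
  assumes "\<forall>n. fn n \<in> H10 \<Omega>" "f \<in> H10 \<Omega>" "(\<lambda>n. H1_norm \<Omega> (f - fn n)) \<longlonglongrightarrow> 0"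
  shows "(\<lambda>n. H1_norm \<Omega> (\<lambda>x. fn n x - f x)) \<longlonglongrightarrow> 0"
proof -
  have "H1_norm \<Omega> (f - fn n) = H1_norm \<Omega> (\<lambda>x. fn n x - f x)" for n
    using H1_norm_minus_commute[OF H10_H1[OF assms(2)] H10_H1[of "fn n"]] assms(1) by (simp add: fun_diff_def)
  then show ?thesis using assms(3) by simp
qed

lemma L2_conv:
  assumes "(\<lambda>n. L2_norm \<Omega> (f - fn n)) \<longlonglongrightarrow> 0"
  shows "(\<lambda>n. L2_norm \<Omega> (\<lambda>x. fn n x - f x)) \<longlonglongrightarrow> 0"
  using assms L2_norm_minus_commute[of \<Omega> f] by (simp add: fun_diff_def)

lemma lipschitz2_compose_L2:
  fixes \<Psi> :: "real \<Rightarrow> real \<Rightarrow> real"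
  assumes lip: "\<And>a b c d. \<bar>\<Psi> a b - \<Psi> c d\<bar> \<le> Lu * \<bar>a - c\<bar> + Lv * \<bar>b - d\<bar>" and L: "Lu > 0" "Lv > 0"
    and f: "f \<in> L2 \<Omega>" and g: "g \<in> L2 \<Omega>"
  shows "(\<lambda>x. \<Psi> (f x) (g x)) \<in> L2 \<Omega>"
    "L2_norm \<Omega> (\<lambda>x. \<Psi> (f x) (g x)) \<le> L2_norm \<Omega> (\<lambda>x. \<bar>\<Psi> 0 0\<bar>) + Lu * L2_norm \<Omega> f + Lv * L2_norm \<Omega> g"
    "f' \<in> L2 \<Omega> \<Longrightarrow> g' \<in> L2 \<Omega> \<Longrightarrow> L2_norm \<Omega> (\<lambda>x. \<Psi> (f x) (g x) - \<Psi> (f' x) (g' x))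
      \<le> Lu * L2_norm \<Omega> (\<lambda>x. f x - f' x) + Lv * L2_norm \<Omega> (\<lambda>x. g x - g' x)"
proof -
  have cont: "continuous_on UNIV (\<lambda>p. \<Psi> (fst p) (snd p))"
  proof (rule continuous_at_imp_continuous_on, intro ballI)
    fix p :: "real \<times> real"
    have "((\<lambda>r. Lu * \<bar>fst r - fst p\<bar> + Lv * \<bar>snd r - snd p\<bar>) \<longlongrightarrow> Lu * \<bar>fst p - fst p\<bar> + Lv * \<bar>snd p - snd p\<bar>) (at p)"
      by (intro tendsto_add tendsto_mult_left tendsto_rabs tendsto_diff tendsto_fst tendsto_snd tendsto_const tendsto_ident_at)
    then have 0: "((\<lambda>r. Lu * \<bar>fst r - fst p\<bar> + Lv * \<bar>snd r - snd p\<bar>) \<longlongrightarrow> 0) (at p)" by simp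
    have "\<forall>r. norm (\<Psi> (fst r) (snd r) - \<Psi> (fst p) (snd p)) \<le> Lu * \<bar>fst r - fst p\<bar> + Lv * \<bar>snd r - snd p\<bar>"
      using lip by simp
    from Lim_null_comparison[OF always_eventually[OF this] 0]
    show "isCont (\<lambda>p. \<Psi> (fst p) (snd p)) p" by (simp add: isCont_def LIM_zero_iff)
  qed
  have abs: "(\<lambda>x. \<bar>h x\<bar>) \<in> L2 \<Omega>" "L2_norm \<Omega> (\<lambda>x. \<bar>h x\<bar>) = L2_norm \<Omega> h" if "h \<in> L2 \<Omega>" for h :: "'a \<Rightarrow> real"
    using L2I_bound[OF that, of "\<lambda>x. \<bar>h x\<bar>"] L2_measurable[OF that] by (auto simp: L2_norm_def)
  have sum: "(\<lambda>x. Lu * \<bar>h x\<bar> + Lv * \<bar>h' x\<bar>) \<in> L2 \<Omega>"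
    "L2_norm \<Omega> (\<lambda>x. Lu * \<bar>h x\<bar> + Lv * \<bar>h' x\<bar>) \<le> Lu * L2_norm \<Omega> h + Lv * L2_norm \<Omega> h'"
    if "h \<in> L2 \<Omega>" "h' \<in> L2 \<Omega>" for h h' :: "'a \<Rightarrow> real"
  proof -
    note a = L2_cmult[OF abs(1)[OF that(1)], of Lu] and b = L2_cmult[OF abs(1)[OF that(2)], of Lv]
    show "(\<lambda>x. Lu * \<bar>h x\<bar> + Lv * \<bar>h' x\<bar>) \<in> L2 \<Omega>" by (rule L2_add[OF a b])
    show "L2_norm \<Omega> (\<lambda>x. Lu * \<bar>h x\<bar> + Lv * \<bar>h' x\<bar>) \<le> Lu * L2_norm \<Omega> h + Lv * L2_norm \<Omega> h'"
      using L2_norm_triangle[OF a b] L2_norm_scaleR[of \<Omega> Lu "\<lambda>x. \<bar>h x\<bar>"] L2_norm_scaleR[of \<Omega> Lv "\<lambda>x. \<bar>h' x\<bar>"]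
        abs(2)[OF that(1)] abs(2)[OF that(2)] L by simp
  qed
  have comp: "(\<lambda>x. \<Psi> (f x) (g x)) \<in> L2 \<Omega>" "L2_norm \<Omega> (\<lambda>x. \<Psi> (f x) (g x)) \<le> L2_norm \<Omega> (\<lambda>x. \<bar>\<Psi> 0 0\<bar>) + Lu * L2_norm \<Omega> f + Lv * L2_norm \<Omega> g"
    if f: "f \<in> L2 \<Omega>" and g: "g \<in> L2 \<Omega>" for f g
  proof -
    note c = L2_const[OF lmeasurable_\<Omega>, of "\<bar>\<Psi> 0 0\<bar>"] and s = sum[OF f g]
    have "(\<lambda>x. \<Psi> (f x) (g x)) \<in> borel_measurable (lebesgue_on \<Omega>)"
      using L2_measurable[OF f] L2_measurable[OF g] cont by (rule borel_measurable_continuous_Pair)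
    moreover have le: "AE x in lebesgue_on \<Omega>. norm (\<Psi> (f x) (g x)) \<le> norm (\<bar>\<Psi> 0 0\<bar> + (Lu * \<bar>f x\<bar> + Lv * \<bar>g x\<bar>))"
    proof (rule AE_I2)
      fix x show "norm (\<Psi> (f x) (g x)) \<le> norm (\<bar>\<Psi> 0 0\<bar> + (Lu * \<bar>f x\<bar> + Lv * \<bar>g x\<bar>))"
        using lip[of "f x" "g x" 0 0] by simp
    qed
    ultimately show 1: "(\<lambda>x. \<Psi> (f x) (g x)) \<in> L2 \<Omega>" by (intro L2I_bound[OF L2_add[OF c s(1)]])
    show "L2_norm \<Omega> (\<lambda>x. \<Psi> (f x) (g x)) \<le> L2_norm \<Omega> (\<lambda>x. \<bar>\<Psi> 0 0\<bar>) + Lu * L2_norm \<Omega> f + Lv * L2_norm \<Omega> g"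
      using L2_norm_mono[OF 1 L2_add[OF c s(1)] le] L2_norm_triangle[OF c s(1)] s(2) by linarith
  qed
  show "(\<lambda>x. \<Psi> (f x) (g x)) \<in> L2 \<Omega>"
    "L2_norm \<Omega> (\<lambda>x. \<Psi> (f x) (g x)) \<le> L2_norm \<Omega> (\<lambda>x. \<bar>\<Psi> 0 0\<bar>) + Lu * L2_norm \<Omega> f + Lv * L2_norm \<Omega> g"
    by (rule comp[OF f g])+
  assume f': "f' \<in> L2 \<Omega>" and g': "g' \<in> L2 \<Omega>"
  note s = sum[OF L2_diff[OF f f'] L2_diff[OF g g']]
  have "L2_norm \<Omega> (\<lambda>x. \<Psi> (f x) (g x) - \<Psi> (f' x) (g' x)) \<le> L2_norm \<Omega> (\<lambda>x. Lu * \<bar>f x - f' x\<bar> + Lv * \<bar>g x - g' x\<bar>)"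
  proof (rule L2_norm_mono[OF L2_diff[OF comp(1)[OF f g] comp(1)[OF f' g']] s(1) AE_I2])
    fix x show "norm (\<Psi> (f x) (g x) - \<Psi> (f' x) (g' x)) \<le> norm (Lu * \<bar>f x - f' x\<bar> + Lv * \<bar>g x - g' x\<bar>)"
      using lip[of "f x" "g x" "f' x" "g' x"] by simp
  qed
  then show "L2_norm \<Omega> (\<lambda>x. \<Psi> (f x) (g x) - \<Psi> (f' x) (g' x))
      \<le> Lu * L2_norm \<Omega> (\<lambda>x. f x - f' x) + Lv * L2_norm \<Omega> (\<lambda>x. g x - g' x)"
    using s(2) by linarith
qed

text \<open>The chosen gradient of the zero function vanishes only almost everywhere, which is
  enough under the integral. Needed at times where the test function has been cut off.\<close>

lemma weak_gradient_zero_inner: "L2_inner \<Omega> h (weak_gradient \<Omega> (\<lambda>x. 0)) = 0"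
proof -
  have "AE x in lebesgue_on \<Omega>. weak_gradient \<Omega> (\<lambda>x. 0) x = 0"
    using H1_cmult(2)[OF H10_H1[OF H10_zero], of 0] by simp
  then have "AE x in lebesgue_on \<Omega>. h x \<bullet> weak_gradient \<Omega> (\<lambda>x. 0) x = 0" by eventually_elim simp
  then show ?thesis unfolding L2_inner_def by (rule integral_eq_zero_AE)
qed

end

text \<open>For \<open>\<sigma> = 1\<close> the level \<open>k\<close> is an upper bound for \<open>u\<close> and \<open>m\<close> a lower bound for \<open>v\<close>;
  for \<open>\<sigma> = - 1\<close> the roles are exchanged.\<close>

locale comparison = bounded_open \<Omega> for \<Omega> :: "'a::euclidean_space set" +
  fixes T :: real and D :: "real \<Rightarrow> real \<Rightarrow> real" and F :: "real \<Rightarrow> real \<Rightarrow> 'a" and \<Psi>1 \<Psi>2 :: "real \<Rightarrow> real \<Rightarrow> real"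
    and Lu Lv Dm DM FM CF \<sigma> k m :: real and u v U V :: "real \<Rightarrow> 'a \<Rightarrow> real"
    and ut :: "real \<Rightarrow> ('a \<Rightarrow> real) \<Rightarrow> real" and vt :: "real \<Rightarrow> 'a \<Rightarrow> real"
  assumes T: "T > 0"
    and D_cont: "continuous_on UNIV (\<lambda>p. D (fst p) (snd p))" and D_bounds: "0 < Dm" "\<And>a b. Dm \<le> D a b" "\<And>a b. D a b \<le> DM"
    and F_cont: "continuous_on UNIV (\<lambda>p. F (fst p) (snd p))" and F_bound: "\<And>a b. norm (F a b) \<le> FM"
    and F_lin: "\<And>a b. norm (F a b - F k 0) \<le> CF * \<bar>a - k\<bar>" and CF: "CF \<ge> 0"
    and Lip_pos: "Lu > 0" "Lv > 0"
    and \<Psi>1_lip: "\<And>a b c d. \<bar>\<Psi>1 a b - \<Psi>1 c d\<bar> \<le> Lu * \<bar>a - c\<bar> + Lv * \<bar>b - d\<bar>"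
    and \<Psi>2_lip: "\<And>a b c d. \<bar>\<Psi>2 a b - \<Psi>2 c d\<bar> \<le> Lu * \<bar>a - c\<bar> + Lv * \<bar>b - d\<bar>"
    and \<Psi>1_mono: "\<And>a b c d. a \<le> c \<Longrightarrow> b \<le> d \<Longrightarrow> \<Psi>1 c d \<le> \<Psi>1 a b"
    and \<Psi>2_mono: "\<And>a b c d. a \<le> c \<Longrightarrow> b \<le> d \<Longrightarrow> \<Psi>2 c d \<le> \<Psi>2 a b"
    and \<sigma>: "\<sigma> = 1 \<or> \<sigma> = - 1" and k: "\<sigma> * (0 - k) \<le> 0"
    and \<Psi>1_km: "\<sigma> * \<Psi>1 k m \<le> 0" and \<Psi>2_km: "0 \<le> \<sigma> * \<Psi>2 k m"
    and u: "u \<in> L2_H10 T \<Omega>" and v: "v \<in> L2_L2 T \<Omega>"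
    and ut: "time_deriv_Hm1 T \<Omega> u ut" and vt: "time_deriv_L2 T \<Omega> v vt"
    and v_joint: "(\<lambda>(x, t). v t x) \<in> L2 (space_time T \<Omega>)"
    and U_L2: "\<And>t. t \<in> {0..T} \<Longrightarrow> U t \<in> L2 \<Omega>"
    and U_cont: "\<And>t. t \<in> {0..T} \<Longrightarrow> ((\<lambda>s. L2_norm \<Omega> (U s - U t)) \<longlongrightarrow> 0) (at t within {0..T})"
    and U_eq: "AE t in lebesgue_on {0<..<T}. AE x in lebesgue_on \<Omega>. U t x = u t x"
    and V_L2: "\<And>t. t \<in> {0..T} \<Longrightarrow> V t \<in> L2 \<Omega>"
    and V_cont: "\<And>t. t \<in> {0..T} \<Longrightarrow> ((\<lambda>s. L2_norm \<Omega> (V s - V t)) \<longlongrightarrow> 0) (at t within {0..T})"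
    and V_eq: "AE t in lebesgue_on {0<..<T}. AE x in lebesgue_on \<Omega>. V t x = v t x"
    and U_init: "AE x in lebesgue_on \<Omega>. \<sigma> * (U 0 x - k) \<le> 0"
    and V_init: "AE x in lebesgue_on \<Omega>. \<sigma> * (m - V 0 x) \<le> 0"
    and u_eq: "\<And>\<phi>. \<phi> \<in> L2_H10 T \<Omega> \<Longrightarrow>
           (LINT t|lebesgue_on {0<..<T}. ut t (\<phi> t))
           + (LINT t|lebesgue_on {0<..<T}.
                L2_inner \<Omega> (\<lambda>x. D (u t x) (v t x) *\<^sub>R weak_gradient \<Omega> (u t) x) (weak_gradient \<Omega> (\<phi> t)))
           = (LINT t|lebesgue_on {0<..<T}.
                L2_inner \<Omega> (\<lambda>x. F (u t x) (v t x)) (weak_gradient \<Omega> (\<phi> t)))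
           + (LINT t|lebesgue_on {0<..<T}. L2_inner \<Omega> (\<lambda>x. \<Psi>1 (u t x) (v t x)) (\<phi> t))"
    and v_eq: "\<And>\<xi>. (\<lambda>(x, t). \<xi> t x) \<in> L2 (space_time T \<Omega>) \<Longrightarrow>
           (LINT t|lebesgue_on {0<..<T}. L2_inner \<Omega> (vt t) (\<xi> t))
           = (LINT t|lebesgue_on {0<..<T}. L2_inner \<Omega> (\<lambda>x. \<Psi>2 (u t x) (v t x)) (\<xi> t))"
begin

abbreviation M where "M \<equiv> lebesgue_on {0<..<T}"

section \<open>Positive parts and the sign of the reactions\<close>

definition pu where "pu s = max (\<sigma> * (s - k)) 0"
definition qv where "qv s = max (\<sigma> * (m - s)) 0"

lemma pu_lip: "\<bar>pu a - pu b\<bar> \<le> \<bar>a - b\<bar>" and qv_lip: "\<bar>qv a - qv b\<bar> \<le> \<bar>a - b\<bar>"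
  using \<sigma> by (auto simp: pu_def qv_def)

lemma pu_nonneg: "0 \<le> pu s" and qv_nonneg: "0 \<le> qv s"
  by (auto simp: pu_def qv_def)

text \<open>Monotonicity in the first argument moves \<open>a\<close> to the level \<open>k\<close>.
  If \<open>b\<close> lies on the good side of \<open>m\<close>, monotonicity in the second argument
  leads on to the corner, where the sign is given; otherwise the Lipschitz bound costs
  \<open>Lv\<close> times the deficit \<open>qv b\<close>.\<close>

lemma reaction_1:
  assumes "\<sigma> * (a - k) > 0" shows "\<sigma> * \<Psi>1 a b \<le> Lv * qv b"
proof -
  have "\<sigma> * \<Psi>1 a b \<le> \<sigma> * \<Psi>1 k b"
    using \<sigma> assms \<Psi>1_mono[of k a b b] \<Psi>1_mono[of a k b b] by auto
  also have "\<dots> \<le> Lv * qv b"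
  proof (cases "\<sigma> * (m - b) \<le> 0")
    case True
    then have "\<sigma> * \<Psi>1 k b \<le> \<sigma> * \<Psi>1 k m"
      using \<sigma> \<Psi>1_mono[of k k m b] \<Psi>1_mono[of k k b m] by auto
    then show ?thesis using \<Psi>1_km True by (simp add: qv_def max_def)
  next
    case False
    have "\<sigma> * \<Psi>1 k b \<le> \<sigma> * \<Psi>1 k m + \<bar>\<Psi>1 k b - \<Psi>1 k m\<bar>" using \<sigma> by auto
    moreover have "\<bar>m - b\<bar> = qv b" using \<sigma> False by (auto simp: qv_def)
    ultimately show ?thesis using \<Psi>1_lip[of k b k m] \<Psi>1_km by (simp add: abs_minus_commute)
  qed
  finally show ?thesis .
qed

text \<open>The mirror argument: the second argument is moved to \<open>m\<close> first, then the
  first one is compared with \<open>k\<close> at the cost \<open>Lu * pu a\<close>.\<close>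

lemma reaction_2:
  assumes "\<sigma> * (m - b) > 0" shows "- \<sigma> * \<Psi>2 a b \<le> Lu * pu a"
proof -
  have "- \<sigma> * \<Psi>2 a b \<le> - \<sigma> * \<Psi>2 a m"
    using \<sigma> assms \<Psi>2_mono[of a a b m] \<Psi>2_mono[of a a m b] by auto
  also have "\<dots> \<le> Lu * pu a"
  proof (cases "\<sigma> * (a - k) \<le> 0")
    case True
    then have "- \<sigma> * \<Psi>2 a m \<le> - \<sigma> * \<Psi>2 k m"
      using \<sigma> \<Psi>2_mono[of a k m m] \<Psi>2_mono[of k a m m] by auto
    then show ?thesis using \<Psi>2_km True by (simp add: pu_def max_def)
  next
    case False
    have "- \<sigma> * \<Psi>2 a m \<le> - \<sigma> * \<Psi>2 k m + \<bar>\<Psi>2 a m - \<Psi>2 k m\<bar>" using \<sigma> by auto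
    moreover have "\<bar>a - k\<bar> = pu a" using \<sigma> False by (auto simp: pu_def)
    ultimately show ?thesis using \<Psi>2_lip[of a m k m] \<Psi>2_km by simp
  qed
  finally show ?thesis .
qed

text \<open>A functional of two space functions, so that it can be evaluated both at
  \<open>u t\<close>, \<open>v t\<close>, where the equations hold, and at the representatives
  \<open>U t\<close>, \<open>V t\<close>, whose continuity Gronwall's inequality needs.\<close>

definition PQ where "PQ f g = (L2_norm \<Omega> (\<lambda>x. pu (f x)))\<^sup>2 + (L2_norm \<Omega> (\<lambda>x. qv (g x)))\<^sup>2"

lemma pu_L2: "f \<in> L2 \<Omega> \<Longrightarrow> (\<lambda>x. pu (f x)) \<in> L2 \<Omega>" and qv_L2: "f \<in> L2 \<Omega> \<Longrightarrow> (\<lambda>x. qv (f x)) \<in> L2 \<Omega>"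
  by (rule lipschitz_compose_L2(1)[OF pu_lip], assumption) (rule lipschitz_compose_L2(1)[OF qv_lip])

lemma pu_qv_inner_le:
  assumes "f \<in> L2 \<Omega>" "g \<in> L2 \<Omega>"
  shows "integrable (lebesgue_on \<Omega>) (\<lambda>x. (pu (f x))\<^sup>2 + (qv (g x))\<^sup>2)"
    "(LINT x|lebesgue_on \<Omega>. (pu (f x))\<^sup>2 + (qv (g x))\<^sup>2) = PQ f g"
proof -
  note i = L2_integrable_sq[OF pu_L2[OF assms(1)]] L2_integrable_sq[OF qv_L2[OF assms(2)]]
  show "integrable (lebesgue_on \<Omega>) (\<lambda>x. (pu (f x))\<^sup>2 + (qv (g x))\<^sup>2)"
    using Bochner_Integration.integrable_add[OF i] by simp
  show "(LINT x|lebesgue_on \<Omega>. (pu (f x))\<^sup>2 + (qv (g x))\<^sup>2) = PQ f g"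
    using Bochner_Integration.integral_add[OF i] by (simp add: PQ_def L2_norm_sq)
qed

lemma reaction_2_inner:
  assumes f: "f \<in> L2 \<Omega>" and g: "g \<in> L2 \<Omega>"
  shows "L2_inner \<Omega> (\<lambda>x. \<Psi>2 (f x) (g x)) (\<lambda>x. - \<sigma> * qv (g x)) \<le> Lu * PQ f g"
proof -
  have "L2_inner \<Omega> (\<lambda>x. \<Psi>2 (f x) (g x)) (\<lambda>x. - \<sigma> * qv (g x)) \<le> (LINT x|lebesgue_on \<Omega>. Lu * ((pu (f x))\<^sup>2 + (qv (g x))\<^sup>2))"
    unfolding L2_inner_def
  proof (rule integral_mono)
    show "integrable (lebesgue_on \<Omega>) (\<lambda>x. \<Psi>2 (f x) (g x) \<bullet> (- \<sigma> * qv (g x)))"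
      by (intro L2_inner_integrable lipschitz2_compose_L2(1)[OF \<Psi>2_lip Lip_pos f g] L2_cmult qv_L2 g)
    show "integrable (lebesgue_on \<Omega>) (\<lambda>x. Lu * ((pu (f x))\<^sup>2 + (qv (g x))\<^sup>2))"
      by (intro integrable_mult_right pu_qv_inner_le f g)
    fix x
    have "\<Psi>2 (f x) (g x) * (- \<sigma> * qv (g x)) \<le> Lu * pu (f x) * qv (g x)"
    proof (cases "\<sigma> * (m - g x) > 0")
      case True
      from mult_right_mono[OF reaction_2[OF True, of "f x"] qv_nonneg[of "g x"]]
      show ?thesis by (simp add: mult.commute mult.left_commute)
    qed (simp add: qv_def)
    also have "\<dots> \<le> Lu * ((pu (f x))\<^sup>2 + (qv (g x))\<^sup>2)"
    proof -
      have "pu (f x) * qv (g x) \<le> (pu (f x))\<^sup>2 + (qv (g x))\<^sup>2"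
        using zero_le_power2[of "pu (f x) - qv (g x)"] zero_le_power2[of "pu (f x)"] zero_le_power2[of "qv (g x)"]
          unfolding power2_diff by linarith
      then show ?thesis using Lip_pos(1) by (simp add: mult.assoc)
    qed
    finally show "\<Psi>2 (f x) (g x) \<bullet> (- \<sigma> * qv (g x)) \<le> Lu * ((pu (f x))\<^sup>2 + (qv (g x))\<^sup>2)" by simp
  qed
  also have "\<dots> = Lu * PQ f g" using pu_qv_inner_le[OF f g] by simp
  finally show ?thesis .
qed

lemma norm_compose_continuous:
  assumes lip: "\<And>a b. \<bar>\<rho> a - \<rho> b\<bar> \<le> \<bar>a - b\<bar>"
    and Z: "\<And>t. t \<in> {0..T} \<Longrightarrow> Z t \<in> L2 \<Omega>"
    and Zc: "\<And>t. t \<in> {0..T} \<Longrightarrow> ((\<lambda>s. L2_norm \<Omega> (Z s - Z t)) \<longlongrightarrow> 0) (at t within {0..T})"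
  shows "continuous_on {0..T} (\<lambda>t. L2_norm \<Omega> (\<lambda>x. \<rho> (Z t x :: real) :: real))"
  unfolding continuous_on_def
proof (intro ballI)
  fix t assume t: "t \<in> {0..T}"
  have "((\<lambda>s. L2_norm \<Omega> (\<lambda>x. \<rho> (Z s x)) - L2_norm \<Omega> (\<lambda>x. \<rho> (Z t x))) \<longlongrightarrow> 0) (at t within {0..T})"
  proof (rule Lim_null_comparison[OF _ Zc[OF t]])
    show "\<forall>\<^sub>F s in at t within {0..T}. norm (L2_norm \<Omega> (\<lambda>x. \<rho> (Z s x)) - L2_norm \<Omega> (\<lambda>x. \<rho> (Z t x))) \<le> L2_norm \<Omega> (Z s - Z t)"
      unfolding eventually_at_filter
    proof (rule always_eventually, intro allI impI)
      fix s assume s: "s \<in> {0..T}"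
      note c = lipschitz_compose_L2[OF lip]
      show "norm (L2_norm \<Omega> (\<lambda>x. \<rho> (Z s x)) - L2_norm \<Omega> (\<lambda>x. \<rho> (Z t x))) \<le> L2_norm \<Omega> (Z s - Z t)"
        using L2_norm_triangle_diff[OF c(1)[OF Z[OF s]] c(1)[OF Z[OF t]]] c(3)[OF Z[OF s] Z[OF t]]
        by (simp add: fun_diff_def)
    qed
  qed
  then show "((\<lambda>t. L2_norm \<Omega> (\<lambda>x. \<rho> (Z t x))) \<longlongrightarrow> L2_norm \<Omega> (\<lambda>x. \<rho> (Z t x))) (at t within {0..T})"
    by (simp add: LIM_zero_iff)
qed

lemma PQ_continuous: "continuous_on {0..T} (\<lambda>t. PQ (U t) (V t))"
  unfolding PQ_def
  by (intro continuous_on_add continuous_on_power norm_compose_continuous[OF pu_lip U_L2 U_cont]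
      norm_compose_continuous[OF qv_lip V_L2 V_cont])

lemma PQ_AE: "AE t in M. PQ (u t) (v t) = PQ (U t) (V t)"
proof -
  have "AE t in M. t \<in> {0<..<T}" by (rule AE_I2) (simp add: space_restrict_space)
  then show ?thesis
    using U_eq V_eq L2_BochnerD(1)[OF u] L2_BochnerD(1)[OF v]
  proof eventually_elim
    case (elim t)
    have L: "u t \<in> L2 \<Omega>" "v t \<in> L2 \<Omega>" "U t \<in> L2 \<Omega>" "V t \<in> L2 \<Omega>"
      using elim(1) weak_gradientD(1)[OF H10_H1[OF elim(4)]] elim(5) U_L2[of t] V_L2[of t] by auto
    have "L2_norm \<Omega> (\<lambda>x. pu (u t x)) = L2_norm \<Omega> (\<lambda>x. pu (U t x))"
      by (rule L2_norm_cong_AE[OF L2_measurable[OF pu_L2[OF L(1)]] L2_measurable[OF pu_L2[OF L(3)]]])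
        (use elim(2) in eventually_elim, simp)
    moreover have "L2_norm \<Omega> (\<lambda>x. qv (v t x)) = L2_norm \<Omega> (\<lambda>x. qv (V t x))"
      by (rule L2_norm_cong_AE[OF L2_measurable[OF qv_L2[OF L(2)]] L2_measurable[OF qv_L2[OF L(4)]]])
        (use elim(3) in eventually_elim, simp)
    ultimately show ?case by (simp add: PQ_def)
  qed
qed

lemma LINT_PQ:
  assumes b: "0 < b" "b \<le> T" and f: "integrable (lebesgue_on {0<..<b}) f"
    and le: "AE t in M. f t \<le> c * PQ (u t) (v t)"
  shows "(LINT t|lebesgue_on {0<..<b}. f t) \<le> c * integral {0..b} (\<lambda>t. PQ (U t) (V t))"
proof -
  let ?y = "\<lambda>t. PQ (U t) (V t)"
  have "integrable (lebesgue_on {0..b}) ?y"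
    by (rule continuous_imp_integrable_real[OF continuous_on_subset[OF PQ_continuous]]) (use b in auto)
  then have yi: "integrable (lebesgue_on {0<..<b}) ?y" by (rule integrable_lebesgue_on_subset) auto
  have "AE t in M. f t \<le> c * ?y t" using le PQ_AE by eventually_elim simp
  then have ae: "AE t in lebesgue_on {0<..<b}. f t \<le> c * ?y t"
    by (rule AE_lebesgue_on_subset) (use b in auto)
  have "(LINT t|lebesgue_on {0<..<b}. f t) \<le> (LINT t|lebesgue_on {0<..<b}. c * ?y t)"
    by (rule integral_mono_AE[OF f integrable_mult_right[OF yi] ae])
  then show ?thesis using LINT_Ioo[OF yi] by simp
qed

lemma u_L2_AE: "AE t in M. u t \<in> L2 \<Omega>"
  using L2_BochnerD(1)[OF u] by eventually_elim (rule weak_gradientD(1)[OF H10_H1])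

text \<open>This equation holds in \<open>L2\<close> and contains no gradient, so a Lipschitz test
  function is admissible and the positive part is used without smoothing:
  \<open>- \<sigma> * qv s\<close> is the derivative of \<open>(qv s)\<^sup>2 / 2\<close>.\<close>

lemma v_energy:
  assumes b: "0 < b" "b \<le> T"
  shows "(L2_norm \<Omega> (\<lambda>x. qv (V b x)))\<^sup>2 / 2 \<le> Lu * integral {0..b} (\<lambda>t. PQ (U t) (V t))"
proof -
  let ?\<beta> = "\<lambda>s. - \<sigma> * qv s" and ?G = "\<lambda>s. (qv s)\<^sup>2 / 2"
  interpret S: seminormed "L2 \<Omega>" "L2_norm \<Omega>" by (rule seminormed_L2)
  have lip: "\<bar>?\<beta> s - ?\<beta> r\<bar> \<le> \<bar>s - r\<bar>" for s r
    using qv_lip[of s r] \<sigma> by auto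
  have vtB: "vt \<in> L2_L2 T \<Omega>" using vt unfolding time_deriv_L2_def by blast
  note L = lipschitz_compose_L2[OF lip]
  have \<phi>: "(\<lambda>t x. ?\<beta> (v t x)) \<in> L2_L2 T \<Omega>"
  proof (rule S.Bochner_compose[OF v])
    show "(\<lambda>x. ?\<beta> (f x)) \<in> L2 \<Omega>" if "f \<in> L2 \<Omega>" for f by (rule L(1)[OF that])
    show "L2_norm \<Omega> (\<lambda>x. ?\<beta> (f x)) \<le> L2_norm \<Omega> (\<lambda>x. \<bar>?\<beta> 0\<bar>) + L2_norm \<Omega> f" if "f \<in> L2 \<Omega>" for f by (rule L(2)[OF that])
    fix fn and f :: "'a \<Rightarrow> real" assume *: "\<forall>n::nat. fn n \<in> L2 \<Omega>" "f \<in> L2 \<Omega>" "(\<lambda>n. L2_norm \<Omega> (f - fn n)) \<longlonglongrightarrow> 0"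
    show "(\<lambda>n. L2_norm \<Omega> ((\<lambda>x. ?\<beta> (f x)) - (\<lambda>x. ?\<beta> (fn n x)))) \<longlonglongrightarrow> 0"
    proof (rule tendsto_sandwich[OF _ _ tendsto_const[of 0] *(3)])
      show "\<forall>\<^sub>F n in sequentially. L2_norm \<Omega> ((\<lambda>x. ?\<beta> (f x)) - (\<lambda>x. ?\<beta> (fn n x))) \<le> L2_norm \<Omega> (f - fn n)"
        using L(3)[OF *(2), of "fn _"] *(1) by (intro always_eventually) (simp add: fun_diff_def)
    qed simp
  qed
  interpret E: convex_energy \<Omega> "L2 \<Omega>" "L2_norm \<Omega>" T v V "\<lambda>t. L2_inner \<Omega> (vt t)" "\<lambda>t. \<bar>L2_norm \<Omega> (vt t)\<bar>" ?G ?\<beta>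
  proof
    show "T > 0" by (rule T)
    show "L2 \<Omega> \<subseteq> L2 \<Omega>" by simp
    show "(\<lambda>t. \<bar>L2_norm \<Omega> (vt t)\<bar>) \<in> L2 {0<..<T}" by (rule Bochner_norm_L2[OF vtB])
    show "(\<lambda>t. L2_inner \<Omega> (vt t) \<psi>) \<in> borel_measurable M" if \<psi>: "\<psi> \<in> L2 \<Omega>" for \<psi>
    proof (rule L2_Bochner_measurable[OF vtB])
      fix fn and f :: "'a \<Rightarrow> real" assume *: "\<forall>n::nat. fn n \<in> L2 \<Omega>" "f \<in> L2 \<Omega>" "(\<lambda>n. L2_norm \<Omega> (f - fn n)) \<longlonglongrightarrow> 0"
      show "(\<lambda>n. L2_inner \<Omega> (fn n) \<psi>) \<longlonglongrightarrow> L2_inner \<Omega> f \<psi>"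
        by (rule L2_inner_tendsto[OF _ *(2) L2_conv[OF *(3)] \<psi> \<psi>]) (use *(1) in \<open>simp_all add: L2_norm_def\<close>)
    qed
    show "AE t in M. \<forall>\<psi>\<in>L2 \<Omega>. \<bar>L2_inner \<Omega> (vt t) \<psi>\<bar> \<le> \<bar>L2_norm \<Omega> (vt t)\<bar> * L2_norm \<Omega> \<psi>"
      using L2_BochnerD(1)[OF vtB] by eventually_elim (simp add: L2_Cauchy_Schwarz)
    show "AE t in M. \<forall>f\<in>L2 \<Omega>. \<forall>g\<in>L2 \<Omega>. L2_inner \<Omega> (vt t) (f - g) = L2_inner \<Omega> (vt t) f - L2_inner \<Omega> (vt t) g"
      using L2_BochnerD(1)[OF vtB]
    proof eventually_elim
      case (elim t)
      show ?case
      proof (intro ballI)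
        fix f g :: "'a \<Rightarrow> real" assume fg: "f \<in> L2 \<Omega>" "g \<in> L2 \<Omega>"
        show "L2_inner \<Omega> (vt t) (f - g) = L2_inner \<Omega> (vt t) f - L2_inner \<Omega> (vt t) g"
          using L2_inner_diff_left[OF fg elim] by (simp add: fun_diff_def L2_inner_commute[of \<Omega> "vt t"])
      qed
    qed
    show "(LINT t|M. deriv \<eta> t * L2_inner \<Omega> (v t) \<psi>) = - (LINT t|M. \<eta> t * L2_inner \<Omega> (vt t) \<psi>)"
      if "\<psi> \<in> L2 \<Omega>" "\<eta> \<in> test_functions {0<..<T}" for \<psi> \<eta>
      using vt that unfolding time_deriv_L2_def by blast
    show "AE t in M. v t \<in> L2 \<Omega>" by (rule L2_BochnerD(1)[OF v])
    show "V t \<in> L2 \<Omega>" "((\<lambda>s. L2_norm \<Omega> (V s - V t)) \<longlongrightarrow> 0) (at t within {0..T})" if "t \<in> {0..T}" for t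
      by (rule V_L2[OF that], rule V_cont[OF that])
    show "AE t in M. AE x in lebesgue_on \<Omega>. V t x = v t x" by (rule V_eq)
    show "continuous_on UNIV ?G" unfolding qv_def by (intro continuous_intros) auto
    show "?G s - ?G r \<le> ?\<beta> s * (s - r)" for s r
    proof -
      \<comment> \<open>In these variables the claim is the subgradient inequality for half the
        squared positive part: replace \<open>b\<close> by its positive part and apply
        \<open>2 p q \<le> p\<^sup>2 + q\<^sup>2\<close>. The two signs in \<open>- \<sigma>\<close>
        and \<open>s - r\<close> combine to \<open>a - b\<close>.\<close>
      define a b where "a = \<sigma> * (m - s)" and "b = \<sigma> * (m - r)"
      have q: "qv s = max a 0" "qv r = max b 0" by (simp_all add: qv_def a_def b_def)
      have e: "?\<beta> s * (s - r) = max a 0 * (a - b)"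
        using \<sigma> by (auto simp: qv_def a_def b_def algebra_simps)
      have "max a 0 * (a - b) = (max a 0)\<^sup>2 - max a 0 * b" by (simp add: max_def power2_eq_square right_diff_distrib)
      moreover have "max a 0 * b \<le> max a 0 * max b 0" by (intro mult_left_mono) auto
      moreover have "max a 0 * max b 0 \<le> (max a 0)\<^sup>2 / 2 + (max b 0)\<^sup>2 / 2"
        using zero_le_power2[of "max a 0 - max b 0"] unfolding power2_diff by linarith
      ultimately have "(max a 0)\<^sup>2 / 2 - (max b 0)\<^sup>2 / 2 \<le> max a 0 * (a - b)" by linarith
      then show ?thesis unfolding e unfolding q .
    qed
    show "\<bar>?\<beta> s - ?\<beta> r\<bar> \<le> \<bar>s - r\<bar>" for s r by (rule lip)
    show "(\<lambda>t x. ?\<beta> (v t x)) \<in> L2_L2 T \<Omega>" by (rule \<phi>)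
  qed
  let ?f = "\<lambda>t. L2_inner \<Omega> (\<lambda>x. \<Psi>2 (u t x) (v t x)) (\<lambda>x. ?\<beta> (v t x))"
  have fm: "?f \<in> borel_measurable M"
  proof (rule L2_Bochner_measurable2[OF u v, where \<Phi> = "\<lambda>f g. L2_inner \<Omega> (\<lambda>x. \<Psi>2 (f x) (g x)) (\<lambda>x. ?\<beta> (g x))"])
    fix fn f and gn :: "nat \<Rightarrow> 'a \<Rightarrow> real" and g
    assume *: "\<forall>n::nat. fn n \<in> H10 \<Omega>" "f \<in> H10 \<Omega>" "(\<lambda>n. H1_norm \<Omega> (f - fn n)) \<longlonglongrightarrow> 0"
      "\<forall>n. gn n \<in> L2 \<Omega>" "g \<in> L2 \<Omega>" "(\<lambda>n. L2_norm \<Omega> (g - gn n)) \<longlonglongrightarrow> 0"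
    have fL: "fn n \<in> L2 \<Omega>" "f \<in> L2 \<Omega>" for n using *(1,2) weak_gradientD(1)[OF H10_H1] by auto
    have fc: "(\<lambda>n. L2_norm \<Omega> (\<lambda>x. fn n x - f x)) \<longlonglongrightarrow> 0"
      using H10_conv[OF *(1-3)] H1_tendsto_iff[of fn f] *(1,2) H10_H1 by blast
    note gc = L2_conv[OF *(6)] and gL = *(4)[rule_format] *(5) and P = lipschitz2_compose_L2[OF \<Psi>2_lip Lip_pos]
    show "(\<lambda>n. L2_inner \<Omega> (\<lambda>x. \<Psi>2 (fn n x) (gn n x)) (\<lambda>x. ?\<beta> (gn n x))) \<longlonglongrightarrow> L2_inner \<Omega> (\<lambda>x. \<Psi>2 (f x) (g x)) (\<lambda>x. ?\<beta> (g x))"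
    proof (rule L2_inner_tendsto[OF P(1)[OF fL(1) gL(1)] P(1)[OF fL(2) gL(2)] _ L(1)[OF gL(1)] L(1)[OF gL(2)]])
      have "(\<lambda>n. Lu * L2_norm \<Omega> (\<lambda>x. fn n x - f x) + Lv * L2_norm \<Omega> (\<lambda>x. gn n x - g x)) \<longlonglongrightarrow> Lu * 0 + Lv * 0"
        by (intro tendsto_intros fc gc)
      then have "(\<lambda>n. Lu * L2_norm \<Omega> (\<lambda>x. fn n x - f x) + Lv * L2_norm \<Omega> (\<lambda>x. gn n x - g x)) \<longlonglongrightarrow> 0" by simp
      from tendsto_sandwich[OF _ _ tendsto_const[of 0] this] P(3)[OF fL(1) gL(1) fL(2) gL(2)]
      show "(\<lambda>n. L2_norm \<Omega> (\<lambda>x. \<Psi>2 (fn n x) (gn n x) - \<Psi>2 (f x) (g x))) \<longlonglongrightarrow> 0" by simp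
      show "(\<lambda>n. L2_norm \<Omega> (\<lambda>x. ?\<beta> (gn n x) - ?\<beta> (g x))) \<longlonglongrightarrow> 0"
        by (rule tendsto_sandwich[OF _ _ tendsto_const[of 0] gc])
          (intro always_eventually allI L2_norm_nonneg L(3)[OF gL(1) gL(2)])+
    qed
  qed
  have fi: "integrable M ?f"
  proof (rule Bochner_Integration.integrable_bound[OF _ fm])
    let ?c = "L2_norm \<Omega> (\<lambda>x. \<bar>\<Psi>2 0 0\<bar>)" and ?d = "L2_norm \<Omega> (\<lambda>x. \<bar>?\<beta> 0\<bar>)"
    have NL: "(\<lambda>t. ?c + (Lu * H1_norm \<Omega> (u t) + Lv * L2_norm \<Omega> (v t))) \<in> L2 {0<..<T}"
      using Bochner_norm_L2[OF u] Bochner_norm_L2[OF v]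
      by (intro L2_add L2_cmult L2_const) simp_all
    have dL: "(\<lambda>t. ?d + L2_norm \<Omega> (v t)) \<in> L2 {0<..<T}"
      using Bochner_norm_L2[OF v] by (intro L2_add L2_const) simp_all
    show "integrable M (\<lambda>t. (?c + (Lu * H1_norm \<Omega> (u t) + Lv * L2_norm \<Omega> (v t))) \<bullet> (?d + L2_norm \<Omega> (v t)))"
      by (rule L2_inner_integrable[OF NL dL])
    show "AE t in M. norm (?f t) \<le> norm ((?c + (Lu * H1_norm \<Omega> (u t) + Lv * L2_norm \<Omega> (v t))) \<bullet> (?d + L2_norm \<Omega> (v t)))"
      using u_L2_AE L2_BochnerD(1)[OF v]
    proof eventually_elim
      case (elim t)
      note P = lipschitz2_compose_L2[OF \<Psi>2_lip Lip_pos elim]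
      have "\<bar>?f t\<bar> \<le> L2_norm \<Omega> (\<lambda>x. \<Psi>2 (u t x) (v t x)) * L2_norm \<Omega> (\<lambda>x. ?\<beta> (v t x))"
        by (rule L2_Cauchy_Schwarz[OF P(1) L(1)[OF elim(2)]])
      also have "\<dots> \<le> (?c + (Lu * H1_norm \<Omega> (u t) + Lv * L2_norm \<Omega> (v t))) * (?d + L2_norm \<Omega> (v t))"
      proof (rule mult_mono[OF _ L(2)[OF elim(2)]])
        have "Lu * L2_norm \<Omega> (u t) \<le> Lu * H1_norm \<Omega> (u t)"
          using Lip_pos L2_norm_le_H1_norm(1) by (intro mult_left_mono) auto
        then show "L2_norm \<Omega> (\<lambda>x. \<Psi>2 (u t x) (v t x)) \<le> ?c + (Lu * H1_norm \<Omega> (u t) + Lv * L2_norm \<Omega> (v t))"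
          using P(2) by linarith
        show "0 \<le> ?c + (Lu * H1_norm \<Omega> (u t) + Lv * L2_norm \<Omega> (v t))"
          using Lip_pos by (intro add_nonneg_nonneg mult_nonneg_nonneg) auto
      qed simp
      finally show ?case by (simp add: abs_le_iff)
    qed
  qed
  \<comment> \<open>Test functions of this equation must be jointly measurable on the space-time
    cylinder. Here \<open>v_joint\<close> enters, and the cut-off in time becomes the indicator of
    an open product set.\<close>
  let ?\<xi> = "\<lambda>t x. if t \<in> {0<..<b} then ?\<beta> (v t x) else 0"
  have "(\<lambda>(x, t). ?\<xi> t x) \<in> L2 (space_time T \<Omega>)"
  proof -
    have Sb: "space_time T \<Omega> \<in> lmeasurable"
    proof (rule bounded_set_imp_lmeasurable)
      show "bounded (space_time T \<Omega>)" unfolding space_time_def by (intro bounded_Times bounded_\<Omega> bounded_Ioc)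
      have "\<Omega> \<times> {0<..T} \<in> sets (borel \<Otimes>\<^sub>M borel)" using open_\<Omega> by (intro pair_measureI) auto
      then show "space_time T \<Omega> \<in> sets lebesgue" unfolding space_time_def borel_prod by simp
    qed
    let ?v = "\<lambda>p. v (snd p) (fst p)"
    have vm: "?v \<in> L2 (space_time T \<Omega>)" using v_joint by (simp add: case_prod_unfold)
    have nv: "(\<lambda>p. norm (?v p)) \<in> L2 (space_time T \<Omega>)" by (rule L2I_bound[OF vm]) (use L2_measurable[OF vm] in auto)
    have "continuous_on UNIV ?\<beta>" unfolding qv_def by (intro continuous_intros)
    from borel_measurable_continuous_on[OF this L2_measurable[OF vm]]
    have 1: "(\<lambda>p. ?\<beta> (?v p)) \<in> borel_measurable (lebesgue_on (space_time T \<Omega>))" .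
    have "open (UNIV \<times> {0<..<b} :: ('a \<times> real) set)" by (intro open_Times) auto
    then have 2: "indicat_real (UNIV \<times> {0<..<b}) \<in> borel_measurable (lebesgue_on (space_time T \<Omega>))"
      by (intro measurable_restrict_space1 borel_measurable_indicator) simp
    have "(\<lambda>p. indicat_real (UNIV \<times> {0<..<b}) p * ?\<beta> (?v p)) \<in> L2 (space_time T \<Omega>)"
    proof (rule L2I_bound[OF L2_add[OF L2_const[OF Sb, of "\<bar>?\<beta> 0\<bar>"] nv] borel_measurable_times[OF 2 1] AE_I2])
      fix p :: "'a \<times> real"
      have "\<bar>?\<beta> (?v p)\<bar> \<le> \<bar>?\<beta> 0\<bar> + \<bar>?v p\<bar>" using lip[of "?v p" 0] by linarith
      then show "norm (indicat_real (UNIV \<times> {0<..<b}) p * ?\<beta> (?v p)) \<le> norm (\<bar>?\<beta> 0\<bar> + norm (?v p))"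
        by (cases "p \<in> UNIV \<times> {0<..<b}") simp_all
    qed
    moreover have "(\<lambda>(x, t). ?\<xi> t x) = (\<lambda>p. indicat_real (UNIV \<times> {0<..<b}) p * ?\<beta> (?v p))"
      by (auto simp: fun_eq_iff indicator_def)
    ultimately show ?thesis by simp
  qed
  note eq = v_eq[OF this]
  have z: "L2_inner \<Omega> h (\<lambda>x. 0) = 0" for h :: "'a \<Rightarrow> real" by (simp add: L2_inner_def)
  have e1: "(LINT t|M. L2_inner \<Omega> (vt t) (?\<xi> t)) = (LINT t|lebesgue_on {0<..<b}. L2_inner \<Omega> (vt t) (\<lambda>x. ?\<beta> (v t x)))"
    by (rule LINT_restrict_AE[OF E.w_Bochner_measurable[OF \<phi>] AE_I2 b(2)]) (simp add: z)
  have e2: "(LINT t|M. L2_inner \<Omega> (\<lambda>x. \<Psi>2 (u t x) (v t x)) (?\<xi> t)) = (LINT t|lebesgue_on {0<..<b}. ?f t)"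
    by (rule LINT_restrict_AE[OF fm AE_I2 b(2)]) (simp add: z)
  have e0: "E.energy 0 = 0"
  proof -
    have "AE x in lebesgue_on \<Omega>. ?G (V 0 x) = 0" using V_init by eventually_elim (simp add: qv_def)
    then show ?thesis unfolding E.energy_def by (rule integral_eq_zero_AE)
  qed
  have "(L2_norm \<Omega> (\<lambda>x. qv (V b x)))\<^sup>2 / 2 = E.energy b"
    unfolding E.energy_def L2_norm_sq by simp
  also have "\<dots> \<le> (LINT t|lebesgue_on {0<..<b}. ?f t)"
    using E.energy_inequality[OF b] e0 e1 e2 eq by simp
  also have "\<dots> \<le> Lu * integral {0..b} (\<lambda>t. PQ (U t) (V t))"
  proof (rule LINT_PQ[OF b])
    show "integrable (lebesgue_on {0<..<b}) ?f" by (rule integrable_lebesgue_on_subset[OF fi]) (use b in auto)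
    show "AE t in M. ?f t \<le> Lu * PQ (u t) (v t)"
      using u_L2_AE L2_BochnerD(1)[OF v] by eventually_elim (rule reaction_2_inner)
  qed
  finally show ?thesis .
qed

text \<open>Young's inequality absorbs the convective term into the diffusive one; the constant part
  \<open>F k 0\<close> of the flux contributes nothing, as gradients of \<open>H10\<close> functions have mean zero.\<close>

lemma flux_le:
  fixes z :: 'a
  assumes d: "0 \<le> d" "d \<le> 1" and supp: "\<sigma> * (a - k) \<le> 0 \<Longrightarrow> d = 0"
  shows "(F a b - F k 0) \<bullet> (d *\<^sub>R z) - (D a b *\<^sub>R z) \<bullet> (d *\<^sub>R z) \<le> CF\<^sup>2 / (4 * Dm) * (pu a)\<^sup>2"
proof -
  have nn: "0 \<le> CF\<^sup>2 / (4 * Dm) * (pu a)\<^sup>2" using D_bounds(1) by simp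
  show ?thesis
  proof (cases "\<sigma> * (a - k) \<le> 0")
    case True
    then show ?thesis using supp nn by simp
  next
    case False
    then have p: "\<bar>a - k\<bar> = pu a" using \<sigma> by (auto simp: pu_def)
    have "(F a b - F k 0) \<bullet> z \<le> norm (F a b - F k 0) * norm z" by (rule norm_cauchy_schwarz)
    also have "\<dots> \<le> CF * pu a * norm z" using F_lin[of a b] p by (intro mult_right_mono) auto
    finally have 1: "(F a b - F k 0) \<bullet> z \<le> CF * pu a * norm z" .
    have 2: "Dm * (norm z)\<^sup>2 \<le> (D a b *\<^sub>R z) \<bullet> z"
      using D_bounds(2)[of a b] by (simp add: power2_norm_eq_inner[symmetric] mult_right_mono)
    have 3: "CF * pu a * norm z - Dm * (norm z)\<^sup>2 \<le> CF\<^sup>2 / (4 * Dm) * (pu a)\<^sup>2"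
    proof -
      have "4 * Dm * (CF * pu a * norm z - Dm * (norm z)\<^sup>2) \<le> (CF * pu a)\<^sup>2"
        using zero_le_power2[of "CF * pu a - 2 * Dm * norm z"]
        unfolding power2_eq_square by (simp add: algebra_simps)
      then have "CF * pu a * norm z - Dm * (norm z)\<^sup>2 \<le> (CF * pu a)\<^sup>2 / (4 * Dm)"
        using D_bounds(1) by (simp add: field_simps)
      then show ?thesis by (simp add: power_mult_distrib)
    qed
    let ?c = "CF\<^sup>2 / (4 * Dm) * (pu a)\<^sup>2"
    have "(F a b - F k 0) \<bullet> z - (D a b *\<^sub>R z) \<bullet> z \<le> ?c" using 1 2 3 by linarith
    then have "d * ((F a b - F k 0) \<bullet> z - (D a b *\<^sub>R z) \<bullet> z) \<le> d * ?c" using d(1) by (rule mult_left_mono)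
    also have "\<dots> \<le> 1 * ?c" using d(2) nn by (rule mult_right_mono)
    finally show ?thesis by (simp add: right_diff_distrib mult.commute)
  qed
qed

lemma F_compose_L2: "f \<in> L2 \<Omega> \<Longrightarrow> g \<in> L2 \<Omega> \<Longrightarrow> (\<lambda>x. F (f x) (g x)) \<in> L2 \<Omega>"
  by (rule bounded_L2[OF borel_measurable_continuous_Pair[OF _ _ F_cont] F_bound]) (rule L2_measurable, assumption)+

lemma D_abs: "\<bar>D a b\<bar> \<le> DM"
  using D_bounds(1) D_bounds(2,3)[of a b] by simp

text \<open>The constant does not depend on \<open>\<epsilon>\<close>, because the derivative of the
  truncation stays in \<open>[0, 1]\<close> and \<open>soft_pos\<close> lies below the positive
  part. \<open>CF\<^sup>2 / (4 * Dm)\<close> pays for the flux after absorption, \<open>Lv\<close>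
  for the reaction.\<close>

lemma soft_energy_bound:
  assumes e: "\<epsilon> > 0" and b: "0 < b" "b \<le> T"
  shows "(LINT x|lebesgue_on \<Omega>. soft_pos_primitive \<epsilon> (\<sigma> * (U b x - k)))
    \<le> (CF\<^sup>2 / (4 * Dm) + Lv) * integral {0..b} (\<lambda>t. PQ (U t) (V t))"
proof -
  define \<beta> where "\<beta> s = \<sigma> * soft_pos \<epsilon> (\<sigma> * (s - k))" for s
  define \<beta>' where "\<beta>' s = soft_pos_deriv \<epsilon> (\<sigma> * (s - k))" for s
  define G where "G s = soft_pos_primitive \<epsilon> (\<sigma> * (s - k))" for s
  interpret truncation_on \<Omega> \<beta> \<beta>'
    using truncation_soft_pos[OF e \<sigma> k] bounded_open_axioms
    unfolding truncation_on_def \<beta>_def[abs_def] \<beta>'_def[abs_def] by blast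
  interpret S: seminormed "H10 \<Omega>" "H1_norm \<Omega>" by (rule seminormed_H10)
  have utB: "ut \<in> L2_Hm1 T \<Omega>" using ut unfolding time_deriv_Hm1_def by blast
  have G_deriv: "(G has_real_derivative \<beta> s) (at s)" for s
  proof -
    have "((\<lambda>s. \<sigma> * (s - k)) has_real_derivative \<sigma>) (at s)" by (auto intro!: derivative_eq_intros)
    from DERIV_chain2[OF soft_pos_primitive_has_derivative[OF e] this]
    show ?thesis unfolding G_def[abs_def] \<beta>_def by (simp add: mult.commute)
  qed
  have \<phi>: "(\<lambda>t x. \<beta> (u t x)) \<in> L2_H10 T \<Omega>"
  proof (rule S.Bochner_compose[OF u])
    show "(\<lambda>x. \<beta> (f x)) \<in> H10 \<Omega>" if "f \<in> H10 \<Omega>" for f by (rule H10_\<beta>(1)[OF that])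
    show "H1_norm \<Omega> (\<lambda>x. \<beta> (f x)) \<le> 0 + H1_norm \<Omega> f" if "f \<in> H10 \<Omega>" for f using H1_norm_\<beta>_le[OF that] by simp
    fix fn f assume *: "\<forall>n::nat. fn n \<in> H10 \<Omega>" "f \<in> H10 \<Omega>" "(\<lambda>n. H1_norm \<Omega> (f - fn n)) \<longlonglongrightarrow> 0"
    have "H1_norm \<Omega> ((\<lambda>x. \<beta> (f x)) - (\<lambda>x. \<beta> (fn n x))) = H1_norm \<Omega> (\<lambda>x. \<beta> (fn n x) - \<beta> (f x))" for n
      using H1_norm_minus_commute[OF H10_H1[OF H10_\<beta>(1)[OF *(2)]] H10_H1[OF H10_\<beta>(1)[OF *(1)[rule_format, of n]]]]
      by (simp add: fun_diff_def)
    then show "(\<lambda>n. H1_norm \<Omega> ((\<lambda>x. \<beta> (f x)) - (\<lambda>x. \<beta> (fn n x)))) \<longlonglongrightarrow> 0"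
      using H10_\<beta>_tendsto[OF *(1)[rule_format] *(2) H10_conv[OF *]] by simp
  qed
  interpret E: convex_energy \<Omega> "H10 \<Omega>" "H1_norm \<Omega>" T u U ut "\<lambda>t. \<bar>Hm1_norm \<Omega> (ut t)\<bar>" G \<beta>
  proof
    show "T > 0" by (rule T)
    show "H10 \<Omega> \<subseteq> L2 \<Omega>" using weak_gradientD(1)[OF H10_H1] by blast
    show "(\<lambda>t. \<bar>Hm1_norm \<Omega> (ut t)\<bar>) \<in> L2 {0<..<T}" by (rule Bochner_norm_L2[OF utB])
    show "(\<lambda>t. ut t \<psi>) \<in> borel_measurable M" if \<psi>: "\<psi> \<in> H10 \<Omega>" for \<psi>
    proof (rule L2_Bochner_measurable[OF utB])
      fix ln l assume *: "\<forall>n::nat. ln n \<in> Hm1 \<Omega>" "l \<in> Hm1 \<Omega>" "(\<lambda>n. Hm1_norm \<Omega> (l - ln n)) \<longlonglongrightarrow> 0"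
      have "\<forall>n. norm (l \<psi> - ln n \<psi>) \<le> Hm1_norm \<Omega> (l - ln n) * H1_norm \<Omega> \<psi>"
        using Hm1_bound[OF Hm1_diff[OF *(2) *(1)[rule_format]] \<psi>] by simp
      from Lim_null_comparison[OF always_eventually[OF this] tendsto_mult_left_zero[OF *(3)]]
      have "(\<lambda>n. l \<psi> - ln n \<psi>) \<longlonglongrightarrow> 0" .
      from tendsto_diff[OF tendsto_const[of "l \<psi>"] this] show "(\<lambda>n. ln n \<psi>) \<longlonglongrightarrow> l \<psi>" by simp
    qed
    show "AE t in M. \<forall>\<psi>\<in>H10 \<Omega>. \<bar>ut t \<psi>\<bar> \<le> \<bar>Hm1_norm \<Omega> (ut t)\<bar> * H1_norm \<Omega> \<psi>"
      using L2_BochnerD(1)[OF utB]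
    proof eventually_elim
      case (elim t)
      show ?case
      proof
        fix \<psi> assume "\<psi> \<in> H10 \<Omega>"
        from Hm1_bound[OF elim this]
        have "\<bar>ut t \<psi>\<bar> \<le> Hm1_norm \<Omega> (ut t) * H1_norm \<Omega> \<psi>" .
        also have "\<dots> \<le> \<bar>Hm1_norm \<Omega> (ut t)\<bar> * H1_norm \<Omega> \<psi>" by (intro mult_right_mono) auto
        finally show "\<bar>ut t \<psi>\<bar> \<le> \<bar>Hm1_norm \<Omega> (ut t)\<bar> * H1_norm \<Omega> \<psi>" .
      qed
    qed
    show "AE t in M. \<forall>f\<in>H10 \<Omega>. \<forall>g\<in>H10 \<Omega>. ut t (f - g) = ut t f - ut t g"
      using L2_BochnerD(1)[OF utB] by eventually_elim (intro ballI Hm1_diff_arg)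
    show "(LINT t|M. deriv \<eta> t * L2_inner \<Omega> (u t) \<psi>) = - (LINT t|M. \<eta> t * ut t \<psi>)"
      if "\<psi> \<in> H10 \<Omega>" "\<eta> \<in> test_functions {0<..<T}" for \<psi> \<eta>
      using ut that unfolding time_deriv_Hm1_def by blast
    show "AE t in M. u t \<in> L2 \<Omega>" by (rule u_L2_AE)
    show "U t \<in> L2 \<Omega>" "((\<lambda>s. L2_norm \<Omega> (U s - U t)) \<longlongrightarrow> 0) (at t within {0..T})" if "t \<in> {0..T}" for t
      by (rule U_L2[OF that], rule U_cont[OF that])
    show "AE t in M. AE x in lebesgue_on \<Omega>. U t x = u t x" by (rule U_eq)
    show "continuous_on UNIV G"
      by (rule DERIV_continuous_on[OF has_field_derivative_at_within[OF G_deriv]])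
    show "G s - G r \<le> \<beta> s * (s - r)" for s r by (rule convex_of_mono_deriv[OF G_deriv \<beta>_mono])
    show "\<bar>\<beta> s - \<beta> r\<bar> \<le> \<bar>s - r\<bar>" for s r by (rule \<beta>_lipschitz)
    show "(\<lambda>t x. \<beta> (u t x)) \<in> L2_H10 T \<Omega>" by (rule \<phi>)
  qed
  \<comment> \<open>The three spatial terms are written as functions of a pair \<open>f\<close>,
    \<open>g\<close>: their continuity on \<open>H10\<close> times \<open>L2\<close> gives
    measurability in time, and the estimate \<open>bound\<close> can be proved for fixed space
    functions.\<close>
  define fD where "fD f g = L2_inner \<Omega> (\<lambda>x. D (f x) (g x) *\<^sub>R weak_gradient \<Omega> f x) (weak_gradient \<Omega> (\<lambda>x. \<beta> (f x)))" for f g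
  define fF where "fF f g = L2_inner \<Omega> (\<lambda>x. F (f x) (g x)) (weak_gradient \<Omega> (\<lambda>x. \<beta> (f x)))" for f g
  define fP where "fP f g = L2_inner \<Omega> (\<lambda>x. \<Psi>1 (f x) (g x)) (\<lambda>x. \<beta> (f x))" for f g
  note P = lipschitz2_compose_L2[OF \<Psi>1_lip Lip_pos]
  note Dg = L2_scaleR_compose[OF D_cont D_abs]
  have gr: "weak_gradient \<Omega> f \<in> L2 \<Omega>" "weak_gradient \<Omega> (\<lambda>x. \<beta> (f x)) \<in> L2 \<Omega>" "f \<in> L2 \<Omega>" if "f \<in> H10 \<Omega>" for f
    using weak_gradientD[OF H10_H1[OF that]] weak_gradientD[OF H10_H1[OF H10_\<beta>(1)[OF that]]] by auto
  have meas: "(\<lambda>t. fD (u t) (v t)) \<in> borel_measurable M" "(\<lambda>t. fF (u t) (v t)) \<in> borel_measurable M"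
    "(\<lambda>t. fP (u t) (v t)) \<in> borel_measurable M"
  proof -
    have conv: "(\<lambda>n. fD (fn n) (gn n)) \<longlonglongrightarrow> fD f g \<and> (\<lambda>n. fF (fn n) (gn n)) \<longlonglongrightarrow> fF f g \<and> (\<lambda>n. fP (fn n) (gn n)) \<longlonglongrightarrow> fP f g"
      if *: "\<forall>n::nat. fn n \<in> H10 \<Omega>" "f \<in> H10 \<Omega>" "(\<lambda>n. H1_norm \<Omega> (f - fn n)) \<longlonglongrightarrow> 0"
        "\<forall>n. gn n \<in> L2 \<Omega>" "g \<in> L2 \<Omega>" "(\<lambda>n. L2_norm \<Omega> (g - gn n)) \<longlonglongrightarrow> 0" for fn f gn g
    proof (intro conjI)
      note fL = gr[OF *(1)[rule_format]] gr[OF *(2)] and gL = *(4)[rule_format] *(5)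
      have c: "(\<lambda>n. L2_norm \<Omega> (\<lambda>x. fn n x - f x)) \<longlonglongrightarrow> 0"
        "(\<lambda>n. L2_norm \<Omega> (\<lambda>x. weak_gradient \<Omega> (fn n) x - weak_gradient \<Omega> f x)) \<longlonglongrightarrow> 0"
        using H10_conv[OF *(1-3)] H1_tendsto_iff[of fn f] *(1,2) H10_H1 by blast+
      have cb: "(\<lambda>n. L2_norm \<Omega> (\<lambda>x. \<beta> (fn n x) - \<beta> (f x))) \<longlonglongrightarrow> 0"
        "(\<lambda>n. L2_norm \<Omega> (\<lambda>x. weak_gradient \<Omega> (\<lambda>x. \<beta> (fn n x)) x - weak_gradient \<Omega> (\<lambda>x. \<beta> (f x)) x)) \<longlonglongrightarrow> 0"
        using H10_\<beta>_tendsto[OF *(1)[rule_format] *(2) H10_conv[OF *(1-3)]]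
          H1_tendsto_iff[of "\<lambda>n x. \<beta> (fn n x)" "\<lambda>x. \<beta> (f x)", OF H10_H1[OF H10_\<beta>(1)[OF *(1)[rule_format]]] H10_H1[OF H10_\<beta>(1)[OF *(2)]]]
        by blast+
      note gc = L2_conv[OF *(6)]
      show "(\<lambda>n. fD (fn n) (gn n)) \<longlonglongrightarrow> fD f g"
        unfolding fD_def
        by (rule L2_inner_tendsto[OF Dg(1)[OF fL(3) gL(1) fL(1)] Dg(1)[OF fL(6) gL(2) fL(4)]
              L2_scaleR_compose_tendsto[OF D_cont D_abs fL(3) fL(6) c(1) gL gc fL(1) fL(4) c(2)] fL(2) fL(5) cb(2)])
      have "(\<lambda>n. L2_norm \<Omega> (\<lambda>x. F (fn n x) (gn n x) - F (f x) (g x))) \<longlonglongrightarrow> 0"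
        by (rule L2_compose_tendsto[OF fL(3) fL(6) c(1) gL gc F_cont L2_measurable[OF F_compose_L2] L2_const[OF lmeasurable_\<Omega>, of FM] F_bound])
      then show "(\<lambda>n. fF (fn n) (gn n)) \<longlonglongrightarrow> fF f g"
        unfolding fF_def
        by (rule L2_inner_tendsto[OF F_compose_L2[OF fL(3) gL(1)] F_compose_L2[OF fL(6) gL(2)] _ fL(2) fL(5) cb(2)])
      have "(\<lambda>n. Lu * L2_norm \<Omega> (\<lambda>x. fn n x - f x) + Lv * L2_norm \<Omega> (\<lambda>x. gn n x - g x)) \<longlonglongrightarrow> Lu * 0 + Lv * 0"
        by (intro tendsto_intros c gc)
      then have "(\<lambda>n. Lu * L2_norm \<Omega> (\<lambda>x. fn n x - f x) + Lv * L2_norm \<Omega> (\<lambda>x. gn n x - g x)) \<longlonglongrightarrow> 0" by simp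
      from tendsto_sandwich[OF _ _ tendsto_const[of 0] this] P(3)[OF fL(3) gL(1) fL(6) gL(2)]
      have "(\<lambda>n. L2_norm \<Omega> (\<lambda>x. \<Psi>1 (fn n x) (gn n x) - \<Psi>1 (f x) (g x))) \<longlonglongrightarrow> 0" by simp
      then show "(\<lambda>n. fP (fn n) (gn n)) \<longlonglongrightarrow> fP f g"
        unfolding fP_def
        by (rule L2_inner_tendsto[OF P(1)[OF fL(3) gL(1)] P(1)[OF fL(6) gL(2)] _ \<beta>_L2[OF fL(3)] \<beta>_L2[OF fL(6)] cb(1)])
    qed
    show "(\<lambda>t. fD (u t) (v t)) \<in> borel_measurable M"
      by (rule L2_Bochner_measurable2[OF u v]) (use conv in blast)
    show "(\<lambda>t. fF (u t) (v t)) \<in> borel_measurable M"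
      by (rule L2_Bochner_measurable2[OF u v]) (use conv in blast)
    show "(\<lambda>t. fP (u t) (v t)) \<in> borel_measurable M"
      by (rule L2_Bochner_measurable2[OF u v]) (use conv in blast)
  qed
  let ?N = "\<lambda>t. H1_norm \<Omega> (u t)"
  have NL: "?N \<in> L2 {0<..<T}" and vL: "(\<lambda>t. L2_norm \<Omega> (v t)) \<in> L2 {0<..<T}"
    using Bochner_norm_L2[OF u] Bochner_norm_L2[OF v] by simp_all
  have gb: "L2_norm \<Omega> (weak_gradient \<Omega> (\<lambda>x. \<beta> (f x))) \<le> H1_norm \<Omega> f" "L2_norm \<Omega> (\<lambda>x. \<beta> (f x)) \<le> H1_norm \<Omega> f"
    if "f \<in> H10 \<Omega>" for f
    using L2_norm_le_H1_norm[of "\<lambda>x. \<beta> (f x)"] H1_norm_\<beta>_le[OF that] by linarith+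
  have iD: "integrable M (\<lambda>t. fD (u t) (v t))"
  proof (rule Bochner_Integration.integrable_bound[OF _ meas(1)])
    show "integrable M (\<lambda>t. (DM * ?N t) \<bullet> ?N t)" by (rule L2_inner_integrable[OF L2_cmult[OF NL] NL])
    show "AE t in M. norm (fD (u t) (v t)) \<le> norm ((DM * ?N t) \<bullet> ?N t)"
      using L2_BochnerD(1)[OF u] L2_BochnerD(1)[OF v]
    proof eventually_elim
      case (elim t)
      note g = gr[OF elim(1)] and d = Dg[OF gr(3)[OF elim(1)] elim(2) gr(1)[OF elim(1)]]
      have DM: "DM \<ge> 0" using D_abs[of 0 0] by linarith
      have "\<bar>fD (u t) (v t)\<bar> \<le> L2_norm \<Omega> (\<lambda>x. D (u t x) (v t x) *\<^sub>R weak_gradient \<Omega> (u t) x) * L2_norm \<Omega> (weak_gradient \<Omega> (\<lambda>x. \<beta> (u t x)))"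
        unfolding fD_def by (rule L2_Cauchy_Schwarz[OF d(1) g(2)])
      also have "\<dots> \<le> (DM * ?N t) * ?N t"
      proof (rule mult_mono[OF order_trans[OF d(2)] gb(1)[OF elim(1)]])
        show "DM * L2_norm \<Omega> (weak_gradient \<Omega> (u t)) \<le> DM * ?N t"
          using L2_norm_le_H1_norm(2) DM by (rule mult_left_mono)
      qed (use DM in auto)
      finally show ?case by (simp add: abs_le_iff)
    qed
  qed
  have iF: "integrable M (\<lambda>t. fF (u t) (v t))"
  proof (rule Bochner_Integration.integrable_bound[OF _ meas(2)])
    let ?c = "L2_norm \<Omega> (\<lambda>x. FM)"
    show "integrable M (\<lambda>t. ?c * ?N t)"
      by (intro integrable_mult_right L2_integrable[OF _ NL]) simp
    show "AE t in M. norm (fF (u t) (v t)) \<le> norm (?c * ?N t)"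
      using L2_BochnerD(1)[OF u] L2_BochnerD(1)[OF v]
    proof eventually_elim
      case (elim t)
      note g = gr[OF elim(1)] and f = F_compose_L2[OF gr(3)[OF elim(1)] elim(2)]
      have "L2_norm \<Omega> (\<lambda>x. F (u t x) (v t x)) \<le> ?c"
      proof (rule L2_norm_mono[OF f L2_const[OF lmeasurable_\<Omega>] AE_I2])
        show "norm (F (u t x) (v t x)) \<le> norm FM" for x using F_bound[of "u t x" "v t x"] by simp
      qed
      then have "L2_norm \<Omega> (\<lambda>x. F (u t x) (v t x)) * L2_norm \<Omega> (weak_gradient \<Omega> (\<lambda>x. \<beta> (u t x))) \<le> ?c * ?N t"
        using gb(1)[OF elim(1)] by (intro mult_mono) auto
      then show ?case using L2_Cauchy_Schwarz[OF f g(2)] unfolding fF_def by simp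
    qed
  qed
  have iP: "integrable M (\<lambda>t. fP (u t) (v t))"
  proof (rule Bochner_Integration.integrable_bound[OF _ meas(3)])
    let ?c = "L2_norm \<Omega> (\<lambda>x. \<bar>\<Psi>1 0 0\<bar>)"
    have L: "(\<lambda>t. ?c + (Lu * ?N t + Lv * L2_norm \<Omega> (v t))) \<in> L2 {0<..<T}"
      by (intro L2_add L2_cmult L2_const NL vL) simp
    show "integrable M (\<lambda>t. (?c + (Lu * ?N t + Lv * L2_norm \<Omega> (v t))) \<bullet> ?N t)"
      by (rule L2_inner_integrable[OF L NL])
    show "AE t in M. norm (fP (u t) (v t)) \<le> norm ((?c + (Lu * ?N t + Lv * L2_norm \<Omega> (v t))) \<bullet> ?N t)"
      using L2_BochnerD(1)[OF u] L2_BochnerD(1)[OF v]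
    proof eventually_elim
      case (elim t)
      note g = gr[OF elim(1)] and p = P[OF gr(3)[OF elim(1)] elim(2)]
      have "\<bar>fP (u t) (v t)\<bar> \<le> L2_norm \<Omega> (\<lambda>x. \<Psi>1 (u t x) (v t x)) * L2_norm \<Omega> (\<lambda>x. \<beta> (u t x))"
        unfolding fP_def by (rule L2_Cauchy_Schwarz[OF p(1) \<beta>_L2[OF g(3)]])
      also have "\<dots> \<le> (?c + (Lu * ?N t + Lv * L2_norm \<Omega> (v t))) * ?N t"
      proof (rule mult_mono[OF _ gb(2)[OF elim(1)]])
        have "Lu * L2_norm \<Omega> (u t) \<le> Lu * ?N t"
          using Lip_pos L2_norm_le_H1_norm(1) by (intro mult_left_mono) auto
        then show "L2_norm \<Omega> (\<lambda>x. \<Psi>1 (u t x) (v t x)) \<le> ?c + (Lu * ?N t + Lv * L2_norm \<Omega> (v t))"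
          using p(2) by linarith
        show "0 \<le> ?c + (Lu * ?N t + Lv * L2_norm \<Omega> (v t))"
          using Lip_pos by (intro add_nonneg_nonneg mult_nonneg_nonneg) auto
      qed simp
      finally show ?case by (simp add: abs_le_iff)
    qed
  qed
  have bound: "fF f g - fD f g + fP f g \<le> (CF\<^sup>2 / (4 * Dm) + Lv) * PQ f g" if f: "f \<in> H10 \<Omega>" and g: "g \<in> L2 \<Omega>" for f g
  proof -
    let ?w = "weak_gradient \<Omega> f" and ?wb = "weak_gradient \<Omega> (\<lambda>x. \<beta> (f x))"
    let ?C = "CF\<^sup>2 / (4 * Dm)"
    note fL = gr[OF f]
    have kL: "(\<lambda>x. F k 0) \<in> L2 \<Omega>" by (rule L2_const[OF lmeasurable_\<Omega>])
    have C: "?C \<ge> 0" using D_bounds(1) by simp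
    have i1: "integrable (lebesgue_on \<Omega>) (\<lambda>x. (F (f x) (g x) - F k 0) \<bullet> ?wb x)"
      by (rule L2_inner_integrable[OF L2_diff[OF F_compose_L2[OF fL(3) g] kL] fL(2)])
    have i2: "integrable (lebesgue_on \<Omega>) (\<lambda>x. (D (f x) (g x) *\<^sub>R ?w x) \<bullet> ?wb x)"
      by (rule L2_inner_integrable[OF Dg(1)[OF fL(3) g fL(1)] fL(2)])
    have i3: "integrable (lebesgue_on \<Omega>) (\<lambda>x. \<Psi>1 (f x) (g x) \<bullet> \<beta> (f x))"
      by (rule L2_inner_integrable[OF P(1)[OF fL(3) g] \<beta>_L2[OF fL(3)]])
    have "fF f g = L2_inner \<Omega> (\<lambda>x. F (f x) (g x) - F k 0) ?wb"
      unfolding fF_def using L2_inner_diff_left[OF F_compose_L2[OF fL(3) g] kL fL(2)]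
        H10_integral_gradient[OF H10_\<beta>(1)[OF f], of "F k 0"] by simp
    then have "fF f g - fD f g + fP f g = (LINT x|lebesgue_on \<Omega>. (F (f x) (g x) - F k 0) \<bullet> ?wb x
        - (D (f x) (g x) *\<^sub>R ?w x) \<bullet> ?wb x + \<Psi>1 (f x) (g x) \<bullet> \<beta> (f x))"
      unfolding fD_def fP_def L2_inner_def
      using Bochner_Integration.integral_add[OF Bochner_Integration.integrable_diff[OF i1 i2] i3]
        Bochner_Integration.integral_diff[OF i1 i2] by simp
    also have "\<dots> \<le> (LINT x|lebesgue_on \<Omega>. (?C + Lv) * ((pu (f x))\<^sup>2 + (qv (g x))\<^sup>2))"
    proof (rule integral_mono_AE)
      show "integrable (lebesgue_on \<Omega>) (\<lambda>x. (F (f x) (g x) - F k 0) \<bullet> ?wb x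
        - (D (f x) (g x) *\<^sub>R ?w x) \<bullet> ?wb x + \<Psi>1 (f x) (g x) \<bullet> \<beta> (f x))"
        by (intro Bochner_Integration.integrable_add Bochner_Integration.integrable_diff i1 i2 i3)
      show "integrable (lebesgue_on \<Omega>) (\<lambda>x. (?C + Lv) * ((pu (f x))\<^sup>2 + (qv (g x))\<^sup>2))"
        by (intro integrable_mult_right pu_qv_inner_le fL(3) g)
      show "AE x in lebesgue_on \<Omega>. (F (f x) (g x) - F k 0) \<bullet> ?wb x
        - (D (f x) (g x) *\<^sub>R ?w x) \<bullet> ?wb x + \<Psi>1 (f x) (g x) \<bullet> \<beta> (f x) \<le> (?C + Lv) * ((pu (f x))\<^sup>2 + (qv (g x))\<^sup>2)"
        using H10_\<beta>(2)[OF f]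
      proof eventually_elim
        case (elim x)
        have d0: "\<beta>' (f x) = 0" if "\<sigma> * (f x - k) \<le> 0"
          using soft_pos_deriv_bounds(3)[OF e that] by (simp add: \<beta>'_def)
        have 1: "(F (f x) (g x) - F k 0) \<bullet> ?wb x - (D (f x) (g x) *\<^sub>R ?w x) \<bullet> ?wb x \<le> ?C * (pu (f x))\<^sup>2"
          unfolding elim by (rule flux_le[OF \<beta>'_bounds d0])
        have 2: "\<Psi>1 (f x) (g x) * \<beta> (f x) \<le> Lv * (pu (f x) * qv (g x))"
        proof (cases "\<sigma> * (f x - k) > 0")
          case True
          have "\<Psi>1 (f x) (g x) * \<beta> (f x) = (\<sigma> * \<Psi>1 (f x) (g x)) * soft_pos \<epsilon> (\<sigma> * (f x - k))"
            by (simp add: \<beta>_def)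
          also have "\<dots> \<le> (Lv * qv (g x)) * soft_pos \<epsilon> (\<sigma> * (f x - k))"
            by (rule mult_right_mono[OF reaction_1[OF True] soft_pos_bounds(1)[OF e]])
          also have "\<dots> \<le> (Lv * qv (g x)) * pu (f x)"
            using soft_pos_bounds(2)[OF e] Lip_pos(2) qv_nonneg unfolding pu_def by (intro mult_left_mono) auto
          finally show ?thesis by (simp add: mult.commute mult.left_commute)
        next
          case False
          then have "\<beta> (f x) = 0" using soft_pos_zero[OF e, of "\<sigma> * (f x - k)"] by (simp add: \<beta>_def)
          then show ?thesis using Lip_pos(2) pu_nonneg qv_nonneg by simp
        qed
        have 3: "pu (f x) * qv (g x) \<le> (pu (f x))\<^sup>2 + (qv (g x))\<^sup>2"
          using zero_le_power2[of "pu (f x) - qv (g x)"] zero_le_power2[of "pu (f x)"] zero_le_power2[of "qv (g x)"]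
          unfolding power2_diff by linarith
        have "Lv * (pu (f x) * qv (g x)) \<le> Lv * ((pu (f x))\<^sup>2 + (qv (g x))\<^sup>2)"
          using 3 Lip_pos(2) by simp
        moreover have "?C * (pu (f x))\<^sup>2 \<le> ?C * ((pu (f x))\<^sup>2 + (qv (g x))\<^sup>2)"
          using C by (intro mult_left_mono) auto
        ultimately show ?case using 1 2 unfolding distrib_right inner_real_def by linarith
      qed
    qed
    also have "\<dots> = (?C + Lv) * PQ f g" using pu_qv_inner_le[OF fL(3) g] by simp
    finally show ?thesis .
  qed
  \<comment> \<open>With this test function all four terms of the equation reduce to integrals over
    \<open>{0<..<b}\<close>, since each of them vanishes where the test function is 0.\<close>
  have \<phi>b: "(\<lambda>t. if t \<in> {0<..<b} then (\<lambda>x. \<beta> (u t x)) else (\<lambda>x. 0)) \<in> L2_H10 T \<Omega>"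
    by (rule S.Bochner_restrict[OF \<phi>]) simp
  note eq = u_eq[OF \<phi>b]
  have z: "L2_inner \<Omega> h (\<lambda>x. 0) = 0" for h :: "'a \<Rightarrow> real" by (simp add: L2_inner_def)
  let ?Mb = "lebesgue_on {0<..<b}"
  have e1: "(LINT t|M. ut t (if t \<in> {0<..<b} then (\<lambda>x. \<beta> (u t x)) else (\<lambda>x. 0))) = (LINT t|?Mb. ut t (\<lambda>x. \<beta> (u t x)))"
  proof (rule LINT_restrict_AE[OF E.w_Bochner_measurable[OF \<phi>] _ b(2)])
    show "AE t in M. ut t (if t \<in> {0<..<b} then (\<lambda>x. \<beta> (u t x)) else (\<lambda>x. 0)) = (if t \<in> {0<..<b} then ut t (\<lambda>x. \<beta> (u t x)) else 0)"
      using L2_BochnerD(1)[OF utB]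
    proof eventually_elim
      case (elim t)
      have "ut t (\<lambda>x. 0) = 0" using Hm1_D(2)[OF elim H10_zero, of 0] by simp
      then show ?case by simp
    qed
  qed
  have e2: "(LINT t|M. L2_inner \<Omega> (\<lambda>x. D (u t x) (v t x) *\<^sub>R weak_gradient \<Omega> (u t) x)
      (weak_gradient \<Omega> (if t \<in> {0<..<b} then (\<lambda>x. \<beta> (u t x)) else (\<lambda>x. 0)))) = (LINT t|?Mb. fD (u t) (v t))"
    by (rule LINT_restrict_AE[OF meas(1) AE_I2 b(2)]) (simp add: fD_def weak_gradient_zero_inner)
  have e3: "(LINT t|M. L2_inner \<Omega> (\<lambda>x. F (u t x) (v t x))
      (weak_gradient \<Omega> (if t \<in> {0<..<b} then (\<lambda>x. \<beta> (u t x)) else (\<lambda>x. 0)))) = (LINT t|?Mb. fF (u t) (v t))"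
    by (rule LINT_restrict_AE[OF meas(2) AE_I2 b(2)]) (simp add: fF_def weak_gradient_zero_inner)
  have e4: "(LINT t|M. L2_inner \<Omega> (\<lambda>x. \<Psi>1 (u t x) (v t x))
      (if t \<in> {0<..<b} then (\<lambda>x. \<beta> (u t x)) else (\<lambda>x. 0))) = (LINT t|?Mb. fP (u t) (v t))"
    by (rule LINT_restrict_AE[OF meas(3) AE_I2 b(2)]) (simp add: fP_def z)
  have ib: "integrable ?Mb h" if "integrable M h" for h :: "real \<Rightarrow> real"
    by (rule integrable_lebesgue_on_subset[OF that]) (use b in auto)
  note bi = ib[OF iF] ib[OF iD] ib[OF iP]
  have "(LINT t|?Mb. ut t (\<lambda>x. \<beta> (u t x))) = (LINT t|?Mb. fF (u t) (v t)) - (LINT t|?Mb. fD (u t) (v t)) + (LINT t|?Mb. fP (u t) (v t))"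
    using eq unfolding e1 e2 e3 e4 by linarith
  also have "\<dots> = (LINT t|?Mb. fF (u t) (v t) - fD (u t) (v t) + fP (u t) (v t))"
    using Bochner_Integration.integral_add[OF Bochner_Integration.integrable_diff[OF bi(1,2)] bi(3)]
      Bochner_Integration.integral_diff[OF bi(1,2)] by simp
  also have "\<dots> \<le> (CF\<^sup>2 / (4 * Dm) + Lv) * integral {0..b} (\<lambda>t. PQ (U t) (V t))"
  proof (rule LINT_PQ[OF b])
    show "integrable ?Mb (\<lambda>t. fF (u t) (v t) - fD (u t) (v t) + fP (u t) (v t))"
      by (intro Bochner_Integration.integrable_add Bochner_Integration.integrable_diff bi)
    show "AE t in M. fF (u t) (v t) - fD (u t) (v t) + fP (u t) (v t) \<le> (CF\<^sup>2 / (4 * Dm) + Lv) * PQ (u t) (v t)"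
      using L2_BochnerD(1)[OF u] L2_BochnerD(1)[OF v] by eventually_elim (rule bound)
  qed
  finally have le: "(LINT t|?Mb. ut t (\<lambda>x. \<beta> (u t x))) \<le> (CF\<^sup>2 / (4 * Dm) + Lv) * integral {0..b} (\<lambda>t. PQ (U t) (V t))" .
  have "E.energy 0 = 0"
  proof -
    have "AE x in lebesgue_on \<Omega>. G (U 0 x) = 0"
      using U_init
    proof eventually_elim
      case (elim x)
      then have "max (\<sigma> * (U 0 x - k)) 0 = 0" by simp
      then show ?case
        using soft_pos_primitive_bounds(1)[of \<epsilon> "\<sigma> * (U 0 x - k)"] soft_pos_primitive_bounds(2)[OF e, of "\<sigma> * (U 0 x - k)"]
        by (simp add: G_def)
    qed
    then show ?thesis unfolding E.energy_def by (rule integral_eq_zero_AE)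
  qed
  then have "E.energy b \<le> (CF\<^sup>2 / (4 * Dm) + Lv) * integral {0..b} (\<lambda>t. PQ (U t) (V t))"
    using E.energy_inequality[OF b] le by linarith
  then show ?thesis unfolding E.energy_def G_def .
qed

text \<open>As \<open>\<epsilon>\<close> tends to 0 the primitives converge pointwise to half the
  squared positive part, which also dominates them, while the right-hand side stays fixed.\<close>

lemma u_energy:
  assumes b: "0 < b" "b \<le> T"
  shows "(L2_norm \<Omega> (\<lambda>x. pu (U b x)))\<^sup>2 / 2 \<le> (CF\<^sup>2 / (4 * Dm) + Lv) * integral {0..b} (\<lambda>t. PQ (U t) (V t))"
proof -
  define \<epsilon> where "\<epsilon> n = inverse (real (Suc n))" for n
  have e: "\<And>n. \<epsilon> n > 0" "\<epsilon> \<longlonglongrightarrow> 0"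
    unfolding \<epsilon>_def using LIMSEQ_inverse_real_of_nat by simp_all
  have Ub: "U b \<in> L2 \<Omega>" using U_L2[of b] b by simp
  note pL = L2_integrable_sq[OF pu_L2[OF Ub]]
  have "(\<lambda>n. LINT x|lebesgue_on \<Omega>. soft_pos_primitive (\<epsilon> n) (\<sigma> * (U b x - k))) \<longlonglongrightarrow> (LINT x|lebesgue_on \<Omega>. (norm (pu (U b x)))\<^sup>2 / 2)"
  proof (rule integral_dominated_convergence)
    show "integrable (lebesgue_on \<Omega>) (\<lambda>x. (norm (pu (U b x)))\<^sup>2 / 2)" using pL by simp
    then show "(\<lambda>x. (norm (pu (U b x)))\<^sup>2 / 2) \<in> borel_measurable (lebesgue_on \<Omega>)" by (rule borel_measurable_integrable)
    show "(\<lambda>x. soft_pos_primitive (\<epsilon> n) (\<sigma> * (U b x - k))) \<in> borel_measurable (lebesgue_on \<Omega>)" for n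
    proof -
      have "continuous_on UNIV (\<lambda>s. soft_pos_primitive (\<epsilon> n) (\<sigma> * (s - k)))"
        by (rule continuous_on_compose2[OF DERIV_continuous_on[OF has_field_derivative_at_within[OF soft_pos_primitive_has_derivative[OF e(1)]]], of UNIV])
          (auto intro!: continuous_intros)
      then show ?thesis by (rule borel_measurable_continuous_on[OF _ L2_measurable[OF Ub]])
    qed
    show "AE x in lebesgue_on \<Omega>. (\<lambda>n. soft_pos_primitive (\<epsilon> n) (\<sigma> * (U b x - k))) \<longlonglongrightarrow> (norm (pu (U b x)))\<^sup>2 / 2"
      using soft_pos_primitive_tendsto[OF e] by (intro AE_I2) (simp add: pu_def)
    show "AE x in lebesgue_on \<Omega>. norm (soft_pos_primitive (\<epsilon> n) (\<sigma> * (U b x - k))) \<le> (norm (pu (U b x)))\<^sup>2 / 2" for n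
      using soft_pos_primitive_bounds(1) soft_pos_primitive_bounds(2)[OF e(1)] by (intro AE_I2) (simp add: pu_def)
  qed
  then have "(LINT x|lebesgue_on \<Omega>. (norm (pu (U b x)))\<^sup>2 / 2) \<le> (CF\<^sup>2 / (4 * Dm) + Lv) * integral {0..b} (\<lambda>t. PQ (U t) (V t))"
    by (rule LIMSEQ_le_const2) (use soft_energy_bound[OF e(1) b] in blast)
  then show ?thesis by (simp add: L2_norm_sq)
qed

theorem one_sided_bounds:
  "AE t in M. AE x in lebesgue_on \<Omega>. \<sigma> * (u t x - k) \<le> 0 \<and> \<sigma> * (m - v t x) \<le> 0"
proof -
  \<comment> \<open>The sum of the two energy estimates; the factor 2 removes the halves on their
    left-hand sides.\<close>
  let ?y = "\<lambda>t. PQ (U t) (V t)" and ?C = "2 * (CF\<^sup>2 / (4 * Dm) + Lv + Lu)"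
  have y0: "?y t \<le> 0" if t: "0 < t" "t \<le> T" for t
  proof (rule Gronwall_zero[OF _ PQ_continuous _ t])
    show "?C \<ge> 0" using D_bounds(1) Lip_pos by simp
    show "?y b \<le> ?C * integral {0..b} ?y" if "0 < b" "b \<le> T" for b
      using u_energy[OF that] v_energy[OF that] by (simp add: PQ_def algebra_simps)
  qed
  have "AE t in M. t \<in> {0<..<T}" by (rule AE_I2) (simp add: space_restrict_space)
  then show ?thesis
    using PQ_AE u_L2_AE L2_BochnerD(1)[OF v]
  proof eventually_elim
    case (elim t)
    have "PQ (u t) (v t) \<le> 0" using y0[of t] elim(1,2) by simp
    then have "(L2_norm \<Omega> (\<lambda>x. pu (u t x)))\<^sup>2 = 0" "(L2_norm \<Omega> (\<lambda>x. qv (v t x)))\<^sup>2 = 0"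
      unfolding PQ_def
      using zero_le_power2[of "L2_norm \<Omega> (\<lambda>x. pu (u t x))"] zero_le_power2[of "L2_norm \<Omega> (\<lambda>x. qv (v t x))"] by linarith+
    then have "AE x in lebesgue_on \<Omega>. pu (u t x) = 0" "AE x in lebesgue_on \<Omega>. qv (v t x) = 0"
      using L2_norm_eq_0[OF pu_L2[OF elim(3)]] L2_norm_eq_0[OF qv_L2[OF elim(4)]] by simp_all
    then show ?case by eventually_elim (simp add: pu_def qv_def max_def split: if_splits)
  qed
qed

end

section \<open>Invariant rectangle\<close>

lemma continuous_of_partial_C1:
  assumes "Ck 1 (\<lambda>(a, b). f a b :: real)" shows "continuous_on UNIV (\<lambda>p. f (fst p) (snd p))"
proof -
  have "Ck 0 (\<lambda>(a, b). f a b)" using assms Ck_SucD[of 0 "\<lambda>(a, b). f a b"] by simp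
  then show ?thesis by (simp add: case_prod_unfold)
qed

lemma flux_continuous:
  fixes F :: "real \<Rightarrow> real \<Rightarrow> 'a::euclidean_space"
  assumes "flux_admissible F" shows "continuous_on UNIV (\<lambda>p. F (fst p) (snd p))"
proof (subst continuous_on_componentwise, intro ballI)
  fix i :: 'a assume "i \<in> Basis"
  then have "Ck 1 (\<lambda>(a, b). F a b \<bullet> i)" using assms unfolding flux_admissible_def by blast
  from continuous_of_partial_C1[OF this] show "continuous_on UNIV (\<lambda>p. F (fst p) (snd p) \<bullet> i)" .
qed

text \<open>Differentiability at the single point \<open>k\<close> together with boundedness already gives a global
  linear bound, although \<open>F\<close> need not be Lipschitz.\<close>

lemma flux_linear_bound:
  fixes F :: "real \<Rightarrow> real \<Rightarrow> 'a::euclidean_space"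
  assumes F: "flux_admissible F" and indep: "\<forall>a b b'. F a b = F a b'"
  obtains C where "C \<ge> 0" "\<forall>a b. norm (F a b - F k 0) \<le> C * \<bar>a - k\<bar>"
proof -
  obtain FM where FM: "FM > 0" "\<forall>a b. norm (F a b) \<le> FM" using F unfolding flux_admissible_def by blast
  have "\<exists>C\<ge>0. \<forall>a. \<bar>F a 0 \<bullet> i - F k 0 \<bullet> i\<bar> \<le> C * \<bar>a - k\<bar>" if i: "i \<in> Basis" for i
  proof -
    let ?f = "\<lambda>a. F a 0 \<bullet> i"
    have fb: "\<bar>?f a\<bar> \<le> FM" for a
      using Basis_le_norm[OF i, of "F a 0"] FM(2)[rule_format, of a 0] by linarith
    have "Ck 1 (\<lambda>(a, b). F a b \<bullet> i)" using F i unfolding flux_admissible_def by blast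
    then have "(\<lambda>(a, b). F a b \<bullet> i) differentiable (at (k, 0))" by simp
    then obtain L where L: "((\<lambda>p. F (fst p) (snd p) \<bullet> i) has_derivative L) (at (k, 0))"
      unfolding differentiable_def case_prod_unfold by blast
    have "((\<lambda>a. (a, 0::real)) has_derivative (\<lambda>h. (h, 0))) (at k)"
      by (auto intro!: derivative_eq_intros)
    from has_derivative_compose[OF this, of "\<lambda>p. F (fst p) (snd p) \<bullet> i" L] L
    have "(?f has_derivative (\<lambda>h. L (h, 0))) (at k)" by simp
    then have "?f differentiable (at k)" unfolding differentiable_def by blast
    then obtain d where d: "(?f has_real_derivative d) (at k)" by (auto simp: real_differentiable_def)
    then have "(\<lambda>a. (?f a - ?f k) / (a - k)) \<midarrow>k\<rightarrow> d" by (simp add: has_field_derivative_iff)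
    then have "\<exists>\<delta>>0. \<forall>a. a \<noteq> k \<and> norm (a - k) < \<delta> \<longrightarrow> norm ((?f a - ?f k) / (a - k) - d) < 1"
      by (rule LIM_D) simp
    then obtain \<delta> where \<delta>: "\<delta> > 0" "\<forall>a. a \<noteq> k \<and> norm (a - k) < \<delta> \<longrightarrow> norm ((?f a - ?f k) / (a - k) - d) < 1"
      by blast
    \<comment> \<open>Within distance \<open>\<delta>\<close> of \<open>k\<close> the difference
      quotient is within 1 of the derivative \<open>d\<close>; at distance at least
      \<open>\<delta>\<close> the total variation \<open>2 * FM\<close> is at most
      \<open>2 * FM / \<delta>\<close> times the distance.\<close>
    let ?C = "max (\<bar>d\<bar> + 1) (2 * FM / \<delta>)"
    have "\<bar>?f a - ?f k\<bar> \<le> ?C * \<bar>a - k\<bar>" for a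
    proof (cases "a = k")
      case False
      show ?thesis
      proof (cases "\<bar>a - k\<bar> < \<delta>")
        case True
        then have "\<bar>(?f a - ?f k) / (a - k) - d\<bar> < 1" using \<delta>(2) False by simp
        then have "\<bar>(?f a - ?f k) / (a - k)\<bar> \<le> \<bar>d\<bar> + 1" by linarith
        then have "\<bar>?f a - ?f k\<bar> \<le> (\<bar>d\<bar> + 1) * \<bar>a - k\<bar>" using False by (simp add: abs_divide field_simps)
        also have "\<dots> \<le> ?C * \<bar>a - k\<bar>" by (rule mult_right_mono) auto
        finally show ?thesis .
      next
        case False
        have "\<bar>?f a - ?f k\<bar> \<le> 2 * FM" using fb[of a] fb[of k] by linarith
        also have "\<dots> = 2 * FM / \<delta> * \<delta>" using \<delta>(1) by simp
        also have "\<dots> \<le> ?C * \<bar>a - k\<bar>" using False \<delta>(1) FM(1) by (intro mult_mono) auto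
        finally show ?thesis .
      qed
    qed simp
    then show ?thesis by (intro exI[of _ ?C]) auto
  qed
  then obtain c where c: "\<And>i. i \<in> Basis \<Longrightarrow> c i \<ge> 0" "\<And>i a. i \<in> Basis \<Longrightarrow> \<bar>F a 0 \<bullet> i - F k 0 \<bullet> i\<bar> \<le> c i * \<bar>a - k\<bar>"
    by metis
  have "norm (F a b - F k 0) \<le> (\<Sum>i\<in>Basis. c i) * \<bar>a - k\<bar>" for a b
  proof -
    have "F a b = F a 0" using indep by blast
    then have "norm (F a b - F k 0) \<le> (\<Sum>i\<in>Basis. \<bar>(F a 0 - F k 0) \<bullet> i\<bar>)" using norm_le_l1 by simp
    also have "\<dots> \<le> (\<Sum>i\<in>Basis. c i * \<bar>a - k\<bar>)"
      using c(2) by (intro sum_mono) (simp add: inner_diff_left)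
    finally show ?thesis by (simp add: sum_distrib_right)
  qed
  moreover have "(\<Sum>i\<in>Basis. c i) \<ge> 0" using c(1) by (rule sum_nonneg)
  ultimately show ?thesis using that by simp
qed

text \<open>The sign conditions vary one argument at a time, so the comparison passes through the
  intermediate point \<open>(c, b)\<close>.\<close>

lemma reaction_admissibleD:
  assumes "reaction_admissible Lu Lv \<Psi>"
  shows "\<bar>\<Psi> a b - \<Psi> c d\<bar> \<le> Lu * \<bar>a - c\<bar> + Lv * \<bar>b - d\<bar>"
    "a \<le> c \<Longrightarrow> b \<le> d \<Longrightarrow> \<Psi> c d \<le> \<Psi> a b"
proof -
  show "\<bar>\<Psi> a b - \<Psi> c d\<bar> \<le> Lu * \<bar>a - c\<bar> + Lv * \<bar>b - d\<bar>"
    using assms unfolding reaction_admissible_def by blast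
  assume ac: "a \<le> c" and bd: "b \<le> d"
  have "\<Psi> c d \<le> \<Psi> c b"
  proof (cases "b = d")
    case False
    then have "(\<Psi> c d - \<Psi> c b) / (d - b) \<le> 0" using assms unfolding reaction_admissible_def by metis
    then show ?thesis using False bd by (simp add: divide_le_0_iff)
  qed simp
  also have "\<dots> \<le> \<Psi> a b"
  proof (cases "a = c")
    case False
    then have "(\<Psi> c b - \<Psi> a b) / (c - a) \<le> 0" using assms unfolding reaction_admissible_def by metis
    then show ?thesis using False ac by (simp add: divide_le_0_iff)
  qed simp
  finally show "\<Psi> c d \<le> \<Psi> a b" .
qed

text \<open>\<open>u t\<close> has zero boundary values, so bounds by \<open>u_l\<close> and
  \<open>u_r\<close> are only possible if 0 lies between them. In the proof
  \<open>boundary_value\<close> makes the truncations at both levels vanish at 0, which keeps the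
  truncated solution in \<open>H10\<close>.\<close>

theorem proposition1:
  fixes \<Omega> :: "'a::euclidean_space set"
    and T :: real
    and D :: "real \<Rightarrow> real \<Rightarrow> real"
    and F :: "real \<Rightarrow> real \<Rightarrow> 'a"
    and \<Psi>1 \<Psi>2 :: "real \<Rightarrow> real \<Rightarrow> real"
    and Lu Lv :: real
    and u0 v0 :: "'a \<Rightarrow> real"
    and u v :: "real \<Rightarrow> 'a \<Rightarrow> real"
    and u_l u_r v_l v_r :: real
  assumes "C1_domain \<Omega>" and "T > 0"
    and "diffusion_admissible D"
    and "flux_admissible F"
    and "Lu > 0" and "Lv > 0" and "reaction_admissible Lu Lv \<Psi>1" and "reaction_admissible Lu Lv \<Psi>2"
    and "initial_admissible \<Omega> \<Psi>2 u0 v0"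
    and F_indep: "\<forall>a b b'. F a b = F a b'"
    and v_l: "v_l = ess_inf_on \<Omega> v0"
    and v_r: "v_r = ess_sup_on \<Omega> v0"
    and "u_l < u_r"
    and boundary_value: "0 \<in> {u_l..u_r}"
    and "AE x in lebesgue_on \<Omega>. u0 x \<in> {u_l..u_r}"
    and "\<Psi>1 u_r v_l \<le> 0" and "0 \<le> \<Psi>2 u_r v_l"
    and "\<Psi>2 u_l v_r \<le> 0" and "0 \<le> \<Psi>1 u_l v_r"
    and "weak_solution T \<Omega> D F \<Psi>1 \<Psi>2 u0 v0 u v"
  shows "AE (x, t) in lebesgue_on (space_time T \<Omega>).
           v_l \<le> v t x \<and> v t x \<le> v_r \<and> u_l \<le> u t x \<and> u t x \<le> u_r"
proof -
  have dom: "open \<Omega>" "bounded \<Omega>" "\<Omega> \<noteq> {}" using assms(1) unfolding C1_domain_def by auto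
  interpret bounded_open \<Omega> by standard (rule dom)+
  obtain Dm DM where D: "0 < Dm" "\<forall>a b. Dm \<le> D a b \<and> D a b \<le> DM"
    using assms(3) unfolding diffusion_admissible_def by blast
  have D_cont: "continuous_on UNIV (\<lambda>p. D (fst p) (snd p))"
    using assms(3) unfolding diffusion_admissible_def by (blast intro: continuous_of_partial_C1)
  obtain FM where FM: "\<forall>a b. norm (F a b) \<le> FM" using assms(4) unfolding flux_admissible_def by blast
  note ws = \<open>weak_solution T \<Omega> D F \<Psi>1 \<Psi>2 u0 v0 u v\<close>[unfolded weak_solution_def]
  have joint: "(\<lambda>(x, t). u t x) \<in> L2 (space_time T \<Omega>)" "(\<lambda>(x, t). v t x) \<in> L2 (space_time T \<Omega>)"
    using ws by blast+
  have uB: "u \<in> L2_H10 T \<Omega>" using ws unfolding W_space_def by blast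
  have vB: "v \<in> L2_L2 T \<Omega>" using ws unfolding H1_L2_def by blast
  obtain ut vt where td: "time_deriv_Hm1 T \<Omega> u ut" "time_deriv_L2 T \<Omega> v vt"
    and u_eq: "\<forall>\<phi>\<in>L2_H10 T \<Omega>.
           (LINT t|lebesgue_on {0<..<T}. ut t (\<phi> t))
           + (LINT t|lebesgue_on {0<..<T}.
                L2_inner \<Omega> (\<lambda>x. D (u t x) (v t x) *\<^sub>R weak_gradient \<Omega> (u t) x) (weak_gradient \<Omega> (\<phi> t)))
           = (LINT t|lebesgue_on {0<..<T}.
                L2_inner \<Omega> (\<lambda>x. F (u t x) (v t x)) (weak_gradient \<Omega> (\<phi> t)))
           + (LINT t|lebesgue_on {0<..<T}. L2_inner \<Omega> (\<lambda>x. \<Psi>1 (u t x) (v t x)) (\<phi> t))"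
    and v_eq: "\<forall>\<xi>. (\<lambda>(x, t). \<xi> t x) \<in> L2 (space_time T \<Omega>) \<longrightarrow>
           (LINT t|lebesgue_on {0<..<T}. L2_inner \<Omega> (vt t) (\<xi> t))
           = (LINT t|lebesgue_on {0<..<T}. L2_inner \<Omega> (\<lambda>x. \<Psi>2 (u t x) (v t x)) (\<xi> t))"
    using ws by blast
  obtain U where U: "\<forall>t\<in>{0..T}. U t \<in> L2 \<Omega>"
    "\<forall>t\<in>{0..T}. ((\<lambda>s. L2_norm \<Omega> (U s - U t)) \<longlongrightarrow> 0) (at t within {0..T})"
    "AE t in lebesgue_on {0<..<T}. AE x in lebesgue_on \<Omega>. U t x = u t x" "AE x in lebesgue_on \<Omega>. U 0 x = u0 x"
    using ws unfolding has_initial_value_def by blast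
  obtain V where V: "\<forall>t\<in>{0..T}. V t \<in> L2 \<Omega>"
    "\<forall>t\<in>{0..T}. ((\<lambda>s. L2_norm \<Omega> (V s - V t)) \<longlongrightarrow> 0) (at t within {0..T})"
    "AE t in lebesgue_on {0<..<T}. AE x in lebesgue_on \<Omega>. V t x = v t x" "AE x in lebesgue_on \<Omega>. V 0 x = v0 x"
    using ws unfolding has_initial_value_def by blast
  have v0: "v0 \<in> Linf \<Omega>" using assms(9) unfolding initial_admissible_def by blast
  \<comment> \<open>To be used with \<open>\<sigma> = 1\<close> at the corner
    \<open>(u_r, v_l)\<close> and with \<open>\<sigma> = - 1\<close> at \<open>(u_l, v_r)\<close>;
    multiplication by \<open>\<sigma>\<close> turns the second pair of corner conditions into the
    form of the first.\<close>
  have one_sided: "AE t in lebesgue_on {0<..<T}. AE x in lebesgue_on \<Omega>. \<sigma> * (u t x - k) \<le> 0 \<and> \<sigma> * (m - v t x) \<le> 0"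
    if \<sigma>: "\<sigma> = 1 \<or> \<sigma> = - 1" and k: "\<sigma> * (0 - k) \<le> 0" and \<Psi>: "\<sigma> * \<Psi>1 k m \<le> 0" "0 \<le> \<sigma> * \<Psi>2 k m"
      and init: "AE x in lebesgue_on \<Omega>. \<sigma> * (u0 x - k) \<le> 0" "AE x in lebesgue_on \<Omega>. \<sigma> * (m - v0 x) \<le> 0"
    for \<sigma> k m
  proof -
    obtain CF where CF: "CF \<ge> 0" "\<forall>a b. norm (F a b - F k 0) \<le> CF * \<bar>a - k\<bar>"
      by (rule flux_linear_bound[OF assms(4) F_indep])
    interpret comparison \<Omega> T D F \<Psi>1 \<Psi>2 Lu Lv Dm DM FM CF \<sigma> k m u v U V ut vt
    proof
      show "AE x in lebesgue_on \<Omega>. \<sigma> * (U 0 x - k) \<le> 0" using U(4) init(1) by eventually_elim simp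
      show "AE x in lebesgue_on \<Omega>. \<sigma> * (m - V 0 x) \<le> 0" using V(4) init(2) by eventually_elim simp
      show "continuous_on UNIV (\<lambda>p. F (fst p) (snd p))" by (rule flux_continuous[OF assms(4)])
      show "AE t in lebesgue_on {0<..<T}. AE x in lebesgue_on \<Omega>. U t x = u t x" by (rule U(3))
      show "AE t in lebesgue_on {0<..<T}. AE x in lebesgue_on \<Omega>. V t x = v t x" by (rule V(3))
    qed (fact assms D(1) D_cont D(2)[rule_format, THEN conjunct1] D(2)[rule_format, THEN conjunct2] FM[rule_format] CF(1) CF(2)[rule_format]
        reaction_admissibleD[OF assms(7)] reaction_admissibleD[OF assms(8)] \<sigma> k \<Psi> uB vB td joint
        U(1)[rule_format] U(2)[rule_format] V(1)[rule_format] V(2)[rule_format] u_eq[rule_format] v_eq[rule_format])+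
    show ?thesis by (rule one_sided_bounds)
  qed
  have up: "AE t in lebesgue_on {0<..<T}. AE x in lebesgue_on \<Omega>. 1 * (u t x - u_r) \<le> 0 \<and> 1 * (v_l - v t x) \<le> 0"
  proof (rule one_sided)
    show "AE x in lebesgue_on \<Omega>. 1 * (u0 x - u_r) \<le> 0" using assms(15) by eventually_elim simp
    show "AE x in lebesgue_on \<Omega>. 1 * (v_l - v0 x) \<le> 0"
      using ess_inf_on_AE[OF dom(1,3) v0] unfolding v_l by eventually_elim simp
  qed (use assms(14,16,17) in simp_all)
  have lo: "AE t in lebesgue_on {0<..<T}. AE x in lebesgue_on \<Omega>. - 1 * (u t x - u_l) \<le> 0 \<and> - 1 * (v_r - v t x) \<le> 0"
  proof (rule one_sided)
    show "AE x in lebesgue_on \<Omega>. - 1 * (u0 x - u_l) \<le> 0" using assms(15) by eventually_elim simp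
    show "AE x in lebesgue_on \<Omega>. - 1 * (v_r - v0 x) \<le> 0"
      using ess_sup_on_AE[OF dom(1,3) v0] unfolding v_r by eventually_elim simp
  qed (use assms(14,18,19) in simp_all)
  let ?P = "\<lambda>x t. v_l \<le> v t x \<and> v t x \<le> v_r \<and> u_l \<le> u t x \<and> u t x \<le> u_r"
  have ae: "AE t in lebesgue_on {0<..<T}. AE x in lebesgue_on \<Omega>. ?P x t"
    using up lo
  proof eventually_elim
    case (elim t)
    from elim show ?case by eventually_elim simp
  qed
  have S: "space_time T \<Omega> \<in> sets lebesgue"
  proof -
    have "\<Omega> \<times> {0<..T} \<in> sets (borel \<Otimes>\<^sub>M borel)" using open_\<Omega> by (intro pair_measureI) auto
    then show ?thesis unfolding space_time_def borel_prod by simp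
  qed
  \<comment> \<open>Joint measurability of the representatives makes the exceptional set measurable,
    as required to pass from almost every time and almost every point to almost everywhere in the
    cylinder.\<close>
  have "{(x, t) \<in> space_time T \<Omega>. \<not> ?P x t} \<in> sets lebesgue"
  proof -
    note [measurable] = joint[THEN L2_measurable, unfolded case_prod_unfold]
    have "{p \<in> space (lebesgue_on (space_time T \<Omega>)). \<not> ?P (fst p) (snd p)} \<in> sets (lebesgue_on (space_time T \<Omega>))"
      by measurable
    moreover have "{p \<in> space (lebesgue_on (space_time T \<Omega>)). \<not> ?P (fst p) (snd p)} = {(x, t) \<in> space_time T \<Omega>. \<not> ?P x t}"
      by (auto simp: space_restrict_space)
    ultimately show ?thesis using S by (simp add: sets_restrict_space_iff)
  qed
  then show ?thesis by (rule AE_space_time[OF sets_\<Omega> _ ae S])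
qed

end
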